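(* Let $\mathcal H,\mathcal G$ be groupoids, let $\mathcal X$ be an $(\mathcal H,\mathcal G)$-self-similar para-equivalence, and let $\mathcal B=(q_{\mathcal B}\colon B\to\mathcal X)$ be a saturated Fell bundle. Suppose that $\mathcal H$ and $\mathcal G$ act on the left resp. right of $\mathcal B$ by self-similar actions $\triangleright$ resp. $\blacktriangleleft$ (lying over the given self-similar actions on $\mathcal X$) such that $(h\triangleright b)\blacktriangleleft t=h\triangleright(b\blacktriangleleft t)$ for all $h\in\mathcal H$, $b\in\mathcal B_x$, $t\in\mathcal G$ for which $(h\triangleright x)\blacktriangleleft t$ is defined. Let $\mathcal A=(\mathcal B/\mathcal G)\bowtie\mathcal H$, a Fell bundle over $(\mathcal X/\mathcal G)\bowtie\mathcal H$, and $\mathcal C=\mathcal G\bowtie(\mathcal H\backslash\mathcal B)$, a Fell bundle over $\mathcal G\bowtie(\mathcal H\backslash\mathcal X)$. Then $\mathcal B$ is a Fell bundle equivalence between $\mathcal A$ and $\mathcal C$ (over the groupoid equivalence $\mathcal X$ between $(\mathcal X/\mathcal G)\bowtie\mathcal H$ and $\mathcal G\bowtie(\mathcal H\backslash\mathcal X)$) in the following way: (1) $\mathcal A$ acts on the left of $\mathcal B$: whenever $(\Theta,h)\in\mathcal A$ and $b\in\mathcal B$ satisfy $s_{\mathcal A}(\Theta,h)=\mathfrak r_{\mathcal B}(b)$, let $(\Theta,h)\cdot b=a[h\triangleright b]$, where $a\in\Theta$ is such that $s_{\mathcal B}(a)=r_{\mathcal B}(h\triangleright b)$. (2) $\mathcal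 C$ acts on the right of $\mathcal B$: whenever $b\in\mathcal B$ and $(t,\Xi)\in\mathcal C$ satisfy $\mathfrak s_{\mathcal B}(b)=r_{\mathcal C}(t,\Xi)$, let $b\cdot(t,\Xi)=[b\blacktriangleleft t]c$, where $c\in\Xi$ is such that $s_{\mathcal B}(b\blacktriangleleft t)=r_{\mathcal B}(c)$. (3) The left $\mathcal A$-valued inner product, defined on pairs $(a,b)$ with $\mathfrak s_{\mathcal B}(a)=\mathfrak s_{\mathcal B}(b)$, is $${}_{\mathcal A}\langle a\mid b\rangle=\bigl([a(h\triangleright b^* )]\blacktriangleleft\mathcal G,\; h\triangleleft b^*\bigr),$$ where $h$ is the unique element of $\mathcal H$ with $s_{\mathcal B}(a)=h\triangleright s_{\mathcal B}(b)$. (4) The right $\mathcal C$-valued inner product, defined on pairs $(a,b)$ with $\mathfrak r_{\mathcal B}(a)=\mathfrak r_{\mathcal B}(b)$, is $$\langle a\mid b\rangle_{\mathcal C}=\bigl(a^*\blacktriangleright t,\;\mathcal H\triangleright[(a^*\blacktriangleleft t)b]\bigr),$$ where $t$ is the unique element of $\mathcal G$ with $r_{\mathcal B}(a)\blacktriangleleft t=r_{\mathcal B}(b)$.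
   Context: **Conventions.** All groupoids are topological groupoids that are locally compact Hausdorff and second countable; $r,s$ denote range and source maps, $\mathcal K^{(0)}$ the unit space and $\mathcal K^{(2)}$ the composable pairs ($(x,y)$ with $s(x)=r(y)$) of a groupoid $\mathcal K$. **Self-similar left action.** A self-similar left action of $\mathcal H$ on $\mathcal X$ consists of a continuous surjection $\rho^{(0)}\colon\mathcal X^{(0)}\to\mathcal H^{(0)}$ and, with $\rho=\rho^{(0)}\circ r_{\mathcal X}$, two continuous maps defined on $\{(h,x)\in\mathcal H\times\mathcal X: s_{\mathcal H}(h)=\rho(x)\}$, $(h,x)\mapsto h\triangleright x\in\mathcal X$ and $(h,x)\mapsto h\triangleleft x\in\mathcal H$, such that whenever the expressions make sense: (L1) $r(h)=\rho(h\triangleright x)$, $s(h\triangleleft x)=\rho(x^{-1})$, $r(h\triangleleft x)=\rho((h\triangleright x)^{-1})$; (L2) $h\triangleleft v=h$ for $v\in\mathcal X^{(0)}$, and $\rho(x)\triangleright x=x$; for $(x,y)\in\mathcal X^{(2)}$: $s(h\triangleright x)=r((h\triangleleft x)\triangleright y)$, (L3) $h\triangleleft(xy)=(h\triangleleft x)\triangleleft y$, (L4) $h\triangleright(xy)=(h\triangleright x)[(h\triangleleft x)\triangleright y]$; for $(h,k)\in\mathcal H^{(2)}$: (L5) $(hk)\triangleright x=h\triangleright(k\triangleright x)$, (L6) $(hk)\triangleleft x=[h\triangleleft(k\triangleright x)](k\triangleleft x)$. It is free (proper) if $\triangleright$ is a free (proper) action of $\mathcal H$ on the space $\mathcal X$.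 **Self-similar right action.** A self-similar right action of $\mathcal G$ on $\mathcal X$ consists of a continuous surjection $\sigma^{(0)}\colon\mathcal X^{(0)}\to\mathcal G^{(0)}$ and, with $\sigma=\sigma^{(0)}\circ s_{\mathcal X}$, two continuous maps on $\{(x,t):\sigma(x)=r_{\mathcal G}(t)\}$, $(x,t)\mapsto x\blacktriangleleft t\in\mathcal X$ and $(x,t)\mapsto x\blacktriangleright t\in\mathcal G$, such that: (R1) $\sigma(x\blacktriangleleft t)=s(t)$, $\sigma(x^{-1})=r(x\blacktriangleright t)$, $\sigma((x\blacktriangleleft t)^{-1})=s(x\blacktriangleright t)$; (R2) $v\blacktriangleright t=t$ for $v\in\mathcal X^{(0)}$, $x\blacktriangleleft\sigma(x)=x$; for $(x,y)\in\mathcal X^{(2)}$: $s(x\blacktriangleleft(y\blacktriangleright t))=r(y\blacktriangleleft t)$, (R3) $(xy)\blacktriangleright t=x\blacktriangleright(y\blacktriangleright t)$, (R4) $(xy)\blacktriangleleft t=[x\blacktriangleleft(y\blacktriangleright t)](y\blacktriangleleft t)$; for $(t,t')\in\mathcal G^{(2)}$: (R5) $x\blacktriangleleft(tt')=(x\blacktriangleleft t)\blacktriangleleft t'$, (R6) $x\blacktriangleright(tt')=(x\blacktriangleright t)[(x\blacktriangleleft t)\blacktriangleright t']$. Free/proper refers to $\blacktriangleleft$. **Para-equivalence.** The actions are in tune if, whenever $s(h)=\rho(x)$ and $\sigma(x)=r(t)$: $\sigma(h\triangleright x)=\sigma(x)$, $\rho(x\blacktriangleleft t)=\rho(x)$,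 $h\triangleright(x\blacktriangleleft t)=(h\triangleright x)\blacktriangleleft t$, $(h\triangleright x)\blacktriangleright t=x\blacktriangleright t$, $h\triangleleft(x\blacktriangleleft t)=h\triangleleft x$. $\mathcal X$ is an $(\mathcal H,\mathcal G)$-self-similar para-equivalence if $\mathcal H$ has a self-similar left action and $\mathcal G$ a self-similar right action on $\mathcal X$, both free and proper, the two are in tune, and $\mathcal H,\mathcal G,\mathcal X$ have open source maps. **Self-similar product groupoids.** $\mathcal X\bowtie\mathcal H=\{(x,h):\rho(x^{-1})=r(h)\}$ with $(x,h)(y,k)=(x(h\triangleright y),(h\triangleleft y)k)$ when $s(x)=h\triangleright r(y)$, $(x,h)^{-1}=(h^{-1}\triangleright x^{-1},h^{-1}\triangleleft x^{-1})$; unit space identified with $\mathcal X^{(0)}$ via $(u,\rho(u))\leftrightarrow u$, so that $r(x,h)=r(x)$, $s(x,h)=h^{-1}\triangleright s(x)$. Likewise $\mathcal G\bowtie\mathcal X=\{(t,x):s(t)=\sigma(x^{-1})\}$ with $(s,x)(t,y)=(s(x\blacktriangleright t),(x\blacktriangleleft t)y)$ when $s(x)=r(y)\blacktriangleleft t^{-1}$, $(t,x)^{-1}=(x^{-1}\blacktriangleright t^{-1},x^{-1}\blacktriangleleft t^{-1})$; unit space identified with $\mathcal X^{(0)}$, $r(t,x)=r(x)\blacktriangleleft t^{-1}$, $s(t,x)=s(x)$. Subspace topologies. **Quotient groupoids.** $\mathcal H\backslash\mathcal X=\{\mathcal H\triangleright x\}$ with quotient topology has unit space $\mathcal H\backslash\mathcal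 X^{(0)}$, $s(\mathcal H\triangleright x)=\mathcal H\triangleright s(x)$, $r(\mathcal H\triangleright x)=\mathcal H\triangleright r(x)$, $\xi\eta=\mathcal H\triangleright(xy)$ for any $x\in\xi,y\in\eta$ with $s(x)=r(y)$, $(\mathcal H\triangleright x)^{-1}=\mathcal H\triangleright x^{-1}$; similarly $\mathcal X/\mathcal G=\{x\blacktriangleleft\mathcal G\}$. $\mathcal H$ has a self-similar left action on $\mathcal X/\mathcal G$ with momentum map $x\blacktriangleleft\mathcal G\mapsto\rho(x)$: $h\triangleright(x\blacktriangleleft\mathcal G)=(h\triangleright x)\blacktriangleleft\mathcal G$, $h\triangleleft(x\blacktriangleleft\mathcal G)=h\triangleleft x$. $\mathcal G$ has a self-similar right action on $\mathcal H\backslash\mathcal X$ with momentum map $\mathcal H\triangleright x\mapsto\sigma(x)$: $(\mathcal H\triangleright x)\blacktriangleleft t=\mathcal H\triangleright(x\blacktriangleleft t)$, $(\mathcal H\triangleright x)\blacktriangleright t=x\blacktriangleright t$. These define $(\mathcal X/\mathcal G)\bowtie\mathcal H$ and $\mathcal G\bowtie(\mathcal H\backslash\mathcal X)$, with unit spaces $\mathcal X^{(0)}/\mathcal G$ and $\mathcal H\backslash\mathcal X^{(0)}$. **The groupoid equivalence $\mathcal X$.** Put $\mathfrak r(x)=r_{\mathcal X}(x)\blacktriangleleft\mathcal G$ and $\mathfrak s(x)=\mathcal H\triangleright s_{\mathcal X}(x)$. With these momentum maps and the actions $(\xi,h)\cdot y=x(h\triangleright y)$ (where $x\in\xi$, $s(x)=r(h\triangleright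 y)$) and $y\cdot(t,\eta)=(y\blacktriangleleft t)z$ (where $z\in\eta$, $s(y\blacktriangleleft t)=r(z)$), $\mathcal X$ is a groupoid equivalence between $(\mathcal X/\mathcal G)\bowtie\mathcal H$ and $\mathcal G\bowtie(\mathcal H\backslash\mathcal X)$. **Fell bundles.** A Fell bundle $\mathcal B=(q_{\mathcal B}\colon B\to\mathcal X)$ is an upper semicontinuous Banach bundle with fibres $\mathcal B_x$, with a continuous multiplication on $\mathcal B^{(2)}=\{(a,b):(q(a),q(b))\in\mathcal X^{(2)}\}$ and a continuous involution such that $\mathcal B_x\mathcal B_y\subseteq\mathcal B_{xy}$, multiplication is bilinear and associative, $\|bc\|\le\|b\|\|c\|$, $\mathcal B_x^*\subseteq\mathcal B_{x^{-1}}$, $*$ is conjugate linear, $(bc)^*=c^*b^*$, $b^{**}=b$, $\|b^*b\|=\|b\|^2=\|b^*\|^2$, $b^*b\ge0$ in the C*-algebra $\mathcal B_{s(q(b))}$. It is saturated if the closed linear span of $\mathcal B_x\mathcal B_y$ is $\mathcal B_{xy}$ for all $(x,y)\in\mathcal X^{(2)}$. Write $r_{\mathcal B}=r_{\mathcal X}\circ q_{\mathcal B}$, $s_{\mathcal B}=s_{\mathcal X}\circ q_{\mathcal B}$, $\mathfrak r_{\mathcal B}=\mathfrak r\circ q_{\mathcal B}$, $\mathfrak s_{\mathcal B}=\mathfrak s\circ q_{\mathcal B}$, and analogously $r_{\mathcal A},s_{\mathcal A},r_{\mathcal C},s_{\mathcal C}$ for range/source composed with the bundle projections. **Self-similar actions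 on Fell bundles.** Given a self-similar left action of $\mathcal H$ on $\mathcal X$, a self-similar left action of $\mathcal H$ on $\mathcal B$ is a continuous map $(h,b)\mapsto h\triangleright b\in B$ on $\{(h,b): s(h)=\rho(q(b))\}$ such that: $h\triangleright\cdot$ maps $\mathcal B_x$ linearly into $\mathcal B_{h\triangleright x}$; $k\triangleright(h\triangleright b)=(kh)\triangleright b$; units act as identity; $h\triangleright(bc)=(h\triangleright b)[(h\triangleleft b)\triangleright c]$; $(h\triangleright b)^*=(h\triangleleft b)\triangleright b^*$; here $h\triangleleft b:=h\triangleleft q(b)\in\mathcal H$. A self-similar right action of $\mathcal G$ on $\mathcal B$ is, symmetrically, a continuous map $(b,t)\mapsto b\blacktriangleleft t$ on $\{(b,t):\sigma(q(b))=r(t)\}$ mapping $\mathcal B_x$ linearly into $\mathcal B_{x\blacktriangleleft t}$, with $(b\blacktriangleleft t)\blacktriangleleft t'=b\blacktriangleleft(tt')$, units acting as identity, $(bc)\blacktriangleleft t=[b\blacktriangleleft(c\blacktriangleright t)](c\blacktriangleleft t)$, $(b\blacktriangleleft t)^*=b^*\blacktriangleleft(b\blacktriangleright t)$, where $b\blacktriangleright t:=q(b)\blacktriangleright t\in\mathcal G$. **Quotient Fell bundles.** $\mathcal H\backslash\mathcal B$ has total space $\mathcal H\backslash B=\{\mathcal H\triangleright b\}$ (quotient topology), projection $\mathcal H\triangleright b\mapsto\mathcal H\triangleright q(b)\in\mathcal H\backslash\mathcal X$, norm $\|\mathcal H\triangleright b\|=\|b\|$, linear structure on fibres computed on representatives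 lying in a common fibre of $\mathcal B$, product $\Xi\Theta=\mathcal H\triangleright(bc)$ for $b\in\Xi,c\in\Theta$ with $(b,c)\in\mathcal B^{(2)}$, involution $(\mathcal H\triangleright b)^*=\mathcal H\triangleright b^*$. $\mathcal B/\mathcal G=\{b\blacktriangleleft\mathcal G\}$ over $\mathcal X/\mathcal G$ is defined symmetrically. $\mathcal H$ acts (self-similarly) on $\mathcal B/\mathcal G$ by $h\triangleright(b\blacktriangleleft\mathcal G)=(h\triangleright b)\blacktriangleleft\mathcal G$ and $\mathcal G$ on $\mathcal H\backslash\mathcal B$ by $(\mathcal H\triangleright b)\blacktriangleleft t=\mathcal H\triangleright(b\blacktriangleleft t)$. **Self-similar product Fell bundles.** For a self-similar left action of $\mathcal H$ on a Fell bundle $\mathcal B\to\mathcal X$, $\mathcal B\bowtie\mathcal H$ has total space $\{(b,h):(q(b),h)\in\mathcal X\bowtie\mathcal H\}$ (subspace topology), projection $(b,h)\mapsto(q(b),h)$, norm $\|(b,h)\|=\|b\|$, product $(a,h)(b,k)=(a[h\triangleright b],[h\triangleleft b]k)$, involution $(b,h)^*=(h^{-1}\triangleright b^*,h^{-1}\triangleleft b^* )$. Symmetrically $\mathcal G\bowtie\mathcal B=\{(t,b):(t,q(b))\in\mathcal G\bowtie\mathcal X\}$ with $(s,a)(t,b)=(s(a\blacktriangleright t),(a\blacktriangleleft t)b)$, $(t,b)^*=(b^*\blacktriangleright t^{-1},b^*\blacktriangleleft t^{-1})$. **Fell bundle equivalence.** Let $\mathcal K,\mathcal L$ be groupoids,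 $Z$ a $(\mathcal K,\mathcal L)$-equivalence with momentum maps $\mathfrak r\colon Z\to\mathcal K^{(0)}$, $\mathfrak s\colon Z\to\mathcal L^{(0)}$, $\mathcal A\to\mathcal K$, $\mathcal C\to\mathcal L$ saturated Fell bundles and $\mathcal M=(q_{\mathcal M}\colon M\to Z)$ an upper semicontinuous Banach bundle. A left action of $\mathcal A$ on $\mathcal M$ is a continuous map $(a,m)\mapsto a\cdot m$, defined when $s(q_{\mathcal A}(a))=\mathfrak r(q_{\mathcal M}(m))$, with $q_{\mathcal M}(a\cdot m)=q_{\mathcal A}(a)\cdot q_{\mathcal M}(m)$, $a\cdot(b\cdot m)=(ab)\cdot m$, $\|a\cdot m\|\le\|a\|\|m\|$; right actions similarly. $\mathcal M$ is an $\mathcal A$–$\mathcal C$ equivalence if: (FE1) it has a left $\mathcal A$- and a right $\mathcal C$-action which commute; (FE2) there are sesquilinear maps ${}_{\mathcal A}\langle\cdot\mid\cdot\rangle$ (defined on pairs with equal $\mathfrak s\circ q_{\mathcal M}$, $\mathcal A$-valued, linear in the first variable) and $\langle\cdot\mid\cdot\rangle_{\mathcal C}$ (defined on pairs with equal $\mathfrak r\circ q_{\mathcal M}$, $\mathcal C$-valued, linear in the second variable) with $q_{\mathcal M}(m_1)=q_{\mathcal A}({}_{\mathcal A}\langle m_1\mid m_2\rangle)\cdot q_{\mathcal M}(m_2)$, $q_{\mathcal M}(m_1)\cdot q_{\mathcal C}(\langle m_1\mid m_2\rangle_{\mathcal C})=q_{\mathcal M}(m_2)$, ${}_{\mathcal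 A}\langle m_1\mid m_2\rangle^*={}_{\mathcal A}\langle m_2\mid m_1\rangle$, $\langle m_1\mid m_2\rangle_{\mathcal C}^*=\langle m_2\mid m_1\rangle_{\mathcal C}$, ${}_{\mathcal A}\langle a\cdot m_1\mid m_2\rangle=a\,{}_{\mathcal A}\langle m_1\mid m_2\rangle$, $\langle m_1\mid m_2\cdot c\rangle_{\mathcal C}=\langle m_1\mid m_2\rangle_{\mathcal C}c$, and ${}_{\mathcal A}\langle m_1\mid m_2\rangle\cdot m_3=m_1\cdot\langle m_2\mid m_3\rangle_{\mathcal C}$; (FE3) with these actions and inner products each fibre $M(z)$ is an imprimitivity bimodule between the C*-algebras $\mathcal A_{\mathfrak r(z)}$ and $\mathcal C_{\mathfrak s(z)}$. *)

theory Defs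
  imports "HOL-Analysis.Analysis"
begin

section \<open>Topological groupoids\<close>

text \<open>
  A groupoid is given by its arrows, namely the points of the topology; the unit space is a set of
  arrows, so range and source are maps from arrows to arrows.
\<close>

record 'a groupoid =
  gtop :: "'a topology"
  rng :: "'a \<Rightarrow> 'a"
  src :: "'a \<Rightarrow> 'a"
  gmult :: "'a \<Rightarrow> 'a \<Rightarrow> 'a"  (infixl "\<cdot>\<index>" 70)
  ginv :: "'a \<Rightarrow> 'a"

definition arrows :: "'a groupoid \<Rightarrow> 'a set"
  where "arrows K = topspace (gtop K)"

definition units :: "'a groupoid \<Rightarrow> 'a set"
  where "units K = src K ` arrows K"

definition unit_top :: "'a groupoid \<Rightarrow> 'a topology"
  where "unit_top K = subtopology (gtop K) (units K)"

definition composable :: "'a groupoid \<Rightarrow> ('a \<times> 'a) set"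
  where "composable K = {(x, y). x \<in> arrows K \<and> y \<in> arrows K \<and> src K x = rng K y}"

locale topological_groupoid =
  fixes K :: "'a groupoid"
  assumes rng_unit: "x \<in> arrows K \<Longrightarrow> rng K x \<in> units K"
    and units_arrows: "units K \<subseteq> arrows K"
    and rng_of_unit: "u \<in> units K \<Longrightarrow> rng K u = u"
    and src_of_unit: "u \<in> units K \<Longrightarrow> src K u = u"
    and mult_closed: "(x, y) \<in> composable K \<Longrightarrow> x \<cdot>\<^bsub>K\<^esub> y \<in> arrows K"
    and rng_mult: "(x, y) \<in> composable K \<Longrightarrow> rng K (x \<cdot>\<^bsub>K\<^esub> y) = rng K x"
    and src_mult: "(x, y) \<in> composable K \<Longrightarrow> src K (x \<cdot>\<^bsub>K\<^esub> y) = src K y"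
    and mult_assoc: "\<lbrakk>(x, y) \<in> composable K; (y, z) \<in> composable K\<rbrakk>
        \<Longrightarrow> (x \<cdot>\<^bsub>K\<^esub> y) \<cdot>\<^bsub>K\<^esub> z = x \<cdot>\<^bsub>K\<^esub> (y \<cdot>\<^bsub>K\<^esub> z)"
    and rng_left_unit: "x \<in> arrows K \<Longrightarrow> rng K x \<cdot>\<^bsub>K\<^esub> x = x"
    and src_right_unit: "x \<in> arrows K \<Longrightarrow> x \<cdot>\<^bsub>K\<^esub> src K x = x"
    and inv_closed: "x \<in> arrows K \<Longrightarrow> ginv K x \<in> arrows K"
    and rng_inv: "x \<in> arrows K \<Longrightarrow> rng K (ginv K x) = src K x"
    and src_inv: "x \<in> arrows K \<Longrightarrow> src K (ginv K x) = rng K x"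
    and inv_right: "x \<in> arrows K \<Longrightarrow> x \<cdot>\<^bsub>K\<^esub> ginv K x = rng K x"
    and inv_left: "x \<in> arrows K \<Longrightarrow> ginv K x \<cdot>\<^bsub>K\<^esub> x = src K x"
    and rng_continuous: "continuous_map (gtop K) (gtop K) (rng K)"
    and src_continuous: "continuous_map (gtop K) (gtop K) (src K)"
    and mult_continuous:
      "continuous_map (subtopology (prod_topology (gtop K) (gtop K)) (composable K)) (gtop K)
         (\<lambda>(x, y). x \<cdot>\<^bsub>K\<^esub> y)"
    and inv_continuous: "continuous_map (gtop K) (gtop K) (ginv K)"
    and Hausdorff: "Hausdorff_space (gtop K)"
    and locally_compact: "locally_compact_space (gtop K)"
    and second_countable: "second_countable (gtop K)"

definition open_source :: "'a groupoid \<Rightarrow> bool"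
  where "open_source K \<longleftrightarrow> open_map (gtop K) (unit_top K) (src K)"


section \<open>Groupoid actions on spaces\<close>

text \<open>
  In each of the following, \<open>m\<close> is the momentum map and \<open>a\<close> the action, which is only meaningful on
  its domain: pairs \<open>(k, z)\<close> with \<open>src K k = m z\<close> on the left, pairs \<open>(z, k)\<close> with
  \<open>m z = rng K k\<close> on the right.
\<close>

definition ldom :: "'k groupoid \<Rightarrow> 'z topology \<Rightarrow> ('z \<Rightarrow> 'k) \<Rightarrow> ('k \<times> 'z) set"
  where "ldom K Z m = {(k, z). k \<in> arrows K \<and> z \<in> topspace Z \<and> src K k = m z}"

definition ldom_top :: "'k groupoid \<Rightarrow> 'z topology \<Rightarrow> ('z \<Rightarrow> 'k) \<Rightarrow> ('k \<times> 'z) topology"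
  where "ldom_top K Z m = subtopology (prod_topology (gtop K) Z) (ldom K Z m)"

definition rdom :: "'k groupoid \<Rightarrow> 'z topology \<Rightarrow> ('z \<Rightarrow> 'k) \<Rightarrow> ('z \<times> 'k) set"
  where "rdom K Z m = {(z, k). z \<in> topspace Z \<and> k \<in> arrows K \<and> m z = rng K k}"

definition rdom_top :: "'k groupoid \<Rightarrow> 'z topology \<Rightarrow> ('z \<Rightarrow> 'k) \<Rightarrow> ('z \<times> 'k) topology"
  where "rdom_top K Z m = subtopology (prod_topology Z (gtop K)) (rdom K Z m)"

definition lorbit :: "'k groupoid \<Rightarrow> ('z \<Rightarrow> 'k) \<Rightarrow> ('k \<Rightarrow> 'z \<Rightarrow> 'z) \<Rightarrow> 'z \<Rightarrow> 'z set"
  where "lorbit K m a z = {a k z | k. k \<in> arrows K \<and> src K k = m z}"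

definition rorbit :: "'k groupoid \<Rightarrow> ('z \<Rightarrow> 'k) \<Rightarrow> ('z \<Rightarrow> 'k \<Rightarrow> 'z) \<Rightarrow> 'z \<Rightarrow> 'z set"
  where "rorbit K m a z = {a z k | k. k \<in> arrows K \<and> m z = rng K k}"

definition free_laction :: "'k groupoid \<Rightarrow> 'z topology \<Rightarrow> ('z \<Rightarrow> 'k) \<Rightarrow> ('k \<Rightarrow> 'z \<Rightarrow> 'z) \<Rightarrow> bool"
  where "free_laction K Z m a \<longleftrightarrow> (\<forall>(k, z) \<in> ldom K Z m. a k z = z \<longrightarrow> k \<in> units K)"

definition free_raction :: "'k groupoid \<Rightarrow> 'z topology \<Rightarrow> ('z \<Rightarrow> 'k) \<Rightarrow> ('z \<Rightarrow> 'k \<Rightarrow> 'z) \<Rightarrow> bool"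
  where "free_raction K Z m a \<longleftrightarrow> (\<forall>(z, k) \<in> rdom K Z m. a z k = z \<longrightarrow> k \<in> units K)"

definition proper_laction :: "'k groupoid \<Rightarrow> 'z topology \<Rightarrow> ('z \<Rightarrow> 'k) \<Rightarrow> ('k \<Rightarrow> 'z \<Rightarrow> 'z) \<Rightarrow> bool"
  where "proper_laction K Z m a \<longleftrightarrow>
    proper_map (ldom_top K Z m) (prod_topology Z Z) (\<lambda>(k, z). (a k z, z))"

definition proper_raction :: "'k groupoid \<Rightarrow> 'z topology \<Rightarrow> ('z \<Rightarrow> 'k) \<Rightarrow> ('z \<Rightarrow> 'k \<Rightarrow> 'z) \<Rightarrow> bool"
  where "proper_raction K Z m a \<longleftrightarrow>
    proper_map (rdom_top K Z m) (prod_topology Z Z) (\<lambda>(z, k). (a z k, z))"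

locale groupoid_left_space = topological_groupoid K for K :: "'k groupoid" +
  fixes Z :: "'z topology" and m :: "'z \<Rightarrow> 'k" and a :: "'k \<Rightarrow> 'z \<Rightarrow> 'z"
  assumes momentum_continuous: "continuous_map Z (unit_top K) m"
    and act_continuous: "continuous_map (ldom_top K Z m) Z (\<lambda>(k, z). a k z)"
    and momentum_act: "(k, z) \<in> ldom K Z m \<Longrightarrow> m (a k z) = rng K k"
    and act_act: "\<lbrakk>(k', k) \<in> composable K; (k, z) \<in> ldom K Z m\<rbrakk> \<Longrightarrow> a k' (a k z) = a (k' \<cdot>\<^bsub>K\<^esub> k) z"
    and act_unit: "z \<in> topspace Z \<Longrightarrow> a (m z) z = z"

locale groupoid_right_space = topological_groupoid K for K :: "'k groupoid" +
  fixes Z :: "'z topology" and m :: "'z \<Rightarrow> 'k" and a :: "'z \<Rightarrow> 'k \<Rightarrow> 'z"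
  assumes momentum_continuous: "continuous_map Z (unit_top K) m"
    and act_continuous: "continuous_map (rdom_top K Z m) Z (\<lambda>(z, k). a z k)"
    and momentum_act: "(z, k) \<in> rdom K Z m \<Longrightarrow> m (a z k) = src K k"
    and act_act: "\<lbrakk>(z, k) \<in> rdom K Z m; (k, k') \<in> composable K\<rbrakk> \<Longrightarrow> a (a z k) k' = a z (k \<cdot>\<^bsub>K\<^esub> k')"
    and act_unit: "z \<in> topspace Z \<Longrightarrow> a z (m z) = z"

definition quotient_topology :: "'a topology \<Rightarrow> ('a \<Rightarrow> 'b) \<Rightarrow> 'b topology"
  where "quotient_topology T f =
    topology (\<lambda>U. U \<subseteq> f ` topspace T \<and> openin T {x \<in> topspace T. f x \<in> U})"

lemma openin_quotient_topology:
  "openin (quotient_topology T f) U \<longleftrightarrow> U \<subseteq> f ` topspace T \<and> openin T {x \<in> topspace T. f x \<in> U}"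
proof -
  have "istopology (\<lambda>U. U \<subseteq> f ` topspace T \<and> openin T {x \<in> topspace T. f x \<in> U})"
    unfolding istopology_def
  proof (rule conjI, intro allI impI)
    fix S U
    assume "S \<subseteq> f ` topspace T \<and> openin T {x \<in> topspace T. f x \<in> S}"
      and "U \<subseteq> f ` topspace T \<and> openin T {x \<in> topspace T. f x \<in> U}"
    moreover have "{x \<in> topspace T. f x \<in> S \<inter> U}
        = {x \<in> topspace T. f x \<in> S} \<inter> {x \<in> topspace T. f x \<in> U}"
      by blast
    ultimately show "S \<inter> U \<subseteq> f ` topspace T \<and> openin T {x \<in> topspace T. f x \<in> S \<inter> U}"
      by (metis (no_types, lifting) inf.coboundedI1 openin_Int)
  next
    show "\<forall>\<K>. (\<forall>V\<in>\<K>. V \<subseteq> f ` topspace T \<and> openin T {x \<in> topspace T. f x \<in> V}) \<longrightarrow>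
        \<Union>\<K> \<subseteq> f ` topspace T \<and> openin T {x \<in> topspace T. f x \<in> \<Union>\<K>}"
    proof (intro allI impI)
      fix \<K> assume "\<forall>V\<in>\<K>. V \<subseteq> f ` topspace T \<and> openin T {x \<in> topspace T. f x \<in> V}"
      moreover have "{x \<in> topspace T. f x \<in> \<Union>\<K>} = \<Union>((\<lambda>V. {x \<in> topspace T. f x \<in> V}) ` \<K>)"
        by blast
      ultimately show "\<Union>\<K> \<subseteq> f ` topspace T \<and> openin T {x \<in> topspace T. f x \<in> \<Union>\<K>}"
        by (auto intro!: openin_Union)
    qed
  qed
  then show ?thesis
    by (simp add: quotient_topology_def topology_inverse')
qed

lemma topspace_quotient_topology: "topspace (quotient_topology T f) = f ` topspace T"
proof -
  have "{x \<in> topspace T. f x \<in> f ` topspace T} = topspace T" by blast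
  then have "openin (quotient_topology T f) (f ` topspace T)"
    by (simp add: openin_quotient_topology)
  then show ?thesis
    by (metis openin_quotient_topology openin_subset openin_topspace subset_antisym)
qed

lemma quotient_map_quotient_topology: "quotient_map T (quotient_topology T f) f"
  by (simp add: quotient_map_def topspace_quotient_topology openin_quotient_topology)

locale groupoid_equivalence =
  left: groupoid_left_space K Z rZ la + right: groupoid_right_space L Z sZ ra
  for K :: "'k groupoid" and L :: "'l groupoid" and Z :: "'z topology"
    and rZ :: "'z \<Rightarrow> 'k" and sZ :: "'z \<Rightarrow> 'l"
    and la :: "'k \<Rightarrow> 'z \<Rightarrow> 'z" and ra :: "'z \<Rightarrow> 'l \<Rightarrow> 'z" +
  assumes Hausdorff: "Hausdorff_space Z"
    and locally_compact: "locally_compact_space Z"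
    and open_momentum: "open_map Z (unit_top K) rZ" "open_map Z (unit_top L) sZ"
    and free: "free_laction K Z rZ la" "free_raction L Z sZ ra"
    and proper: "proper_laction K Z rZ la" "proper_raction L Z sZ ra"
    and invariant: "(k, z) \<in> ldom K Z rZ \<Longrightarrow> sZ (la k z) = sZ z"
      "(z, t) \<in> rdom L Z sZ \<Longrightarrow> rZ (ra z t) = rZ z"
    and commute: "\<lbrakk>(k, z) \<in> ldom K Z rZ; (z, t) \<in> rdom L Z sZ\<rbrakk>
        \<Longrightarrow> ra (la k z) t = la k (ra z t)"
    and orbits_homeo:
      "\<exists>f. homeomorphic_map (quotient_topology Z (rorbit L sZ ra)) (unit_top K) f
         \<and> (\<forall>z\<in>topspace Z. f (rorbit L sZ ra z) = rZ z)"
      "\<exists>g. homeomorphic_map (quotient_topology Z (lorbit K rZ la)) (unit_top L) g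
         \<and> (\<forall>z\<in>topspace Z. g (lorbit K rZ la z) = sZ z)"


section \<open>Self-similar actions on groupoids\<close>

text \<open>
  The field \<open>lmom\<close> (\<open>rmom\<close>) is the map on the unit space of the groupoid acted upon, so that it is
  only meaningful there; \<open>lrho\<close> and \<open>rsigma\<close> extend it to all arrows.
\<close>

record ('h, 'x) left_ss =
  lmom :: "'x \<Rightarrow> 'h"
  lact :: "'h \<Rightarrow> 'x \<Rightarrow> 'x"  (infixr "\<triangleright>\<index>" 75)
  lres :: "'h \<Rightarrow> 'x \<Rightarrow> 'h"  (infixl "\<triangleleft>\<index>" 75)

record ('g, 'x) right_ss =
  rmom :: "'x \<Rightarrow> 'g"
  ract :: "'x \<Rightarrow> 'g \<Rightarrow> 'x"  (infixl "\<blacktriangleleft>\<index>" 75)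
  rres :: "'x \<Rightarrow> 'g \<Rightarrow> 'g"  (infixr "\<blacktriangleright>\<index>" 75)

definition lrho :: "'x groupoid \<Rightarrow> ('h, 'x) left_ss \<Rightarrow> 'x \<Rightarrow> 'h"
  where "lrho X \<alpha> x = lmom \<alpha> (rng X x)"

definition rsigma :: "'x groupoid \<Rightarrow> ('g, 'x) right_ss \<Rightarrow> 'x \<Rightarrow> 'g"
  where "rsigma X \<beta> x = rmom \<beta> (src X x)"

locale self_similar_left =
  H: topological_groupoid H + X: topological_groupoid X
  for H :: "'h groupoid" and X :: "'x groupoid" +
  fixes \<alpha> :: "('h, 'x) left_ss"
  assumes mom_continuous: "continuous_map (unit_top X) (unit_top H) (lmom \<alpha>)"
    and mom_surj: "lmom \<alpha> ` units X = units H"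
    and act_continuous: "continuous_map (ldom_top H (gtop X) (lrho X \<alpha>)) (gtop X) (\<lambda>(h, x). h \<triangleright>\<^bsub>\<alpha>\<^esub> x)"
    and res_continuous: "continuous_map (ldom_top H (gtop X) (lrho X \<alpha>)) (gtop H) (\<lambda>(h, x). h \<triangleleft>\<^bsub>\<alpha>\<^esub> x)"
    and L1: "(h, x) \<in> ldom H (gtop X) (lrho X \<alpha>) \<Longrightarrow> rng H h = lrho X \<alpha> (h \<triangleright>\<^bsub>\<alpha>\<^esub> x)"
      "(h, x) \<in> ldom H (gtop X) (lrho X \<alpha>) \<Longrightarrow> src H (h \<triangleleft>\<^bsub>\<alpha>\<^esub> x) = lrho X \<alpha> (ginv X x)"
      "(h, x) \<in> ldom H (gtop X) (lrho X \<alpha>)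
        \<Longrightarrow> rng H (h \<triangleleft>\<^bsub>\<alpha>\<^esub> x) = lrho X \<alpha> (ginv X (h \<triangleright>\<^bsub>\<alpha>\<^esub> x))"
    and L2: "\<lbrakk>(h, v) \<in> ldom H (gtop X) (lrho X \<alpha>); v \<in> units X\<rbrakk> \<Longrightarrow> h \<triangleleft>\<^bsub>\<alpha>\<^esub> v = h"
      "x \<in> arrows X \<Longrightarrow> lrho X \<alpha> x \<triangleright>\<^bsub>\<alpha>\<^esub> x = x"
    and act_composable: "\<lbrakk>(h, x) \<in> ldom H (gtop X) (lrho X \<alpha>); (x, y) \<in> composable X\<rbrakk>
        \<Longrightarrow> src X (h \<triangleright>\<^bsub>\<alpha>\<^esub> x) = rng X ((h \<triangleleft>\<^bsub>\<alpha>\<^esub> x) \<triangleright>\<^bsub>\<alpha>\<^esub> y)"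
    and L3: "\<lbrakk>(h, x) \<in> ldom H (gtop X) (lrho X \<alpha>); (x, y) \<in> composable X\<rbrakk>
        \<Longrightarrow> h \<triangleleft>\<^bsub>\<alpha>\<^esub> (x \<cdot>\<^bsub>X\<^esub> y) = (h \<triangleleft>\<^bsub>\<alpha>\<^esub> x) \<triangleleft>\<^bsub>\<alpha>\<^esub> y"
    and L4: "\<lbrakk>(h, x) \<in> ldom H (gtop X) (lrho X \<alpha>); (x, y) \<in> composable X\<rbrakk>
        \<Longrightarrow> h \<triangleright>\<^bsub>\<alpha>\<^esub> (x \<cdot>\<^bsub>X\<^esub> y) = (h \<triangleright>\<^bsub>\<alpha>\<^esub> x) \<cdot>\<^bsub>X\<^esub> ((h \<triangleleft>\<^bsub>\<alpha>\<^esub> x) \<triangleright>\<^bsub>\<alpha>\<^esub> y)"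
    and L5: "\<lbrakk>(h, k) \<in> composable H; (k, x) \<in> ldom H (gtop X) (lrho X \<alpha>)\<rbrakk>
        \<Longrightarrow> (h \<cdot>\<^bsub>H\<^esub> k) \<triangleright>\<^bsub>\<alpha>\<^esub> x = h \<triangleright>\<^bsub>\<alpha>\<^esub> (k \<triangleright>\<^bsub>\<alpha>\<^esub> x)"
    and L6: "\<lbrakk>(h, k) \<in> composable H; (k, x) \<in> ldom H (gtop X) (lrho X \<alpha>)\<rbrakk>
        \<Longrightarrow> (h \<cdot>\<^bsub>H\<^esub> k) \<triangleleft>\<^bsub>\<alpha>\<^esub> x = (h \<triangleleft>\<^bsub>\<alpha>\<^esub> (k \<triangleright>\<^bsub>\<alpha>\<^esub> x)) \<cdot>\<^bsub>H\<^esub> (k \<triangleleft>\<^bsub>\<alpha>\<^esub> x)"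

locale self_similar_right =
  G: topological_groupoid G + X: topological_groupoid X
  for G :: "'g groupoid" and X :: "'x groupoid" +
  fixes \<beta> :: "('g, 'x) right_ss"
  assumes mom_continuous: "continuous_map (unit_top X) (unit_top G) (rmom \<beta>)"
    and mom_surj: "rmom \<beta> ` units X = units G"
    and act_continuous: "continuous_map (rdom_top G (gtop X) (rsigma X \<beta>)) (gtop X) (\<lambda>(x, t). x \<blacktriangleleft>\<^bsub>\<beta>\<^esub> t)"
    and res_continuous: "continuous_map (rdom_top G (gtop X) (rsigma X \<beta>)) (gtop G) (\<lambda>(x, t). x \<blacktriangleright>\<^bsub>\<beta>\<^esub> t)"
    and R1: "(x, t) \<in> rdom G (gtop X) (rsigma X \<beta>) \<Longrightarrow> rsigma X \<beta> (x \<blacktriangleleft>\<^bsub>\<beta>\<^esub> t) = src G t"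
      "(x, t) \<in> rdom G (gtop X) (rsigma X \<beta>) \<Longrightarrow> rsigma X \<beta> (ginv X x) = rng G (x \<blacktriangleright>\<^bsub>\<beta>\<^esub> t)"
      "(x, t) \<in> rdom G (gtop X) (rsigma X \<beta>)
        \<Longrightarrow> rsigma X \<beta> (ginv X (x \<blacktriangleleft>\<^bsub>\<beta>\<^esub> t)) = src G (x \<blacktriangleright>\<^bsub>\<beta>\<^esub> t)"
    and R2: "\<lbrakk>(v, t) \<in> rdom G (gtop X) (rsigma X \<beta>); v \<in> units X\<rbrakk> \<Longrightarrow> v \<blacktriangleright>\<^bsub>\<beta>\<^esub> t = t"
      "x \<in> arrows X \<Longrightarrow> x \<blacktriangleleft>\<^bsub>\<beta>\<^esub> rsigma X \<beta> x = x"
    and act_composable: "\<lbrakk>(x, y) \<in> composable X; (y, t) \<in> rdom G (gtop X) (rsigma X \<beta>)\<rbrakk>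
        \<Longrightarrow> src X (x \<blacktriangleleft>\<^bsub>\<beta>\<^esub> (y \<blacktriangleright>\<^bsub>\<beta>\<^esub> t)) = rng X (y \<blacktriangleleft>\<^bsub>\<beta>\<^esub> t)"
    and R3: "\<lbrakk>(x, y) \<in> composable X; (y, t) \<in> rdom G (gtop X) (rsigma X \<beta>)\<rbrakk>
        \<Longrightarrow> (x \<cdot>\<^bsub>X\<^esub> y) \<blacktriangleright>\<^bsub>\<beta>\<^esub> t = x \<blacktriangleright>\<^bsub>\<beta>\<^esub> (y \<blacktriangleright>\<^bsub>\<beta>\<^esub> t)"
    and R4: "\<lbrakk>(x, y) \<in> composable X; (y, t) \<in> rdom G (gtop X) (rsigma X \<beta>)\<rbrakk>
        \<Longrightarrow> (x \<cdot>\<^bsub>X\<^esub> y) \<blacktriangleleft>\<^bsub>\<beta>\<^esub> t = (x \<blacktriangleleft>\<^bsub>\<beta>\<^esub> (y \<blacktriangleright>\<^bsub>\<beta>\<^esub> t)) \<cdot>\<^bsub>X\<^esub> (y \<blacktriangleleft>\<^bsub>\<beta>\<^esub> t)"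
    and R5: "\<lbrakk>(x, t) \<in> rdom G (gtop X) (rsigma X \<beta>); (t, t') \<in> composable G\<rbrakk>
        \<Longrightarrow> x \<blacktriangleleft>\<^bsub>\<beta>\<^esub> (t \<cdot>\<^bsub>G\<^esub> t') = (x \<blacktriangleleft>\<^bsub>\<beta>\<^esub> t) \<blacktriangleleft>\<^bsub>\<beta>\<^esub> t'"
    and R6: "\<lbrakk>(x, t) \<in> rdom G (gtop X) (rsigma X \<beta>); (t, t') \<in> composable G\<rbrakk>
        \<Longrightarrow> x \<blacktriangleright>\<^bsub>\<beta>\<^esub> (t \<cdot>\<^bsub>G\<^esub> t') = (x \<blacktriangleright>\<^bsub>\<beta>\<^esub> t) \<cdot>\<^bsub>G\<^esub> ((x \<blacktriangleleft>\<^bsub>\<beta>\<^esub> t) \<blacktriangleright>\<^bsub>\<beta>\<^esub> t')"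

definition in_tune ::
  "'h groupoid \<Rightarrow> 'g groupoid \<Rightarrow> 'x groupoid \<Rightarrow> ('h, 'x) left_ss \<Rightarrow> ('g, 'x) right_ss \<Rightarrow> bool"
  where "in_tune H G X \<alpha> \<beta> \<longleftrightarrow>
    (\<forall>h x t. (h, x) \<in> ldom H (gtop X) (lrho X \<alpha>) \<and> (x, t) \<in> rdom G (gtop X) (rsigma X \<beta>) \<longrightarrow>
      rsigma X \<beta> (h \<triangleright>\<^bsub>\<alpha>\<^esub> x) = rsigma X \<beta> x \<and>
      lrho X \<alpha> (x \<blacktriangleleft>\<^bsub>\<beta>\<^esub> t) = lrho X \<alpha> x \<and>
      h \<triangleright>\<^bsub>\<alpha>\<^esub> (x \<blacktriangleleft>\<^bsub>\<beta>\<^esub> t) = (h \<triangleright>\<^bsub>\<alpha>\<^esub> x) \<blacktriangleleft>\<^bsub>\<beta>\<^esub> t \<and>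
      (h \<triangleright>\<^bsub>\<alpha>\<^esub> x) \<blacktriangleright>\<^bsub>\<beta>\<^esub> t = x \<blacktriangleright>\<^bsub>\<beta>\<^esub> t \<and>
      h \<triangleleft>\<^bsub>\<alpha>\<^esub> (x \<blacktriangleleft>\<^bsub>\<beta>\<^esub> t) = h \<triangleleft>\<^bsub>\<alpha>\<^esub> x)"

definition para_equivalence ::
  "'h groupoid \<Rightarrow> 'g groupoid \<Rightarrow> 'x groupoid \<Rightarrow> ('h, 'x) left_ss \<Rightarrow> ('g, 'x) right_ss \<Rightarrow> bool"
  where "para_equivalence H G X \<alpha> \<beta> \<longleftrightarrow>
    self_similar_left H X \<alpha> \<and> self_similar_right G X \<beta> \<and>
    free_laction H (gtop X) (lrho X \<alpha>) (lact \<alpha>) \<and> proper_laction H (gtop X) (lrho X \<alpha>) (lact \<alpha>) \<and>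
    free_raction G (gtop X) (rsigma X \<beta>) (ract \<beta>) \<and> proper_raction G (gtop X) (rsigma X \<beta>) (ract \<beta>) \<and>
    in_tune H G X \<alpha> \<beta> \<and>
    open_source H \<and> open_source G \<and> open_source X"


section \<open>Self-similar product groupoids and quotient groupoids\<close>

text \<open>
  Since units are arrows here, the identification of a unit \<open>u\<close> of \<open>X\<close> with a unit of the product
  groupoid is made explicit by \<open>lprod_unit\<close> and \<open>rprod_unit\<close>.
\<close>

definition lprod_unit :: "('h, 'x) left_ss \<Rightarrow> 'x \<Rightarrow> 'x \<times> 'h"
  where "lprod_unit \<alpha> u = (u, lmom \<alpha> u)"

definition rprod_unit :: "('g, 'x) right_ss \<Rightarrow> 'x \<Rightarrow> 'g \<times> 'x"
  where "rprod_unit \<beta> u = (rmom \<beta> u, u)"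

definition lprod_groupoid ::
  "'x groupoid \<Rightarrow> 'h groupoid \<Rightarrow> ('h, 'x) left_ss \<Rightarrow> ('x \<times> 'h) groupoid"
  where "lprod_groupoid X H \<alpha> =
    \<lparr> gtop = subtopology (prod_topology (gtop X) (gtop H))
               {(x, h). x \<in> arrows X \<and> h \<in> arrows H \<and> lrho X \<alpha> (ginv X x) = rng H h},
      rng = (\<lambda>(x, h). lprod_unit \<alpha> (rng X x)),
      src = (\<lambda>(x, h). lprod_unit \<alpha> (ginv H h \<triangleright>\<^bsub>\<alpha>\<^esub> src X x)),
      gmult = (\<lambda>(x, h) (y, k). (x \<cdot>\<^bsub>X\<^esub> (h \<triangleright>\<^bsub>\<alpha>\<^esub> y), (h \<triangleleft>\<^bsub>\<alpha>\<^esub> y) \<cdot>\<^bsub>H\<^esub> k)),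
      ginv = (\<lambda>(x, h). (ginv H h \<triangleright>\<^bsub>\<alpha>\<^esub> ginv X x, ginv H h \<triangleleft>\<^bsub>\<alpha>\<^esub> ginv X x)) \<rparr>"

definition rprod_groupoid ::
  "'g groupoid \<Rightarrow> 'x groupoid \<Rightarrow> ('g, 'x) right_ss \<Rightarrow> ('g \<times> 'x) groupoid"
  where "rprod_groupoid G X \<beta> =
    \<lparr> gtop = subtopology (prod_topology (gtop G) (gtop X))
               {(t, x). t \<in> arrows G \<and> x \<in> arrows X \<and> src G t = rsigma X \<beta> (ginv X x)},
      rng = (\<lambda>(t, x). rprod_unit \<beta> (rng X x \<blacktriangleleft>\<^bsub>\<beta>\<^esub> ginv G t)),
      src = (\<lambda>(t, x). rprod_unit \<beta> (src X x)),
      gmult = (\<lambda>(s, x) (t, y). (s \<cdot>\<^bsub>G\<^esub> (x \<blacktriangleright>\<^bsub>\<beta>\<^esub> t), (x \<blacktriangleleft>\<^bsub>\<beta>\<^esub> t) \<cdot>\<^bsub>X\<^esub> y)),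
      ginv = (\<lambda>(t, x). (ginv X x \<blacktriangleright>\<^bsub>\<beta>\<^esub> ginv G t, ginv X x \<blacktriangleleft>\<^bsub>\<beta>\<^esub> ginv G t)) \<rparr>"

text \<open>
  Operations on orbits are computed on representatives: \<open>the_elem\<close> extracts the common value over
  all admissible representatives.
\<close>

definition orbit_groupoid :: "'x groupoid \<Rightarrow> ('x \<Rightarrow> 'x set) \<Rightarrow> 'x set groupoid"
  where "orbit_groupoid X orb =
    \<lparr> gtop = quotient_topology (gtop X) orb,
      rng = (\<lambda>\<xi>. the_elem ((\<lambda>x. orb (rng X x)) ` \<xi>)),
      src = (\<lambda>\<xi>. the_elem ((\<lambda>x. orb (src X x)) ` \<xi>)),
      gmult = (\<lambda>\<xi> \<eta>. the_elem {orb (x \<cdot>\<^bsub>X\<^esub> y) | x y. x \<in> \<xi> \<and> y \<in> \<eta> \<and> src X x = rng X y}),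
      ginv = (\<lambda>\<xi>. the_elem ((\<lambda>x. orb (ginv X x)) ` \<xi>)) \<rparr>"

definition horb :: "'h groupoid \<Rightarrow> 'x groupoid \<Rightarrow> ('h, 'x) left_ss \<Rightarrow> 'x \<Rightarrow> 'x set"
  where "horb H X \<alpha> = lorbit H (lrho X \<alpha>) (lact \<alpha>)"

definition gorb :: "'g groupoid \<Rightarrow> 'x groupoid \<Rightarrow> ('g, 'x) right_ss \<Rightarrow> 'x \<Rightarrow> 'x set"
  where "gorb G X \<beta> = rorbit G (rsigma X \<beta>) (ract \<beta>)"

definition lquot :: "'h groupoid \<Rightarrow> 'x groupoid \<Rightarrow> ('h, 'x) left_ss \<Rightarrow> 'x set groupoid"
  where "lquot H X \<alpha> = orbit_groupoid X (horb H X \<alpha>)"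

definition rquot :: "'x groupoid \<Rightarrow> 'g groupoid \<Rightarrow> ('g, 'x) right_ss \<Rightarrow> 'x set groupoid"
  where "rquot X G \<beta> = orbit_groupoid X (gorb G X \<beta>)"

definition lact_on_rquot ::
  "'g groupoid \<Rightarrow> 'x groupoid \<Rightarrow> ('h, 'x) left_ss \<Rightarrow> ('g, 'x) right_ss \<Rightarrow> ('h, 'x set) left_ss"
  where "lact_on_rquot G X \<alpha> \<beta> =
    \<lparr> lmom = (\<lambda>\<xi>. the_elem (lrho X \<alpha> ` \<xi>)),
      lact = (\<lambda>h \<xi>. the_elem ((\<lambda>x. gorb G X \<beta> (h \<triangleright>\<^bsub>\<alpha>\<^esub> x)) ` \<xi>)),
      lres = (\<lambda>h \<xi>. the_elem ((\<lambda>x. h \<triangleleft>\<^bsub>\<alpha>\<^esub> x) ` \<xi>)) \<rparr>"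

definition ract_on_lquot ::
  "'h groupoid \<Rightarrow> 'x groupoid \<Rightarrow> ('h, 'x) left_ss \<Rightarrow> ('g, 'x) right_ss \<Rightarrow> ('g, 'x set) right_ss"
  where "ract_on_lquot H X \<alpha> \<beta> =
    \<lparr> rmom = (\<lambda>\<xi>. the_elem (rsigma X \<beta> ` \<xi>)),
      ract = (\<lambda>\<xi> t. the_elem ((\<lambda>x. horb H X \<alpha> (x \<blacktriangleleft>\<^bsub>\<beta>\<^esub> t)) ` \<xi>)),
      rres = (\<lambda>\<xi> t. the_elem ((\<lambda>x. x \<blacktriangleright>\<^bsub>\<beta>\<^esub> t) ` \<xi>)) \<rparr>"

text \<open>The momentum maps and actions making \<open>X\<close> an equivalence of the two product groupoids.\<close>

definition fr ::
  "'g groupoid \<Rightarrow> 'x groupoid \<Rightarrow> ('h, 'x) left_ss \<Rightarrow> ('g, 'x) right_ss \<Rightarrow> 'x \<Rightarrow> 'x set \<times> 'h"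
  where "fr G X \<alpha> \<beta> x = lprod_unit (lact_on_rquot G X \<alpha> \<beta>) (gorb G X \<beta> (rng X x))"

definition fs ::
  "'h groupoid \<Rightarrow> 'x groupoid \<Rightarrow> ('h, 'x) left_ss \<Rightarrow> ('g, 'x) right_ss \<Rightarrow> 'x \<Rightarrow> 'g \<times> 'x set"
  where "fs H X \<alpha> \<beta> x = rprod_unit (ract_on_lquot H X \<alpha> \<beta>) (horb H X \<alpha> (src X x))"

definition para_lact ::
  "'x groupoid \<Rightarrow> ('h, 'x) left_ss \<Rightarrow> 'x set \<times> 'h \<Rightarrow> 'x \<Rightarrow> 'x"
  where "para_lact X \<alpha> = (\<lambda>(\<xi>, h) y.
    (THE x. x \<in> \<xi> \<and> src X x = rng X (h \<triangleright>\<^bsub>\<alpha>\<^esub> y)) \<cdot>\<^bsub>X\<^esub> (h \<triangleright>\<^bsub>\<alpha>\<^esub> y))"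

definition para_ract ::
  "'x groupoid \<Rightarrow> ('g, 'x) right_ss \<Rightarrow> 'x \<Rightarrow> 'g \<times> 'x set \<Rightarrow> 'x"
  where "para_ract X \<beta> = (\<lambda>y (t, \<eta>).
    (y \<blacktriangleleft>\<^bsub>\<beta>\<^esub> t) \<cdot>\<^bsub>X\<^esub> (THE z. z \<in> \<eta> \<and> src X (y \<blacktriangleleft>\<^bsub>\<beta>\<^esub> t) = rng X z))"


section \<open>Banach spaces, C*-algebras and imprimitivity bimodules\<close>

record 'v cnormed =
  carr :: "'v set"
  vadd :: "'v \<Rightarrow> 'v \<Rightarrow> 'v"
  vzero :: 'v
  vsmul :: "complex \<Rightarrow> 'v \<Rightarrow> 'v"
  vnorm :: "'v \<Rightarrow> real"

definition vdiff :: "('v, 'e) cnormed_scheme \<Rightarrow> 'v \<Rightarrow> 'v \<Rightarrow> 'v"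
  where "vdiff V x y = vadd V x (vsmul V (-1) y)"

locale complex_banach =
  fixes V :: "('v, 'e) cnormed_scheme"
  assumes zero_closed: "vzero V \<in> carr V"
    and add_closed: "\<lbrakk>x \<in> carr V; y \<in> carr V\<rbrakk> \<Longrightarrow> vadd V x y \<in> carr V"
    and smul_closed: "x \<in> carr V \<Longrightarrow> vsmul V c x \<in> carr V"
    and add_assoc: "\<lbrakk>x \<in> carr V; y \<in> carr V; z \<in> carr V\<rbrakk>
        \<Longrightarrow> vadd V (vadd V x y) z = vadd V x (vadd V y z)"
    and add_commute: "\<lbrakk>x \<in> carr V; y \<in> carr V\<rbrakk> \<Longrightarrow> vadd V x y = vadd V y x"
    and add_zero: "x \<in> carr V \<Longrightarrow> vadd V x (vzero V) = x"
    and add_inverse: "x \<in> carr V \<Longrightarrow> \<exists>y\<in>carr V. vadd V x y = vzero V"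
    and smul_add_right: "\<lbrakk>x \<in> carr V; y \<in> carr V\<rbrakk>
        \<Longrightarrow> vsmul V c (vadd V x y) = vadd V (vsmul V c x) (vsmul V c y)"
    and smul_add_left: "x \<in> carr V \<Longrightarrow> vsmul V (c + d) x = vadd V (vsmul V c x) (vsmul V d x)"
    and smul_smul: "x \<in> carr V \<Longrightarrow> vsmul V c (vsmul V d x) = vsmul V (c * d) x"
    and smul_one: "x \<in> carr V \<Longrightarrow> vsmul V 1 x = x"
    and norm_nonneg: "x \<in> carr V \<Longrightarrow> 0 \<le> vnorm V x"
    and norm_eq_zero: "x \<in> carr V \<Longrightarrow> vnorm V x = 0 \<longleftrightarrow> x = vzero V"
    and norm_triangle: "\<lbrakk>x \<in> carr V; y \<in> carr V\<rbrakk> \<Longrightarrow> vnorm V (vadd V x y) \<le> vnorm V x + vnorm V y"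
    and norm_smul: "x \<in> carr V \<Longrightarrow> vnorm V (vsmul V c x) = cmod c * vnorm V x"
    and complete: "\<lbrakk>range f \<subseteq> carr V;
          \<And>e. e > 0 \<Longrightarrow> \<exists>N. \<forall>m\<ge>N. \<forall>n\<ge>N. vnorm V (vdiff V (f m) (f n)) < e\<rbrakk>
        \<Longrightarrow> \<exists>l\<in>carr V. (\<lambda>n::nat. vnorm V (vdiff V (f n) l)) \<longlonglongrightarrow> 0"

inductive_set lin_span :: "('v, 'e) cnormed_scheme \<Rightarrow> 'v set \<Rightarrow> 'v set"
  for V :: "('v, 'e) cnormed_scheme" and S :: "'v set"
  where zero: "vzero V \<in> lin_span V S"
  | base: "x \<in> S \<Longrightarrow> x \<in> lin_span V S"
  | add: "\<lbrakk>x \<in> lin_span V S; y \<in> lin_span V S\<rbrakk> \<Longrightarrow> vadd V x y \<in> lin_span V S"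
  | smul: "x \<in> lin_span V S \<Longrightarrow> vsmul V c x \<in> lin_span V S"

definition closed_span :: "('v, 'e) cnormed_scheme \<Rightarrow> 'v set \<Rightarrow> 'v set"
  where "closed_span V S = {v \<in> carr V. \<forall>e>0. \<exists>w\<in>lin_span V S. vnorm V (vdiff V v w) < e}"

record 'v star_alg = "'v cnormed" +
  amult :: "'v \<Rightarrow> 'v \<Rightarrow> 'v"
  astar :: "'v \<Rightarrow> 'v"

locale cstar_algebra = complex_banach A for A :: "'v star_alg" +
  assumes mult_closed: "\<lbrakk>a \<in> carr A; b \<in> carr A\<rbrakk> \<Longrightarrow> amult A a b \<in> carr A"
    and mult_assoc: "\<lbrakk>a \<in> carr A; b \<in> carr A; c \<in> carr A\<rbrakk>
        \<Longrightarrow> amult A (amult A a b) c = amult A a (amult A b c)"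
    and mult_add: "\<lbrakk>a \<in> carr A; b \<in> carr A; c \<in> carr A\<rbrakk>
        \<Longrightarrow> amult A (vadd A a b) c = vadd A (amult A a c) (amult A b c)"
      "\<lbrakk>a \<in> carr A; b \<in> carr A; c \<in> carr A\<rbrakk>
        \<Longrightarrow> amult A a (vadd A b c) = vadd A (amult A a b) (amult A a c)"
    and mult_smul: "\<lbrakk>a \<in> carr A; b \<in> carr A\<rbrakk> \<Longrightarrow> amult A (vsmul A k a) b = vsmul A k (amult A a b)"
      "\<lbrakk>a \<in> carr A; b \<in> carr A\<rbrakk> \<Longrightarrow> amult A a (vsmul A k b) = vsmul A k (amult A a b)"
    and norm_mult: "\<lbrakk>a \<in> carr A; b \<in> carr A\<rbrakk> \<Longrightarrow> vnorm A (amult A a b) \<le> vnorm A a * vnorm A b"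
    and star_closed: "a \<in> carr A \<Longrightarrow> astar A a \<in> carr A"
    and star_add: "\<lbrakk>a \<in> carr A; b \<in> carr A\<rbrakk> \<Longrightarrow> astar A (vadd A a b) = vadd A (astar A a) (astar A b)"
    and star_smul: "a \<in> carr A \<Longrightarrow> astar A (vsmul A k a) = vsmul A (cnj k) (astar A a)"
    and star_mult: "\<lbrakk>a \<in> carr A; b \<in> carr A\<rbrakk>
        \<Longrightarrow> astar A (amult A a b) = amult A (astar A b) (astar A a)"
    and star_star: "a \<in> carr A \<Longrightarrow> astar A (astar A a) = a"
    and cstar_identity: "a \<in> carr A \<Longrightarrow> vnorm A (amult A (astar A a) a) = (vnorm A a)\<^sup>2"

definition cstar_positive :: "'v star_alg \<Rightarrow> 'v \<Rightarrow> bool"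
  where "cstar_positive A a \<longleftrightarrow> (\<exists>c\<in>carr A. a = amult A (astar A c) c)"

text \<open>
  The given Banach norm of \<open>V\<close> is required to be the norm of both Hilbert module structures
  (\<open>norm_lip\<close>, \<open>norm_rip\<close>), so completeness and definiteness of these are part of \<open>complex_banach\<close>.
\<close>

locale imprimitivity_bimodule =
  A: cstar_algebra A + C: cstar_algebra C + V: complex_banach V
  for A :: "'a star_alg" and C :: "'c star_alg" and V :: "('v, 'e) cnormed_scheme" +
  fixes la :: "'a \<Rightarrow> 'v \<Rightarrow> 'v" and ra :: "'v \<Rightarrow> 'c \<Rightarrow> 'v"
    and lip :: "'v \<Rightarrow> 'v \<Rightarrow> 'a" and rip :: "'v \<Rightarrow> 'v \<Rightarrow> 'c"
  assumes la_closed: "\<lbrakk>a \<in> carr A; x \<in> carr V\<rbrakk> \<Longrightarrow> la a x \<in> carr V"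
    and la_add_left: "\<lbrakk>a \<in> carr A; b \<in> carr A; x \<in> carr V\<rbrakk>
        \<Longrightarrow> la (vadd A a b) x = vadd V (la a x) (la b x)"
    and la_add_right: "\<lbrakk>a \<in> carr A; x \<in> carr V; y \<in> carr V\<rbrakk>
        \<Longrightarrow> la a (vadd V x y) = vadd V (la a x) (la a y)"
    and la_smul: "\<lbrakk>a \<in> carr A; x \<in> carr V\<rbrakk> \<Longrightarrow> la (vsmul A k a) x = vsmul V k (la a x)"
      "\<lbrakk>a \<in> carr A; x \<in> carr V\<rbrakk> \<Longrightarrow> la a (vsmul V k x) = vsmul V k (la a x)"
    and la_assoc: "\<lbrakk>a \<in> carr A; b \<in> carr A; x \<in> carr V\<rbrakk> \<Longrightarrow> la (amult A a b) x = la a (la b x)"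
    and ra_closed: "\<lbrakk>x \<in> carr V; c \<in> carr C\<rbrakk> \<Longrightarrow> ra x c \<in> carr V"
    and ra_add_right: "\<lbrakk>x \<in> carr V; c \<in> carr C; d \<in> carr C\<rbrakk>
        \<Longrightarrow> ra x (vadd C c d) = vadd V (ra x c) (ra x d)"
    and ra_add_left: "\<lbrakk>x \<in> carr V; y \<in> carr V; c \<in> carr C\<rbrakk>
        \<Longrightarrow> ra (vadd V x y) c = vadd V (ra x c) (ra y c)"
    and ra_smul: "\<lbrakk>x \<in> carr V; c \<in> carr C\<rbrakk> \<Longrightarrow> ra x (vsmul C k c) = vsmul V k (ra x c)"
      "\<lbrakk>x \<in> carr V; c \<in> carr C\<rbrakk> \<Longrightarrow> ra (vsmul V k x) c = vsmul V k (ra x c)"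
    and ra_assoc: "\<lbrakk>x \<in> carr V; c \<in> carr C; d \<in> carr C\<rbrakk> \<Longrightarrow> ra x (amult C c d) = ra (ra x c) d"
    and bimodule: "\<lbrakk>a \<in> carr A; x \<in> carr V; c \<in> carr C\<rbrakk> \<Longrightarrow> ra (la a x) c = la a (ra x c)"
    and lip_closed: "\<lbrakk>x \<in> carr V; y \<in> carr V\<rbrakk> \<Longrightarrow> lip x y \<in> carr A"
    and lip_add: "\<lbrakk>x \<in> carr V; y \<in> carr V; z \<in> carr V\<rbrakk>
        \<Longrightarrow> lip (vadd V x y) z = vadd A (lip x z) (lip y z)"
    and lip_smul: "\<lbrakk>x \<in> carr V; y \<in> carr V\<rbrakk> \<Longrightarrow> lip (vsmul V k x) y = vsmul A k (lip x y)"
    and lip_la: "\<lbrakk>a \<in> carr A; x \<in> carr V; y \<in> carr V\<rbrakk> \<Longrightarrow> lip (la a x) y = amult A a (lip x y)"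
    and lip_star: "\<lbrakk>x \<in> carr V; y \<in> carr V\<rbrakk> \<Longrightarrow> astar A (lip x y) = lip y x"
    and lip_positive: "x \<in> carr V \<Longrightarrow> cstar_positive A (lip x x)"
    and norm_lip: "x \<in> carr V \<Longrightarrow> (vnorm V x)\<^sup>2 = vnorm A (lip x x)"
    and rip_closed: "\<lbrakk>x \<in> carr V; y \<in> carr V\<rbrakk> \<Longrightarrow> rip x y \<in> carr C"
    and rip_add: "\<lbrakk>x \<in> carr V; y \<in> carr V; z \<in> carr V\<rbrakk>
        \<Longrightarrow> rip x (vadd V y z) = vadd C (rip x y) (rip x z)"
    and rip_smul: "\<lbrakk>x \<in> carr V; y \<in> carr V\<rbrakk> \<Longrightarrow> rip x (vsmul V k y) = vsmul C k (rip x y)"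
    and rip_ra: "\<lbrakk>x \<in> carr V; y \<in> carr V; c \<in> carr C\<rbrakk> \<Longrightarrow> rip x (ra y c) = amult C (rip x y) c"
    and rip_star: "\<lbrakk>x \<in> carr V; y \<in> carr V\<rbrakk> \<Longrightarrow> astar C (rip x y) = rip y x"
    and rip_positive: "x \<in> carr V \<Longrightarrow> cstar_positive C (rip x x)"
    and norm_rip: "x \<in> carr V \<Longrightarrow> (vnorm V x)\<^sup>2 = vnorm C (rip x x)"
    and lip_full: "closed_span A {lip x y | x y. x \<in> carr V \<and> y \<in> carr V} = carr A"
    and rip_full: "closed_span C {rip x y | x y. x \<in> carr V \<and> y \<in> carr V} = carr C"
    and rip_la_adjoint: "\<lbrakk>a \<in> carr A; x \<in> carr V; y \<in> carr V\<rbrakk>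
        \<Longrightarrow> rip (la a x) y = rip x (la (astar A a) y)"
    and lip_ra_adjoint: "\<lbrakk>x \<in> carr V; y \<in> carr V; c \<in> carr C\<rbrakk>
        \<Longrightarrow> lip (ra x c) y = lip x (ra y (astar C c))"
    and imprimitivity: "\<lbrakk>x \<in> carr V; y \<in> carr V; z \<in> carr V\<rbrakk> \<Longrightarrow> la (lip x y) z = ra x (rip y z)"


section \<open>Banach bundles and Fell bundles\<close>

text \<open>\<open>badd\<close> is only meaningful on pairs of points in a common fibre.\<close>

record ('b, 'x) banach_bundle =
  btop :: "'b topology"
  proj :: "'b \<Rightarrow> 'x"
  badd :: "'b \<Rightarrow> 'b \<Rightarrow> 'b"
  bzero :: "'x \<Rightarrow> 'b"
  bsmul :: "complex \<Rightarrow> 'b \<Rightarrow> 'b"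
  bnorm :: "'b \<Rightarrow> real"

record ('b, 'x) fell_bundle = "('b, 'x) banach_bundle" +
  bmult :: "'b \<Rightarrow> 'b \<Rightarrow> 'b"  (infixl "\<odot>\<index>" 70)
  bstar :: "'b \<Rightarrow> 'b"

definition points :: "('b, 'x, 'e) banach_bundle_scheme \<Rightarrow> 'b set"
  where "points E = topspace (btop E)"

definition fibre :: "('b, 'x, 'e) banach_bundle_scheme \<Rightarrow> 'x \<Rightarrow> 'b set"
  where "fibre E x = {b \<in> points E. proj E b = x}"

definition fibre_space :: "('b, 'x, 'e) banach_bundle_scheme \<Rightarrow> 'x \<Rightarrow> 'b cnormed"
  where "fibre_space E x =
    \<lparr> carr = fibre E x, vadd = badd E, vzero = bzero E x, vsmul = bsmul E, vnorm = bnorm E \<rparr>"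

definition fibre_alg :: "('b, 'x) fell_bundle \<Rightarrow> 'x \<Rightarrow> 'b star_alg"
  where "fibre_alg E u =
    \<lparr> carr = fibre E u, vadd = badd E, vzero = bzero E u, vsmul = bsmul E, vnorm = bnorm E,
      amult = bmult E, astar = bstar E \<rparr>"

locale usc_banach_bundle =
  fixes T :: "'x topology" and E :: "('b, 'x, 'e) banach_bundle_scheme"
  assumes proj_continuous: "continuous_map (btop E) T (proj E)"
    and proj_open: "open_map (btop E) T (proj E)"
    and proj_surj: "proj E ` points E = topspace T"
    and fibre_banach: "x \<in> topspace T \<Longrightarrow> complex_banach (fibre_space E x)"
    and norm_usc: "openin (btop E) {b \<in> points E. bnorm E b < r}"
    and add_continuous:
      "continuous_map
         (subtopology (prod_topology (btop E) (btop E)) {(a, b). proj E a = proj E b})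
         (btop E) (\<lambda>(a, b). badd E a b)"
    and smul_continuous: "continuous_map (btop E) (btop E) (bsmul E c)"
    and zero_limit: \<comment> \<open>nets in the total space are represented by filters on it\<close>
      "\<lbrakk>x \<in> topspace T; F \<le> principal (points E); limitin T (proj E) x F; (bnorm E \<longlongrightarrow> 0) F\<rbrakk>
         \<Longrightarrow> limitin (btop E) (\<lambda>b. b) (bzero E x) F"

definition bcomposable :: "'x groupoid \<Rightarrow> ('b, 'x) fell_bundle \<Rightarrow> ('b \<times> 'b) set"
  where "bcomposable X E =
    {(a, b). a \<in> points E \<and> b \<in> points E \<and> (proj E a, proj E b) \<in> composable X}"

locale fell_bundle =
  X: topological_groupoid X + usc_banach_bundle "gtop X" E
  for X :: "'x groupoid" and E :: "('b, 'x) fell_bundle" +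
  assumes mult_continuous:
      "continuous_map (subtopology (prod_topology (btop E) (btop E)) (bcomposable X E)) (btop E)
         (\<lambda>(a, b). a \<odot>\<^bsub>E\<^esub> b)"
    and star_continuous: "continuous_map (btop E) (btop E) (bstar E)"
    and proj_mult: "(a, b) \<in> bcomposable X E \<Longrightarrow> proj E (a \<odot>\<^bsub>E\<^esub> b) = proj E a \<cdot>\<^bsub>X\<^esub> proj E b"
    and mult_add_left: "\<lbrakk>(a, c) \<in> bcomposable X E; b \<in> fibre E (proj E a)\<rbrakk>
        \<Longrightarrow> badd E a b \<odot>\<^bsub>E\<^esub> c = badd E (a \<odot>\<^bsub>E\<^esub> c) (b \<odot>\<^bsub>E\<^esub> c)"
    and mult_add_right: "\<lbrakk>(a, b) \<in> bcomposable X E; c \<in> fibre E (proj E b)\<rbrakk>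
        \<Longrightarrow> a \<odot>\<^bsub>E\<^esub> badd E b c = badd E (a \<odot>\<^bsub>E\<^esub> b) (a \<odot>\<^bsub>E\<^esub> c)"
    and mult_smul: "(a, b) \<in> bcomposable X E \<Longrightarrow> bsmul E k a \<odot>\<^bsub>E\<^esub> b = bsmul E k (a \<odot>\<^bsub>E\<^esub> b)"
      "(a, b) \<in> bcomposable X E \<Longrightarrow> a \<odot>\<^bsub>E\<^esub> bsmul E k b = bsmul E k (a \<odot>\<^bsub>E\<^esub> b)"
    and mult_assoc: "\<lbrakk>(a, b) \<in> bcomposable X E; (b, c) \<in> bcomposable X E\<rbrakk>
        \<Longrightarrow> (a \<odot>\<^bsub>E\<^esub> b) \<odot>\<^bsub>E\<^esub> c = a \<odot>\<^bsub>E\<^esub> (b \<odot>\<^bsub>E\<^esub> c)"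
    and norm_mult: "(a, b) \<in> bcomposable X E \<Longrightarrow> bnorm E (a \<odot>\<^bsub>E\<^esub> b) \<le> bnorm E a * bnorm E b"
    and proj_star: "b \<in> points E \<Longrightarrow> proj E (bstar E b) = ginv X (proj E b)"
    and star_add: "\<lbrakk>a \<in> points E; b \<in> fibre E (proj E a)\<rbrakk>
        \<Longrightarrow> bstar E (badd E a b) = badd E (bstar E a) (bstar E b)"
    and star_smul: "b \<in> points E \<Longrightarrow> bstar E (bsmul E k b) = bsmul E (cnj k) (bstar E b)"
    and star_mult: "(a, b) \<in> bcomposable X E \<Longrightarrow> bstar E (a \<odot>\<^bsub>E\<^esub> b) = bstar E b \<odot>\<^bsub>E\<^esub> bstar E a"
    and star_star: "b \<in> points E \<Longrightarrow> bstar E (bstar E b) = b"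
    and norm_star_mult: "b \<in> points E \<Longrightarrow> bnorm E (bstar E b \<odot>\<^bsub>E\<^esub> b) = (bnorm E b)\<^sup>2"
    and norm_star: "b \<in> points E \<Longrightarrow> (bnorm E b)\<^sup>2 = (bnorm E (bstar E b))\<^sup>2"
    and star_mult_positive: "b \<in> points E
        \<Longrightarrow> cstar_positive (fibre_alg E (src X (proj E b))) (bstar E b \<odot>\<^bsub>E\<^esub> b)"

definition saturated :: "'x groupoid \<Rightarrow> ('b, 'x) fell_bundle \<Rightarrow> bool"
  where "saturated X E \<longleftrightarrow> (\<forall>(x, y) \<in> composable X.
    closed_span (fibre_space E (x \<cdot>\<^bsub>X\<^esub> y)) {a \<odot>\<^bsub>E\<^esub> b | a b. a \<in> fibre E x \<and> b \<in> fibre E y}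
      = fibre E (x \<cdot>\<^bsub>X\<^esub> y))"


section \<open>Self-similar actions on Fell bundles\<close>

definition bldom ::
  "'h groupoid \<Rightarrow> 'x groupoid \<Rightarrow> ('h, 'x) left_ss \<Rightarrow> ('b, 'x) fell_bundle \<Rightarrow> ('h \<times> 'b) set"
  where "bldom H X \<alpha> E = ldom H (btop E) (\<lambda>b. lrho X \<alpha> (proj E b))"

definition brdom ::
  "'g groupoid \<Rightarrow> 'x groupoid \<Rightarrow> ('g, 'x) right_ss \<Rightarrow> ('b, 'x) fell_bundle \<Rightarrow> ('b \<times> 'g) set"
  where "brdom G X \<beta> E = rdom G (btop E) (\<lambda>b. rsigma X \<beta> (proj E b))"

locale self_similar_left_bundle =
  ss: self_similar_left H X \<alpha> + fell: fell_bundle X E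
  for H :: "'h groupoid" and X :: "'x groupoid" and \<alpha> :: "('h, 'x) left_ss"
    and E :: "('b, 'x) fell_bundle" +
  fixes act :: "'h \<Rightarrow> 'b \<Rightarrow> 'b"
  assumes bact_continuous:
      "continuous_map (ldom_top H (btop E) (\<lambda>b. lrho X \<alpha> (proj E b))) (btop E) (\<lambda>(h, b). act h b)"
    and proj_bact: "(h, b) \<in> bldom H X \<alpha> E \<Longrightarrow> proj E (act h b) = h \<triangleright>\<^bsub>\<alpha>\<^esub> proj E b"
    and bact_add: "\<lbrakk>(h, b) \<in> bldom H X \<alpha> E; c \<in> fibre E (proj E b)\<rbrakk>
        \<Longrightarrow> act h (badd E b c) = badd E (act h b) (act h c)"
    and bact_smul: "(h, b) \<in> bldom H X \<alpha> E \<Longrightarrow> act h (bsmul E w b) = bsmul E w (act h b)"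
    and bact_bact: "\<lbrakk>(k, h) \<in> composable H; (h, b) \<in> bldom H X \<alpha> E\<rbrakk>
        \<Longrightarrow> act k (act h b) = act (k \<cdot>\<^bsub>H\<^esub> h) b"
    and bact_unit: "b \<in> points E \<Longrightarrow> act (lrho X \<alpha> (proj E b)) b = b"
    and bact_mult: "\<lbrakk>(h, b) \<in> bldom H X \<alpha> E; (b, c) \<in> bcomposable X E\<rbrakk>
        \<Longrightarrow> act h (b \<odot>\<^bsub>E\<^esub> c) = act h b \<odot>\<^bsub>E\<^esub> act (h \<triangleleft>\<^bsub>\<alpha>\<^esub> proj E b) c"
    and bact_star: "(h, b) \<in> bldom H X \<alpha> E
        \<Longrightarrow> bstar E (act h b) = act (h \<triangleleft>\<^bsub>\<alpha>\<^esub> proj E b) (bstar E b)"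

locale self_similar_right_bundle =
  ss: self_similar_right G X \<beta> + fell: fell_bundle X E
  for G :: "'g groupoid" and X :: "'x groupoid" and \<beta> :: "('g, 'x) right_ss"
    and E :: "('b, 'x) fell_bundle" +
  fixes act :: "'b \<Rightarrow> 'g \<Rightarrow> 'b"
  assumes bact_continuous:
      "continuous_map (rdom_top G (btop E) (\<lambda>b. rsigma X \<beta> (proj E b))) (btop E) (\<lambda>(b, t). act b t)"
    and proj_bact: "(b, t) \<in> brdom G X \<beta> E \<Longrightarrow> proj E (act b t) = proj E b \<blacktriangleleft>\<^bsub>\<beta>\<^esub> t"
    and bact_add: "\<lbrakk>(b, t) \<in> brdom G X \<beta> E; c \<in> fibre E (proj E b)\<rbrakk>
        \<Longrightarrow> act (badd E b c) t = badd E (act b t) (act c t)"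
    and bact_smul: "(b, t) \<in> brdom G X \<beta> E \<Longrightarrow> act (bsmul E w b) t = bsmul E w (act b t)"
    and bact_bact: "\<lbrakk>(b, t) \<in> brdom G X \<beta> E; (t, t') \<in> composable G\<rbrakk>
        \<Longrightarrow> act (act b t) t' = act b (t \<cdot>\<^bsub>G\<^esub> t')"
    and bact_unit: "b \<in> points E \<Longrightarrow> act b (rsigma X \<beta> (proj E b)) = b"
    and bact_mult: "\<lbrakk>(b, c) \<in> bcomposable X E; (c, t) \<in> brdom G X \<beta> E\<rbrakk>
        \<Longrightarrow> act (b \<odot>\<^bsub>E\<^esub> c) t = act b (proj E c \<blacktriangleright>\<^bsub>\<beta>\<^esub> t) \<odot>\<^bsub>E\<^esub> act c t"
    and bact_star: "(b, t) \<in> brdom G X \<beta> E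
        \<Longrightarrow> bstar E (act b t) = act (bstar E b) (proj E b \<blacktriangleright>\<^bsub>\<beta>\<^esub> t)"


section \<open>Quotient and self-similar product Fell bundles\<close>

definition bhorb ::
  "'h groupoid \<Rightarrow> 'x groupoid \<Rightarrow> ('h, 'x) left_ss \<Rightarrow> ('b, 'x) fell_bundle \<Rightarrow> ('h \<Rightarrow> 'b \<Rightarrow> 'b)
    \<Rightarrow> 'b \<Rightarrow> 'b set"
  where "bhorb H X \<alpha> E act = lorbit H (\<lambda>b. lrho X \<alpha> (proj E b)) act"

definition bgorb ::
  "'g groupoid \<Rightarrow> 'x groupoid \<Rightarrow> ('g, 'x) right_ss \<Rightarrow> ('b, 'x) fell_bundle \<Rightarrow> ('b \<Rightarrow> 'g \<Rightarrow> 'b)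
    \<Rightarrow> 'b \<Rightarrow> 'b set"
  where "bgorb G X \<beta> E act = rorbit G (\<lambda>b. rsigma X \<beta> (proj E b)) act"

definition orbit_bundle ::
  "'x groupoid \<Rightarrow> ('b, 'x) fell_bundle \<Rightarrow> ('x \<Rightarrow> 'x set) \<Rightarrow> ('b \<Rightarrow> 'b set) \<Rightarrow> ('b set, 'x set) fell_bundle"
  where "orbit_bundle X E xorb orb =
    \<lparr> btop = quotient_topology (btop E) orb,
      proj = (\<lambda>\<Theta>. the_elem ((\<lambda>b. xorb (proj E b)) ` \<Theta>)),
      badd = (\<lambda>\<Theta> \<Xi>. the_elem {orb (badd E b c) | b c. b \<in> \<Theta> \<and> c \<in> \<Xi> \<and> proj E b = proj E c}),
      bzero = (\<lambda>\<xi>. the_elem ((\<lambda>x. orb (bzero E x)) ` \<xi>)),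
      bsmul = (\<lambda>k \<Theta>. the_elem ((\<lambda>b. orb (bsmul E k b)) ` \<Theta>)),
      bnorm = (\<lambda>\<Theta>. the_elem (bnorm E ` \<Theta>)),
      bmult = (\<lambda>\<Theta> \<Xi>. the_elem {orb (b \<odot>\<^bsub>E\<^esub> c) | b c. b \<in> \<Theta> \<and> c \<in> \<Xi> \<and> (b, c) \<in> bcomposable X E}),
      bstar = (\<lambda>\<Theta>. the_elem ((\<lambda>b. orb (bstar E b)) ` \<Theta>)) \<rparr>"

definition lquot_bundle ::
  "'h groupoid \<Rightarrow> 'x groupoid \<Rightarrow> ('h, 'x) left_ss \<Rightarrow> ('b, 'x) fell_bundle \<Rightarrow> ('h \<Rightarrow> 'b \<Rightarrow> 'b)
    \<Rightarrow> ('b set, 'x set) fell_bundle"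
  where "lquot_bundle H X \<alpha> E act = orbit_bundle X E (horb H X \<alpha>) (bhorb H X \<alpha> E act)"

definition rquot_bundle ::
  "'x groupoid \<Rightarrow> ('b, 'x) fell_bundle \<Rightarrow> 'g groupoid \<Rightarrow> ('g, 'x) right_ss \<Rightarrow> ('b \<Rightarrow> 'g \<Rightarrow> 'b)
    \<Rightarrow> ('b set, 'x set) fell_bundle"
  where "rquot_bundle X E G \<beta> act = orbit_bundle X E (gorb G X \<beta>) (bgorb G X \<beta> E act)"

definition bact_on_rquot ::
  "'g groupoid \<Rightarrow> 'x groupoid \<Rightarrow> ('g, 'x) right_ss \<Rightarrow> ('b, 'x) fell_bundle
    \<Rightarrow> ('h \<Rightarrow> 'b \<Rightarrow> 'b) \<Rightarrow> ('b \<Rightarrow> 'g \<Rightarrow> 'b) \<Rightarrow> 'h \<Rightarrow> 'b set \<Rightarrow> 'b set"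
  where "bact_on_rquot G X \<beta> E lb rb h \<Theta> = the_elem ((\<lambda>b. bgorb G X \<beta> E rb (lb h b)) ` \<Theta>)"

definition bact_on_lquot ::
  "'h groupoid \<Rightarrow> 'x groupoid \<Rightarrow> ('h, 'x) left_ss \<Rightarrow> ('b, 'x) fell_bundle
    \<Rightarrow> ('h \<Rightarrow> 'b \<Rightarrow> 'b) \<Rightarrow> ('b \<Rightarrow> 'g \<Rightarrow> 'b) \<Rightarrow> 'b set \<Rightarrow> 'g \<Rightarrow> 'b set"
  where "bact_on_lquot H X \<alpha> E lb rb \<Xi> t = the_elem ((\<lambda>b. bhorb H X \<alpha> E lb (rb b t)) ` \<Xi>)"

definition lprod_bundle ::
  "'x groupoid \<Rightarrow> ('b, 'x) fell_bundle \<Rightarrow> 'h groupoid \<Rightarrow> ('h, 'x) left_ss \<Rightarrow> ('h \<Rightarrow> 'b \<Rightarrow> 'b)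
    \<Rightarrow> ('b \<times> 'h, 'x \<times> 'h) fell_bundle"
  where "lprod_bundle X E H \<alpha> act =
    \<lparr> btop = subtopology (prod_topology (btop E) (gtop H))
               {(b, h). (proj E b, h) \<in> arrows (lprod_groupoid X H \<alpha>)},
      proj = (\<lambda>(b, h). (proj E b, h)),
      badd = (\<lambda>(b, h) (c, k). (badd E b c, h)),
      bzero = (\<lambda>(x, h). (bzero E x, h)),
      bsmul = (\<lambda>k (b, h). (bsmul E k b, h)),
      bnorm = (\<lambda>(b, h). bnorm E b),
      bmult = (\<lambda>(a, h) (b, k). (a \<odot>\<^bsub>E\<^esub> act h b, (h \<triangleleft>\<^bsub>\<alpha>\<^esub> proj E b) \<cdot>\<^bsub>H\<^esub> k)),
      bstar = (\<lambda>(b, h). (act (ginv H h) (bstar E b), ginv H h \<triangleleft>\<^bsub>\<alpha>\<^esub> proj E (bstar E b))) \<rparr>"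

definition rprod_bundle ::
  "'g groupoid \<Rightarrow> 'x groupoid \<Rightarrow> ('b, 'x) fell_bundle \<Rightarrow> ('g, 'x) right_ss \<Rightarrow> ('b \<Rightarrow> 'g \<Rightarrow> 'b)
    \<Rightarrow> ('g \<times> 'b, 'g \<times> 'x) fell_bundle"
  where "rprod_bundle G X E \<beta> act =
    \<lparr> btop = subtopology (prod_topology (gtop G) (btop E))
               {(t, b). (t, proj E b) \<in> arrows (rprod_groupoid G X \<beta>)},
      proj = (\<lambda>(t, b). (t, proj E b)),
      badd = (\<lambda>(t, b) (s, c). (t, badd E b c)),
      bzero = (\<lambda>(t, x). (t, bzero E x)),
      bsmul = (\<lambda>k (t, b). (t, bsmul E k b)),
      bnorm = (\<lambda>(t, b). bnorm E b),
      bmult = (\<lambda>(s, a) (t, b). (s \<cdot>\<^bsub>G\<^esub> (proj E a \<blacktriangleright>\<^bsub>\<beta>\<^esub> t), act a t \<odot>\<^bsub>E\<^esub> b)),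
      bstar = (\<lambda>(t, b). (proj E (bstar E b) \<blacktriangleright>\<^bsub>\<beta>\<^esub> ginv G t, act (bstar E b) (ginv G t))) \<rparr>"


section \<open>Fell bundle equivalences\<close>

text \<open>
  The notion includes its own context: the base is a groupoid equivalence, \<open>A\<close> and \<open>C\<close> are saturated
  Fell bundles and \<open>M\<close> is an upper semicontinuous Banach bundle.
\<close>

locale fell_bundle_equivalence =
  base: groupoid_equivalence K L Z rZ sZ la ra +
  A: fell_bundle K A + C: fell_bundle L C + M: usc_banach_bundle Z M
  for K :: "'k groupoid" and L :: "'l groupoid" and Z :: "'z topology"
    and rZ :: "'z \<Rightarrow> 'k" and sZ :: "'z \<Rightarrow> 'l" and la :: "'k \<Rightarrow> 'z \<Rightarrow> 'z" and ra :: "'z \<Rightarrow> 'l \<Rightarrow> 'z"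
    and A :: "('a, 'k) fell_bundle" and C :: "('c, 'l) fell_bundle"
    and M :: "('m, 'z, 'e) banach_bundle_scheme" +
  fixes lm :: "'a \<Rightarrow> 'm \<Rightarrow> 'm" and rm :: "'m \<Rightarrow> 'c \<Rightarrow> 'm"
    and lip :: "'m \<Rightarrow> 'm \<Rightarrow> 'a" and rip :: "'m \<Rightarrow> 'm \<Rightarrow> 'c"
  assumes saturated: "saturated K A" "saturated L C"
    and lm_continuous:
      "continuous_map
         (subtopology (prod_topology (btop A) (btop M)) {(a, m). src K (proj A a) = rZ (proj M m)})
         (btop M) (\<lambda>(a, m). lm a m)"
    and lm_proj: "\<lbrakk>a \<in> points A; m \<in> points M; src K (proj A a) = rZ (proj M m)\<rbrakk>
        \<Longrightarrow> proj M (lm a m) = la (proj A a) (proj M m)"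
    and lm_assoc: "\<lbrakk>(a, b) \<in> bcomposable K A; m \<in> points M; src K (proj A b) = rZ (proj M m)\<rbrakk>
        \<Longrightarrow> lm a (lm b m) = lm (a \<odot>\<^bsub>A\<^esub> b) m"
    and lm_norm: "\<lbrakk>a \<in> points A; m \<in> points M; src K (proj A a) = rZ (proj M m)\<rbrakk>
        \<Longrightarrow> bnorm M (lm a m) \<le> bnorm A a * bnorm M m"
    and rm_continuous:
      "continuous_map
         (subtopology (prod_topology (btop M) (btop C)) {(m, c). sZ (proj M m) = rng L (proj C c)})
         (btop M) (\<lambda>(m, c). rm m c)"
    and rm_proj: "\<lbrakk>m \<in> points M; c \<in> points C; sZ (proj M m) = rng L (proj C c)\<rbrakk>
        \<Longrightarrow> proj M (rm m c) = ra (proj M m) (proj C c)"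
    and rm_assoc: "\<lbrakk>m \<in> points M; (c, d) \<in> bcomposable L C; sZ (proj M m) = rng L (proj C c)\<rbrakk>
        \<Longrightarrow> rm (rm m c) d = rm m (c \<odot>\<^bsub>C\<^esub> d)"
    and rm_norm: "\<lbrakk>m \<in> points M; c \<in> points C; sZ (proj M m) = rng L (proj C c)\<rbrakk>
        \<Longrightarrow> bnorm M (rm m c) \<le> bnorm M m * bnorm C c"
    and lm_rm_commute: "\<lbrakk>a \<in> points A; m \<in> points M; c \<in> points C;
          src K (proj A a) = rZ (proj M m); sZ (proj M m) = rng L (proj C c)\<rbrakk>
        \<Longrightarrow> rm (lm a m) c = lm a (rm m c)"
    and lip_closed: "\<lbrakk>m \<in> points M; n \<in> points M; sZ (proj M m) = sZ (proj M n)\<rbrakk>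
        \<Longrightarrow> lip m n \<in> points A"
    and lip_add_left: "\<lbrakk>m \<in> points M; m' \<in> fibre M (proj M m); n \<in> points M; sZ (proj M m) = sZ (proj M n)\<rbrakk>
        \<Longrightarrow> lip (badd M m m') n = badd A (lip m n) (lip m' n)"
    and lip_add_right: "\<lbrakk>m \<in> points M; n \<in> points M; n' \<in> fibre M (proj M n); sZ (proj M m) = sZ (proj M n)\<rbrakk>
        \<Longrightarrow> lip m (badd M n n') = badd A (lip m n) (lip m n')"
    and lip_smul: "\<lbrakk>m \<in> points M; n \<in> points M; sZ (proj M m) = sZ (proj M n)\<rbrakk>
        \<Longrightarrow> lip (bsmul M k m) n = bsmul A k (lip m n)"
      "\<lbrakk>m \<in> points M; n \<in> points M; sZ (proj M m) = sZ (proj M n)\<rbrakk>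
        \<Longrightarrow> lip m (bsmul M k n) = bsmul A (cnj k) (lip m n)"
    and rip_closed: "\<lbrakk>m \<in> points M; n \<in> points M; rZ (proj M m) = rZ (proj M n)\<rbrakk>
        \<Longrightarrow> rip m n \<in> points C"
    and rip_add_left: "\<lbrakk>m \<in> points M; m' \<in> fibre M (proj M m); n \<in> points M; rZ (proj M m) = rZ (proj M n)\<rbrakk>
        \<Longrightarrow> rip (badd M m m') n = badd C (rip m n) (rip m' n)"
    and rip_add_right: "\<lbrakk>m \<in> points M; n \<in> points M; n' \<in> fibre M (proj M n); rZ (proj M m) = rZ (proj M n)\<rbrakk>
        \<Longrightarrow> rip m (badd M n n') = badd C (rip m n) (rip m n')"
    and rip_smul: "\<lbrakk>m \<in> points M; n \<in> points M; rZ (proj M m) = rZ (proj M n)\<rbrakk>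
        \<Longrightarrow> rip (bsmul M k m) n = bsmul C (cnj k) (rip m n)"
      "\<lbrakk>m \<in> points M; n \<in> points M; rZ (proj M m) = rZ (proj M n)\<rbrakk>
        \<Longrightarrow> rip m (bsmul M k n) = bsmul C k (rip m n)"
    and lip_proj: "\<lbrakk>m \<in> points M; n \<in> points M; sZ (proj M m) = sZ (proj M n)\<rbrakk>
        \<Longrightarrow> src K (proj A (lip m n)) = rZ (proj M n) \<and> proj M m = la (proj A (lip m n)) (proj M n)"
    and rip_proj: "\<lbrakk>m \<in> points M; n \<in> points M; rZ (proj M m) = rZ (proj M n)\<rbrakk>
        \<Longrightarrow> sZ (proj M m) = rng L (proj C (rip m n)) \<and> ra (proj M m) (proj C (rip m n)) = proj M n"
    and lip_star: "\<lbrakk>m \<in> points M; n \<in> points M; sZ (proj M m) = sZ (proj M n)\<rbrakk>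
        \<Longrightarrow> bstar A (lip m n) = lip n m"
    and rip_star: "\<lbrakk>m \<in> points M; n \<in> points M; rZ (proj M m) = rZ (proj M n)\<rbrakk>
        \<Longrightarrow> bstar C (rip m n) = rip n m"
    and lip_lm: "\<lbrakk>a \<in> points A; m \<in> points M; n \<in> points M;
          src K (proj A a) = rZ (proj M m); sZ (proj M m) = sZ (proj M n)\<rbrakk>
        \<Longrightarrow> lip (lm a m) n = a \<odot>\<^bsub>A\<^esub> lip m n"
    and rip_rm: "\<lbrakk>m \<in> points M; n \<in> points M; c \<in> points C;
          rZ (proj M m) = rZ (proj M n); sZ (proj M n) = rng L (proj C c)\<rbrakk>
        \<Longrightarrow> rip m (rm n c) = rip m n \<odot>\<^bsub>C\<^esub> c"
    and lip_rip: "\<lbrakk>m \<in> points M; n \<in> points M; p \<in> points M;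
          sZ (proj M m) = sZ (proj M n); rZ (proj M n) = rZ (proj M p)\<rbrakk>
        \<Longrightarrow> lm (lip m n) p = rm m (rip n p)"
    and fibre_imprimitivity: "z \<in> topspace Z
        \<Longrightarrow> imprimitivity_bimodule (fibre_alg A (rZ z)) (fibre_alg C (sZ z)) (fibre_space M z)
              lm rm lip rip"

end

theory Submission
  imports Defs
begin

text \<open>
  An orbit of a free action contains exactly one point with a prescribed source (or range) in the
  corresponding orbit of units; by properness this point depends continuously on the data, and orbit
  maps are open because the source maps are. Hence all operations on the quotients, on the product
  groupoids and on the bundles over them are computed on matching representatives, where their
  identities reduce to those in \<open>X\<close> and \<open>B\<close>. The norm descends to the quotient bundles because the
  C*-identity forces a self-similar action on a Fell bundle to be isometric. Passing to opposite
  groupoids and opposite bundles exchanges the two sides, so only the statements about the left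
  module structure are proved directly.
\<close>


section \<open>Open quotient maps\<close>

text \<open>Operations on orbit spaces must be continuous on products and on subsets such as
  composable pairs or action domains. Neither products nor restrictions of quotient maps need be
  quotient maps; open surjections survive products and restriction to full preimages, and this is
  why openness is carried through all constructions. That a self-similar action is isometric is not
  among its axioms. Continuity and \<open>zero_limit\<close> yield only some bound on a unit fibre,
  with a constant depending on the arrow, and the growing powers absorb this constant. The reversal
  cannot be mere instantiation: a right product lists the acting groupoid in its first coordinate,
  so it is the opposite of a left product only after the coordinates are exchanged, and results are
  carried along anti-isomorphisms. The two statements that involve both sides, compatibility of the
  two actions and the exchange relation of the two inner products, come from one identity between
  triple products; in the second case its middle factor is an adjoint.\<close>

lemma second_countable_prod_topology:
  assumes "second_countable X" and "second_countable Y"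
  shows "second_countable (prod_topology X Y)"
proof -
  obtain \<B> where \<B>: "countable \<B>" "\<And>V. V \<in> \<B> \<Longrightarrow> openin X V"
      "\<And>U x. \<lbrakk>openin X U; x \<in> U\<rbrakk> \<Longrightarrow> \<exists>V\<in>\<B>. x \<in> V \<and> V \<subseteq> U"
    using assms(1) unfolding second_countable_def by metis
  obtain \<C> where \<C>: "countable \<C>" "\<And>V. V \<in> \<C> \<Longrightarrow> openin Y V"
      "\<And>U x. \<lbrakk>openin Y U; x \<in> U\<rbrakk> \<Longrightarrow> \<exists>V\<in>\<C>. x \<in> V \<and> V \<subseteq> U"
    using assms(2) unfolding second_countable_def by metis
  show ?thesis
    unfolding second_countable_def
  proof (intro exI[of _ "(\<lambda>(U, V). U \<times> V) ` (\<B> \<times> \<C>)"] conjI ballI allI impI)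
    show "countable ((\<lambda>(U, V). U \<times> V) ` (\<B> \<times> \<C>))"
      using \<B>(1) \<C>(1) by blast
    show "openin (prod_topology X Y) W" if "W \<in> (\<lambda>(U, V). U \<times> V) ` (\<B> \<times> \<C>)" for W
      using that \<B>(2) \<C>(2) by (auto simp: openin_prod_Times_iff)
    fix W z assume W: "openin (prod_topology X Y) W \<and> z \<in> W"
    obtain x y where z: "z = (x, y)" by fastforce
    obtain U V where UV: "openin X U" "openin Y V" "x \<in> U" "y \<in> V" "U \<times> V \<subseteq> W"
      using W unfolding z openin_prod_topology_alt by metis
    obtain U' where U': "U' \<in> \<B>" "x \<in> U'" "U' \<subseteq> U" using \<B>(3)[OF UV(1,3)] by blast
    obtain V' where V': "V' \<in> \<C>" "y \<in> V'" "V' \<subseteq> V" using \<C>(3)[OF UV(2,4)] by blast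
    have "U' \<times> V' \<in> (\<lambda>(U, V). U \<times> V) ` (\<B> \<times> \<C>)" using U'(1) V'(1) by force
    moreover have "z \<in> U' \<times> V'" "U' \<times> V' \<subseteq> W" using U' V' UV z by auto
    ultimately show "\<exists>V\<in>(\<lambda>(U, V). U \<times> V) ` (\<B> \<times> \<C>). z \<in> V \<and> V \<subseteq> W" by blast
  qed
qed

text \<open>Plain quotient maps are not stable under products or under restriction to subspaces.
  Open continuous surjections are stable under products and under restriction to full preimages, so
  that continuity of an operation on orbits can be tested on representatives.\<close>

definition open_quotient :: "'a topology \<Rightarrow> 'b topology \<Rightarrow> ('a \<Rightarrow> 'b) \<Rightarrow> bool"
  where "open_quotient X Y q \<longleftrightarrow>
    continuous_map X Y q \<and> open_map X Y q \<and> q ` topspace X = topspace Y"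

lemma open_quotient_id: "open_quotient X X (\<lambda>x. x)"
  by (simp add: open_quotient_def open_map_def)

lemma open_quotient_quotient_topology:
  "open_map X (quotient_topology X f) f \<Longrightarrow> open_quotient X (quotient_topology X f) f"
  by (simp add: open_quotient_def quotient_map_quotient_topology topspace_quotient_topology
      quotient_imp_continuous_map)

text \<open>Boxes suffice: a box inside \<open>W\<close> is mapped onto the box of the images, and
  this is open because both factors are open maps.\<close>

lemma open_quotient_prod:
  assumes "open_quotient X Y q" and "open_quotient X' Y' q'"
  shows "open_quotient (prod_topology X X') (prod_topology Y Y') (\<lambda>p. (q (fst p), q' (snd p)))"
proof -
  have "continuous_map (prod_topology X X') (prod_topology Y Y') (\<lambda>p. (q (fst p), q' (snd p)))"
    using assms unfolding open_quotient_def
    by (intro continuous_map_pairedI continuous_map_of_fst[unfolded o_def, THEN iffD2]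
        continuous_map_of_snd[unfolded o_def, THEN iffD2]) auto
  moreover have "open_map (prod_topology X X') (prod_topology Y Y') (\<lambda>p. (q (fst p), q' (snd p)))"
    unfolding open_map_def
  proof (intro allI impI)
    fix W assume W: "openin (prod_topology X X') W"
    show "openin (prod_topology Y Y') ((\<lambda>p. (q (fst p), q' (snd p))) ` W)"
      unfolding openin_prod_topology_alt
    proof (intro allI impI)
      fix y y' assume "(y, y') \<in> (\<lambda>p. (q (fst p), q' (snd p))) ` W"
      then obtain x x' where x: "(x, x') \<in> W" "y = q x" "y' = q' x'" by auto
      obtain U V where UV: "openin X U" "openin X' V" "x \<in> U" "x' \<in> V" "U \<times> V \<subseteq> W"
        using W x(1) unfolding openin_prod_topology_alt by metis
      have "openin Y (q ` U)" "openin Y' (q' ` V)"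
        using assms UV unfolding open_quotient_def open_map_def by auto
      moreover have "q ` U \<times> q' ` V \<subseteq> (\<lambda>p. (q (fst p), q' (snd p))) ` W"
        using UV(5) by force
      ultimately show "\<exists>U V. openin Y U \<and> openin Y' V \<and> y \<in> U \<and> y' \<in> V
          \<and> U \<times> V \<subseteq> (\<lambda>p. (q (fst p), q' (snd p))) ` W"
        using x UV by blast
    qed
  qed
  moreover have "(\<lambda>p. (q (fst p), q' (snd p))) ` topspace (prod_topology X X')
      = topspace (prod_topology Y Y')"
  proof -
    have q: "q ` topspace X = topspace Y" "q' ` topspace X' = topspace Y'"
      using assms unfolding open_quotient_def by blast+
    show ?thesis unfolding topspace_prod_topology q[symmetric] by (auto simp: image_iff)
  qed
  ultimately show ?thesis unfolding open_quotient_def by blast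
qed

text \<open>The map stays open on a full preimage, since the image of \<open>U\<close> cut down to
  that preimage is exactly the image of \<open>U\<close> intersected with \<open>S\<close>.\<close>

lemma open_quotient_restrict:
  assumes "open_quotient X Y q"
  shows "open_quotient (subtopology X {x. q x \<in> S}) (subtopology Y S) q"
proof -
  have "open_map (subtopology X {x. q x \<in> S}) (subtopology Y S) q"
    unfolding open_map_def
  proof (intro allI impI)
    fix W assume "openin (subtopology X {x. q x \<in> S}) W"
    then obtain U where U: "openin X U" "W = U \<inter> {x. q x \<in> S}" by (auto simp: openin_subtopology)
    have "q ` W = q ` U \<inter> S" using U(2) by auto
    then show "openin (subtopology Y S) (q ` W)"
      using U(1) assms unfolding open_quotient_def open_map_def openin_subtopology by metis
  qed
  then show ?thesis
    using assms unfolding open_quotient_def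
    by (auto simp: continuous_map_in_subtopology continuous_map_from_subtopology)
qed

lemma open_quotient_continuous:
  assumes "open_quotient X Y q" and "continuous_map X Z (\<lambda>x. f (q x))"
  shows "continuous_map Y Z f"
  using assms continuous_compose_quotient_map[of X Y q Z f] continuous_open_imp_quotient_map
  unfolding open_quotient_def o_def by blast

text \<open>The form in which partial operations are handled: \<open>S\<close> is a set of
  composable pairs or the domain of an action, and \<open>f\<close> is only evaluated on images of
  representatives.\<close>

lemma open_quotient_lift:
  assumes "open_quotient X Y q" and "continuous_map (subtopology X {x. q x \<in> S}) Z (\<lambda>x. f (q x))"
  shows "continuous_map (subtopology Y S) Z f"
  using open_quotient_continuous[OF open_quotient_restrict[OF assms(1)] assms(2)] .

lemma open_quotient_lift2:
  assumes "open_quotient X Y q" and "open_quotient X' Y' q'"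
    and "continuous_map (subtopology (prod_topology X X') {p. (q (fst p), q' (snd p)) \<in> S}) Z
           (\<lambda>p. f (q (fst p), q' (snd p)))"
  shows "continuous_map (subtopology (prod_topology Y Y') S) Z f"
  using open_quotient_lift[OF open_quotient_prod[OF assms(1,2)], of S Z f] assms(3) by simp

text \<open>The complement of the closed relation is open, and the open product map sends it exactly
  onto the complement of the diagonal.\<close>

lemma open_quotient_Hausdorff:
  assumes q: "open_quotient X Y q"
    and cl: "closedin (prod_topology X X) {p \<in> topspace (prod_topology X X). q (fst p) = q (snd p)}"
  shows "Hausdorff_space Y"
  unfolding Hausdorff_space_closedin_diagonal
proof -
  let ?R = "{p \<in> topspace (prod_topology X X). q (fst p) = q (snd p)}"
  have "openin (prod_topology X X) (topspace (prod_topology X X) - ?R)" using cl by blast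
  then have "openin (prod_topology Y Y)
      ((\<lambda>p. (q (fst p), q (snd p))) ` (topspace (prod_topology X X) - ?R))"
    using open_quotient_prod[OF q q] unfolding open_quotient_def open_map_def by blast
  moreover have "(\<lambda>p. (q (fst p), q (snd p))) ` (topspace (prod_topology X X) - ?R)
      = topspace (prod_topology Y Y) - (\<lambda>y. (y, y)) ` topspace Y"
  proof -
    have Y: "topspace Y = q ` topspace X" using q unfolding open_quotient_def by blast
    have "(q x, q x') \<in> (\<lambda>p. (q (fst p), q (snd p))) ` (topspace (prod_topology X X) - ?R)"
      if "x \<in> topspace X" "x' \<in> topspace X" "q x \<noteq> q x'" for x x'
      by (rule image_eqI[of _ _ "(x, x')"]) (use that in auto)
    then show ?thesis using Y by fastforce
  qed
  ultimately show "closedin (prod_topology Y Y) ((\<lambda>x. (x, x)) ` topspace Y)"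
    by (auto simp: closedin_def)
qed

text \<open>A homeomorphism onto a closed subset is proper: the inverse on \<open>S\<close> makes
  \<open>f\<close> a closed map, and it is injective. Properness of the action of the product
  groupoid on \<open>X\<close> is obtained in this way, from an explicit inverse.\<close>

lemma proper_map_of_continuous_inverse:
  assumes f: "f \<in> topspace X \<rightarrow> S" and S: "closedin Y S"
    and g: "continuous_map (subtopology Y S) X g"
    and gf: "\<And>x. x \<in> topspace X \<Longrightarrow> g (f x) = x" and fg: "\<And>y. y \<in> S \<Longrightarrow> f (g y) = y"
  shows "proper_map X Y f"
proof (rule closed_injective_imp_proper_map)
  show "inj_on f (topspace X)" by (metis gf inj_onI)
  show "closed_map X Y f"
    unfolding closed_map_def
  proof (intro allI impI)
    fix C assume C: "closedin X C"
    have "closedin (subtopology Y S) {y \<in> topspace (subtopology Y S). g y \<in> C}"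
      using closedin_continuous_map_preimage[OF g C] .
    moreover have "{y \<in> topspace (subtopology Y S). g y \<in> C} = f ` C"
    proof -
      have "C \<subseteq> topspace X" using C closedin_subset by blast
      moreover have "S \<subseteq> topspace Y" using S closedin_subset by blast
      ultimately show ?thesis
        using f gf fg by (auto simp: image_iff) metis
    qed
    ultimately show "closedin Y (f ` C)" using S closedin_trans_full by metis
  qed
qed

text \<open>If \<open>k\<close> factors through the closed injective map \<open>f\<close>, the
  preimage of \<open>C\<close> under the factor \<open>g\<close> is the preimage under
  \<open>k\<close> of the closed image of \<open>C\<close>. For a free proper action
  \<open>f\<close> sends a point and an arrow to the translate and the point, and \<open>g\<close>
  recovers the arrow.\<close>

lemma continuous_map_through_closed_injective:
  assumes "closed_map X Y f" and inj: "inj_on f (topspace X)" and k: "continuous_map T Y k"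
    and g: "\<And>p. p \<in> topspace T \<Longrightarrow> g p \<in> topspace X \<and> f (g p) = k p"
  shows "continuous_map T X g"
  unfolding continuous_map_closedin
proof (intro conjI allI impI)
  show "g \<in> topspace T \<rightarrow> topspace X" using g by blast
  fix C assume C: "closedin X C"
  then have sub: "C \<subseteq> topspace X" using closedin_subset by blast
  have "closedin Y (f ` C)" using assms(1) C unfolding closed_map_def by blast
  then have "closedin T {p \<in> topspace T. k p \<in> f ` C}"
    using closedin_continuous_map_preimage[OF k] by blast
  moreover have "{p \<in> topspace T. k p \<in> f ` C} = {p \<in> topspace T. g p \<in> C}"
  proof -
    have "k p \<in> f ` C \<longleftrightarrow> g p \<in> C" if "p \<in> topspace T" for p
      using g[OF that] inj_on_image_mem_iff[OF inj, of "g p" C] sub by metis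
    then show ?thesis by blast
  qed
  ultimately show "closedin T {p \<in> topspace T. g p \<in> C}" by simp
qed

lemma continuous_map_apply2:
  assumes "continuous_map (subtopology (prod_topology X Y) D) Z (\<lambda>(x, y). f x y)"
    and "continuous_map T X a" and "continuous_map T Y b"
    and "\<And>p. p \<in> topspace T \<Longrightarrow> (a p, b p) \<in> D"
  shows "continuous_map T Z (\<lambda>p. f (a p) (b p))"
proof -
  have "continuous_map T (subtopology (prod_topology X Y) D) (\<lambda>p. (a p, b p))"
    using assms by (auto simp: continuous_map_in_subtopology intro: continuous_map_pairedI)
  from continuous_map_compose[OF this assms(1)] show ?thesis by (simp add: o_def)
qed

lemma continuous_map_fst_sub: "continuous_map (subtopology (prod_topology X Y) S) X fst"
  and continuous_map_snd_sub: "continuous_map (subtopology (prod_topology X Y) S) Y snd"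
  by (auto simp: continuous_map_from_subtopology continuous_map_fst continuous_map_snd)

lemma continuous_map_fst_comp:
    "continuous_map T (prod_topology X Y) f \<Longrightarrow> continuous_map T X (\<lambda>p. fst (f p))"
  and continuous_map_snd_comp:
    "continuous_map T (prod_topology X Y) f \<Longrightarrow> continuous_map T Y (\<lambda>p. snd (f p))"
  using continuous_map_compose[OF _ continuous_map_fst, unfolded o_def]
    continuous_map_compose[OF _ continuous_map_snd, unfolded o_def] by blast+

text \<open>Two quotient maps out of \<open>X\<close> with the same fibres have homeomorphic
  targets. In a groupoid equivalence \<open>q\<close> is the momentum map of one side and
  \<open>orb\<close> the orbit map of the action on the other side.\<close>

lemma open_quotient_orbit_space:
  assumes q: "open_quotient X Y q"
    and orb: "\<And>x x'. \<lbrakk>x \<in> topspace X; x' \<in> topspace X\<rbrakk> \<Longrightarrow> orb x = orb x' \<longleftrightarrow> q x = q x'"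
  shows "\<exists>f. homeomorphic_map (quotient_topology X orb) Y f \<and> (\<forall>x\<in>topspace X. f (orb x) = q x)"
proof -
  let ?Q = "quotient_topology X orb"
  define f where "f \<xi> = q (SOME x. x \<in> topspace X \<and> orb x = \<xi>)" for \<xi>
  have f: "f (orb x) = q x" if "x \<in> topspace X" for x
  proof -
    have "(SOME y. y \<in> topspace X \<and> orb y = orb x) \<in> topspace X
        \<and> orb (SOME y. y \<in> topspace X \<and> orb y = orb x) = orb x"
      by (rule someI[of "\<lambda>y. y \<in> topspace X \<and> orb y = orb x"]) (use that in simp)
    then show ?thesis unfolding f_def using orb that by blast
  qed
  have qm: "quotient_map X Y q"
    using q continuous_open_imp_quotient_map unfolding open_quotient_def by blast
  have orbm: "quotient_map X ?Q orb" by (rule quotient_map_quotient_topology)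
  have "quotient_map X Y (f \<circ> orb)"
    using qm quotient_map_eq f by (metis comp_apply)
  then have "quotient_map ?Q Y f"
    using orbm quotient_map_compose_eq by blast
  moreover have "inj_on f (topspace ?Q)"
    using f orb by (auto simp: inj_on_def topspace_quotient_topology)
  ultimately show ?thesis using f by (auto simp: homeomorphic_map_def)
qed


section \<open>Groupoid algebra\<close>

lemma topspace_unit_top [simp]: "units K \<subseteq> arrows K \<Longrightarrow> topspace (unit_top K) = units K"
  by (auto simp: unit_top_def arrows_def)

lemma ldom_iff: "(k, z) \<in> ldom K Z m \<longleftrightarrow> k \<in> arrows K \<and> z \<in> topspace Z \<and> src K k = m z"
  by (simp add: ldom_def)

lemma rdom_iff: "(z, k) \<in> rdom K Z m \<longleftrightarrow> z \<in> topspace Z \<and> k \<in> arrows K \<and> m z = rng K k"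
  by (simp add: rdom_def)

context topological_groupoid
begin

lemma composable_iff: "(x, y) \<in> composable K \<longleftrightarrow> x \<in> arrows K \<and> y \<in> arrows K \<and> src K x = rng K y"
  by (simp add: composable_def)

lemma src_in_units [simp]: "x \<in> arrows K \<Longrightarrow> src K x \<in> units K"
  by (simp add: units_def)

lemma rng_in_units [simp]: "x \<in> arrows K \<Longrightarrow> rng K x \<in> units K"
  by (rule rng_unit)

lemma unit_arrow [simp]: "u \<in> units K \<Longrightarrow> u \<in> arrows K"
  using units_arrows by blast

lemma src_arrow [simp]: "x \<in> arrows K \<Longrightarrow> src K x \<in> arrows K"
  and rng_arrow [simp]: "x \<in> arrows K \<Longrightarrow> rng K x \<in> arrows K"
  by auto

lemma unit_simps [simp]:
  "u \<in> units K \<Longrightarrow> rng K u = u" "u \<in> units K \<Longrightarrow> src K u = u"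
  by (simp_all add: rng_of_unit src_of_unit)

lemma mul_simps [simp]:
  "\<lbrakk>x \<in> arrows K; y \<in> arrows K; src K x = rng K y\<rbrakk> \<Longrightarrow> x \<cdot>\<^bsub>K\<^esub> y \<in> arrows K"
  "\<lbrakk>x \<in> arrows K; y \<in> arrows K; src K x = rng K y\<rbrakk> \<Longrightarrow> rng K (x \<cdot>\<^bsub>K\<^esub> y) = rng K x"
  "\<lbrakk>x \<in> arrows K; y \<in> arrows K; src K x = rng K y\<rbrakk> \<Longrightarrow> src K (x \<cdot>\<^bsub>K\<^esub> y) = src K y"
  "x \<in> arrows K \<Longrightarrow> rng K x \<cdot>\<^bsub>K\<^esub> x = x" "x \<in> arrows K \<Longrightarrow> x \<cdot>\<^bsub>K\<^esub> src K x = x"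
  by (simp_all add: mult_closed rng_mult src_mult rng_left_unit src_right_unit composable_iff)

lemma assoc:
  "\<lbrakk>x \<in> arrows K; y \<in> arrows K; z \<in> arrows K; src K x = rng K y; src K y = rng K z\<rbrakk>
    \<Longrightarrow> (x \<cdot>\<^bsub>K\<^esub> y) \<cdot>\<^bsub>K\<^esub> z = x \<cdot>\<^bsub>K\<^esub> (y \<cdot>\<^bsub>K\<^esub> z)"
  by (simp add: mult_assoc composable_iff)

lemma inv_simps [simp]:
  "x \<in> arrows K \<Longrightarrow> ginv K x \<in> arrows K"
  "x \<in> arrows K \<Longrightarrow> rng K (ginv K x) = src K x"
  "x \<in> arrows K \<Longrightarrow> src K (ginv K x) = rng K x"
  "x \<in> arrows K \<Longrightarrow> x \<cdot>\<^bsub>K\<^esub> ginv K x = rng K x"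
  "x \<in> arrows K \<Longrightarrow> ginv K x \<cdot>\<^bsub>K\<^esub> x = src K x"
  by (simp_all add: inv_closed rng_inv src_inv inv_right inv_left)

lemma cancel [simp]:
  "\<lbrakk>x \<in> arrows K; y \<in> arrows K; src K x = rng K y\<rbrakk> \<Longrightarrow> ginv K x \<cdot>\<^bsub>K\<^esub> (x \<cdot>\<^bsub>K\<^esub> y) = y"
  "\<lbrakk>x \<in> arrows K; y \<in> arrows K; rng K x = rng K y\<rbrakk> \<Longrightarrow> x \<cdot>\<^bsub>K\<^esub> (ginv K x \<cdot>\<^bsub>K\<^esub> y) = y"
  "\<lbrakk>x \<in> arrows K; y \<in> arrows K; src K y = rng K x\<rbrakk> \<Longrightarrow> (y \<cdot>\<^bsub>K\<^esub> x) \<cdot>\<^bsub>K\<^esub> ginv K x = y"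
  "\<lbrakk>x \<in> arrows K; y \<in> arrows K; src K y = src K x\<rbrakk> \<Longrightarrow> (y \<cdot>\<^bsub>K\<^esub> ginv K x) \<cdot>\<^bsub>K\<^esub> x = y"
proof -
  show "ginv K x \<cdot>\<^bsub>K\<^esub> (x \<cdot>\<^bsub>K\<^esub> y) = y" if "x \<in> arrows K" "y \<in> arrows K" "src K x = rng K y"
    using assoc[of "ginv K x" x y] that by simp
  show "x \<cdot>\<^bsub>K\<^esub> (ginv K x \<cdot>\<^bsub>K\<^esub> y) = y" if "x \<in> arrows K" "y \<in> arrows K" "rng K x = rng K y"
    using assoc[of x "ginv K x" y] that by simp
  show "(y \<cdot>\<^bsub>K\<^esub> x) \<cdot>\<^bsub>K\<^esub> ginv K x = y" if "x \<in> arrows K" "y \<in> arrows K" "src K y = rng K x"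
    using assoc[of y x "ginv K x"] that mul_simps(5)[of y] by simp
  show "(y \<cdot>\<^bsub>K\<^esub> ginv K x) \<cdot>\<^bsub>K\<^esub> x = y" if "x \<in> arrows K" "y \<in> arrows K" "src K y = src K x"
    using assoc[of y "ginv K x" x] that mul_simps(5)[of y] by simp
qed

lemma inverse_unique:
  assumes "x \<in> arrows K" "y \<in> arrows K" "src K x = rng K y" "x \<cdot>\<^bsub>K\<^esub> y = rng K x"
  shows "ginv K x = y"
  by (metis assms cancel(1) inv_simps(1,3) src_right_unit)

lemma inv_inv [simp]: "x \<in> arrows K \<Longrightarrow> ginv K (ginv K x) = x"
  by (rule inverse_unique) simp_all

lemma inv_mult:
  assumes "x \<in> arrows K" "y \<in> arrows K" "src K x = rng K y"
  shows "ginv K (x \<cdot>\<^bsub>K\<^esub> y) = ginv K y \<cdot>\<^bsub>K\<^esub> ginv K x"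
  by (rule inverse_unique) (use assms in \<open>simp_all add: assoc\<close>)

lemma inv_unit [simp]: "u \<in> units K \<Longrightarrow> ginv K u = u"
  by (metis inverse_unique unit_arrow unit_simps(1,2) src_right_unit)

text \<open>Cancelling \<open>x\<close> on the right gives a way to recognize ranges; the range of
  \<open>h \<triangleright> x\<close> is computed with it.\<close>

lemma left_neutral:
  assumes "e \<in> arrows K" "x \<in> arrows K" "src K e = rng K x" "e \<cdot>\<^bsub>K\<^esub> x = x"
  shows "e = rng K x"
  by (metis assms cancel(3) inv_simps(4))

lemma idempotent_unit:
  "\<lbrakk>x \<in> arrows K; src K x = rng K x; x \<cdot>\<^bsub>K\<^esub> x = x\<rbrakk> \<Longrightarrow> x \<in> units K"
  using left_neutral by (metis rng_in_units)

lemma unit_iff: "x \<in> units K \<longleftrightarrow> x \<in> arrows K \<and> src K x = x"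
  by (metis src_in_units unit_arrow unit_simps(2))

lemma continuous_src: "continuous_map T (gtop K) f \<Longrightarrow> continuous_map T (gtop K) (\<lambda>p. src K (f p))"
  and continuous_rng: "continuous_map T (gtop K) f \<Longrightarrow> continuous_map T (gtop K) (\<lambda>p. rng K (f p))"
  and continuous_inv: "continuous_map T (gtop K) f \<Longrightarrow> continuous_map T (gtop K) (\<lambda>p. ginv K (f p))"
  using continuous_map_compose[OF _ src_continuous, unfolded o_def]
    continuous_map_compose[OF _ rng_continuous, unfolded o_def]
    continuous_map_compose[OF _ inv_continuous, unfolded o_def] by blast+

lemma continuous_arrow: "\<lbrakk>continuous_map T (gtop K) f; p \<in> topspace T\<rbrakk> \<Longrightarrow> f p \<in> arrows K"
  by (auto simp: arrows_def continuous_map_def)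

lemma continuous_mult:
  assumes "continuous_map T (gtop K) f" "continuous_map T (gtop K) g"
    and "\<And>p. p \<in> topspace T \<Longrightarrow> src K (f p) = rng K (g p)"
  shows "continuous_map T (gtop K) (\<lambda>p. f p \<cdot>\<^bsub>K\<^esub> g p)"
  by (rule continuous_map_apply2[OF mult_continuous assms(1,2)])
    (use assms continuous_arrow composable_iff in auto)

lemma continuous_unit_top:
  "continuous_map T (unit_top K) f \<longleftrightarrow>
    continuous_map T (gtop K) f \<and> (\<forall>p\<in>topspace T. f p \<in> units K)"
  by (auto simp: unit_top_def continuous_map_in_subtopology)

text \<open>Inversion is a homeomorphism that exchanges source and range, so the ranges of
  \<open>U\<close> are the sources of the inverses.\<close>

lemma open_range:
  assumes "open_source K"
  shows "open_map (gtop K) (unit_top K) (rng K)"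
  unfolding open_map_def
proof (intro allI impI)
  fix U assume U: "openin (gtop K) U"
  let ?V = "{x \<in> topspace (gtop K). ginv K x \<in> U}"
  have "openin (gtop K) ?V" using openin_continuous_map_preimage[OF inv_continuous U] .
  then have "openin (unit_top K) (src K ` ?V)"
    using assms unfolding open_source_def open_map_def by blast
  moreover have "src K ` ?V = rng K ` U"
  proof -
    have "U \<subseteq> arrows K" using U openin_subset arrows_def by metis
    then show ?thesis
      by (auto simp: arrows_def[symmetric] image_iff) (metis inv_simps(2) , metis inv_inv inv_simps(1,3) subsetD)
  qed
  ultimately show "openin (unit_top K) (rng K ` U)" by simp
qed

end

section \<open>Opposite groupoids and anti-isomorphisms\<close>

definition op_groupoid :: "'a groupoid \<Rightarrow> 'a groupoid"
  where "op_groupoid K =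
    \<lparr> gtop = gtop K, rng = src K, src = rng K, gmult = (\<lambda>x y. y \<cdot>\<^bsub>K\<^esub> x), ginv = ginv K \<rparr>"

text \<open>The structure of \<open>L\<close> is prescribed by equations through \<open>g\<close>,
  on arrows only. This covers both uses: the identity onto the opposite groupoid, and the exchange
  of coordinates that turns a left product over opposites into a right product.\<close>

lemma (in topological_groupoid) anti_isomorphic:
  fixes L :: "'l groupoid"
  assumes f: "homeomorphic_maps (gtop K) (gtop L) f g"
    and rngL: "\<And>y. y \<in> arrows L \<Longrightarrow> rng L y = f (src K (g y))"
    and srcL: "\<And>y. y \<in> arrows L \<Longrightarrow> src L y = f (rng K (g y))"
    and multL: "\<And>y z. \<lbrakk>y \<in> arrows L; z \<in> arrows L; src L y = rng L z\<rbrakk>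
      \<Longrightarrow> y \<cdot>\<^bsub>L\<^esub> z = f (g z \<cdot>\<^bsub>K\<^esub> g y)"
    and invL: "\<And>y. y \<in> arrows L \<Longrightarrow> ginv L y = f (ginv K (g y))"
  shows "topological_groupoid L"
proof -
  have fc: "continuous_map (gtop K) (gtop L) f" and gc: "continuous_map (gtop L) (gtop K) g"
    and gf [simp]: "\<And>x. x \<in> arrows K \<Longrightarrow> g (f x) = x"
    and fg [simp]: "\<And>y. y \<in> arrows L \<Longrightarrow> f (g y) = y"
    using f unfolding homeomorphic_maps_def arrows_def by auto
  have fa [simp]: "\<And>x. x \<in> arrows K \<Longrightarrow> f x \<in> arrows L"
    and ga [simp]: "\<And>y. y \<in> arrows L \<Longrightarrow> g y \<in> arrows K"
    using fc gc unfolding arrows_def continuous_map_def by auto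
  have comp: "src K (g z) = rng K (g y)" if "y \<in> arrows L" "z \<in> arrows L" "src L y = rng L z" for y z
    using that by (metis gf rngL srcL ga rng_arrow src_arrow)
  have unitsL: "units L = f ` units K"
  proof
    show "units L \<subseteq> f ` units K" unfolding units_def[of L] using srcL by auto
    show "f ` units K \<subseteq> units L"
      unfolding units_def[of L]
    proof
      fix y assume "y \<in> f ` units K"
      then obtain u where u: "u \<in> units K" "y = f u" by blast
      then have "src L (f u) = f u" using srcL by simp
      then show "y \<in> src L ` arrows L" using u by (metis fa imageI unit_arrow)
    qed
  qed
  have homeo: "gtop K homeomorphic_space gtop L" using f homeomorphic_space_def by blast
  show ?thesis
  proof
    show "continuous_map (gtop L) (gtop L) (rng L)"
      by (rule continuous_map_eq[OF continuous_map_compose[OF continuous_src[OF gc] fc]])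
        (simp add: rngL arrows_def)
    show "continuous_map (gtop L) (gtop L) (src L)"
      by (rule continuous_map_eq[OF continuous_map_compose[OF continuous_rng[OF gc] fc]])
        (simp add: srcL arrows_def)
    show "continuous_map (gtop L) (gtop L) (ginv L)"
      by (rule continuous_map_eq[OF continuous_map_compose[OF continuous_inv[OF gc] fc]])
        (simp add: invL arrows_def)
    let ?D = "subtopology (prod_topology (gtop L) (gtop L)) (composable L)"
    have D: "p \<in> topspace ?D \<Longrightarrow> fst p \<in> arrows L \<and> snd p \<in> arrows L \<and> src L (fst p) = rng L (snd p)" for p
      by (auto simp: composable_def)
    have "continuous_map ?D (gtop K) (\<lambda>p. g (snd p) \<cdot>\<^bsub>K\<^esub> g (fst p))"
      by (rule continuous_mult)
        (use D comp continuous_map_compose[OF continuous_map_fst_sub gc]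
          continuous_map_compose[OF continuous_map_snd_sub gc] in \<open>auto simp: o_def\<close>)
    then show "continuous_map ?D (gtop L) (\<lambda>(x, y). x \<cdot>\<^bsub>L\<^esub> y)"
      by (rule continuous_map_eq[OF continuous_map_compose[OF _ fc]]) (use D multL in auto)
    show "Hausdorff_space (gtop L)" using Hausdorff homeo homeomorphic_Hausdorff_space by blast
    show "locally_compact_space (gtop L)"
      using locally_compact homeo homeomorphic_locally_compact_space by blast
    show "second_countable (gtop L)"
      using second_countable second_countable_open_map_image[OF fc] f
      by (metis homeomorphic_maps_map homeomorphic_imp_open_map homeomorphic_imp_surjective_map)
  qed (auto simp: unitsL rngL srcL multL invL comp composable_def assoc)
qed

lemma (in topological_groupoid) op_topological_groupoid: "topological_groupoid (op_groupoid K)"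
  by (rule anti_isomorphic[of _ "\<lambda>x. x" "\<lambda>x. x"])
    (auto simp: op_groupoid_def arrows_def homeomorphic_maps_def)

lemma op_groupoid_simps [simp]:
  "gtop (op_groupoid K) = gtop K" "rng (op_groupoid K) = src K" "src (op_groupoid K) = rng K"
  "x \<cdot>\<^bsub>op_groupoid K\<^esub> y = y \<cdot>\<^bsub>K\<^esub> x" "ginv (op_groupoid K) = ginv K"
  "arrows (op_groupoid K) = arrows K"
  by (simp_all add: op_groupoid_def arrows_def)

lemma (in topological_groupoid) op_units [simp]: "units (op_groupoid K) = units K"
proof
  show "units (op_groupoid K) \<subseteq> units K" by (auto simp: units_def[of "op_groupoid K"])
  show "units K \<subseteq> units (op_groupoid K)"
  proof
    fix u assume "u \<in> units K"
    then show "u \<in> units (op_groupoid K)"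
      unfolding units_def[of "op_groupoid K"] by (intro image_eqI[of _ _ u]) simp_all
  qed
qed

lemma (in topological_groupoid) op_unit_top [simp]: "unit_top (op_groupoid K) = unit_top K"
  by (simp add: unit_top_def)

lemma (in topological_groupoid) op_open_source: "open_source K \<Longrightarrow> open_source (op_groupoid K)"
  using open_range by (simp add: open_source_def)

lemma (in topological_groupoid) op_composable:
  "(x, y) \<in> composable (op_groupoid K) \<longleftrightarrow> (y, x) \<in> composable K"
  by (auto simp: composable_def)


section \<open>Orbit spaces of right actions\<close>

context groupoid_right_space
begin

lemma momentum_unit [simp]: "z \<in> topspace Z \<Longrightarrow> m z \<in> units K"
  using momentum_continuous by (simp add: continuous_unit_top)

lemma act_closed [simp]: "\<lbrakk>z \<in> topspace Z; k \<in> arrows K; m z = rng K k\<rbrakk> \<Longrightarrow> a z k \<in> topspace Z"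
  using continuous_map_image_subset_topspace[OF act_continuous]
  by (force simp: rdom_top_def rdom_def arrows_def)

lemma momentum_simp [simp]: "\<lbrakk>z \<in> topspace Z; k \<in> arrows K; m z = rng K k\<rbrakk> \<Longrightarrow> m (a z k) = src K k"
  by (simp add: momentum_act rdom_iff)

lemma act_mult:
  "\<lbrakk>z \<in> topspace Z; k \<in> arrows K; m z = rng K k; k' \<in> arrows K; src K k = rng K k'\<rbrakk>
    \<Longrightarrow> a (a z k) k' = a z (k \<cdot>\<^bsub>K\<^esub> k')"
  by (simp add: act_act rdom_iff composable_iff)

lemma act_inv:
  "\<lbrakk>z \<in> topspace Z; k \<in> arrows K; m z = rng K k\<rbrakk> \<Longrightarrow> a (a z k) (ginv K k) = z"
  by (simp add: act_mult) (metis act_unit)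

lemma orbit_self [simp]: "z \<in> topspace Z \<Longrightarrow> z \<in> rorbit K m a z"
  unfolding rorbit_def using act_unit[of z]
  by (metis (mono_tags, lifting) mem_Collect_eq momentum_unit unit_arrow unit_simps(1))

lemma orbit_act:
  assumes "z \<in> topspace Z" "k \<in> arrows K" "m z = rng K k"
  shows "rorbit K m a (a z k) = rorbit K m a z"
proof -
  have sub: "rorbit K m a (a z k) \<subseteq> rorbit K m a z"
    if "z \<in> topspace Z" "k \<in> arrows K" "m z = rng K k" for z k
    using that unfolding rorbit_def by (auto simp: act_mult)
  from sub[of "a z k" "ginv K k"] sub[OF assms] show ?thesis
    using assms by (simp add: act_inv)
qed

lemma orbit_eq:
  assumes "z \<in> topspace Z" "z' \<in> topspace Z"
  shows "rorbit K m a z = rorbit K m a z' \<longleftrightarrow> (\<exists>k\<in>arrows K. m z = rng K k \<and> a z k = z')"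
proof
  assume "rorbit K m a z = rorbit K m a z'"
  then have "z' \<in> rorbit K m a z" using assms by simp
  then show "\<exists>k\<in>arrows K. m z = rng K k \<and> a z k = z'" by (auto simp: rorbit_def)
qed (use assms orbit_act in auto)

text \<open>If an arrow \<open>k\<close> moves \<open>y\<close> into the open set \<open>U\<close>,
  then arrows near \<open>k\<close> move points near \<open>y\<close> into \<open>U\<close>,
  provided that their range is the momentum of the point. Since the range map is open, the ranges of
  such arrows fill a neighbourhood of the momentum of \<open>y\<close>, so every nearby point has an
  admissible arrow.\<close>

lemma orbit_open_quotient:
  assumes "open_source K"
  shows "open_quotient Z (quotient_topology Z (rorbit K m a)) (rorbit K m a)"
proof (rule open_quotient_quotient_topology, unfold open_map_def, intro allI impI)
  fix U assume U: "openin Z U"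
  let ?orb = "rorbit K m a"
  have UZ: "U \<subseteq> topspace Z" using U openin_subset by blast
  have "openin Z {y \<in> topspace Z. ?orb y \<in> ?orb ` U}"
  proof (subst openin_subopen, intro ballI)
    fix y assume "y \<in> {y \<in> topspace Z. ?orb y \<in> ?orb ` U}"
    then obtain k where y: "y \<in> topspace Z" and k: "k \<in> arrows K" "m y = rng K k" "a y k \<in> U"
      using UZ orbit_eq by (auto; metis subsetD)
    have "openin (rdom_top K Z m) {p \<in> topspace (rdom_top K Z m). (\<lambda>(z, k). a z k) p \<in> U}"
      using openin_continuous_map_preimage[OF act_continuous U] .
    then obtain W where W: "openin (prod_topology Z (gtop K)) W"
        "{p \<in> topspace (rdom_top K Z m). (\<lambda>(z, k). a z k) p \<in> U} = W \<inter> rdom K Z m"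
      unfolding rdom_top_def openin_subtopology by blast
    have dom: "topspace (rdom_top K Z m) = rdom K Z m"
      by (auto simp: rdom_top_def rdom_def arrows_def)
    have "(y, k) \<in> W" using W(2) dom k y by (auto simp: rdom_iff)
    then obtain U1 V1 where UV: "openin Z U1" "openin (gtop K) V1" "y \<in> U1" "k \<in> V1" "U1 \<times> V1 \<subseteq> W"
      using W(1) unfolding openin_prod_topology_alt by metis
    \<comment> \<open>The points near \<open>y\<close> for which some arrow in \<open>V1\<close> has
      the range that is required to act.\<close>
    let ?N = "U1 \<inter> {z \<in> topspace Z. m z \<in> rng K ` V1}"
    have "openin (unit_top K) (rng K ` V1)"
      using open_range[OF assms] UV(2) unfolding open_map_def by blast
    then have "openin Z ?N"
      using UV(1) openin_continuous_map_preimage[OF momentum_continuous] by blast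
    moreover have "y \<in> ?N" using y k UV by auto
    moreover have "?N \<subseteq> {y \<in> topspace Z. ?orb y \<in> ?orb ` U}"
    proof
      fix z assume z: "z \<in> ?N"
      then obtain k' where k': "k' \<in> V1" "m z = rng K k'" by auto
      have "k' \<in> arrows K" using k'(1) openin_subset[OF UV(2)] by (auto simp: arrows_def)
      moreover from this have "(z, k') \<in> W \<inter> rdom K Z m" using z k' UV(5) by (auto simp: rdom_iff)
      then have "a z k' \<in> U" unfolding W(2)[symmetric] by simp
      ultimately show "z \<in> {y \<in> topspace Z. ?orb y \<in> ?orb ` U}"
        using z k'(2) orbit_act[of z k'] by auto
    qed
    ultimately show "\<exists>T. openin Z T \<and> y \<in> T \<and> T \<subseteq> {y \<in> topspace Z. ?orb y \<in> ?orb ` U}" by blast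
  qed
  then show "openin (quotient_topology Z ?orb) (?orb ` U)"
    using UZ by (auto simp: openin_quotient_topology)
qed

end


section \<open>Self-similar left actions\<close>

context self_similar_left
begin

lemma lmom_unit [simp]: "u \<in> units X \<Longrightarrow> lmom \<alpha> u \<in> units H"
  using mom_surj by blast

lemma ldom_act: "(h, x) \<in> ldom H (gtop X) (lrho X \<alpha>) \<longleftrightarrow>
    h \<in> arrows H \<and> x \<in> arrows X \<and> src H h = lmom \<alpha> (rng X x)"
  by (simp add: ldom_iff lrho_def arrows_def)

lemma continuous_lmom:
  assumes "continuous_map T (gtop X) f" "\<And>p. p \<in> topspace T \<Longrightarrow> f p \<in> units X"
  shows "continuous_map T (gtop H) (\<lambda>p. lmom \<alpha> (f p))"
proof -
  have "continuous_map T (unit_top X) f" using assms by (simp add: X.continuous_unit_top)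
  from continuous_map_compose[OF this mom_continuous] show ?thesis
    by (simp add: H.continuous_unit_top o_def)
qed

lemma continuous_lact:
  assumes "continuous_map T (gtop H) f" "continuous_map T (gtop X) g"
    and "\<And>p. p \<in> topspace T \<Longrightarrow> src H (f p) = lmom \<alpha> (rng X (g p))"
  shows "continuous_map T (gtop X) (\<lambda>p. f p \<triangleright>\<^bsub>\<alpha>\<^esub> g p)"
  by (rule continuous_map_apply2[OF act_continuous[unfolded ldom_top_def] assms(1,2)])
    (use assms H.continuous_arrow X.continuous_arrow ldom_act in auto)

lemma continuous_lres:
  assumes "continuous_map T (gtop H) f" "continuous_map T (gtop X) g"
    and "\<And>p. p \<in> topspace T \<Longrightarrow> src H (f p) = lmom \<alpha> (rng X (g p))"
  shows "continuous_map T (gtop H) (\<lambda>p. f p \<triangleleft>\<^bsub>\<alpha>\<^esub> g p)"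
  by (rule continuous_map_apply2[OF res_continuous[unfolded ldom_top_def] assms(1,2)])
    (use assms H.continuous_arrow X.continuous_arrow ldom_act in auto)

lemma topspace_ldom_top: "topspace (ldom_top H (gtop X) (lrho X \<alpha>)) = ldom H (gtop X) (lrho X \<alpha>)"
  by (auto simp: ldom_top_def ldom_def arrows_def)

lemma lact_arrow [simp]:
    "\<lbrakk>h \<in> arrows H; x \<in> arrows X; src H h = lmom \<alpha> (rng X x)\<rbrakk> \<Longrightarrow> h \<triangleright>\<^bsub>\<alpha>\<^esub> x \<in> arrows X"
  and lres_arrow [simp]:
    "\<lbrakk>h \<in> arrows H; x \<in> arrows X; src H h = lmom \<alpha> (rng X x)\<rbrakk> \<Longrightarrow> h \<triangleleft>\<^bsub>\<alpha>\<^esub> x \<in> arrows H"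
  using continuous_map_image_subset_topspace[OF act_continuous]
    continuous_map_image_subset_topspace[OF res_continuous]
  unfolding topspace_ldom_top arrows_def[symmetric] by (force simp: ldom_act)+

lemma lact_mult [simp]:
    "\<lbrakk>h \<in> arrows H; x \<in> arrows X; src H h = lmom \<alpha> (rng X x); y \<in> arrows X; src X x = rng X y\<rbrakk>
      \<Longrightarrow> h \<triangleright>\<^bsub>\<alpha>\<^esub> (x \<cdot>\<^bsub>X\<^esub> y) = (h \<triangleright>\<^bsub>\<alpha>\<^esub> x) \<cdot>\<^bsub>X\<^esub> ((h \<triangleleft>\<^bsub>\<alpha>\<^esub> x) \<triangleright>\<^bsub>\<alpha>\<^esub> y)"
  and lres_mult [simp]:
    "\<lbrakk>h \<in> arrows H; x \<in> arrows X; src H h = lmom \<alpha> (rng X x); y \<in> arrows X; src X x = rng X y\<rbrakk>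
      \<Longrightarrow> h \<triangleleft>\<^bsub>\<alpha>\<^esub> (x \<cdot>\<^bsub>X\<^esub> y) = (h \<triangleleft>\<^bsub>\<alpha>\<^esub> x) \<triangleleft>\<^bsub>\<alpha>\<^esub> y"
  by (simp_all add: L3 L4 ldom_act X.composable_iff)

lemma mult_lact:
    "\<lbrakk>h \<in> arrows H; k \<in> arrows H; src H h = rng H k; x \<in> arrows X; src H k = lmom \<alpha> (rng X x)\<rbrakk>
      \<Longrightarrow> (h \<cdot>\<^bsub>H\<^esub> k) \<triangleright>\<^bsub>\<alpha>\<^esub> x = h \<triangleright>\<^bsub>\<alpha>\<^esub> (k \<triangleright>\<^bsub>\<alpha>\<^esub> x)"
  and mult_lres:
    "\<lbrakk>h \<in> arrows H; k \<in> arrows H; src H h = rng H k; x \<in> arrows X; src H k = lmom \<alpha> (rng X x)\<rbrakk>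
      \<Longrightarrow> (h \<cdot>\<^bsub>H\<^esub> k) \<triangleleft>\<^bsub>\<alpha>\<^esub> x = (h \<triangleleft>\<^bsub>\<alpha>\<^esub> (k \<triangleright>\<^bsub>\<alpha>\<^esub> x)) \<cdot>\<^bsub>H\<^esub> (k \<triangleleft>\<^bsub>\<alpha>\<^esub> x)"
  by (simp_all add: L5 L6 ldom_act H.composable_iff)

lemma lact_neutral [simp]: "\<lbrakk>x \<in> arrows X; e = lmom \<alpha> (rng X x)\<rbrakk> \<Longrightarrow> e \<triangleright>\<^bsub>\<alpha>\<^esub> x = x"
  using L2(2)[of x] by (simp add: lrho_def)

lemma lres_unit [simp]: "\<lbrakk>u \<in> units X; h \<in> arrows H; src H h = lmom \<alpha> u\<rbrakk> \<Longrightarrow> h \<triangleleft>\<^bsub>\<alpha>\<^esub> u = h"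
  by (simp add: L2(1) ldom_act)

text \<open>Applying \<open>h\<close> to the product of \<open>rng X x\<close> and \<open>x\<close>
  writes \<open>h \<triangleright> x\<close> as a left multiple of itself, because the residual of
  \<open>h\<close> at a unit is \<open>h\<close>. The left factor is therefore the range.\<close>

lemma rng_lact [simp]:
  assumes "h \<in> arrows H" "x \<in> arrows X" "src H h = lmom \<alpha> (rng X x)"
  shows "rng X (h \<triangleright>\<^bsub>\<alpha>\<^esub> x) = h \<triangleright>\<^bsub>\<alpha>\<^esub> rng X x"
proof (rule X.left_neutral[symmetric])
  show "src X (h \<triangleright>\<^bsub>\<alpha>\<^esub> rng X x) = rng X (h \<triangleright>\<^bsub>\<alpha>\<^esub> x)"
    using act_composable[of h "rng X x" x] assms by (simp add: ldom_act X.composable_iff)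
  show "(h \<triangleright>\<^bsub>\<alpha>\<^esub> rng X x) \<cdot>\<^bsub>X\<^esub> (h \<triangleright>\<^bsub>\<alpha>\<^esub> x) = h \<triangleright>\<^bsub>\<alpha>\<^esub> x"
    using lact_mult[of h "rng X x" x] assms by simp
qed (use assms in simp_all)

lemma lact_unit [simp]:
  assumes "h \<in> arrows H" "u \<in> units X" "src H h = lmom \<alpha> u"
  shows "h \<triangleright>\<^bsub>\<alpha>\<^esub> u \<in> units X"
  using rng_lact[of h u] assms X.rng_in_units[of "h \<triangleright>\<^bsub>\<alpha>\<^esub> u"] by simp

lemma lmom_lact_unit [simp]:
  assumes "h \<in> arrows H" "u \<in> units X" "src H h = lmom \<alpha> u"
  shows "lmom \<alpha> (h \<triangleright>\<^bsub>\<alpha>\<^esub> u) = rng H h"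
  using L1(1)[of h u] assms by (simp add: ldom_act lrho_def)

lemma src_lact [simp]:
  assumes "h \<in> arrows H" "x \<in> arrows X" "src H h = lmom \<alpha> (rng X x)"
  shows "src X (h \<triangleright>\<^bsub>\<alpha>\<^esub> x) = (h \<triangleleft>\<^bsub>\<alpha>\<^esub> x) \<triangleright>\<^bsub>\<alpha>\<^esub> src X x"
  using act_composable[of h x "src X x"] L1(2)[of h x] assms
  by (simp add: ldom_act X.composable_iff lrho_def)

lemma src_lres [simp]:
  "\<lbrakk>h \<in> arrows H; x \<in> arrows X; src H h = lmom \<alpha> (rng X x)\<rbrakk> \<Longrightarrow> src H (h \<triangleleft>\<^bsub>\<alpha>\<^esub> x) = lmom \<alpha> (src X x)"
  using L1(2)[of h x] by (simp add: ldom_act lrho_def)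

text \<open>The unit \<open>e\<close> is idempotent and fixes \<open>x\<close>, so L6 makes its
  residual at \<open>x\<close> idempotent. By L1 the residual has equal source and range; hence it
  is a unit and is determined by its source.\<close>

lemma lres_neutral [simp]:
  assumes "x \<in> arrows X" "e = lmom \<alpha> (rng X x)"
  shows "e \<triangleleft>\<^bsub>\<alpha>\<^esub> x = lmom \<alpha> (src X x)"
proof -
  have e: "e \<in> units H" using assms by simp
  have L: "e \<triangleleft>\<^bsub>\<alpha>\<^esub> x = (e \<triangleleft>\<^bsub>\<alpha>\<^esub> x) \<cdot>\<^bsub>H\<^esub> (e \<triangleleft>\<^bsub>\<alpha>\<^esub> x)"
    using mult_lres[of e e x] assms e H.mul_simps(4)[of e] by simp
  have "rng H (e \<triangleleft>\<^bsub>\<alpha>\<^esub> x) = lmom \<alpha> (src X x)"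
    using L1(3)[of e x] assms e by (simp add: ldom_act lrho_def)
  then have "e \<triangleleft>\<^bsub>\<alpha>\<^esub> x \<in> units H"
    using assms e L by (intro H.idempotent_unit) simp_all
  then show ?thesis using src_lres[of e x] assms e by simp
qed

text \<open>L4 applied to \<open>x\<close> times its inverse exhibits the right-hand side as a right
  inverse of \<open>h \<triangleright> x\<close>.\<close>

lemma inv_lact:
  assumes "h \<in> arrows H" "x \<in> arrows X" "src H h = lmom \<alpha> (rng X x)"
  shows "ginv X (h \<triangleright>\<^bsub>\<alpha>\<^esub> x) = (h \<triangleleft>\<^bsub>\<alpha>\<^esub> x) \<triangleright>\<^bsub>\<alpha>\<^esub> ginv X x"
proof (rule X.inverse_unique)
  show "(h \<triangleright>\<^bsub>\<alpha>\<^esub> x) \<cdot>\<^bsub>X\<^esub> ((h \<triangleleft>\<^bsub>\<alpha>\<^esub> x) \<triangleright>\<^bsub>\<alpha>\<^esub> ginv X x) = rng X (h \<triangleright>\<^bsub>\<alpha>\<^esub> x)"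
    using lact_mult[of h x "ginv X x"] assms by simp
qed (use assms in simp_all)

lemma lmom_src_lact:
  assumes "h \<in> arrows H" "x \<in> arrows X" "src H h = lmom \<alpha> (rng X x)"
  shows "lmom \<alpha> (src X (h \<triangleright>\<^bsub>\<alpha>\<^esub> x)) = rng H (h \<triangleleft>\<^bsub>\<alpha>\<^esub> x)"
  using assms by simp

text \<open>L6 applied to the inverse of \<open>h\<close> times \<open>h\<close>: the two residuals
  multiply to the residual of a unit, which is again a unit by \<open>lres_neutral\<close>.\<close>

lemma inv_lres:
  assumes "h \<in> arrows H" "x \<in> arrows X" "src H h = lmom \<alpha> (rng X x)"
  shows "ginv H (h \<triangleleft>\<^bsub>\<alpha>\<^esub> x) = ginv H h \<triangleleft>\<^bsub>\<alpha>\<^esub> (h \<triangleright>\<^bsub>\<alpha>\<^esub> x)"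
proof -
  have "(ginv H h \<triangleleft>\<^bsub>\<alpha>\<^esub> (h \<triangleright>\<^bsub>\<alpha>\<^esub> x)) \<cdot>\<^bsub>H\<^esub> (h \<triangleleft>\<^bsub>\<alpha>\<^esub> x) = lmom \<alpha> (src X x)"
    using mult_lres[of "ginv H h" h x] assms by simp
  then have "ginv H (ginv H h \<triangleleft>\<^bsub>\<alpha>\<^esub> (h \<triangleright>\<^bsub>\<alpha>\<^esub> x)) = h \<triangleleft>\<^bsub>\<alpha>\<^esub> x"
    using assms mult_lact[of "ginv H h" h x] lmom_src_lact[OF assms] L1(3)[of "ginv H h" "h \<triangleright>\<^bsub>\<alpha>\<^esub> x"]
    by (intro H.inverse_unique) (simp_all add: ldom_act lrho_def)
  then show ?thesis using assms by (metis H.inv_inv H.inv_simps(1,3) X.rng_in_units lact_arrow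
        lmom_lact_unit lres_arrow rng_lact)
qed

lemma inv_lact_lact [simp]:
  "\<lbrakk>h \<in> arrows H; x \<in> arrows X; src H h = lmom \<alpha> (rng X x)\<rbrakk> \<Longrightarrow> ginv H h \<triangleright>\<^bsub>\<alpha>\<^esub> (h \<triangleright>\<^bsub>\<alpha>\<^esub> x) = x"
  "\<lbrakk>h \<in> arrows H; x \<in> arrows X; rng H h = lmom \<alpha> (rng X x)\<rbrakk> \<Longrightarrow> h \<triangleright>\<^bsub>\<alpha>\<^esub> (ginv H h \<triangleright>\<^bsub>\<alpha>\<^esub> x) = x"
  using mult_lact[of "ginv H h" h x] mult_lact[of h "ginv H h" x] by simp_all

text \<open>L3 applied to \<open>x\<close> times its inverse. Taking residuals at \<open>x\<close>
  is thus undone by taking residuals at the inverse, which is how an arrow with a prescribed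
  residual is produced for the left inner product.\<close>

lemma lres_lres_inv [simp]:
  assumes "h \<in> arrows H" "x \<in> arrows X" "src H h = lmom \<alpha> (rng X x)"
  shows "(h \<triangleleft>\<^bsub>\<alpha>\<^esub> x) \<triangleleft>\<^bsub>\<alpha>\<^esub> ginv X x = h"
  using lres_mult[of h x "ginv X x"] assms by simp

end


section \<open>Self-similar products of groupoids\<close>

locale self_similar_left_product = self_similar_left H X \<alpha>
  for H :: "'h groupoid" and X :: "'x groupoid" and \<alpha> :: "('h, 'x) left_ss"
begin

abbreviation K where "K \<equiv> lprod_groupoid X H \<alpha>"

lemma arrows_lprod: "(x, h) \<in> arrows K \<longleftrightarrow> x \<in> arrows X \<and> h \<in> arrows H \<and> lmom \<alpha> (src X x) = rng H h"
  by (auto simp: lprod_groupoid_def arrows_def lrho_def X.rng_inv[unfolded arrows_def])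

lemma rng_lprod: "rng K (x, h) = (rng X x, lmom \<alpha> (rng X x))"
  by (simp add: lprod_groupoid_def lprod_unit_def)

lemma src_lprod:
  assumes "(x, h) \<in> arrows K"
  shows "src K (x, h) = (ginv H h \<triangleright>\<^bsub>\<alpha>\<^esub> src X x, src H h)"
proof -
  have "lmom \<alpha> (ginv H h \<triangleright>\<^bsub>\<alpha>\<^esub> src X x) = src H h"
    using assms lmom_lact_unit[of "ginv H h" "src X x"] by (simp add: arrows_lprod)
  then show ?thesis by (simp add: lprod_groupoid_def lprod_unit_def)
qed

lemma mult_lprod: "(x, h) \<cdot>\<^bsub>K\<^esub> (y, k) = (x \<cdot>\<^bsub>X\<^esub> (h \<triangleright>\<^bsub>\<alpha>\<^esub> y), (h \<triangleleft>\<^bsub>\<alpha>\<^esub> y) \<cdot>\<^bsub>H\<^esub> k)"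
  by (simp add: lprod_groupoid_def)

lemma inv_lprod: "ginv K (x, h) = (ginv H h \<triangleright>\<^bsub>\<alpha>\<^esub> ginv X x, ginv H h \<triangleleft>\<^bsub>\<alpha>\<^esub> ginv X x)"
  by (simp add: lprod_groupoid_def)

text \<open>Solving the source condition for \<open>src X x\<close> removes the inverse of
  \<open>h\<close>; later computations use composability in this form.\<close>

lemma composable_lprod:
  assumes "(x, h) \<in> arrows K" "(y, k) \<in> arrows K"
  shows "src K (x, h) = rng K (y, k) \<longleftrightarrow> src H h = lmom \<alpha> (rng X y) \<and> src X x = h \<triangleright>\<^bsub>\<alpha>\<^esub> rng X y"
proof -
  have "ginv H h \<triangleright>\<^bsub>\<alpha>\<^esub> src X x = rng X y \<longleftrightarrow> src X x = h \<triangleright>\<^bsub>\<alpha>\<^esub> rng X y" if "src H h = lmom \<alpha> (rng X y)"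
  proof -
    have "h \<triangleright>\<^bsub>\<alpha>\<^esub> (ginv H h \<triangleright>\<^bsub>\<alpha>\<^esub> src X x) = src X x" "ginv H h \<triangleright>\<^bsub>\<alpha>\<^esub> (h \<triangleright>\<^bsub>\<alpha>\<^esub> rng X y) = rng X y"
      using assms that by (auto simp: arrows_lprod)
    then show ?thesis by metis
  qed
  then show ?thesis
    using assms by (auto simp: src_lprod rng_lprod arrows_lprod)
qed

lemma units_lprod: "units K = (\<lambda>u. (u, lmom \<alpha> u)) ` units X"
proof (intro equalityI subsetI)
  fix p assume "p \<in> units K"
  then obtain x h where xh: "(x, h) \<in> arrows K" "p = src K (x, h)" by (auto simp: units_def)
  then have "p = (ginv H h \<triangleright>\<^bsub>\<alpha>\<^esub> src X x, lmom \<alpha> (ginv H h \<triangleright>\<^bsub>\<alpha>\<^esub> src X x))" "ginv H h \<triangleright>\<^bsub>\<alpha>\<^esub> src X x \<in> units X"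
    by (simp_all add: src_lprod arrows_lprod)
  then show "p \<in> (\<lambda>u. (u, lmom \<alpha> u)) ` units X" by blast
next
  fix p assume "p \<in> (\<lambda>u. (u, lmom \<alpha> u)) ` units X"
  then obtain u where u: "u \<in> units X" "p = (u, lmom \<alpha> u)" by blast
  then have a: "p \<in> arrows K" by (simp add: arrows_lprod)
  moreover have "src K p = p" using u a by (simp add: src_lprod)
  ultimately show "p \<in> units K" unfolding units_def by force
qed

lemma gtop_lprod: "gtop K = subtopology (prod_topology (gtop X) (gtop H)) (arrows K)"
proof -
  have "gtop K = subtopology (prod_topology (gtop X) (gtop H))
      {(x, h). x \<in> arrows X \<and> h \<in> arrows H \<and> lrho X \<alpha> (ginv X x) = rng H h}"
    by (simp add: lprod_groupoid_def)
  moreover have "{(x, h). x \<in> arrows X \<and> h \<in> arrows H \<and> lrho X \<alpha> (ginv X x) = rng H h} = arrows K"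
    by (auto simp: arrows_lprod lrho_def)
  ultimately show ?thesis by simp
qed

text \<open>The arrows form the set on which two continuous maps into a Hausdorff space agree.
  Closedness gives local compactness of the product groupoid.\<close>

lemma closedin_arrows_lprod: "closedin (prod_topology (gtop X) (gtop H)) (arrows K)"
proof -
  have "closedin (prod_topology (gtop X) (gtop H))
      {p \<in> topspace (prod_topology (gtop X) (gtop H)). lmom \<alpha> (src X (fst p)) = rng H (snd p)}"
    by (intro closedin_continuous_maps_eq[OF H.Hausdorff] continuous_lmom X.continuous_src
        H.continuous_rng continuous_map_fst continuous_map_snd)
      (auto simp: arrows_def[symmetric])
  moreover have "{p \<in> topspace (prod_topology (gtop X) (gtop H)). lmom \<alpha> (src X (fst p)) = rng H (snd p)}
      = arrows K"
    by (auto simp: arrows_lprod) (auto simp: arrows_def)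
  ultimately show ?thesis by simp
qed

lemma continuous_lprod_iff:
  "continuous_map T (gtop K) (\<lambda>p. (f p, g p)) \<longleftrightarrow>
    continuous_map T (gtop X) f \<and> continuous_map T (gtop H) g \<and>
    (\<forall>p\<in>topspace T. (f p, g p) \<in> arrows K)"
  by (auto simp: gtop_lprod continuous_map_in_subtopology continuous_map_pairwise o_def)

lemma continuous_lprod_proj:
  "continuous_map T (gtop K) f \<Longrightarrow> continuous_map T (gtop X) (\<lambda>p. fst (f p))"
  "continuous_map T (gtop K) f \<Longrightarrow> continuous_map T (gtop H) (\<lambda>p. snd (f p))"
  using continuous_lprod_iff[of T "\<lambda>p. fst (f p)" "\<lambda>p. snd (f p)"] by simp_all

text \<open>The axioms are the rules of the action read in coordinates. In \<open>p\<close> times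
  its inverse the second coordinate cancels by \<open>inv_lres\<close>; in the inverse times
  \<open>p\<close> the first coordinate collapses by L4 and the second by
  \<open>lres_lres_inv\<close>.\<close>

lemma topological_groupoid_lprod: "topological_groupoid K"
proof
  have rngK: "rng K p = (rng X (fst p), lmom \<alpha> (rng X (fst p)))" for p
    by (cases p) (simp add: rng_lprod)
  have srcK: "src K p = (ginv H (snd p) \<triangleright>\<^bsub>\<alpha>\<^esub> src X (fst p), src H (snd p))" if "p \<in> arrows K" for p
    using that by (cases p) (simp add: src_lprod)
  have idc: "continuous_map (gtop K) (gtop K) (\<lambda>p. p)" by simp
  have arr: "fst p \<in> arrows X" "snd p \<in> arrows H" "lmom \<alpha> (src X (fst p)) = rng H (snd p)"
    if "p \<in> topspace (gtop K)" for p
    using that by (cases p, simp add: arrows_def[symmetric] arrows_lprod)+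
  note fstc = continuous_lprod_proj(1)[OF idc] and sndc = continuous_lprod_proj(2)[OF idc]
  show "rng K p \<in> units K" if "p \<in> arrows K" for p
    using that by (cases p) (auto simp: rng_lprod units_lprod arrows_lprod)
  then have rng_arr: "rng K p \<in> arrows K" if "p \<in> arrows K" for p
    using that by (cases p) (auto simp: rng_lprod arrows_lprod)
  show "units K \<subseteq> arrows K" by (auto simp: units_lprod arrows_lprod)
  show "rng K u = u" "src K u = u" if "u \<in> units K" for u
    using that by (auto simp: units_lprod rng_lprod src_lprod arrows_lprod)
  show inv_arr: "ginv K p \<in> arrows K" if "p \<in> arrows K" for p
    using that lmom_src_lact[of "ginv H (snd p)" "ginv X (fst p)"]
      L1(3)[of "ginv H (snd p)" "ginv X (fst p)"]
    by (cases p) (simp add: inv_lprod arrows_lprod)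
  show "rng K (ginv K p) = src K p" if "p \<in> arrows K" for p
    using that by (cases p) (simp add: inv_lprod rng_lprod src_lprod arrows_lprod)
  show src_inv: "src K (ginv K p) = rng K p" if "p \<in> arrows K" for p
  proof -
    obtain x h where p: "p = (x, h)" by fastforce
    have h: "ginv H (ginv H h \<triangleleft>\<^bsub>\<alpha>\<^esub> ginv X x) = h \<triangleleft>\<^bsub>\<alpha>\<^esub> (ginv H h \<triangleright>\<^bsub>\<alpha>\<^esub> ginv X x)"
      using that p inv_lres[of "ginv H h" "ginv X x"] by (simp add: arrows_lprod)
    have "ginv H (ginv H h \<triangleleft>\<^bsub>\<alpha>\<^esub> ginv X x) \<triangleright>\<^bsub>\<alpha>\<^esub> (ginv H h \<triangleleft>\<^bsub>\<alpha>\<^esub> ginv X x) \<triangleright>\<^bsub>\<alpha>\<^esub> rng X x = rng X x"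
      using that p inv_lact_lact(1)[of "ginv H h \<triangleleft>\<^bsub>\<alpha>\<^esub> ginv X x" "rng X x"] by (simp add: arrows_lprod)
    then show ?thesis
      using that inv_arr[OF that] p by (simp add: inv_lprod src_lprod rng_lprod) (simp add: arrows_lprod)
  qed
  show "rng K p \<cdot>\<^bsub>K\<^esub> p = p" if "p \<in> arrows K" for p
    using that by (cases p) (simp add: mult_lprod rng_lprod arrows_lprod)
  show "p \<cdot>\<^bsub>K\<^esub> src K p = p" if "p \<in> arrows K" for p
    using that by (cases p) (simp add: mult_lprod src_lprod arrows_lprod)
  show "p \<cdot>\<^bsub>K\<^esub> ginv K p = rng K p" if "p \<in> arrows K" for p
  proof -
    obtain x h where p: "p = (x, h)" by fastforce
    have "h \<triangleleft>\<^bsub>\<alpha>\<^esub> (ginv H h \<triangleright>\<^bsub>\<alpha>\<^esub> ginv X x) = ginv H (ginv H h \<triangleleft>\<^bsub>\<alpha>\<^esub> ginv X x)"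
      using that p inv_lres[of "ginv H h" "ginv X x"] by (simp add: arrows_lprod)
    then show ?thesis
      using that p by (simp add: mult_lprod inv_lprod rng_lprod arrows_lprod)
  qed
  show "ginv K p \<cdot>\<^bsub>K\<^esub> p = src K p" if "p \<in> arrows K" for p
  proof -
    obtain x h where p: "p = (x, h)" by fastforce
    have "(ginv H h \<triangleright>\<^bsub>\<alpha>\<^esub> ginv X x) \<cdot>\<^bsub>X\<^esub> ((ginv H h \<triangleleft>\<^bsub>\<alpha>\<^esub> ginv X x) \<triangleright>\<^bsub>\<alpha>\<^esub> x) = ginv H h \<triangleright>\<^bsub>\<alpha>\<^esub> src X x"
      using that p lact_mult[of "ginv H h" "ginv X x" x] by (simp add: arrows_lprod)
    then show ?thesis
      using that p lres_lres_inv[of "ginv H h" "ginv X x"]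
      by (simp add: mult_lprod inv_lprod src_lprod arrows_lprod)
  qed
  show mult: "p \<cdot>\<^bsub>K\<^esub> q \<in> arrows K" "rng K (p \<cdot>\<^bsub>K\<^esub> q) = rng K p" "src K (p \<cdot>\<^bsub>K\<^esub> q) = src K q"
    if pq: "(p, q) \<in> composable K" for p q
  proof -
    obtain x h y k where p: "p = (x, h)" "q = (y, k)" by fastforce
    have c: "(x, h) \<in> arrows K" "(y, k) \<in> arrows K" "src H h = lmom \<alpha> (rng X y)" "src X x = h \<triangleright>\<^bsub>\<alpha>\<^esub> rng X y"
      using pq composable_lprod[of x h y k] unfolding p by (simp_all add: composable_def)
    then have a: "x \<in> arrows X" "y \<in> arrows X" "h \<in> arrows H" "k \<in> arrows H"
        "lmom \<alpha> (src X y) = rng H k" by (simp_all add: arrows_lprod)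
    show m: "p \<cdot>\<^bsub>K\<^esub> q \<in> arrows K"
      using c a unfolding p by (simp add: mult_lprod arrows_lprod)
    show "rng K (p \<cdot>\<^bsub>K\<^esub> q) = rng K p" using c a unfolding p by (simp add: mult_lprod rng_lprod)
    have "ginv H ((h \<triangleleft>\<^bsub>\<alpha>\<^esub> y) \<cdot>\<^bsub>H\<^esub> k) \<triangleright>\<^bsub>\<alpha>\<^esub> (h \<triangleleft>\<^bsub>\<alpha>\<^esub> y) \<triangleright>\<^bsub>\<alpha>\<^esub> src X y = ginv H k \<triangleright>\<^bsub>\<alpha>\<^esub> src X y"
      using c a by (simp add: H.inv_mult mult_lact)
    then show "src K (p \<cdot>\<^bsub>K\<^esub> q) = src K q"
      using c a m unfolding p by (simp add: mult_lprod src_lprod)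
  qed
  show "(p \<cdot>\<^bsub>K\<^esub> q) \<cdot>\<^bsub>K\<^esub> r = p \<cdot>\<^bsub>K\<^esub> (q \<cdot>\<^bsub>K\<^esub> r)" if pq: "(p, q) \<in> composable K" and qr: "(q, r) \<in> composable K" for p q r
  proof -
    obtain x h y k z l where p: "p = (x, h)" "q = (y, k)" "r = (z, l)" by (metis surj_pair)
    have "src H h = lmom \<alpha> (rng X y)" "src X x = h \<triangleright>\<^bsub>\<alpha>\<^esub> rng X y" "src H k = lmom \<alpha> (rng X z)"
        "src X y = k \<triangleright>\<^bsub>\<alpha>\<^esub> rng X z" "x \<in> arrows X" "y \<in> arrows X" "z \<in> arrows X"
        "h \<in> arrows H" "k \<in> arrows H" "l \<in> arrows H"
        "lmom \<alpha> (src X x) = rng H h" "lmom \<alpha> (src X y) = rng H k" "lmom \<alpha> (src X z) = rng H l"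
      using pq qr composable_lprod[of x h y k] composable_lprod[of y k z l] unfolding p
      by (auto simp: composable_def arrows_lprod)
    then show ?thesis
      unfolding p by (simp add: mult_lprod mult_lact mult_lres X.assoc H.assoc)
  qed
  show "continuous_map (gtop K) (gtop K) (rng K)"
    unfolding rngK continuous_lprod_iff
    by (intro conjI continuous_lmom X.continuous_rng fstc ballI)
      (use arr in \<open>auto simp: rngK[symmetric] arrows_def[symmetric] rng_arr\<close>)
  have srcc: "continuous_map (gtop K) (gtop K) (\<lambda>p. (ginv H (snd p) \<triangleright>\<^bsub>\<alpha>\<^esub> src X (fst p), src H (snd p)))"
    using arr by (auto simp: continuous_lprod_iff arrows_lprod
        intro!: continuous_lact X.continuous_src H.continuous_inv H.continuous_src fstc sndc)
  then show "continuous_map (gtop K) (gtop K) (src K)"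
    by (rule continuous_map_eq) (simp add: srcK arrows_def)
  have "continuous_map (gtop K) (gtop K)
      (\<lambda>p. (ginv H (snd p) \<triangleright>\<^bsub>\<alpha>\<^esub> ginv X (fst p), ginv H (snd p) \<triangleleft>\<^bsub>\<alpha>\<^esub> ginv X (fst p)))"
    using arr by (auto simp: continuous_lprod_iff arrows_lprod
        intro!: continuous_lact continuous_lres X.continuous_inv H.continuous_inv fstc sndc)
  then show "continuous_map (gtop K) (gtop K) (ginv K)"
    by (rule continuous_map_eq) (auto simp: inv_lprod)
  let ?D = "subtopology (prod_topology (gtop K) (gtop K)) (composable K)"
  have D: "fst (fst p) \<in> arrows X" "fst (snd p) \<in> arrows X" "snd (fst p) \<in> arrows H" "snd (snd p) \<in> arrows H"
      "src H (snd (fst p)) = lmom \<alpha> (rng X (fst (snd p)))"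
      "src X (fst (fst p)) = snd (fst p) \<triangleright>\<^bsub>\<alpha>\<^esub> rng X (fst (snd p))"
      "lmom \<alpha> (src X (fst (snd p))) = rng H (snd (snd p))"
    if "p \<in> topspace ?D" for p
    using that composable_lprod[of "fst (fst p)" "snd (fst p)" "fst (snd p)" "snd (snd p)"]
    by (auto simp: composable_def arrows_lprod)
  have f1: "continuous_map ?D (gtop X) (\<lambda>p. fst (fst p))" "continuous_map ?D (gtop H) (\<lambda>p. snd (fst p))"
     "continuous_map ?D (gtop X) (\<lambda>p. fst (snd p))" "continuous_map ?D (gtop H) (\<lambda>p. snd (snd p))"
    using continuous_lprod_proj[OF continuous_map_fst_sub] continuous_lprod_proj[OF continuous_map_snd_sub]
    by blast+
  have "continuous_map ?D (gtop K) (\<lambda>p. (fst (fst p) \<cdot>\<^bsub>X\<^esub> (snd (fst p) \<triangleright>\<^bsub>\<alpha>\<^esub> fst (snd p)),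
      (snd (fst p) \<triangleleft>\<^bsub>\<alpha>\<^esub> fst (snd p)) \<cdot>\<^bsub>H\<^esub> snd (snd p)))"
    unfolding continuous_lprod_iff
    by (intro conjI X.continuous_mult H.continuous_mult continuous_lact continuous_lres f1 ballI)
      (use D in \<open>simp_all add: arrows_lprod\<close>)
  then show "continuous_map ?D (gtop K) (\<lambda>(x, y). x \<cdot>\<^bsub>K\<^esub> y)"
    by (rule continuous_map_eq) (auto simp: mult_lprod)
  show "Hausdorff_space (gtop K)"
    unfolding gtop_lprod by (simp add: Hausdorff_space_subtopology Hausdorff_space_prod_topology
        X.Hausdorff H.Hausdorff)
  show "locally_compact_space (gtop K)"
    unfolding gtop_lprod
    by (intro locally_compact_space_closed_subset closedin_arrows_lprod)
      (simp add: locally_compact_space_prod_topology X.locally_compact H.locally_compact)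
  show "second_countable (gtop K)"
    unfolding gtop_lprod
    by (intro second_countable_subtopology second_countable_prod_topology
        X.second_countable H.second_countable)
qed

end


section \<open>Opposite self-similar actions\<close>

text \<open>Exchanging the arguments alone would not do: \<open>rsigma\<close> is taken at sources,
  so both the acting groupoid and \<open>X\<close> are replaced by their opposites, and then
  \<open>rsigma\<close> becomes \<open>lrho\<close> and R1 to R6 become L1 to L6.\<close>

definition op_right :: "('g, 'x) right_ss \<Rightarrow> ('g, 'x) left_ss"
  where "op_right \<beta> = \<lparr>lmom = rmom \<beta>, lact = (\<lambda>t x. x \<blacktriangleleft>\<^bsub>\<beta>\<^esub> t), lres = (\<lambda>t x. x \<blacktriangleright>\<^bsub>\<beta>\<^esub> t)\<rparr>"

definition op_left :: "('h, 'x) left_ss \<Rightarrow> ('h, 'x) right_ss"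
  where "op_left \<alpha> = \<lparr>rmom = lmom \<alpha>, ract = (\<lambda>x h. h \<triangleright>\<^bsub>\<alpha>\<^esub> x), rres = (\<lambda>x h. h \<triangleleft>\<^bsub>\<alpha>\<^esub> x)\<rparr>"

lemma op_right_simps [simp]:
  "lmom (op_right \<beta>) = rmom \<beta>" "lact (op_right \<beta>) t x = x \<blacktriangleleft>\<^bsub>\<beta>\<^esub> t" "lres (op_right \<beta>) t x = x \<blacktriangleright>\<^bsub>\<beta>\<^esub> t"
  by (simp_all add: op_right_def)

lemma op_left_simps [simp]:
  "rmom (op_left \<alpha>) = lmom \<alpha>" "ract (op_left \<alpha>) x h = h \<triangleright>\<^bsub>\<alpha>\<^esub> x" "rres (op_left \<alpha>) x h = h \<triangleleft>\<^bsub>\<alpha>\<^esub> x"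
  by (simp_all add: op_left_def)

lemma lrho_op [simp]: "lrho (op_groupoid X) (op_right \<beta>) = rsigma X \<beta>"
  and rsigma_op [simp]: "rsigma (op_groupoid X) (op_left \<alpha>) = lrho X \<alpha>"
  by (auto simp: lrho_def rsigma_def)

lemma ldom_op [simp]: "(t, x) \<in> ldom (op_groupoid G) Z m \<longleftrightarrow> (x, t) \<in> rdom G Z m"
  and rdom_op [simp]: "(x, t) \<in> rdom (op_groupoid G) Z m \<longleftrightarrow> (t, x) \<in> ldom G Z m"
  by (auto simp: ldom_def rdom_def)

lemma continuous_map_ldom_op:
  "continuous_map (ldom_top (op_groupoid G) Z m) Y (\<lambda>(t, x). f x t) \<longleftrightarrow>
    continuous_map (rdom_top G Z m) Y (\<lambda>(x, t). f x t)" (is "?l \<longleftrightarrow> ?r")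
proof
  assume l: ?l
  have "continuous_map (rdom_top G Z m) Y (\<lambda>p. f (fst p) (snd p))"
    by (rule continuous_map_apply2[OF l[unfolded ldom_top_def], of _ snd fst])
      (auto simp: rdom_top_def continuous_map_fst_sub continuous_map_snd_sub rdom_def ldom_def)
  then show ?r by (simp add: case_prod_unfold)
next
  assume r: ?r
  have "continuous_map (ldom_top (op_groupoid G) Z m) Y (\<lambda>p. f (snd p) (fst p))"
    by (rule continuous_map_apply2[OF r[unfolded rdom_top_def], of _ snd fst])
      (auto simp: ldom_top_def continuous_map_fst_sub continuous_map_snd_sub rdom_def ldom_def)
  then show ?l by (simp add: case_prod_unfold)
qed

lemma continuous_map_rdom_op:
  "continuous_map (rdom_top (op_groupoid G) Z m) Y (\<lambda>(x, t). f t x) \<longleftrightarrow>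
    continuous_map (ldom_top G Z m) Y (\<lambda>(t, x). f t x)" (is "?l \<longleftrightarrow> ?r")
proof
  assume l: ?l
  have "continuous_map (ldom_top G Z m) Y (\<lambda>p. f (fst p) (snd p))"
    by (rule continuous_map_apply2[OF l[unfolded rdom_top_def], of _ snd fst])
      (auto simp: ldom_top_def continuous_map_fst_sub continuous_map_snd_sub rdom_def ldom_def)
  then show ?r by (simp add: case_prod_unfold)
next
  assume r: ?r
  have "continuous_map (rdom_top (op_groupoid G) Z m) Y (\<lambda>p. f (snd p) (fst p))"
    by (rule continuous_map_apply2[OF r[unfolded ldom_top_def], of _ snd fst])
      (auto simp: rdom_top_def continuous_map_fst_sub continuous_map_snd_sub rdom_def ldom_def)
  then show ?l by (simp add: case_prod_unfold)
qed

lemma (in self_similar_right) op_self_similar_left: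
  "self_similar_left (op_groupoid G) (op_groupoid X) (op_right \<beta>)"
proof (intro self_similar_left.intro G.op_topological_groupoid X.op_topological_groupoid
    self_similar_left_axioms.intro, goal_cases)
  case 3 then show ?case using act_continuous by (simp add: continuous_map_ldom_op)
next
  case 4 then show ?case using res_continuous by (simp add: continuous_map_ldom_op)
qed (use mom_continuous mom_surj in \<open>auto simp: X.op_composable G.op_composable R1 R2 R3 R4 R5 R6
      act_composable\<close>)

lemma (in self_similar_left) op_self_similar_right:
  "self_similar_right (op_groupoid H) (op_groupoid X) (op_left \<alpha>)"
proof (intro self_similar_right.intro H.op_topological_groupoid X.op_topological_groupoid
    self_similar_right_axioms.intro, goal_cases)
  case 3 then show ?case using act_continuous by (simp add: continuous_map_rdom_op)
next
  case 4 then show ?case using res_continuous by (simp add: continuous_map_rdom_op)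
qed (use mom_continuous mom_surj in \<open>auto simp: X.op_composable H.op_composable L1 L2 L3 L4 L5 L6
      act_composable\<close>)


section \<open>Quotients by free and proper right actions\<close>

context self_similar_right
begin

interpretation op: self_similar_left "op_groupoid G" "op_groupoid X" "op_right \<beta>"
  by (rule op_self_similar_left)

lemmas op_simps = op_groupoid_simps op_right_simps X.op_units G.op_units

lemmas rmom_unit [simp] = op.lmom_unit[unfolded op_simps]
lemmas continuous_rmom = op.continuous_lmom[unfolded op_simps]
lemmas continuous_ract = op.continuous_lact[unfolded op_simps]
lemmas ract_arrow [simp] = op.lact_arrow[unfolded op_simps]
lemmas rres_arrow [simp] = op.lres_arrow[unfolded op_simps]
lemmas ract_mult = op.lact_mult[unfolded op_simps]
lemmas mult_ract = op.mult_lact[unfolded op_simps]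
lemmas ract_neutral [simp] = op.lact_neutral[unfolded op_simps]
lemmas src_ract [simp] = op.rng_lact[unfolded op_simps]
lemmas ract_unit [simp] = op.lact_unit[unfolded op_simps]
lemmas rmom_ract_unit [simp] = op.lmom_lact_unit[unfolded op_simps]
lemmas rng_ract [simp] = op.src_lact[unfolded op_simps]
lemmas rng_rres [simp] = op.src_lres[unfolded op_simps]
lemmas inv_ract = op.inv_lact[unfolded op_simps]
lemmas ract_ract_inv [simp] = op.inv_lact_lact[unfolded op_simps]

lemma rdom_act: "(x, t) \<in> rdom G (gtop X) (rsigma X \<beta>) \<longleftrightarrow>
    x \<in> arrows X \<and> t \<in> arrows G \<and> rng G t = rmom \<beta> (src X x)"
  by (auto simp: rdom_iff rsigma_def arrows_def)

end

lemma the_elem_image_eq: "\<lbrakk>x \<in> S; \<And>y. y \<in> S \<Longrightarrow> F y = F x\<rbrakk> \<Longrightarrow> the_elem (F ` S) = F x"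
proof -
  assume "x \<in> S" "\<And>y. y \<in> S \<Longrightarrow> F y = F x"
  then have "F ` S = {F x}" by (metis (no_types, lifting) image_cong image_constant)
  then show "the_elem (F ` S) = F x" by simp
qed

lemma the_elem_eq': "\<lbrakk>c \<in> S; \<And>y. y \<in> S \<Longrightarrow> y = c\<rbrakk> \<Longrightarrow> the_elem S = c"
proof -
  assume "c \<in> S" "\<And>y. y \<in> S \<Longrightarrow> y = c"
  then have "S = {c}" by blast
  then show "the_elem S = c" by simp
qed

locale free_proper_right_action = self_similar_right G X \<beta>
  for G :: "'g groupoid" and X :: "'x groupoid" and \<beta> :: "('g, 'x) right_ss" +
  assumes free: "free_raction G (gtop X) (rsigma X \<beta>) (ract \<beta>)"
    and proper: "proper_raction G (gtop X) (rsigma X \<beta>) (ract \<beta>)"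
    and open_source_acting: "open_source G"
begin

sublocale space: groupoid_right_space G "gtop X" "rsigma X \<beta>" "ract \<beta>"
proof
  show "continuous_map (gtop X) (unit_top G) (rsigma X \<beta>)"
    unfolding G.continuous_unit_top rsigma_def
    by (auto intro!: continuous_rmom X.continuous_src simp: arrows_def[symmetric])
qed (use act_continuous R1(1) R5 R2(2) in \<open>auto simp: arrows_def[symmetric]\<close>)

abbreviation orb ("\<pi>") where "\<pi> \<equiv> gorb G X \<beta>"
abbreviation Q where "Q \<equiv> rquot X G \<beta>"

lemma orb_eq:
  "\<lbrakk>x \<in> arrows X; y \<in> arrows X\<rbrakk> \<Longrightarrow>
    \<pi> x = \<pi> y \<longleftrightarrow> (\<exists>t\<in>arrows G. rng G t = rmom \<beta> (src X x) \<and> x \<blacktriangleleft>\<^bsub>\<beta>\<^esub> t = y)"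
  using space.orbit_eq[of x y] unfolding gorb_def rsigma_def arrows_def[symmetric] by metis

lemma orb_self [simp]: "x \<in> arrows X \<Longrightarrow> x \<in> \<pi> x"
  using space.orbit_self[of x] by (simp add: gorb_def arrows_def)

lemma orb_ract [simp]:
  "\<lbrakk>t \<in> arrows G; x \<in> arrows X; rng G t = rmom \<beta> (src X x)\<rbrakk> \<Longrightarrow> \<pi> (x \<blacktriangleleft>\<^bsub>\<beta>\<^esub> t) = \<pi> x"
  using orb_eq[of x "x \<blacktriangleleft>\<^bsub>\<beta>\<^esub> t"] by auto

lemma in_orbE:
  assumes "y \<in> \<pi> x" "x \<in> arrows X"
  obtains t where "t \<in> arrows G" "rng G t = rmom \<beta> (src X x)" "y = x \<blacktriangleleft>\<^bsub>\<beta>\<^esub> t" "y \<in> arrows X" "\<pi> y = \<pi> x"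
proof -
  obtain t where t: "t \<in> arrows G" "rng G t = rmom \<beta> (src X x)" "y = x \<blacktriangleleft>\<^bsub>\<beta>\<^esub> t"
    using assms unfolding gorb_def rorbit_def rsigma_def by auto
  show thesis by (rule that[OF t]) (use t assms in simp_all)
qed

lemma orb_eqE:
  assumes "\<pi> x = \<pi> y" "x \<in> arrows X" "y \<in> arrows X"
  obtains t where "t \<in> arrows G" "rng G t = rmom \<beta> (src X x)" "y = x \<blacktriangleleft>\<^bsub>\<beta>\<^esub> t"
  using assms orb_eq by metis

text \<open>Freeness speaks of stabilizers. Two arrows with the same effect have the same source,
  namely the momentum of the translate, so \<open>t\<close> times the inverse of \<open>t'\<close>
  is defined and stabilizes \<open>x\<close>.\<close>

lemma ract_cancel:
  assumes "x \<in> arrows X" "t \<in> arrows G" "t' \<in> arrows G"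
    "rng G t = rmom \<beta> (src X x)" "rng G t' = rmom \<beta> (src X x)" "x \<blacktriangleleft>\<^bsub>\<beta>\<^esub> t = x \<blacktriangleleft>\<^bsub>\<beta>\<^esub> t'"
  shows "t = t'"
proof -
  have "src G t = src G t'"
    using assms by (metis X.src_in_units X.unit_simps(2) rmom_ract_unit src_ract)
  moreover from this have "x \<blacktriangleleft>\<^bsub>\<beta>\<^esub> (t \<cdot>\<^bsub>G\<^esub> ginv G t') = x"
    using assms mult_ract[of "ginv G t'" t x] ract_ract_inv(1)[of t' x] by simp
  ultimately have "t \<cdot>\<^bsub>G\<^esub> ginv G t' \<in> units G"
    using free assms unfolding free_raction_def
    by (force simp: rdom_act)
  then have "t \<cdot>\<^bsub>G\<^esub> ginv G t' = rng G t'"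
    using assms(2,3) \<open>src G t = src G t'\<close> G.unit_simps(2)[of "t \<cdot>\<^bsub>G\<^esub> ginv G t'"]
      G.mul_simps(3)[of t "ginv G t'"] by simp
  then show ?thesis
    using assms \<open>src G t = src G t'\<close> G.cancel(4)[of t' t] G.mul_simps(4)[of t'] by simp
qed

definition transporter where
  "transporter x y = (THE t. t \<in> arrows G \<and> rng G t = rmom \<beta> (src X x) \<and> x \<blacktriangleleft>\<^bsub>\<beta>\<^esub> t = y)"

lemma transporter_ract [simp]:
  "\<lbrakk>t \<in> arrows G; x \<in> arrows X; rng G t = rmom \<beta> (src X x)\<rbrakk> \<Longrightarrow> transporter x (x \<blacktriangleleft>\<^bsub>\<beta>\<^esub> t) = t"
  unfolding transporter_def by (rule the_equality) (auto intro: ract_cancel)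

lemma transporter [simp]:
  assumes "\<pi> x = \<pi> y" "x \<in> arrows X" "y \<in> arrows X"
  shows "transporter x y \<in> arrows G" "rng G (transporter x y) = rmom \<beta> (src X x)"
    "x \<blacktriangleleft>\<^bsub>\<beta>\<^esub> transporter x y = y"
  using orb_eqE[OF assms] transporter_ract assms(2) by metis+

text \<open>Freeness makes the map from a point and an arrow to the translate and the point
  injective, properness makes it closed. The pair of \<open>f\<close> and the transporter is the
  factor of the pair of \<open>g\<close> and \<open>f\<close> through this map, hence continuous.
  Every continuous choice of matching representatives below rests on this.\<close>

lemma continuous_transporter:
  assumes f: "continuous_map T (gtop X) f" and g: "continuous_map T (gtop X) g"
    and orb: "\<And>p. p \<in> topspace T \<Longrightarrow> \<pi> (f p) = \<pi> (g p)"
  shows "continuous_map T (gtop G) (\<lambda>p. transporter (f p) (g p))"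
proof -
  have dom: "topspace (rdom_top G (gtop X) (rsigma X \<beta>)) = rdom G (gtop X) (rsigma X \<beta>)"
    by (auto simp: rdom_top_def rdom_def arrows_def)
  have "continuous_map T (rdom_top G (gtop X) (rsigma X \<beta>)) (\<lambda>p. (f p, transporter (f p) (g p)))"
  proof (rule continuous_map_through_closed_injective)
    show "closed_map (rdom_top G (gtop X) (rsigma X \<beta>)) (prod_topology (gtop X) (gtop X))
        (\<lambda>(z, k). (z \<blacktriangleleft>\<^bsub>\<beta>\<^esub> k, z))"
      using proper unfolding proper_raction_def by (rule proper_imp_closed_map)
    show "inj_on (\<lambda>(z, k). (z \<blacktriangleleft>\<^bsub>\<beta>\<^esub> k, z)) (topspace (rdom_top G (gtop X) (rsigma X \<beta>)))"
      unfolding dom by (auto simp: inj_on_def rdom_act intro: ract_cancel)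
    show "continuous_map T (prod_topology (gtop X) (gtop X)) (\<lambda>p. (g p, f p))"
      by (intro continuous_map_pairedI f g)
    show "(f p, transporter (f p) (g p)) \<in> topspace (rdom_top G (gtop X) (rsigma X \<beta>))
        \<and> (case (f p, transporter (f p) (g p)) of (z, k) \<Rightarrow> (z \<blacktriangleleft>\<^bsub>\<beta>\<^esub> k, z)) = (g p, f p)"
      if "p \<in> topspace T" for p
      using that orb X.continuous_arrow[OF f] X.continuous_arrow[OF g] by (simp add: dom rdom_act)
  qed
  then show ?thesis
    by (simp add: rdom_top_def continuous_map_in_subtopology continuous_map_pairwise o_def)
qed

text \<open>The relation is the image of the whole domain under the closed map attached to the
  proper action. Hausdorffness of the orbit space follows from it.\<close>

lemma closedin_orbit_relation:
  "closedin (prod_topology (gtop X) (gtop X))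
    {p \<in> topspace (prod_topology (gtop X) (gtop X)). \<pi> (fst p) = \<pi> (snd p)}"
proof -
  let ?f = "\<lambda>(z, k). (z \<blacktriangleleft>\<^bsub>\<beta>\<^esub> k, z)" and ?D = "rdom_top G (gtop X) (rsigma X \<beta>)"
  have "closedin (prod_topology (gtop X) (gtop X)) (?f ` topspace ?D)"
    using proper closedin_topspace unfolding proper_raction_def proper_map_def closed_map_def by blast
  moreover have "?f ` topspace ?D
      = {p \<in> topspace (prod_topology (gtop X) (gtop X)). \<pi> (fst p) = \<pi> (snd p)}"
  proof -
    have dom: "topspace ?D = rdom G (gtop X) (rsigma X \<beta>)"
      by (auto simp: rdom_top_def rdom_def arrows_def)
    have "(x, y) \<in> ?f ` rdom G (gtop X) (rsigma X \<beta>)" if "x \<in> arrows X" "y \<in> arrows X" "\<pi> x = \<pi> y" for x y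
      by (rule image_eqI[of _ _ "(y, transporter y x)"]) (use that in \<open>simp_all add: rdom_act\<close>)
    then show ?thesis unfolding dom by (auto simp: rdom_act arrows_def[symmetric])
  qed
  ultimately show ?thesis by simp
qed

lemma gtop_quot: "gtop Q = quotient_topology (gtop X) \<pi>"
  by (simp add: rquot_def orbit_groupoid_def)

lemma open_quotient_orb: "open_quotient (gtop X) (gtop Q) \<pi>"
  using space.orbit_open_quotient[OF open_source_acting] by (simp add: gtop_quot gorb_def)

lemma arrows_quot: "arrows Q = \<pi> ` arrows X"
  by (simp add: arrows_def gtop_quot topspace_quotient_topology)

lemma orb_arrow [simp]: "x \<in> arrows X \<Longrightarrow> \<pi> x \<in> arrows Q"
  by (simp add: arrows_quot)

lemma continuous_orb: "continuous_map T (gtop X) f \<Longrightarrow> continuous_map T (gtop Q) (\<lambda>p. \<pi> (f p))"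
  using continuous_map_compose[of T "gtop X" f "gtop Q" \<pi>] open_quotient_orb
  by (simp add: open_quotient_def o_def)

lemma rng_quot [simp]:
  assumes "x \<in> arrows X"
  shows "rng Q (\<pi> x) = \<pi> (rng X x)"
proof -
  have "the_elem ((\<lambda>x. \<pi> (rng X x)) ` \<pi> x) = \<pi> (rng X x)"
  proof (rule the_elem_image_eq)
    fix y assume "y \<in> \<pi> x"
    then obtain t where "t \<in> arrows G" "rng G t = rmom \<beta> (src X x)" "y = x \<blacktriangleleft>\<^bsub>\<beta>\<^esub> t"
      using assms by (rule in_orbE)
    then show "\<pi> (rng X y) = \<pi> (rng X x)" using assms by (simp)
  qed (use assms in simp)
  then show ?thesis by (simp add: rquot_def orbit_groupoid_def)
qed

lemma src_quot [simp]:
  assumes "x \<in> arrows X"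
  shows "src Q (\<pi> x) = \<pi> (src X x)"
proof -
  have "the_elem ((\<lambda>x. \<pi> (src X x)) ` \<pi> x) = \<pi> (src X x)"
  proof (rule the_elem_image_eq)
    fix y assume "y \<in> \<pi> x"
    then obtain t where "t \<in> arrows G" "rng G t = rmom \<beta> (src X x)" "y = x \<blacktriangleleft>\<^bsub>\<beta>\<^esub> t"
      using assms by (rule in_orbE)
    then show "\<pi> (src X y) = \<pi> (src X x)" using assms by (simp)
  qed (use assms in simp)
  then show ?thesis by (simp add: rquot_def orbit_groupoid_def)
qed

lemma inv_quot [simp]:
  assumes "x \<in> arrows X"
  shows "ginv Q (\<pi> x) = \<pi> (ginv X x)"
proof -
  have "the_elem ((\<lambda>x. \<pi> (ginv X x)) ` \<pi> x) = \<pi> (ginv X x)"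
  proof (rule the_elem_image_eq)
    fix y assume "y \<in> \<pi> x"
    then obtain t where "t \<in> arrows G" "rng G t = rmom \<beta> (src X x)" "y = x \<blacktriangleleft>\<^bsub>\<beta>\<^esub> t"
      using assms by (rule in_orbE)
    then show "\<pi> (ginv X y) = \<pi> (ginv X x)" using assms by (simp add: inv_ract)
  qed (use assms in simp)
  then show ?thesis by (simp add: rquot_def orbit_groupoid_def)
qed

text \<open>Two composable pairs over the same orbits are related by a single arrow
  \<open>t\<close>: it moves the right factor, hence its range, and freeness at that unit forces the
  left factor to be moved by \<open>y \<blacktriangleright> t\<close>. By R4 the products are then
  related by \<open>t\<close> as well.\<close>

lemma composable_representatives:
  assumes "x \<in> arrows X" "y \<in> arrows X" "src X x = rng X y" "x' \<in> \<pi> x" "y' \<in> \<pi> y" "src X x' = rng X y'"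
  obtains t where "t \<in> arrows G" "rng G t = rmom \<beta> (src X y)" "x' = x \<blacktriangleleft>\<^bsub>\<beta>\<^esub> (y \<blacktriangleright>\<^bsub>\<beta>\<^esub> t)" "y' = y \<blacktriangleleft>\<^bsub>\<beta>\<^esub> t"
proof -
  obtain s where s: "s \<in> arrows G" "rng G s = rmom \<beta> (src X x)" "x' = x \<blacktriangleleft>\<^bsub>\<beta>\<^esub> s"
    using assms(1,4) by (auto elim: in_orbE)
  obtain t where t: "t \<in> arrows G" "rng G t = rmom \<beta> (src X y)" "y' = y \<blacktriangleleft>\<^bsub>\<beta>\<^esub> t"
    using assms(2,5) by (auto elim: in_orbE)
  \<comment> \<open>Both arrows move the unit \<open>rng X y\<close> to the unit at which the new
    pair is composed.\<close>
  have "rng X y \<blacktriangleleft>\<^bsub>\<beta>\<^esub> s = rng X y \<blacktriangleleft>\<^bsub>\<beta>\<^esub> (y \<blacktriangleright>\<^bsub>\<beta>\<^esub> t)" using assms s t by simp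
  then have "s = y \<blacktriangleright>\<^bsub>\<beta>\<^esub> t" by (rule ract_cancel[of "rng X y", rotated 5]) (use assms s t in simp_all)
  then show thesis using that s t by blast
qed

lemma mult_quot [simp]:
  assumes "x \<in> arrows X" "y \<in> arrows X" "src X x = rng X y"
  shows "\<pi> x \<cdot>\<^bsub>Q\<^esub> \<pi> y = \<pi> (x \<cdot>\<^bsub>X\<^esub> y)"
proof -
  have "\<pi> (x' \<cdot>\<^bsub>X\<^esub> y') = \<pi> (x \<cdot>\<^bsub>X\<^esub> y)" if xy: "x' \<in> \<pi> x" "y' \<in> \<pi> y" "src X x' = rng X y'" for x' y'
  proof -
    obtain t where t: "t \<in> arrows G" "rng G t = rmom \<beta> (src X y)" "x' = x \<blacktriangleleft>\<^bsub>\<beta>\<^esub> (y \<blacktriangleright>\<^bsub>\<beta>\<^esub> t)" "y' = y \<blacktriangleleft>\<^bsub>\<beta>\<^esub> t"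
      using composable_representatives[OF assms xy] .
    then show ?thesis using assms ract_mult[of t y x] orb_ract[of t "x \<cdot>\<^bsub>X\<^esub> y"] by simp
  qed
  then have "the_elem {\<pi> (x' \<cdot>\<^bsub>X\<^esub> y') |x' y'. x' \<in> \<pi> x \<and> y' \<in> \<pi> y \<and> src X x' = rng X y'} = \<pi> (x \<cdot>\<^bsub>X\<^esub> y)"
    using orb_self[OF assms(1)] orb_self[OF assms(2)] assms(3) by (intro the_elem_eq') blast+
  then show ?thesis by (simp add: rquot_def orbit_groupoid_def)
qed

lemma orb_unitD: "\<lbrakk>x \<in> arrows X; \<pi> x \<in> \<pi> ` units X\<rbrakk> \<Longrightarrow> x \<in> units X"
proof -
  assume x: "x \<in> arrows X" and "\<pi> x \<in> \<pi> ` units X"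
  then obtain u where u: "u \<in> units X" "\<pi> u = \<pi> x" by (metis imageE)
  then obtain t where "t \<in> arrows G" "rng G t = rmom \<beta> (src X u)" "x = u \<blacktriangleleft>\<^bsub>\<beta>\<^esub> t"
    using x by (metis X.unit_arrow orb_eqE)
  then show "x \<in> units X" using u(1) by simp
qed

lemma units_quot: "units Q = \<pi> ` units X"
proof -
  have "src Q ` \<pi> ` arrows X = (\<lambda>x. \<pi> (src X x)) ` arrows X"
    unfolding image_image by (rule image_cong) simp_all
  then show ?thesis unfolding units_def arrows_quot image_image .
qed

text \<open>An arrow of \<open>G\<close> acts on the source of \<open>y\<close> as it acts on
  \<open>y\<close>, so the transporter between the sources takes any representative to the
  prescribed source.\<close>

lemma lift_src:
  assumes "\<xi> \<in> arrows Q" "v \<in> units X" "src Q \<xi> = \<pi> v"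
  obtains x where "x \<in> arrows X" "\<pi> x = \<xi>" "src X x = v"
proof -
  obtain y where y: "y \<in> arrows X" "\<xi> = \<pi> y" using assms by (auto simp: arrows_quot)
  then have e: "\<pi> (src X y) = \<pi> v" using assms by simp
  show thesis
    by (rule that[of "y \<blacktriangleleft>\<^bsub>\<beta>\<^esub> transporter (src X y) v"]) (use y e assms in simp_all)
qed

text \<open>The arrow of \<open>G\<close> relating \<open>x\<close> and \<open>y\<close> fixes their
  common source and is neutral by freeness. With \<open>lift_src\<close> this gives unique matching
  representatives, and it makes the definite description in \<open>para_lact\<close>
  meaningful.\<close>

lemma orb_src_unique:
  assumes "x \<in> arrows X" "y \<in> arrows X" "\<pi> x = \<pi> y" "src X x = src X y"
  shows "x = y"
proof -
  obtain t where t: "t \<in> arrows G" "rng G t = rmom \<beta> (src X x)" "y = x \<blacktriangleleft>\<^bsub>\<beta>\<^esub> t"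
    using orb_eqE[OF assms(3,1,2)] .
  have e: "src X x \<blacktriangleleft>\<^bsub>\<beta>\<^esub> t = src X x" using src_ract[OF t(1) assms(1) t(2)] assms(4) t(3) by metis
  have "t = rmom \<beta> (src X x)"
    by (rule ract_cancel[of "src X x"]) (use e assms(1) t in simp_all)
  then show ?thesis using t(3) assms(1) by simp
qed

lemma topological_groupoid_quot: "topological_groupoid Q"
proof
  have qcont: "continuous_map (gtop Q) (gtop Q) F"
    if "continuous_map (gtop X) (gtop X) f" "\<And>x. x \<in> arrows X \<Longrightarrow> F (\<pi> x) = \<pi> (f x)" for f F
    by (rule open_quotient_continuous[OF open_quotient_orb], rule continuous_map_eq[OF continuous_orb[OF that(1)]])
      (simp add: that(2) arrows_def)
  show "continuous_map (gtop Q) (gtop Q) (rng Q)" by (rule qcont[OF X.rng_continuous]) simp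
  show "continuous_map (gtop Q) (gtop Q) (src Q)" by (rule qcont[OF X.src_continuous]) simp
  show "continuous_map (gtop Q) (gtop Q) (ginv Q)" by (rule qcont[OF X.inv_continuous]) simp
  show "continuous_map (subtopology (prod_topology (gtop Q) (gtop Q)) (composable Q)) (gtop Q) (\<lambda>(x, y). x \<cdot>\<^bsub>Q\<^esub> y)"
  proof (rule open_quotient_lift2[OF open_quotient_orb open_quotient_orb])
    let ?D = "subtopology (prod_topology (gtop X) (gtop X)) {p. (\<pi> (fst p), \<pi> (snd p)) \<in> composable Q}"
    have D: "fst p \<in> arrows X" "snd p \<in> arrows X" "\<pi> (src X (fst p)) = \<pi> (rng X (snd p))"
      if "p \<in> topspace ?D" for p
      using that by (auto simp: composable_def) (auto simp: arrows_def)
    \<comment> \<open>The left representative is moved so that its source becomes the range of the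
      right one; the move is continuous because the transporter is.\<close>
    have "continuous_map ?D (gtop Q)
        (\<lambda>p. \<pi> ((fst p \<blacktriangleleft>\<^bsub>\<beta>\<^esub> transporter (src X (fst p)) (rng X (snd p))) \<cdot>\<^bsub>X\<^esub> snd p))"
      by (intro continuous_orb X.continuous_mult continuous_ract continuous_transporter
          X.continuous_src X.continuous_rng continuous_map_fst_sub continuous_map_snd_sub)
        (use D in simp_all)
    then show "continuous_map ?D (gtop Q) (\<lambda>p. case (\<pi> (fst p), \<pi> (snd p)) of (x, y) \<Rightarrow> x \<cdot>\<^bsub>Q\<^esub> y)"
    proof (rule continuous_map_eq)
      fix p assume p: "p \<in> topspace ?D"
      let ?x = "fst p \<blacktriangleleft>\<^bsub>\<beta>\<^esub> transporter (src X (fst p)) (rng X (snd p))"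
      have "?x \<in> arrows X" "\<pi> ?x = \<pi> (fst p)" "src X ?x = rng X (snd p)"
        using D[OF p] by simp_all
      then show "\<pi> (?x \<cdot>\<^bsub>X\<^esub> snd p) = (case (\<pi> (fst p), \<pi> (snd p)) of (x, y) \<Rightarrow> x \<cdot>\<^bsub>Q\<^esub> y)"
        using D[OF p] mult_quot[of ?x "snd p"] by simp
    qed
  qed
  show "Hausdorff_space (gtop Q)"
    using open_quotient_Hausdorff[OF open_quotient_orb closedin_orbit_relation] .
  show "locally_compact_space (gtop Q)"
    using locally_compact_space_continuous_open_map_image[of "gtop X" "gtop Q" \<pi>]
      X.locally_compact open_quotient_orb unfolding open_quotient_def by blast
  show "second_countable (gtop Q)"
    using second_countable_open_map_image[of "gtop X" "gtop Q" \<pi>]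
      X.second_countable open_quotient_orb unfolding open_quotient_def by blast
  show "rng Q u = u" "src Q u = u" if "u \<in> units Q" for u
    using that by (auto simp: units_quot)
  show "units Q \<subseteq> arrows Q" by (auto simp: units_quot)
  fix \<xi> assume xi: "\<xi> \<in> arrows Q"
  then obtain x where x: "x \<in> arrows X" "\<xi> = \<pi> x" by (auto simp: arrows_quot)
  show "rng Q \<xi> \<in> units Q" "rng Q \<xi> \<cdot>\<^bsub>Q\<^esub> \<xi> = \<xi>" "\<xi> \<cdot>\<^bsub>Q\<^esub> src Q \<xi> = \<xi>" "ginv Q \<xi> \<in> arrows Q"
    "rng Q (ginv Q \<xi>) = src Q \<xi>" "src Q (ginv Q \<xi>) = rng Q \<xi>"
    "\<xi> \<cdot>\<^bsub>Q\<^esub> ginv Q \<xi> = rng Q \<xi>" "ginv Q \<xi> \<cdot>\<^bsub>Q\<^esub> \<xi> = src Q \<xi>"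
    using x by (simp_all add: units_quot)
next
  fix \<xi> \<eta> assume "(\<xi>, \<eta>) \<in> composable Q"
  then obtain y where y: "y \<in> arrows X" "\<eta> = \<pi> y" "src Q \<xi> = \<pi> (rng X y)" "\<xi> \<in> arrows Q"
    by (auto simp: composable_def arrows_quot)
  then obtain x where x: "x \<in> arrows X" "\<pi> x = \<xi>" "src X x = rng X y"
    using lift_src[of \<xi> "rng X y"] by auto
  then show "\<xi> \<cdot>\<^bsub>Q\<^esub> \<eta> \<in> arrows Q" "rng Q (\<xi> \<cdot>\<^bsub>Q\<^esub> \<eta>) = rng Q \<xi>" "src Q (\<xi> \<cdot>\<^bsub>Q\<^esub> \<eta>) = src Q \<eta>"
    using y by (auto simp: x(2)[symmetric])
  fix \<zeta> assume "(\<eta>, \<zeta>) \<in> composable Q"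
  then obtain z where z: "z \<in> arrows X" "\<zeta> = \<pi> z" "src Q \<eta> = \<pi> (rng X z)" "\<eta> \<in> arrows Q"
    by (auto simp: composable_def arrows_quot)
  \<comment> \<open>Associativity needs one chain of representatives, so new ones are lifted from
    right to left, starting from \<open>z\<close>.\<close>
  then obtain y' where y': "y' \<in> arrows X" "\<pi> y' = \<eta>" "src X y' = rng X z"
    using lift_src[of \<eta> "rng X z"] by auto
  have "src Q \<xi> = \<pi> (rng X y')" using y y' rng_quot by metis
  then obtain x' where x': "x' \<in> arrows X" "\<pi> x' = \<xi>" "src X x' = rng X y'"
    using lift_src[of \<xi> "rng X y'"] y y' by auto
  show "\<xi> \<cdot>\<^bsub>Q\<^esub> \<eta> \<cdot>\<^bsub>Q\<^esub> \<zeta> = \<xi> \<cdot>\<^bsub>Q\<^esub> (\<eta> \<cdot>\<^bsub>Q\<^esub> \<zeta>)"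
    using x' y' z by (simp add: x'(2)[symmetric] y'(2)[symmetric] X.assoc)
qed

end


section \<open>Banach bundles\<close>

text \<open>Fibres of quotient and product bundles are copies of fibres of the original bundle;
  their Banach space axioms, completeness included, arrive along a linear isometric
  bijection.\<close>

lemma complex_banach_transport:
  assumes V: "complex_banach V" and \<phi>: "bij_betw \<phi> (carr V) (carr W)"
    and zero: "\<phi> (vzero V) = vzero W"
    and add: "\<And>x y. \<lbrakk>x \<in> carr V; y \<in> carr V\<rbrakk> \<Longrightarrow> \<phi> (vadd V x y) = vadd W (\<phi> x) (\<phi> y)"
    and smul: "\<And>c x. x \<in> carr V \<Longrightarrow> \<phi> (vsmul V c x) = vsmul W c (\<phi> x)"
    and norm: "\<And>x. x \<in> carr V \<Longrightarrow> vnorm W (\<phi> x) = vnorm V x"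
  shows "complex_banach W"
proof -
  interpret V: complex_banach V by (rule V)
  have im: "\<exists>x. x \<in> carr V \<and> y = \<phi> x" if "y \<in> carr W" for y
    using \<phi> that unfolding bij_betw_def by blast
  have cl: "\<phi> x \<in> carr W" if "x \<in> carr V" for x using \<phi> that unfolding bij_betw_def by blast
  have inj: "\<phi> x = \<phi> y \<longleftrightarrow> x = y" if "x \<in> carr V" "y \<in> carr V" for x y
    using \<phi> that unfolding bij_betw_def inj_on_def by blast
  note pull = add[symmetric] smul[symmetric] zero[symmetric] norm inj cl
    V.add_closed V.smul_closed V.zero_closed
  show ?thesis
  proof
    show "vzero W \<in> carr W" by (simp add: pull)
    show "vadd W x y \<in> carr W" "vadd W x y = vadd W y x" "vnorm W (vadd W x y) \<le> vnorm W x + vnorm W y"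
      "vsmul W c (vadd W x y) = vadd W (vsmul W c x) (vsmul W c y)"
      if "x \<in> carr W" "y \<in> carr W" for x y c
      using im[OF that(1)] im[OF that(2)]
      by (auto simp: pull V.add_commute V.norm_triangle V.smul_add_right)
    show "vadd W (vadd W x y) z = vadd W x (vadd W y z)"
      if "x \<in> carr W" "y \<in> carr W" "z \<in> carr W" for x y z
      using im[OF that(1)] im[OF that(2)] im[OF that(3)] by (auto simp: pull V.add_assoc)
    show "vsmul W c x \<in> carr W" "vadd W x (vzero W) = x" "vsmul W 1 x = x" "0 \<le> vnorm W x"
      "vnorm W x = 0 \<longleftrightarrow> x = vzero W" "vnorm W (vsmul W c x) = cmod c * vnorm W x"
      "vsmul W (c + d) x = vadd W (vsmul W c x) (vsmul W d x)"
      "vsmul W c (vsmul W d x) = vsmul W (c * d) x"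
      if "x \<in> carr W" for x c d
      using im[OF that]
      by (auto simp: pull V.add_zero V.smul_one V.norm_nonneg V.norm_eq_zero V.norm_smul
          V.smul_add_left V.smul_smul)
    show "\<exists>y\<in>carr W. vadd W x y = vzero W" if x: "x \<in> carr W" for x
    proof -
      obtain a where a: "a \<in> carr V" "x = \<phi> a" using im[OF x] by blast
      obtain b where b: "b \<in> carr V" "vadd V a b = vzero V" using V.add_inverse[OF a(1)] by blast
      show ?thesis by (rule bexI[of _ "\<phi> b"]) (use a b in \<open>simp_all add: pull\<close>)
    qed
  next
    fix f :: "nat \<Rightarrow> _"
    assume f: "range f \<subseteq> carr W"
      and cauchy: "\<And>e. e > 0 \<Longrightarrow> \<exists>N. \<forall>m\<ge>N. \<forall>n\<ge>N. vnorm W (vdiff W (f m) (f n)) < e"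
    define g where "g n = inv_into (carr V) \<phi> (f n)" for n
    have g: "g n \<in> carr V" "\<phi> (g n) = f n" for n
      using \<phi> f unfolding g_def bij_betw_def
      by (metis inv_into_into rangeI subsetD, metis f_inv_into_f rangeI subsetD)
    have diff: "vnorm W (vdiff W (\<phi> a) (\<phi> b)) = vnorm V (vdiff V a b)"
      if "a \<in> carr V" "b \<in> carr V" for a b
      using that by (simp add: vdiff_def pull)
    have "\<exists>N. \<forall>m\<ge>N. \<forall>n\<ge>N. vnorm V (vdiff V (g m) (g n)) < e" if "e > 0" for e
      using cauchy[OF that] g diff by metis
    then obtain l where l: "l \<in> carr V" "(\<lambda>n. vnorm V (vdiff V (g n) l)) \<longlonglongrightarrow> 0"
      using V.complete[of g] g(1) by blast
    have "(\<lambda>n. vnorm W (vdiff W (f n) (\<phi> l))) = (\<lambda>n. vnorm V (vdiff V (g n) l))"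
      by (simp add: g(2)[symmetric] diff g(1) l(1))
    then show "\<exists>l\<in>carr W. (\<lambda>n. vnorm W (vdiff W (f n) l)) \<longlonglongrightarrow> 0"
      using l cl by metis
  qed
qed

text \<open>A linear isometric bijection carries spans to spans and preserves distances. Saturation
  of the derived bundles and fullness of the inner products are inherited in this way.\<close>

lemma closed_span_transport:
  assumes V: "complex_banach V" and \<phi>: "bij_betw \<phi> (carr V) (carr W)"
    and zero: "\<phi> (vzero V) = vzero W"
    and add: "\<And>x y. \<lbrakk>x \<in> carr V; y \<in> carr V\<rbrakk> \<Longrightarrow> \<phi> (vadd V x y) = vadd W (\<phi> x) (\<phi> y)"
    and smul: "\<And>c x. x \<in> carr V \<Longrightarrow> \<phi> (vsmul V c x) = vsmul W c (\<phi> x)"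
    and norm: "\<And>x. x \<in> carr V \<Longrightarrow> vnorm W (\<phi> x) = vnorm V x"
    and S: "S \<subseteq> carr V"
  shows "closed_span W (\<phi> ` S) = \<phi> ` closed_span V S"
proof -
  interpret V: complex_banach V by (rule V)
  have sub: "x \<in> carr V" if "x \<in> lin_span V S" for x
    using that by induction (use S V.add_closed V.smul_closed V.zero_closed in auto)
  have 1: "\<phi> x \<in> lin_span W (\<phi> ` S)" if "x \<in> lin_span V S" for x
    using that
    by induction (auto simp: zero add smul sub intro: lin_span.intros
        simp: lin_span.zero[of W "\<phi> ` S", folded zero])
  have 2: "y \<in> \<phi> ` lin_span V S" if "y \<in> lin_span W (\<phi> ` S)" for y
    using that
  proof induction
    case zero then show ?case using lin_span.zero[of V S] assms(3) by (metis imageI)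
  next
    case (base x) then show ?case by (auto intro: lin_span.base)
  next
    case (add x y)
    then obtain a b where "x = \<phi> a" "y = \<phi> b" "a \<in> lin_span V S" "b \<in> lin_span V S" by blast
    then show ?case using lin_span.add[of a V S b] assms(4)[of a b] sub by (metis imageI)
  next
    case (smul x c)
    then obtain a where "x = \<phi> a" "a \<in> lin_span V S" by blast
    then show ?case using lin_span.smul[of a V S c] assms(5)[of a c] sub by (metis imageI)
  qed
  have span: "lin_span W (\<phi> ` S) = \<phi> ` lin_span V S" using 1 2 by blast
  have diff: "vnorm W (vdiff W (\<phi> a) (\<phi> b)) = vnorm V (vdiff V a b)"
    if "a \<in> carr V" "b \<in> carr V" for a b
    using that by (simp add: vdiff_def add[symmetric] smul[symmetric] norm V.add_closed V.smul_closed)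
  have carrW: "carr W = \<phi> ` carr V" using \<phi> unfolding bij_betw_def by blast
  show ?thesis
    unfolding closed_span_def span carrW by (auto simp: diff sub)
qed

lemma fibre_space_simps [simp]:
  "carr (fibre_space E x) = fibre E x" "vadd (fibre_space E x) = badd E"
  "vzero (fibre_space E x) = bzero E x" "vsmul (fibre_space E x) = bsmul E"
  "vnorm (fibre_space E x) = bnorm E"
  by (simp_all add: fibre_space_def)

lemma fibre_alg_simps [simp]:
  "carr (fibre_alg E x) = fibre E x" "vadd (fibre_alg E x) = badd E"
  "vzero (fibre_alg E x) = bzero E x" "vsmul (fibre_alg E x) = bsmul E"
  "vnorm (fibre_alg E x) = bnorm E" "amult (fibre_alg E x) = bmult E" "astar (fibre_alg E x) = bstar E"
  by (simp_all add: fibre_alg_def)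

lemma in_fibre: "b \<in> fibre E x \<longleftrightarrow> b \<in> points E \<and> proj E b = x"
  by (simp add: fibre_def)

context usc_banach_bundle
begin

lemma proj_point [simp]: "b \<in> points E \<Longrightarrow> proj E b \<in> topspace T"
  using proj_surj by blast

lemma badd_point [simp]:
  "\<lbrakk>a \<in> points E; b \<in> points E; proj E a = proj E b\<rbrakk> \<Longrightarrow> badd E a b \<in> points E"
  "\<lbrakk>a \<in> points E; b \<in> points E; proj E a = proj E b\<rbrakk> \<Longrightarrow> proj E (badd E a b) = proj E b"
  using complex_banach.add_closed[OF fibre_banach[OF proj_point[of b]], of a b] by (simp_all add: in_fibre)

lemma bsmul_point [simp]:
  "a \<in> points E \<Longrightarrow> bsmul E k a \<in> points E" "a \<in> points E \<Longrightarrow> proj E (bsmul E k a) = proj E a"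
  using complex_banach.smul_closed[OF fibre_banach[OF proj_point[of a]], of a k] by (simp_all add: in_fibre)

lemma bzero_point [simp]:
  "x \<in> topspace T \<Longrightarrow> bzero E x \<in> points E" "x \<in> topspace T \<Longrightarrow> proj E (bzero E x) = x"
  using complex_banach.zero_closed[OF fibre_banach] by (simp_all add: in_fibre)

lemma bnorm_nonneg [simp]: "a \<in> points E \<Longrightarrow> 0 \<le> bnorm E a"
  using complex_banach.norm_nonneg[OF fibre_banach[OF proj_point[of a]], of a] by (simp add: in_fibre)

lemma bnorm_eq_zero: "a \<in> points E \<Longrightarrow> bnorm E a = 0 \<longleftrightarrow> a = bzero E (proj E a)"
  using complex_banach.norm_eq_zero[OF fibre_banach[OF proj_point[of a]], of a] by (simp add: in_fibre)

lemma bnorm_zero [simp]: "x \<in> topspace T \<Longrightarrow> bnorm E (bzero E x) = 0"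
  by (simp add: bnorm_eq_zero)

lemma bnorm_smul: "a \<in> points E \<Longrightarrow> bnorm E (bsmul E k a) = cmod k * bnorm E a"
  using complex_banach.norm_smul[OF fibre_banach[OF proj_point[of a]], of a] by (simp add: in_fibre)

lemma bsmul_zero: "a \<in> points E \<Longrightarrow> bsmul E 0 a = bzero E (proj E a)"
  using bnorm_eq_zero[of "bsmul E 0 a"] by (simp add: bnorm_smul)

lemma continuous_proj: "continuous_map T' (btop E) f \<Longrightarrow> continuous_map T' T (\<lambda>p. proj E (f p))"
  using continuous_map_compose[OF _ proj_continuous, of T' f] by (simp add: o_def)

lemma continuous_badd:
  "\<lbrakk>continuous_map T' (btop E) f; continuous_map T' (btop E) g;
    \<And>p. p \<in> topspace T' \<Longrightarrow> proj E (f p) = proj E (g p)\<rbrakk>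
   \<Longrightarrow> continuous_map T' (btop E) (\<lambda>p. badd E (f p) (g p))"
  by (rule continuous_map_apply2[OF add_continuous]) auto

lemma continuous_point: "\<lbrakk>continuous_map T' (btop E) f; p \<in> topspace T'\<rbrakk> \<Longrightarrow> f p \<in> points E"
  by (auto simp: points_def continuous_map_def)

text \<open>
  Apply \<open>zero_limit\<close> to the filter generated by the sets of points over neighbourhoods of \<open>x\<close> with
  small norm.
\<close>

lemma zero_neighbourhood:
  assumes x: "x \<in> topspace T" and U: "openin (btop E) U" "bzero E x \<in> U"
  obtains V e where "openin T V" "x \<in> V" "e > 0"
    "\<And>b. \<lbrakk>b \<in> points E; proj E b \<in> V; bnorm E b < e\<rbrakk> \<Longrightarrow> b \<in> U"
proof -
  let ?F1 = "inf (principal (points E)) (filtercomap (proj E) (nhdsin T x))"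
  let ?F = "inf ?F1 (filtercomap (bnorm E) (nhds 0))"
  have "limitin T (proj E) x ?F"
    unfolding limitin_def
  proof (intro conjI allI impI x)
    fix V assume "openin T V \<and> x \<in> V"
    then have "eventually (\<lambda>y. y \<in> V) (nhdsin T x)"
      using x by (auto simp: eventually_nhdsin)
    then have "eventually (\<lambda>b. proj E b \<in> V) (filtercomap (proj E) (nhdsin T x))"
      by (rule eventually_filtercomapI)
    then show "eventually (\<lambda>b. proj E b \<in> V) ?F"
      by (rule filter_leD[rotated]) (meson inf.cobounded1 inf.cobounded2 order_trans)
  qed
  moreover have "(bnorm E \<longlongrightarrow> 0) ?F"
    by (simp add: filterlim_iff_le_filtercomap)
  moreover have "?F \<le> principal (points E)" by (simp add: inf.coboundedI1)
  ultimately have "limitin (btop E) (\<lambda>b. b) (bzero E x) ?F" using zero_limit[OF x] by blast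
  then have "eventually (\<lambda>b. b \<in> U) ?F" using U unfolding limitin_def by blast
  then obtain P Q' where P: "eventually P ?F1" "eventually Q' (filtercomap (bnorm E) (nhds 0))"
      "\<And>b. P b \<Longrightarrow> Q' b \<Longrightarrow> b \<in> U"
    unfolding eventually_inf by blast
  obtain P1 P2 where P12: "eventually P1 (principal (points E))"
      "eventually P2 (filtercomap (proj E) (nhdsin T x))" "\<And>b. P1 b \<Longrightarrow> P2 b \<Longrightarrow> P b"
    using P(1) unfolding eventually_inf by blast
  obtain R where R: "eventually R (nhdsin T x)" "\<And>b. R (proj E b) \<Longrightarrow> P2 b"
    using P12(2) unfolding eventually_filtercomap by blast
  then obtain V where V: "openin T V" "x \<in> V" "\<And>y. y \<in> V \<Longrightarrow> R y"
    using x unfolding eventually_nhdsin by blast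
  obtain N where N: "eventually N (nhds 0)" "\<And>b. N (bnorm E b) \<Longrightarrow> Q' b"
    using P(2) unfolding eventually_filtercomap by blast
  then obtain e where e: "e > 0" "\<And>r. dist r 0 < e \<Longrightarrow> N r"
    unfolding eventually_nhds_metric by blast
  show thesis
  proof (rule that[OF V(1,2) e(1)])
    fix b assume "b \<in> points E" "proj E b \<in> V" "bnorm E b < e"
    then show "b \<in> U"
      using P(3) P12(1,3) R(2) V(3) N(2) e(2) by (simp add: eventually_principal dist_real_def)
  qed
qed

end

text \<open>Converse of \<open>zero_neighbourhood\<close>. Between the two, the axiom about filters
  is exchanged for a statement about open sets, which passes through quotient maps, products and
  homeomorphisms.\<close>

lemma zero_limit_of_neighbourhoods:
  assumes x: "x \<in> topspace T" and F: "F \<le> principal (points E)"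
    and lim: "limitin T (proj E) x F" "(bnorm E \<longlongrightarrow> 0) F" and zero: "bzero E x \<in> points E"
    and nbhd: "\<And>U. \<lbrakk>openin (btop E) U; bzero E x \<in> U\<rbrakk> \<Longrightarrow>
      \<exists>V e. openin T V \<and> x \<in> V \<and> e > 0 \<and> (\<forall>b. b \<in> points E \<and> proj E b \<in> V \<and> bnorm E b < e \<longrightarrow> b \<in> U)"
  shows "limitin (btop E) (\<lambda>b. b) (bzero E x) F"
  unfolding limitin_def
proof (intro conjI allI impI)
  show "bzero E x \<in> topspace (btop E)" using zero by (simp add: points_def)
  fix U assume "openin (btop E) U \<and> bzero E x \<in> U"
  then obtain V e where V: "openin T V" "x \<in> V" "e > 0"
      "\<And>b. \<lbrakk>b \<in> points E; proj E b \<in> V; bnorm E b < e\<rbrakk> \<Longrightarrow> b \<in> U"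
    using nbhd by metis
  have "eventually (\<lambda>b. b \<in> points E) F"
    using F by (meson eventually_principal filter_leD)
  moreover have "eventually (\<lambda>b. proj E b \<in> V) F" using lim(1) V unfolding limitin_def by blast
  moreover have "eventually (\<lambda>b. bnorm E b < e) F" using order_tendstoD(2)[OF lim(2) V(3)] .
  ultimately show "eventually (\<lambda>b. b \<in> U) F" by eventually_elim (use V in blast)
qed


section \<open>Fell bundles\<close>

context fell_bundle
begin

lemma proj_arrow [simp]: "b \<in> points E \<Longrightarrow> proj E b \<in> arrows X"
  by (simp add: arrows_def)

lemma bcomposable_iff:
  "(a, b) \<in> bcomposable X E \<longleftrightarrow> a \<in> points E \<and> b \<in> points E \<and> src X (proj E a) = rng X (proj E b)"
  by (auto simp: bcomposable_def X.composable_iff)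

lemma bmult_point [simp]:
  assumes "a \<in> points E" "b \<in> points E" "src X (proj E a) = rng X (proj E b)"
  shows "a \<odot>\<^bsub>E\<^esub> b \<in> points E" "proj E (a \<odot>\<^bsub>E\<^esub> b) = proj E a \<cdot>\<^bsub>X\<^esub> proj E b"
proof -
  have "(a, b) \<in> topspace (subtopology (prod_topology (btop E) (btop E)) (bcomposable X E))"
    using assms by (simp add: bcomposable_iff points_def)
  then show "a \<odot>\<^bsub>E\<^esub> b \<in> points E"
    using continuous_map_image_subset_topspace[OF mult_continuous] unfolding points_def by force
qed (simp add: assms proj_mult bcomposable_iff)

lemma bstar_point [simp]:
  "b \<in> points E \<Longrightarrow> bstar E b \<in> points E" "b \<in> points E \<Longrightarrow> proj E (bstar E b) = ginv X (proj E b)"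
  using continuous_map_image_subset_topspace[OF star_continuous]
  by (auto simp: points_def proj_star)

lemma bstar_bstar [simp]: "b \<in> points E \<Longrightarrow> bstar E (bstar E b) = b"
  by (rule star_star)

lemma bnorm_bstar [simp]: "b \<in> points E \<Longrightarrow> bnorm E (bstar E b) = bnorm E b"
  using norm_star[of b] by simp

lemma bmult_assoc:
  "\<lbrakk>a \<in> points E; b \<in> points E; c \<in> points E; src X (proj E a) = rng X (proj E b);
    src X (proj E b) = rng X (proj E c)\<rbrakk> \<Longrightarrow> (a \<odot>\<^bsub>E\<^esub> b) \<odot>\<^bsub>E\<^esub> c = a \<odot>\<^bsub>E\<^esub> (b \<odot>\<^bsub>E\<^esub> c)"
  by (simp add: mult_assoc bcomposable_iff)

lemma bstar_bmult:
  "\<lbrakk>a \<in> points E; b \<in> points E; src X (proj E a) = rng X (proj E b)\<rbrakk>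
    \<Longrightarrow> bstar E (a \<odot>\<^bsub>E\<^esub> b) = bstar E b \<odot>\<^bsub>E\<^esub> bstar E a"
  by (simp add: star_mult bcomposable_iff)

lemma bmult_badd:
  "\<lbrakk>a \<in> points E; b \<in> points E; c \<in> points E; src X (proj E a) = rng X (proj E b); proj E c = proj E b\<rbrakk>
    \<Longrightarrow> a \<odot>\<^bsub>E\<^esub> badd E b c = badd E (a \<odot>\<^bsub>E\<^esub> b) (a \<odot>\<^bsub>E\<^esub> c)"
  "\<lbrakk>a \<in> points E; b \<in> points E; c \<in> points E; src X (proj E a) = rng X (proj E b); proj E c = proj E a\<rbrakk>
    \<Longrightarrow> badd E a c \<odot>\<^bsub>E\<^esub> b = badd E (a \<odot>\<^bsub>E\<^esub> b) (c \<odot>\<^bsub>E\<^esub> b)"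
  by (simp_all add: mult_add_left mult_add_right bcomposable_iff in_fibre)

lemma bmult_bsmul:
  "\<lbrakk>a \<in> points E; b \<in> points E; src X (proj E a) = rng X (proj E b)\<rbrakk>
    \<Longrightarrow> bsmul E k a \<odot>\<^bsub>E\<^esub> b = bsmul E k (a \<odot>\<^bsub>E\<^esub> b)"
  "\<lbrakk>a \<in> points E; b \<in> points E; src X (proj E a) = rng X (proj E b)\<rbrakk>
    \<Longrightarrow> a \<odot>\<^bsub>E\<^esub> bsmul E k b = bsmul E k (a \<odot>\<^bsub>E\<^esub> b)"
  by (simp_all add: mult_smul bcomposable_iff)

lemma bnorm_bmult:
  "\<lbrakk>a \<in> points E; b \<in> points E; src X (proj E a) = rng X (proj E b)\<rbrakk>
    \<Longrightarrow> bnorm E (a \<odot>\<^bsub>E\<^esub> b) \<le> bnorm E a * bnorm E b"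
  by (simp add: norm_mult bcomposable_iff)

lemma bstar_badd:
  "\<lbrakk>a \<in> points E; b \<in> points E; proj E b = proj E a\<rbrakk>
    \<Longrightarrow> bstar E (badd E a b) = badd E (bstar E a) (bstar E b)"
  by (simp add: star_add in_fibre)

lemma star_mult_positive':
  assumes "b \<in> points E"
  obtains c where "c \<in> points E" "proj E c = src X (proj E b)" "bstar E b \<odot>\<^bsub>E\<^esub> b = bstar E c \<odot>\<^bsub>E\<^esub> c"
  using star_mult_positive[OF assms] by (auto simp: cstar_positive_def in_fibre)

lemma continuous_bmult:
  assumes "continuous_map T (btop E) f" "continuous_map T (btop E) g"
    and "\<And>p. p \<in> topspace T \<Longrightarrow> src X (proj E (f p)) = rng X (proj E (g p))"
  shows "continuous_map T (btop E) (\<lambda>p. f p \<odot>\<^bsub>E\<^esub> g p)"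
  by (rule continuous_map_apply2[OF mult_continuous assms(1,2)])
    (use assms continuous_point in \<open>auto simp: bcomposable_iff\<close>)

lemma continuous_bstar: "continuous_map T (btop E) f \<Longrightarrow> continuous_map T (btop E) (\<lambda>p. bstar E (f p))"
  using continuous_map_compose[OF _ star_continuous, of T f] by (simp add: o_def)

lemma saturatedD:
  assumes "saturated X E" "x \<in> arrows X" "y \<in> arrows X" "src X x = rng X y"
  shows "closed_span (fibre_space E (x \<cdot>\<^bsub>X\<^esub> y)) {a \<odot>\<^bsub>E\<^esub> b |a b. a \<in> fibre E x \<and> b \<in> fibre E y} = fibre E (x \<cdot>\<^bsub>X\<^esub> y)"
  using assms(1)[unfolded saturated_def, THEN bspec, of "(x, y)"] assms(2-4) by (simp add: X.composable_iff)

text \<open>A unit is idempotent and its own inverse, so the fibre over it is closed under product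
  and adjoint.\<close>

lemma cstar_algebra_unit_fibre:
  assumes "u \<in> units X"
  shows "cstar_algebra (fibre_alg E u)"
proof -
  have "complex_banach (fibre_alg E u)"
    by (rule complex_banach_transport[of "fibre_space E u" "\<lambda>x. x"])
      (use assms fibre_banach[of u] X.unit_arrow[of u] in \<open>auto simp: arrows_def bij_betw_def\<close>)
  moreover have "cstar_algebra_axioms (fibre_alg E u)"
    using assms X.mul_simps(4)[of u]
    by unfold_locales
      (simp_all add: in_fibre bmult_assoc bmult_badd bmult_bsmul bnorm_bmult bstar_badd star_smul
        bstar_bmult norm_star_mult)
  ultimately show ?thesis by (simp add: cstar_algebra_def)
qed

end

text \<open>Used with identity maps for the opposite bundle, and with the exchange of coordinates
  for right product bundles. Axioms about the adjoint of an element times the element turn into ones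
  about the element times its adjoint, so in \<open>E\<close> they are applied to adjoints.\<close>

lemma (in fell_bundle) anti_isomorphic_bundle:
  fixes L :: "'l groupoid" and C :: "('c, 'l) fell_bundle"
  assumes L: "topological_groupoid L" and f: "homeomorphic_maps (gtop X) (gtop L) f g"
    and rngL: "\<And>y. y \<in> arrows L \<Longrightarrow> rng L y = f (src X (g y))"
    and srcL: "\<And>y. y \<in> arrows L \<Longrightarrow> src L y = f (rng X (g y))"
    and multL: "\<And>y z. \<lbrakk>y \<in> arrows L; z \<in> arrows L; src L y = rng L z\<rbrakk> \<Longrightarrow> y \<cdot>\<^bsub>L\<^esub> z = f (g z \<cdot>\<^bsub>X\<^esub> g y)"
    and invL: "\<And>y. y \<in> arrows L \<Longrightarrow> ginv L y = f (ginv X (g y))"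
    and \<phi>: "homeomorphic_maps (btop E) (btop C) \<phi> \<psi>"
    and projC: "\<And>c. c \<in> points C \<Longrightarrow> proj C c = f (proj E (\<psi> c))"
    and addC: "\<And>c d. \<lbrakk>c \<in> points C; d \<in> points C; proj C c = proj C d\<rbrakk>
      \<Longrightarrow> badd C c d = \<phi> (badd E (\<psi> c) (\<psi> d))"
    and zeroC: "\<And>y. y \<in> arrows L \<Longrightarrow> bzero C y = \<phi> (bzero E (g y))"
    and smulC: "\<And>k c. c \<in> points C \<Longrightarrow> bsmul C k c = \<phi> (bsmul E k (\<psi> c))"
    and normC: "\<And>c. c \<in> points C \<Longrightarrow> bnorm C c = bnorm E (\<psi> c)"
    and multC: "\<And>c d. \<lbrakk>c \<in> points C; d \<in> points C; src L (proj C c) = rng L (proj C d)\<rbrakk>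
      \<Longrightarrow> c \<odot>\<^bsub>C\<^esub> d = \<phi> (\<psi> d \<odot>\<^bsub>E\<^esub> \<psi> c)"
    and starC: "\<And>c. c \<in> points C \<Longrightarrow> bstar C c = \<phi> (bstar E (\<psi> c))"
  shows "fell_bundle L C" and "saturated X E \<Longrightarrow> saturated L C"
proof -
  interpret L: topological_groupoid L by (rule L)
  have fc: "continuous_map (gtop X) (gtop L) f" and gc: "continuous_map (gtop L) (gtop X) g"
    and gf [simp]: "\<And>x. x \<in> arrows X \<Longrightarrow> g (f x) = x"
    and fg [simp]: "\<And>y. y \<in> arrows L \<Longrightarrow> f (g y) = y"
    using f unfolding homeomorphic_maps_def arrows_def by auto
  have fa [simp]: "\<And>x. x \<in> arrows X \<Longrightarrow> f x \<in> arrows L"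
    and ga [simp]: "\<And>y. y \<in> arrows L \<Longrightarrow> g y \<in> arrows X"
    using fc gc unfolding arrows_def continuous_map_def by auto
  have \<phi>c: "continuous_map (btop E) (btop C) \<phi>" and \<psi>c: "continuous_map (btop C) (btop E) \<psi>"
    and \<psi>\<phi> [simp]: "\<And>b. b \<in> points E \<Longrightarrow> \<psi> (\<phi> b) = b"
    and \<phi>\<psi> [simp]: "\<And>c. c \<in> points C \<Longrightarrow> \<phi> (\<psi> c) = c"
    using \<phi> unfolding homeomorphic_maps_def points_def by auto
  have \<phi>a [simp]: "\<And>b. b \<in> points E \<Longrightarrow> \<phi> b \<in> points C"
    and \<psi>a [simp]: "\<And>c. c \<in> points C \<Longrightarrow> \<psi> c \<in> points E"
    using \<phi>c \<psi>c unfolding points_def continuous_map_def by auto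
  have comp: "src X (g z) = rng X (g y) \<longleftrightarrow> src L y = rng L z" if "y \<in> arrows L" "z \<in> arrows L" for y z
    using that by (metis gf rngL srcL ga X.rng_arrow X.src_arrow)
  have proj\<phi> [simp]: "proj C (\<phi> b) = f (proj E b)" if "b \<in> points E" for b
    using that by (simp add: projC)
  have proj\<psi>: "proj E (\<psi> c) = g (proj C c)" if "c \<in> points C" for c
    using that by (simp add: projC)
  have pa [simp]: "proj C c \<in> arrows L" if "c \<in> points C" for c using that by (simp add: projC)
  have bcomp: "src X (proj E (\<psi> d)) = rng X (proj E (\<psi> c))"
    if "c \<in> points C" "d \<in> points C" "src L (proj C c) = rng L (proj C d)" for c d
    using that comp[of "proj C c" "proj C d"] by (simp add: proj\<psi>)
  have bcompC: "(c, d) \<in> bcomposable L C \<longleftrightarrow> c \<in> points C \<and> d \<in> points C \<and> src L (proj C c) = rng L (proj C d)"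
    for c d by (auto simp: bcomposable_def L.composable_iff)
  have fib: "bij_betw \<phi> (fibre E (g y)) (fibre C y)" if "y \<in> arrows L" for y
    by (rule bij_betw_byWitness[of _ \<psi>]) (use that in \<open>auto simp: in_fibre proj\<psi>\<close>)
  have homeo: "homeomorphic_map (btop E) (btop C) \<phi>" "homeomorphic_map (gtop X) (gtop L) f"
    "homeomorphic_map (btop C) (btop E) \<psi>"
    using \<phi> f homeomorphic_maps_map homeomorphic_maps_sym by blast+
  have fibC: "proj E (\<psi> c) = proj E (\<psi> d)" if "c \<in> points C" "d \<in> points C" "proj C c = proj C d" for c d
    using that by (simp add: proj\<psi>)
  note sims = in_fibre bcompC projC addC zeroC smulC normC multC starC bcomp fibC
    bmult_assoc bmult_badd bmult_bsmul bnorm_bmult bstar_badd star_smul bstar_bmult norm_star_mult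
  show "fell_bundle L C"
  proof (intro fell_bundle.intro usc_banach_bundle.intro fell_bundle_axioms.intro L)
    have "continuous_map (btop C) (gtop L) (\<lambda>c. f (proj E (\<psi> c)))"
      using continuous_map_compose[OF continuous_proj[OF \<psi>c] fc] by (simp add: o_def)
    then show "continuous_map (btop C) (gtop L) (proj C)"
      by (rule continuous_map_eq) (simp add: projC points_def)
    have "open_map (btop C) (gtop L) (f \<circ> proj E \<circ> \<psi>)"
      by (intro open_map_compose[of _ "btop E"] open_map_compose[OF _ homeomorphic_imp_open_map[OF homeo(2)]]
          homeomorphic_imp_open_map[OF homeo(3)] proj_open)
    then show "open_map (btop C) (gtop L) (proj C)"
      by (rule open_map_eq) (simp add: projC points_def)
    show "proj C ` points C = topspace (gtop L)"
    proof
      show "proj C ` points C \<subseteq> topspace (gtop L)" using pa by (auto simp: arrows_def)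
      show "topspace (gtop L) \<subseteq> proj C ` points C"
      proof
        fix y assume "y \<in> topspace (gtop L)"
        then have y: "y \<in> arrows L" by (simp add: arrows_def)
        then have "y = proj C (\<phi> (bzero E (g y)))" using ga[OF y] by (simp add: arrows_def)
        then show "y \<in> proj C ` points C" using ga[OF y] by (metis \<phi>a bzero_point(1) arrows_def imageI)
      qed
    qed
    show "complex_banach (fibre_space C y)" if "y \<in> topspace (gtop L)" for y
      by (rule complex_banach_transport[OF fibre_banach[of "g y"], of \<phi>])
        (use that ga[of y] fib[of y] in \<open>auto simp: arrows_def sims\<close>)
    have "openin (btop C) {c \<in> topspace (btop C). \<psi> c \<in> {b \<in> points E. bnorm E b < r}}" for r
      by (rule openin_continuous_map_preimage[OF \<psi>c norm_usc])
    moreover have "{c \<in> topspace (btop C). \<psi> c \<in> {b \<in> points E. bnorm E b < r}} = {c \<in> points C. bnorm C c < r}"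
      for r by (auto simp: normC points_def[symmetric])
    ultimately show "openin (btop C) {c \<in> points C. bnorm C c < r}" for r by simp
    show "continuous_map (subtopology (prod_topology (btop C) (btop C)) {(a, b). proj C a = proj C b}) (btop C)
        (\<lambda>(a, b). badd C a b)" (is "continuous_map ?D _ _")
    proof -
      have "continuous_map ?D (btop E) (\<lambda>p. badd E (\<psi> (fst p)) (\<psi> (snd p)))"
        by (intro continuous_badd continuous_map_compose[OF continuous_map_fst_sub \<psi>c, unfolded o_def]
            continuous_map_compose[OF continuous_map_snd_sub \<psi>c, unfolded o_def])
          (auto simp: proj\<psi> points_def)
      from continuous_map_compose[OF this \<phi>c] show ?thesis
        by (rule continuous_map_eq) (auto simp: addC points_def)
    qed
    show "continuous_map (subtopology (prod_topology (btop C) (btop C)) (bcomposable L C)) (btop C)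
        (\<lambda>(a, b). a \<odot>\<^bsub>C\<^esub> b)" (is "continuous_map ?D _ _")
    proof -
      have "continuous_map ?D (btop E) (\<lambda>p. \<psi> (snd p) \<odot>\<^bsub>E\<^esub> \<psi> (fst p))"
        by (intro continuous_bmult continuous_map_compose[OF continuous_map_fst_sub \<psi>c, unfolded o_def]
            continuous_map_compose[OF continuous_map_snd_sub \<psi>c, unfolded o_def])
          (auto simp: bcomp bcompC)
      from continuous_map_compose[OF this \<phi>c] show ?thesis
        by (rule continuous_map_eq) (auto simp: multC bcompC)
    qed
    show "continuous_map (btop C) (btop C) (bsmul C k)" for k
      by (rule continuous_map_eq[OF continuous_map_compose[OF
            continuous_map_compose[OF \<psi>c smul_continuous] \<phi>c]])
        (simp add: smulC points_def)
    show "continuous_map (btop C) (btop C) (bstar C)"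
      by (rule continuous_map_eq[OF continuous_map_compose[OF continuous_bstar[OF \<psi>c] \<phi>c]])
        (simp add: starC points_def)
    show "limitin (btop C) (\<lambda>b. b) (bzero C x) F"
      if x: "x \<in> topspace (gtop L)" and F: "F \<le> principal (points C)"
        and lim: "limitin (gtop L) (proj C) x F" "(bnorm C \<longlongrightarrow> 0) F" for x F
    proof (rule zero_limit_of_neighbourhoods[OF x F lim])
      have xa: "x \<in> arrows L" using x by (simp add: arrows_def)
      have gx: "g x \<in> topspace (gtop X)" using ga[OF xa] by (simp add: arrows_def)
      show "bzero C x \<in> points C" using gx by (simp add: zeroC[OF xa])
      fix U assume U: "openin (btop C) U" "bzero C x \<in> U"
      have "openin (btop E) {b \<in> topspace (btop E). \<phi> b \<in> U}"
        by (rule openin_continuous_map_preimage[OF \<phi>c U(1)])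
      moreover have "bzero E (g x) \<in> {b \<in> topspace (btop E). \<phi> b \<in> U}"
        using U(2) gx bzero_point(1)[OF gx] by (simp add: zeroC[OF xa] points_def)
      ultimately obtain V e where V: "openin (gtop X) V" "g x \<in> V" "e > 0"
          "\<And>b. \<lbrakk>b \<in> points E; proj E b \<in> V; bnorm E b < e\<rbrakk> \<Longrightarrow> b \<in> {b \<in> topspace (btop E). \<phi> b \<in> U}"
        by (rule zero_neighbourhood[OF gx]) (rule that)
      show "\<exists>V e. openin (gtop L) V \<and> x \<in> V \<and> e > 0 \<and>
          (\<forall>b. b \<in> points C \<and> proj C b \<in> V \<and> bnorm C b < e \<longrightarrow> b \<in> U)"
      proof (intro exI conjI allI impI)
        show "openin (gtop L) {y \<in> topspace (gtop L). g y \<in> V}"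
          by (rule openin_continuous_map_preimage[OF gc V(1)])
        show "x \<in> {y \<in> topspace (gtop L). g y \<in> V}" using x V by simp
        show "e > 0" by fact
        fix c assume c: "c \<in> points C \<and> proj C c \<in> {y \<in> topspace (gtop L). g y \<in> V} \<and> bnorm C c < e"
        have "\<psi> c \<in> {b \<in> topspace (btop E). \<phi> b \<in> U}"
          by (rule V(4)) (use c normC[of c] proj\<psi>[of c] in auto)
        then show "c \<in> U" using c by simp
      qed
    qed
    show "cstar_positive (fibre_alg C (src L (proj C c))) (bstar C c \<odot>\<^bsub>C\<^esub> c)" if c: "c \<in> points C" for c
    proof -
      \<comment> \<open>The reversed product turns the adjoint of \<open>c\<close> times
        \<open>c\<close> into an element of \<open>E\<close> times its adjoint; positivity is
        therefore invoked for the adjoint of the preimage.\<close>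
      obtain d where d: "d \<in> points E" "proj E d = src X (proj E (bstar E (\<psi> c)))"
          "bstar E (bstar E (\<psi> c)) \<odot>\<^bsub>E\<^esub> bstar E (\<psi> c) = bstar E d \<odot>\<^bsub>E\<^esub> d"
        using star_mult_positive'[of "bstar E (\<psi> c)"] c by auto
      have pd: "proj E d \<in> units X" "ginv X (proj E d) = proj E d" using d c by auto
      show ?thesis
        unfolding cstar_positive_def
      proof (rule bexI)
        \<comment> \<open>In the reversed product the factorization by \<open>d\<close> becomes a
          factorization by the adjoint of \<open>d\<close>.\<close>
        show "\<phi> (bstar E d) \<in> carr (fibre_alg C (src L (proj C c)))"
          using c d pd by (simp add: in_fibre srcL proj\<psi>)
        show "bstar C c \<odot>\<^bsub>C\<^esub> c = amult (fibre_alg C (src L (proj C c)))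
            (astar (fibre_alg C (src L (proj C c))) (\<phi> (bstar E d))) (\<phi> (bstar E d))"
        proof -
          have "bstar C c \<odot>\<^bsub>C\<^esub> c = \<phi> (\<psi> c \<odot>\<^bsub>E\<^esub> bstar E (\<psi> c))"
            using c multC[of "bstar C c" c] by (simp add: starC srcL rngL proj\<psi>)
          moreover have "bstar C (\<phi> (bstar E d)) = \<phi> d"
            using d(1) starC[of "\<phi> (bstar E d)"] by simp
          moreover have "\<phi> d \<odot>\<^bsub>C\<^esub> \<phi> (bstar E d) = \<phi> (bstar E d \<odot>\<^bsub>E\<^esub> d)"
            using d(1) pd multC[of "\<phi> d" "\<phi> (bstar E d)"] by (simp add: srcL rngL)
          ultimately show ?thesis using c d(3) by simp
        qed
      qed
    qed
    show "proj C (bstar C c) = ginv L (proj C c)" if "c \<in> points C" for c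
      using that by (simp add: starC invL proj\<psi>)
    show "proj C (c \<odot>\<^bsub>C\<^esub> d) = proj C c \<cdot>\<^bsub>L\<^esub> proj C d" if "(c, d) \<in> bcomposable L C" for c d
    proof -
      have cd: "c \<in> points C" "d \<in> points C" "src L (proj C c) = rng L (proj C d)"
        using that by (simp_all add: bcompC)
      have "proj C (c \<odot>\<^bsub>C\<^esub> d) = f (proj E (\<psi> d) \<cdot>\<^bsub>X\<^esub> proj E (\<psi> c))"
        using cd bcomp[OF cd] by (simp add: multC)
      then show ?thesis using cd multL[of "proj C c" "proj C d"] by (simp add: proj\<psi>)
    qed
    show "(a \<odot>\<^bsub>C\<^esub> b) \<odot>\<^bsub>C\<^esub> c = a \<odot>\<^bsub>C\<^esub> (b \<odot>\<^bsub>C\<^esub> c)" if ab: "(a, b) \<in> bcomposable L C" and bc: "(b, c) \<in> bcomposable L C"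
      for a b c
    proof -
      have abc: "a \<in> points C" "b \<in> points C" "c \<in> points C"
        "src L (proj C a) = rng L (proj C b)" "src L (proj C b) = rng L (proj C c)"
        using ab bc by (simp_all add: bcompC)
      note q = bcomp[OF abc(1,2,4)] bcomp[OF abc(2,3,5)]
      have m: "a \<odot>\<^bsub>C\<^esub> b = \<phi> (\<psi> b \<odot>\<^bsub>E\<^esub> \<psi> a)" "b \<odot>\<^bsub>C\<^esub> c = \<phi> (\<psi> c \<odot>\<^bsub>E\<^esub> \<psi> b)"
        using abc by (simp_all add: multC)
      have "proj C (a \<odot>\<^bsub>C\<^esub> b) = proj C a \<cdot>\<^bsub>L\<^esub> proj C b" "proj C (b \<odot>\<^bsub>C\<^esub> c) = proj C b \<cdot>\<^bsub>L\<^esub> proj C c"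
        using abc q multL[of "proj C a" "proj C b"] multL[of "proj C b" "proj C c"]
        by (simp_all add: m proj\<psi>)
      then have "src L (proj C (a \<odot>\<^bsub>C\<^esub> b)) = rng L (proj C c)" "src L (proj C a) = rng L (proj C (b \<odot>\<^bsub>C\<^esub> c))"
        using abc by simp_all
      then have "(a \<odot>\<^bsub>C\<^esub> b) \<odot>\<^bsub>C\<^esub> c = \<phi> (\<psi> c \<odot>\<^bsub>E\<^esub> (\<psi> b \<odot>\<^bsub>E\<^esub> \<psi> a))" "a \<odot>\<^bsub>C\<^esub> (b \<odot>\<^bsub>C\<^esub> c) = \<phi> ((\<psi> c \<odot>\<^bsub>E\<^esub> \<psi> b) \<odot>\<^bsub>E\<^esub> \<psi> a)"
        using abc q multC[of "a \<odot>\<^bsub>C\<^esub> b" c] multC[of a "b \<odot>\<^bsub>C\<^esub> c"] by (simp_all add: m)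
      then show ?thesis using abc q by (simp add: bmult_assoc)
    qed
    show "badd C a b \<odot>\<^bsub>C\<^esub> c = badd C (a \<odot>\<^bsub>C\<^esub> c) (b \<odot>\<^bsub>C\<^esub> c)"
      if "(a, c) \<in> bcomposable L C" "b \<in> fibre C (proj C a)" for a b c
    proof -
      have s: "a \<in> points C" "b \<in> points C" "c \<in> points C" "proj C b = proj C a"
        "src L (proj C a) = rng L (proj C c)" using that by (auto simp: bcompC in_fibre)
      have p: "proj E (\<psi> b) = proj E (\<psi> a)" "proj C (badd C a b) = proj C a"
        using s by (simp_all add: proj\<psi> addC)
      have q: "src X (proj E (\<psi> c)) = rng X (proj E (\<psi> a))" using bcomp s by blast
      show ?thesis
        using s p q by (simp add: multC addC bmult_badd)
    qed
    show "a \<odot>\<^bsub>C\<^esub> badd C b c = badd C (a \<odot>\<^bsub>C\<^esub> b) (a \<odot>\<^bsub>C\<^esub> c)"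
      if "(a, b) \<in> bcomposable L C" "c \<in> fibre C (proj C b)" for a b c
    proof -
      have s: "a \<in> points C" "b \<in> points C" "c \<in> points C" "proj C c = proj C b"
        "src L (proj C a) = rng L (proj C b)" using that by (auto simp: bcompC in_fibre)
      have p: "proj E (\<psi> c) = proj E (\<psi> b)" "proj C (badd C b c) = proj C b"
        using s by (simp_all add: proj\<psi> addC)
      have q: "src X (proj E (\<psi> b)) = rng X (proj E (\<psi> a))" using bcomp s by blast
      show ?thesis
        using s p q by (simp add: multC addC bmult_badd)
    qed
    show "bsmul C k c \<odot>\<^bsub>C\<^esub> d = bsmul C k (c \<odot>\<^bsub>C\<^esub> d)" "c \<odot>\<^bsub>C\<^esub> bsmul C k d = bsmul C k (c \<odot>\<^bsub>C\<^esub> d)"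
      "bnorm C (c \<odot>\<^bsub>C\<^esub> d) \<le> bnorm C c * bnorm C d" "bstar C (c \<odot>\<^bsub>C\<^esub> d) = bstar C d \<odot>\<^bsub>C\<^esub> bstar C c"
      if "(c, d) \<in> bcomposable L C" for c d k
    proof -
      have cd: "c \<in> points C" "d \<in> points C" "src L (proj C c) = rng L (proj C d)"
        using that by (simp_all add: bcompC)
      note q = bcomp[OF cd]
      have p: "proj C (bsmul C k c) = proj C c" "proj C (bsmul C k d) = proj C d"
        using cd by (simp_all add: smulC proj\<psi>)
      then show "bsmul C k c \<odot>\<^bsub>C\<^esub> d = bsmul C k (c \<odot>\<^bsub>C\<^esub> d)" "c \<odot>\<^bsub>C\<^esub> bsmul C k d = bsmul C k (c \<odot>\<^bsub>C\<^esub> d)"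
        using cd q multC[of "bsmul C k c" d] multC[of c "bsmul C k d"]
        by (simp_all add: multC smulC bmult_bsmul)
      show "bnorm C (c \<odot>\<^bsub>C\<^esub> d) \<le> bnorm C c * bnorm C d"
        using cd q bnorm_bmult[of "\<psi> d" "\<psi> c"] by (simp add: multC normC mult.commute)
      have "proj C (bstar C c) = ginv L (proj C c)" "proj C (bstar C d) = ginv L (proj C d)"
        using cd by (simp_all add: starC invL proj\<psi>)
      then have "bstar C d \<odot>\<^bsub>C\<^esub> bstar C c = \<phi> (bstar E (\<psi> c) \<odot>\<^bsub>E\<^esub> bstar E (\<psi> d))"
        using cd multC[of "bstar C d" "bstar C c"] by (simp add: starC)
      then show "bstar C (c \<odot>\<^bsub>C\<^esub> d) = bstar C d \<odot>\<^bsub>C\<^esub> bstar C c"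
        using cd q by (simp add: multC starC bstar_bmult)
    qed
    fix c assume c: "c \<in> points C"
    have pc: "proj C (bstar C c) = ginv L (proj C c)"
      using c by (simp add: starC invL proj\<psi>)
    show "bstar C (badd C c d) = badd C (bstar C c) (bstar C d)" if "d \<in> fibre C (proj C c)" for d
    proof -
      have d: "d \<in> points C" "proj C d = proj C c" using that by (simp_all add: in_fibre)
      then have "proj E (\<psi> d) = proj E (\<psi> c)" "proj C (bstar C d) = ginv L (proj C d)"
        using c by (simp_all add: starC invL proj\<psi>)
      then show ?thesis
        using c d pc addC[of c d] addC[of "bstar C c" "bstar C d"] by (simp add: starC bstar_badd)
    qed
    show "bstar C (bsmul C k c) = bsmul C (cnj k) (bstar C c)" for k
      using c by (simp add: starC smulC star_smul)
    show "bstar C (bstar C c) = c" "(bnorm C c)\<^sup>2 = (bnorm C (bstar C c))\<^sup>2"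
      using c by (simp_all add: starC normC)
    have "bstar C c \<odot>\<^bsub>C\<^esub> c = \<phi> (\<psi> c \<odot>\<^bsub>E\<^esub> bstar E (\<psi> c))"
      using c pc multC[of "bstar C c" c] by (simp add: starC)
    then show "bnorm C (bstar C c \<odot>\<^bsub>C\<^esub> c) = (bnorm C c)\<^sup>2"
      using c norm_star_mult[of "bstar E (\<psi> c)"] by (simp add: normC)
  qed
  show "saturated L C" if "saturated X E"
    unfolding saturated_def
  proof (intro ballI, clarify)
    fix y z assume "(y, z) \<in> composable L"
    then have yz: "y \<in> arrows L" "z \<in> arrows L" "src L y = rng L z" by (auto simp: L.composable_iff)
    let ?x = "g z \<cdot>\<^bsub>X\<^esub> g y" and ?S = "{a \<odot>\<^bsub>E\<^esub> b |a b. a \<in> fibre E (g z) \<and> b \<in> fibre E (g y)}"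
    have c: "src X (g z) = rng X (g y)" using comp yz by blast
    then have gyz: "g (y \<cdot>\<^bsub>L\<^esub> z) = ?x" using yz by (simp add: multL)
    have S: "?S \<subseteq> fibre E ?x" using c by (auto simp: in_fibre)
    have x: "?x \<in> arrows X" using c yz by simp
    have "closed_span (fibre_space E ?x) ?S = fibre E ?x"
      using saturatedD[OF that] c yz by simp
    moreover have "closed_span (fibre_space C (y \<cdot>\<^bsub>L\<^esub> z)) (\<phi> ` ?S) = \<phi> ` closed_span (fibre_space E ?x) ?S"
      by (rule closed_span_transport[OF fibre_banach])
        (use x S yz fib[of "y \<cdot>\<^bsub>L\<^esub> z"] gyz in \<open>auto simp: arrows_def[symmetric] in_fibre zeroC addC smulC normC\<close>)
    moreover have "\<phi> ` ?S = {a \<odot>\<^bsub>C\<^esub> b |a b. a \<in> fibre C y \<and> b \<in> fibre C z}"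
    proof (intro equalityI subsetI)
      fix c assume "c \<in> \<phi> ` ?S"
      then obtain a b where ab: "c = \<phi> (a \<odot>\<^bsub>E\<^esub> b)" "a \<in> points E" "b \<in> points E" "proj E a = g z" "proj E b = g y"
        by (auto simp: in_fibre)
      then have "c = \<phi> b \<odot>\<^bsub>C\<^esub> \<phi> a" using yz by (simp add: multC)
      moreover have "\<phi> b \<in> fibre C y" "\<phi> a \<in> fibre C z" using ab yz by (simp_all add: in_fibre)
      ultimately show "c \<in> {a \<odot>\<^bsub>C\<^esub> b |a b. a \<in> fibre C y \<and> b \<in> fibre C z}" by blast
    next
      fix c assume "c \<in> {a \<odot>\<^bsub>C\<^esub> b |a b. a \<in> fibre C y \<and> b \<in> fibre C z}"
      then obtain a b where ab: "c = a \<odot>\<^bsub>C\<^esub> b" "a \<in> points C" "b \<in> points C" "proj C a = y" "proj C b = z"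
        by (auto simp: in_fibre)
      then have "c = \<phi> (\<psi> b \<odot>\<^bsub>E\<^esub> \<psi> a)" using yz by (simp add: multC)
      moreover have "\<psi> a \<in> fibre E (g y)" "\<psi> b \<in> fibre E (g z)" using ab by (simp_all add: in_fibre proj\<psi>)
      ultimately show "c \<in> \<phi> ` ?S" by blast
    qed
    moreover have "\<phi> ` fibre E ?x = fibre C (y \<cdot>\<^bsub>L\<^esub> z)"
      using fib[of "y \<cdot>\<^bsub>L\<^esub> z"] yz gyz by (simp add: bij_betw_def)
    ultimately show "closed_span (fibre_space C (y \<cdot>\<^bsub>L\<^esub> z)) {a \<odot>\<^bsub>C\<^esub> b |a b. a \<in> fibre C y \<and> b \<in> fibre C z}
        = fibre C (y \<cdot>\<^bsub>L\<^esub> z)" by simp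
  qed
qed


section \<open>Opposite Fell bundles\<close>

definition op_bundle :: "('b, 'x) fell_bundle \<Rightarrow> ('b, 'x) fell_bundle"
  where "op_bundle E =
    \<lparr> btop = btop E, proj = proj E, badd = badd E, bzero = bzero E, bsmul = bsmul E, bnorm = bnorm E,
      bmult = (\<lambda>a b. b \<odot>\<^bsub>E\<^esub> a), bstar = bstar E \<rparr>"

lemma op_bundle_simps [simp]:
  "btop (op_bundle E) = btop E" "proj (op_bundle E) = proj E" "badd (op_bundle E) = badd E"
  "bzero (op_bundle E) = bzero E" "bsmul (op_bundle E) = bsmul E" "bnorm (op_bundle E) = bnorm E"
  "bmult (op_bundle E) a b = b \<odot>\<^bsub>E\<^esub> a" "bstar (op_bundle E) = bstar E"
  "points (op_bundle E) = points E" "fibre (op_bundle E) x = fibre E x"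
  by (simp_all add: op_bundle_def points_def fibre_def)

lemma (in fell_bundle) op_fell_bundle: "fell_bundle (op_groupoid X) (op_bundle E)"
  and op_saturated: "saturated X E \<Longrightarrow> saturated (op_groupoid X) (op_bundle E)"
  by (rule anti_isomorphic_bundle[OF X.op_topological_groupoid, where f = "\<lambda>x. x" and g = "\<lambda>x. x" and \<phi> = "\<lambda>x. x" and \<psi> = "\<lambda>x. x"];
      simp add: homeomorphic_maps_def)+

lemma (in fell_bundle) op_bcomposable:
  "(a, b) \<in> bcomposable (op_groupoid X) (op_bundle E) \<longleftrightarrow> (b, a) \<in> bcomposable X E"
  by (auto simp: bcomposable_def X.op_composable)

lemma (in self_similar_right_bundle) op_self_similar_left_bundle:
  "self_similar_left_bundle (op_groupoid G) (op_groupoid X) (op_right \<beta>) (op_bundle E) (\<lambda>t b. act b t)"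
proof (intro self_similar_left_bundle.intro ss.op_self_similar_left fell.op_fell_bundle
    self_similar_left_bundle_axioms.intro, goal_cases)
  case 1 then show ?case using bact_continuous by (simp add: continuous_map_ldom_op)
next
  case 3 then show ?case
    by (simp add: bldom_def brdom_def[symmetric] bact_add)
next
  case 7 then show ?case
    using bact_mult by (simp add: bldom_def brdom_def[symmetric] fell.op_bcomposable)
next
  case 8 then show ?case using bact_star by (simp add: bldom_def brdom_def[symmetric])
qed (simp_all add: bldom_def brdom_def[symmetric] ss.G.op_composable proj_bact bact_smul bact_bact bact_unit)

lemma (in self_similar_left_bundle) op_self_similar_right_bundle:
  "self_similar_right_bundle (op_groupoid H) (op_groupoid X) (op_left \<alpha>) (op_bundle E) (\<lambda>b h. act h b)"
proof (intro self_similar_right_bundle.intro ss.op_self_similar_right fell.op_fell_bundle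
    self_similar_right_bundle_axioms.intro, goal_cases)
  case 1 then show ?case using bact_continuous by (simp add: continuous_map_rdom_op)
next
  case 3 then show ?case
    by (simp add: brdom_def bldom_def[symmetric] bact_add)
next
  case 7 then show ?case
    using bact_mult by (simp add: brdom_def bldom_def[symmetric] fell.op_bcomposable)
next
  case 8 then show ?case using bact_star by (simp add: brdom_def bldom_def[symmetric])
qed (simp_all add: brdom_def bldom_def[symmetric] ss.H.op_composable proj_bact bact_smul bact_bact bact_unit)


section \<open>Self-similar actions on Fell bundles are isometric\<close>

text \<open>A ratio \<open>y / x\<close> above 1 has unbounded powers, while along the exponents
  \<open>2 ^ n\<close> they stay below \<open>C\<close>. For \<open>x = 0\<close> there is no ratio,
  and the bound at \<open>n = 0\<close> decides.\<close>

lemma le_of_power_bounds: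
  fixes x y C :: real
  assumes x: "0 \<le> x" and bound: "\<And>n. y ^ (2 ^ n) \<le> C * x ^ (2 ^ n)"
  shows "y \<le> x"
proof (rule ccontr)
  assume "\<not> y \<le> x"
  then have xy: "x < y" by simp
  show False
  proof (cases "x = 0")
    case True
    then show False using bound[of 0] xy by simp
  next
    case False
    then have "1 < y / x" using x xy by simp
    then obtain n where n: "C < (y / x) ^ n" using real_arch_pow by blast
    have "n \<le> 2 ^ n" by (simp add: less_imp_le)
    then have "(y / x) ^ n \<le> (y / x) ^ (2 ^ n)" using \<open>1 < y / x\<close> by (intro power_increasing) auto
    moreover have "(y / x) ^ (2 ^ n) \<le> C"
      using bound[of n] x False by (simp add: power_divide field_simps)
    ultimately show False using n by linarith
  qed
qed

context self_similar_left_bundle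
begin

lemma bldom_act: "(h, b) \<in> bldom H X \<alpha> E \<longleftrightarrow>
    h \<in> arrows H \<and> b \<in> points E \<and> src H h = lmom \<alpha> (rng X (proj E b))"
  by (simp add: bldom_def ldom_iff lrho_def points_def)

lemma continuous_bact:
  assumes "continuous_map T (gtop H) f" "continuous_map T (btop E) g"
    and "\<And>p. p \<in> topspace T \<Longrightarrow> src H (f p) = lmom \<alpha> (rng X (proj E (g p)))"
  shows "continuous_map T (btop E) (\<lambda>p. act (f p) (g p))"
  by (rule continuous_map_apply2[OF bact_continuous[unfolded ldom_top_def] assms(1,2)])
    (use assms ss.H.continuous_arrow fell.continuous_point bldom_act in \<open>auto simp: bldom_def\<close>)

lemma bact_point [simp]:
  assumes "h \<in> arrows H" "b \<in> points E" "src H h = lmom \<alpha> (rng X (proj E b))"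
  shows "act h b \<in> points E" "proj E (act h b) = h \<triangleright>\<^bsub>\<alpha>\<^esub> proj E b"
proof -
  have "(h, b) \<in> topspace (ldom_top H (btop E) (\<lambda>b. lrho X \<alpha> (proj E b)))"
    using assms by (simp add: ldom_top_def ldom_iff lrho_def points_def arrows_def)
  then show "act h b \<in> points E"
    using continuous_map_image_subset_topspace[OF bact_continuous] unfolding points_def by force
qed (use assms proj_bact bldom_act in auto)

lemma bact_badd:
  "\<lbrakk>h \<in> arrows H; b \<in> points E; c \<in> points E; src H h = lmom \<alpha> (rng X (proj E b)); proj E c = proj E b\<rbrakk>
    \<Longrightarrow> act h (badd E b c) = badd E (act h b) (act h c)"
  by (simp add: bact_add bldom_act in_fibre)

lemma bact_bsmul:
  "\<lbrakk>h \<in> arrows H; b \<in> points E; src H h = lmom \<alpha> (rng X (proj E b))\<rbrakk>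
    \<Longrightarrow> act h (bsmul E w b) = bsmul E w (act h b)"
  by (simp add: bact_smul bldom_act)

lemma mult_bact:
  "\<lbrakk>k \<in> arrows H; h \<in> arrows H; src H k = rng H h; b \<in> points E; src H h = lmom \<alpha> (rng X (proj E b))\<rbrakk>
    \<Longrightarrow> act (k \<cdot>\<^bsub>H\<^esub> h) b = act k (act h b)"
  by (simp add: bact_bact bldom_act ss.H.composable_iff)

lemma bact_neutral [simp]: "\<lbrakk>b \<in> points E; e = lmom \<alpha> (rng X (proj E b))\<rbrakk> \<Longrightarrow> act e b = b"
  using bact_unit[of b] by (simp add: lrho_def)

lemma bact_bmult:
  "\<lbrakk>h \<in> arrows H; b \<in> points E; src H h = lmom \<alpha> (rng X (proj E b)); c \<in> points E;
    src X (proj E b) = rng X (proj E c)\<rbrakk>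
   \<Longrightarrow> act h (b \<odot>\<^bsub>E\<^esub> c) = act h b \<odot>\<^bsub>E\<^esub> act (h \<triangleleft>\<^bsub>\<alpha>\<^esub> proj E b) c"
  by (simp add: bact_mult bldom_act fell.bcomposable_iff)

lemma bact_bstar:
  "\<lbrakk>h \<in> arrows H; b \<in> points E; src H h = lmom \<alpha> (rng X (proj E b))\<rbrakk>
    \<Longrightarrow> bstar E (act h b) = act (h \<triangleleft>\<^bsub>\<alpha>\<^esub> proj E b) (bstar E b)"
  by (simp add: bact_star bldom_act)

lemma inv_bact_bact [simp]:
  "\<lbrakk>h \<in> arrows H; b \<in> points E; src H h = lmom \<alpha> (rng X (proj E b))\<rbrakk> \<Longrightarrow> act (ginv H h) (act h b) = b"
  "\<lbrakk>h \<in> arrows H; b \<in> points E; rng H h = lmom \<alpha> (rng X (proj E b))\<rbrakk> \<Longrightarrow> act h (act (ginv H h) b) = b"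
  using mult_bact[of "ginv H h" h b] mult_bact[of h "ginv H h" b] by simp_all

lemma bact_bzero:
  assumes "h \<in> arrows H" "x \<in> arrows X" "src H h = lmom \<alpha> (rng X x)"
  shows "act h (bzero E x) = bzero E (h \<triangleright>\<^bsub>\<alpha>\<^esub> x)"
proof -
  have z: "bzero E x \<in> points E" "proj E (bzero E x) = x" using assms by (simp_all add: arrows_def)
  then have "act h (bsmul E 0 (bzero E x)) = bsmul E 0 (act h (bzero E x))"
    using assms by (intro bact_bsmul) simp_all
  then show ?thesis using assms z by (simp add: fell.bsmul_zero)
qed

text \<open>The axioms give continuity only. Near the zero vector over \<open>u\<close> the
  neighbourhoods are controlled by small norms, so continuity sends all small vectors of the fibre
  to vectors of norm below 1, and scaling yields a bound. The constant may depend on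
  \<open>h\<close> and \<open>u\<close>.\<close>

lemma bact_unit_fibre_bounded:
  assumes h: "h \<in> arrows H" "u \<in> units X" "src H h = lmom \<alpha> u"
  obtains C where "\<And>b. b \<in> fibre E u \<Longrightarrow> bnorm E (act h b) \<le> C * bnorm E b"
proof -
  \<comment> \<open>The action of \<open>h\<close> makes sense on this part of the bundle only. The
    open set \<open>W\<close> extends the preimage of the unit ball to the whole space, where
    \<open>zero_neighbourhood\<close> applies.\<close>
  let ?D = "subtopology (btop E) {b. src H h = lmom \<alpha> (rng X (proj E b))}"
  have "continuous_map ?D (btop E) (\<lambda>b. act h b)"
    by (rule continuous_bact)
      (use h in \<open>auto simp: arrows_def continuous_map_from_subtopology\<close>)
  from openin_continuous_map_preimage[OF this fell.norm_usc[of 1]]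
  obtain W where W: "openin (btop E) W" and
    WD: "{b \<in> topspace ?D. act h b \<in> {b \<in> points E. bnorm E b < 1}}
      = W \<inter> {b. src H h = lmom \<alpha> (rng X (proj E b))}"
    unfolding openin_subtopology by blast
  have u: "u \<in> topspace (gtop X)" using h ss.X.unit_arrow[of u] by (simp add: arrows_def)
  have z: "bzero E u \<in> points E" "proj E (bzero E u) = u" using u by simp_all
  have "act h (bzero E u) = bzero E (h \<triangleright>\<^bsub>\<alpha>\<^esub> u)" using h bact_bzero[of h u] by simp
  moreover have "h \<triangleright>\<^bsub>\<alpha>\<^esub> u \<in> topspace (gtop X)" unfolding arrows_def[symmetric] using h by simp
  ultimately have "bzero E u \<in> {b \<in> topspace ?D. act h b \<in> {b \<in> points E. bnorm E b < 1}}"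
    using h z by (simp add: points_def[symmetric])
  then have "bzero E u \<in> W" unfolding WD by blast
  then obtain V e where V: "openin (gtop X) V" "u \<in> V" "e > 0"
      "\<And>b. \<lbrakk>b \<in> points E; proj E b \<in> V; bnorm E b < e\<rbrakk> \<Longrightarrow> b \<in> W"
    by (rule fell.zero_neighbourhood[OF u W]) (rule that)
  have small: "bnorm E (act h b) < 1" if "b \<in> fibre E u" "bnorm E b < e" for b
  proof -
    have "b \<in> W \<inter> {b. src H h = lmom \<alpha> (rng X (proj E b))}" using that V h by (auto simp: in_fibre)
    then show ?thesis unfolding WD[symmetric] by simp
  qed
  show thesis
  \<comment> \<open>A nonzero vector is scaled to norm \<open>e / 2\<close>, strictly inside the
    ball of radius \<open>e\<close>; this is the origin of the factor 2.\<close>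
  proof (rule that[of "2 / e"])
    fix b assume b: "b \<in> fibre E u"
    then have b': "b \<in> points E" "proj E b = u" by (auto simp: in_fibre)
    have ab: "act h b \<in> points E" "proj E (act h b) = h \<triangleright>\<^bsub>\<alpha>\<^esub> u" using h b' by simp_all
    show "bnorm E (act h b) \<le> 2 / e * bnorm E b"
    proof (cases "bnorm E b = 0")
      case True
      then have "b = bzero E u" using fell.bnorm_eq_zero b' by blast
      then have "act h b = bzero E (h \<triangleright>\<^bsub>\<alpha>\<^esub> u)" using bact_bzero[of h u] h by simp
      then show ?thesis using True \<open>h \<triangleright>\<^bsub>\<alpha>\<^esub> u \<in> topspace (gtop X)\<close> by simp
    next
      case False
      then have pos: "bnorm E b > 0" using fell.bnorm_nonneg[OF b'(1)] by linarith
      let ?c = "complex_of_real (e / (2 * bnorm E b))"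
      have c: "cmod ?c = e / (2 * bnorm E b)" unfolding norm_of_real using V(3) pos by simp
      have "bnorm E (bsmul E ?c b) = e / 2" using pos b' by (simp only: fell.bnorm_smul c) simp
      then have "bnorm E (act h (bsmul E ?c b)) < 1" using b' V(3) by (intro small) (simp_all add: in_fibre)
      then have "cmod ?c * bnorm E (act h b) < 1"
        using h b' ab by (simp only: bact_bsmul[OF h(1) b'(1)] fell.bnorm_smul[OF ab(1)]
            ss.X.unit_simps)
      then show ?thesis unfolding c using pos V(3) by (simp add: field_simps)
    qed
  qed
qed

text \<open>
  On unit fibres the action is a bounded *-homomorphism, and the C*-identity applied to the powers
  \<open>b ^ 2 ^ n\<close> of a self-adjoint element turns the bound into contractivity.
\<close>

lemma bnorm_bact_self_adjoint:
  assumes h: "h \<in> arrows H" "u \<in> units X" "src H h = lmom \<alpha> u"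
    and b: "b \<in> fibre E u" "bstar E b = b"
  shows "bnorm E (act h b) \<le> bnorm E b"
proof -
  obtain C where C: "\<And>b. b \<in> fibre E u \<Longrightarrow> bnorm E (act h b) \<le> C * bnorm E b"
    by (rule bact_unit_fibre_bounded[OF h]) (rule that)
  define p where "p n = ((\<lambda>a. a \<odot>\<^bsub>E\<^esub> a) ^^ n) b" for n :: nat
  have uu: "u \<cdot>\<^bsub>X\<^esub> u = u" using ss.X.mul_simps(4)[of u] h(2) by simp
  have hu: "h \<triangleright>\<^bsub>\<alpha>\<^esub> u \<in> units X" using h by simp
  have p: "p n \<in> points E \<and> proj E (p n) = u \<and> bstar E (p n) = p n
      \<and> bnorm E (p n) = bnorm E b ^ (2 ^ n) \<and> bnorm E (act h (p n)) = bnorm E (act h b) ^ (2 ^ n)" for n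
  proof (induction n)
    case 0
    then show ?case using b by (simp add: p_def in_fibre)
  next
    case (Suc n)
    have s: "p (Suc n) = p n \<odot>\<^bsub>E\<^esub> p n" by (simp add: p_def)
    have a: "act h (p n) \<in> points E" "proj E (act h (p n)) = h \<triangleright>\<^bsub>\<alpha>\<^esub> u" using h Suc by simp_all
    \<comment> \<open>Over a unit the residual of \<open>h\<close> is \<open>h\<close> itself, so
      the twisted rules for adjoint and product become the ordinary ones.\<close>
    have star: "bstar E (act h (p n)) = act h (p n)" using h Suc bact_bstar[of h "p n"] by simp
    have "act h (p (Suc n)) = act h (p n) \<odot>\<^bsub>E\<^esub> act h (p n)"
      unfolding s using h Suc bact_bmult[of h "p n" "p n"] by simp
    moreover have "bnorm E (act h (p n) \<odot>\<^bsub>E\<^esub> act h (p n)) = (bnorm E (act h (p n)))\<^sup>2"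
      using fell.norm_star_mult[OF a(1)] star by simp
    moreover have "bnorm E (p n \<odot>\<^bsub>E\<^esub> p n) = (bnorm E (p n))\<^sup>2"
      using fell.norm_star_mult[of "p n"] Suc by simp
    moreover have "p (Suc n) \<in> points E" "proj E (p (Suc n)) = u" "bstar E (p (Suc n)) = p (Suc n)"
      unfolding s using Suc h uu fell.bstar_bmult[of "p n" "p n"] by simp_all
    ultimately show ?case using Suc unfolding s by (simp add: power_mult[symmetric] mult.commute)
  qed
  show ?thesis
  proof (rule le_of_power_bounds)
    show "0 \<le> bnorm E b" using b by (simp add: in_fibre)
    show "bnorm E (act h b) ^ (2 ^ n) \<le> C * bnorm E b ^ (2 ^ n)" for n
      using C[of "p n"] p[of n] by (simp add: in_fibre)
  qed
qed

text \<open>The adjoint of the translate times the translate is the residual of \<open>h\<close>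
  acting on the adjoint of \<open>b\<close> times \<open>b\<close>. The latter is self-adjoint over
  a unit, where contractivity is known, and the C*-identity takes square roots on both
  sides.\<close>

lemma bnorm_bact_le:
  assumes h: "h \<in> arrows H" "b \<in> points E" "src H h = lmom \<alpha> (rng X (proj E b))"
  shows "bnorm E (act h b) \<le> bnorm E b"
proof -
  let ?k = "h \<triangleleft>\<^bsub>\<alpha>\<^esub> proj E b"
  have "bstar E (act h b) \<odot>\<^bsub>E\<^esub> act h b = act ?k (bstar E b \<odot>\<^bsub>E\<^esub> b)"
    using h bact_bmult[of ?k "bstar E b" b] by (simp add: bact_bstar)
  moreover have "bnorm E (act ?k (bstar E b \<odot>\<^bsub>E\<^esub> b)) \<le> bnorm E (bstar E b \<odot>\<^bsub>E\<^esub> b)"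
    by (rule bnorm_bact_self_adjoint[of _ "src X (proj E b)"])
      (use h in \<open>simp_all add: in_fibre fell.bstar_bmult\<close>)
  ultimately have "(bnorm E (act h b))\<^sup>2 \<le> (bnorm E b)\<^sup>2"
    using h fell.norm_star_mult[of b] fell.norm_star_mult[of "act h b"] by simp
  then show ?thesis using h by (simp add: power2_le_iff_abs_le)
qed

lemma bnorm_bact [simp]:
  assumes h: "h \<in> arrows H" "b \<in> points E" "src H h = lmom \<alpha> (rng X (proj E b))"
  shows "bnorm E (act h b) = bnorm E b"
  using bnorm_bact_le[OF h] bnorm_bact_le[of "ginv H h" "act h b"] h by simp

end

context self_similar_right_bundle
begin

interpretation op: self_similar_left_bundle "op_groupoid G" "op_groupoid X" "op_right \<beta>" "op_bundle E"
    "\<lambda>t b. act b t"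
  by (rule op_self_similar_left_bundle)

lemmas bop_simps = op_bundle_simps op_groupoid_simps op_right_simps

lemmas continuous_bact = op.continuous_bact[unfolded bop_simps]
lemmas bact_point [simp] = op.bact_point[unfolded bop_simps]
lemmas bact_badd = op.bact_badd[unfolded bop_simps]
lemmas bact_bsmul = op.bact_bsmul[unfolded bop_simps]
lemmas mult_bact = op.mult_bact[unfolded bop_simps]
lemmas bact_neutral [simp] = op.bact_neutral[unfolded bop_simps]
lemmas bact_bmult = op.bact_bmult[unfolded bop_simps]
lemmas bact_bstar = op.bact_bstar[unfolded bop_simps]
lemmas bact_bzero = op.bact_bzero[unfolded bop_simps]
lemmas bnorm_bact [simp] = op.bnorm_bact[unfolded bop_simps]

end


section \<open>Quotient Fell bundles\<close>

locale free_proper_right_bundle =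
  free_proper_right_action G X \<beta> + bdl: self_similar_right_bundle G X \<beta> E act
  for G :: "'g groupoid" and X :: "'x groupoid" and \<beta> :: "('g, 'x) right_ss"
    and E :: "('b, 'x) fell_bundle" and act :: "'b \<Rightarrow> 'g \<Rightarrow> 'b"
begin

sublocale points: groupoid_right_space G "btop E" "\<lambda>b. rsigma X \<beta> (proj E b)" act
proof
  show "continuous_map (btop E) (unit_top G) (\<lambda>b. rsigma X \<beta> (proj E b))"
    unfolding G.continuous_unit_top rsigma_def
    by (intro conjI continuous_rmom X.continuous_src bdl.fell.proj_continuous ballI)
      (auto simp: points_def[symmetric])
qed (use bdl.bact_continuous bdl.bact_unit in
    \<open>auto simp: points_def[symmetric] rdom_iff rsigma_def G.composable_iff bdl.mult_bact\<close>)

abbreviation borb ("\<kappa>") where "\<kappa> \<equiv> bgorb G X \<beta> E act"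
abbreviation EQ where "EQ \<equiv> rquot_bundle X E G \<beta> act"

lemma borb_eq:
  "\<lbrakk>b \<in> points E; c \<in> points E\<rbrakk> \<Longrightarrow>
    \<kappa> b = \<kappa> c \<longleftrightarrow> (\<exists>t\<in>arrows G. rng G t = rmom \<beta> (src X (proj E b)) \<and> act b t = c)"
  using points.orbit_eq[of b c] unfolding bgorb_def rsigma_def points_def[symmetric] by metis

lemma borb_self [simp]: "b \<in> points E \<Longrightarrow> b \<in> \<kappa> b"
  using points.orbit_self[of b] by (simp add: bgorb_def points_def)

lemma borb_act [simp]:
  "\<lbrakk>t \<in> arrows G; b \<in> points E; rng G t = rmom \<beta> (src X (proj E b))\<rbrakk> \<Longrightarrow> \<kappa> (act b t) = \<kappa> b"
  using borb_eq[of b "act b t"] by auto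

lemma in_borbE:
  assumes "c \<in> \<kappa> b" "b \<in> points E"
  obtains t where "t \<in> arrows G" "rng G t = rmom \<beta> (src X (proj E b))" "c = act b t"
    "c \<in> points E" "\<kappa> c = \<kappa> b"
proof -
  obtain t where t: "t \<in> arrows G" "rng G t = rmom \<beta> (src X (proj E b))" "c = act b t"
    using assms unfolding bgorb_def rorbit_def rsigma_def by auto
  show thesis by (rule that[OF t]) (use t assms in simp_all)
qed

lemma borb_eqE:
  assumes "\<kappa> b = \<kappa> c" "b \<in> points E" "c \<in> points E"
  obtains t where "t \<in> arrows G" "rng G t = rmom \<beta> (src X (proj E b))" "c = act b t"
  using assms borb_eq by metis

lemma btop_quot: "btop EQ = quotient_topology (btop E) \<kappa>"
  by (simp add: rquot_bundle_def orbit_bundle_def)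

lemma open_quotient_borb: "open_quotient (btop E) (btop EQ) \<kappa>"
  using points.orbit_open_quotient[OF open_source_acting] by (simp add: btop_quot bgorb_def)

lemma points_quot: "points EQ = \<kappa> ` points E"
  by (simp add: points_def btop_quot topspace_quotient_topology)

lemma borb_point [simp]: "b \<in> points E \<Longrightarrow> \<kappa> b \<in> points EQ"
  by (simp add: points_quot)

lemma continuous_borb: "continuous_map T (btop E) f \<Longrightarrow> continuous_map T (btop EQ) (\<lambda>p. \<kappa> (f p))"
  using continuous_map_compose[of T "btop E" f "btop EQ" \<kappa>] open_quotient_borb
  by (simp add: open_quotient_def o_def)

lemma the_elem_borb:
  assumes "b \<in> points E"
    and "\<And>t. \<lbrakk>t \<in> arrows G; rng G t = rmom \<beta> (src X (proj E b))\<rbrakk> \<Longrightarrow> F (act b t) = F b"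
  shows "the_elem (F ` \<kappa> b) = F b"
  by (rule the_elem_image_eq) (use assms in \<open>auto elim: in_borbE\<close>)

lemma proj_quot [simp]: "b \<in> points E \<Longrightarrow> proj EQ (\<kappa> b) = \<pi> (proj E b)"
  using the_elem_borb[of b "\<lambda>b. \<pi> (proj E b)"] by (simp add: rquot_bundle_def orbit_bundle_def)

lemma bsmul_quot [simp]: "b \<in> points E \<Longrightarrow> bsmul EQ k (\<kappa> b) = \<kappa> (bsmul E k b)"
  using the_elem_borb[of b "\<lambda>b. \<kappa> (bsmul E k b)"]
  by (simp add: rquot_bundle_def orbit_bundle_def bdl.bact_bsmul[symmetric])

lemma bnorm_quot [simp]: "b \<in> points E \<Longrightarrow> bnorm EQ (\<kappa> b) = bnorm E b"
  using the_elem_borb[of b "bnorm E"] by (simp add: rquot_bundle_def orbit_bundle_def)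

lemma bstar_quot [simp]: "b \<in> points E \<Longrightarrow> bstar EQ (\<kappa> b) = \<kappa> (bstar E b)"
  using the_elem_borb[of b "\<lambda>b. \<kappa> (bstar E b)"]
  by (simp add: rquot_bundle_def orbit_bundle_def bdl.bact_bstar)

lemma bzero_quot [simp]:
  assumes "x \<in> arrows X"
  shows "bzero EQ (\<pi> x) = \<kappa> (bzero E x)"
proof -
  have "the_elem ((\<lambda>x. \<kappa> (bzero E x)) ` \<pi> x) = \<kappa> (bzero E x)"
  proof (rule the_elem_image_eq)
    fix y assume "y \<in> \<pi> x"
    then obtain t where "t \<in> arrows G" "rng G t = rmom \<beta> (src X x)" "y = x \<blacktriangleleft>\<^bsub>\<beta>\<^esub> t"
      using assms by (rule in_orbE)
    then show "\<kappa> (bzero E y) = \<kappa> (bzero E x)"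
      using assms bdl.bact_bzero[of t x] borb_act[of t "bzero E x"] by (simp add: arrows_def)
  qed (use assms in simp)
  then show ?thesis by (simp add: rquot_bundle_def orbit_bundle_def)
qed

text \<open>Two pairs of representatives in common fibres are moved by one and the same arrow, since
  freeness can be applied to the projections; additivity of the action then puts both sums in one
  orbit.\<close>

lemma badd_quot [simp]:
  assumes "b \<in> points E" "c \<in> points E" "proj E b = proj E c"
  shows "badd EQ (\<kappa> b) (\<kappa> c) = \<kappa> (badd E b c)"
proof -
  have "\<kappa> (badd E b' c') = \<kappa> (badd E b c)" if bc: "b' \<in> \<kappa> b" "c' \<in> \<kappa> c" "proj E b' = proj E c'" for b' c'
  proof -
    obtain s where s: "s \<in> arrows G" "rng G s = rmom \<beta> (src X (proj E b))" "b' = act b s"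
      using bc(1) assms(1) by (rule in_borbE)
    obtain t where t: "t \<in> arrows G" "rng G t = rmom \<beta> (src X (proj E c))" "c' = act c t"
      using bc(2) assms(2) by (rule in_borbE)
    have "proj E c \<blacktriangleleft>\<^bsub>\<beta>\<^esub> s = proj E c \<blacktriangleleft>\<^bsub>\<beta>\<^esub> t" using s t bc(3) assms by simp
    then have "s = t" using s t assms by (auto intro: ract_cancel[of "proj E c"])
    moreover have "act (badd E b c) t = badd E (act b t) (act c t)"
      using t(1,2) assms by (intro bdl.bact_badd) simp_all
    ultimately have "badd E b' c' = act (badd E b c) t" using s(3) t(3) by simp
    then show ?thesis using t(1,2) assms by simp
  qed
  then have "the_elem {\<kappa> (badd E b' c') |b' c'. b' \<in> \<kappa> b \<and> c' \<in> \<kappa> c \<and> proj E b' = proj E c'}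
      = \<kappa> (badd E b c)"
    using borb_self[OF assms(1)] borb_self[OF assms(2)] assms(3) by (intro the_elem_eq') blast+
  then show ?thesis by (simp add: rquot_bundle_def orbit_bundle_def)
qed

lemma bmult_quot [simp]:
  assumes "b \<in> points E" "c \<in> points E" "src X (proj E b) = rng X (proj E c)"
  shows "\<kappa> b \<odot>\<^bsub>EQ\<^esub> \<kappa> c = \<kappa> (b \<odot>\<^bsub>E\<^esub> c)"
proof -
  have "\<kappa> (b' \<odot>\<^bsub>E\<^esub> c') = \<kappa> (b \<odot>\<^bsub>E\<^esub> c)" if bc: "b' \<in> \<kappa> b" "c' \<in> \<kappa> c" "(b', c') \<in> bcomposable X E" for b' c'
  proof -
    obtain s where s: "s \<in> arrows G" "rng G s = rmom \<beta> (src X (proj E b))" "b' = act b s"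
      using bc(1) assms(1) by (rule in_borbE)
    obtain t where t: "t \<in> arrows G" "rng G t = rmom \<beta> (src X (proj E c))" "c' = act c t"
      using bc(2) assms(2) by (rule in_borbE)
    have "src X (proj E b) \<blacktriangleleft>\<^bsub>\<beta>\<^esub> s = rng X (proj E c) \<blacktriangleleft>\<^bsub>\<beta>\<^esub> (proj E c \<blacktriangleright>\<^bsub>\<beta>\<^esub> t)"
      using s t bc(3) assms by (simp add: bdl.fell.bcomposable_iff)
    then have "rng X (proj E c) \<blacktriangleleft>\<^bsub>\<beta>\<^esub> s = rng X (proj E c) \<blacktriangleleft>\<^bsub>\<beta>\<^esub> (proj E c \<blacktriangleright>\<^bsub>\<beta>\<^esub> t)" using assms(3) by simp
    then have "s = proj E c \<blacktriangleright>\<^bsub>\<beta>\<^esub> t"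
      by (rule ract_cancel[of "rng X (proj E c)", rotated 5]) (use s t assms in simp_all)
    then show ?thesis
      using s t assms bdl.bact_bmult[of t c b] borb_act[of t "b \<odot>\<^bsub>E\<^esub> c"] by simp
  qed
  then have "the_elem {\<kappa> (b' \<odot>\<^bsub>E\<^esub> c') |b' c'. b' \<in> \<kappa> b \<and> c' \<in> \<kappa> c \<and> (b', c') \<in> bcomposable X E}
      = \<kappa> (b \<odot>\<^bsub>E\<^esub> c)"
    using borb_self[OF assms(1)] borb_self[OF assms(2)] bdl.fell.bcomposable_iff[of b c] assms
    by (intro the_elem_eq') blast+
  then show ?thesis by (simp add: rquot_bundle_def orbit_bundle_def)
qed

text \<open>The relating arrow fixes the common source in \<open>X\<close> and is neutral by
  freeness there, so vectors of one orbit are separated already by the sources of their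
  projections.\<close>

lemma borb_proj_unique:
  assumes "b \<in> points E" "c \<in> points E" "\<kappa> b = \<kappa> c" "src X (proj E b) = src X (proj E c)"
  shows "b = c"
proof -
  obtain t where t: "t \<in> arrows G" "rng G t = rmom \<beta> (src X (proj E b))" "c = act b t"
    using borb_eqE[OF assms(3,1,2)] .
  have e: "src X (proj E b) \<blacktriangleleft>\<^bsub>\<beta>\<^esub> t = src X (proj E b)"
    using t assms(1,4) src_ract[of t "proj E b"] bdl.bact_point[of t b] by (metis bdl.fell.proj_arrow)
  have "t = rmom \<beta> (src X (proj E b))"
    by (rule ract_cancel[of "src X (proj E b)"]) (use e assms(1) t in simp_all)
  then show ?thesis using t(3) assms(1) by simp
qed

lemma blift_src:
  assumes "\<Theta> \<in> points EQ" "v \<in> units X" "src Q (proj EQ \<Theta>) = \<pi> v"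
  obtains b where "b \<in> points E" "\<kappa> b = \<Theta>" "src X (proj E b) = v"
proof -
  obtain c where c: "c \<in> points E" "\<Theta> = \<kappa> c" using assms by (auto simp: points_quot)
  then have e: "\<pi> (src X (proj E c)) = \<pi> v" using assms by simp
  show thesis
    by (rule that[of "act c (transporter (src X (proj E c)) v)"]) (use c e assms in simp_all)
qed

text \<open>Unlike \<open>blift_src\<close> this prescribes the entire projection, which is what a
  comparison of fibres requires.\<close>

lemma blift:
  assumes "\<Theta> \<in> points EQ" "x \<in> arrows X" "proj EQ \<Theta> = \<pi> x"
  obtains b where "b \<in> points E" "\<kappa> b = \<Theta>" "proj E b = x"
proof -
  obtain c where c: "c \<in> points E" "\<Theta> = \<kappa> c" using assms by (auto simp: points_quot)
  then have e: "\<pi> (proj E c) = \<pi> x" using assms by simp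
  show thesis
    by (rule that[of "act c (transporter (proj E c) x)"]) (use c e assms in simp_all)
qed

lemma blift_fibre:
  "\<lbrakk>b \<in> points E; \<Theta> \<in> fibre EQ (proj EQ (\<kappa> b))\<rbrakk> \<Longrightarrow> \<exists>b'. b' \<in> points E \<and> \<kappa> b' = \<Theta> \<and> proj E b' = proj E b"
  by (metis in_fibre blift proj_quot bdl.fell.proj_arrow)

text \<open>Freeness makes the orbit map injective on a fibre, and translation along the orbit of
  \<open>x\<close> makes it onto. A quotient fibre is therefore a copy of any fibre above
  it.\<close>

lemma bij_betw_fibre_quot:
  assumes "x \<in> arrows X"
  shows "bij_betw \<kappa> (fibre E x) (fibre EQ (\<pi> x))"
  unfolding bij_betw_def
proof
  show "inj_on \<kappa> (fibre E x)" by (auto simp: inj_on_def in_fibre intro: borb_proj_unique)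
  show "\<kappa> ` fibre E x = fibre EQ (\<pi> x)"
  proof (intro equalityI subsetI)
    fix \<Theta> assume "\<Theta> \<in> fibre EQ (\<pi> x)"
    then obtain b where "b \<in> points E" "\<kappa> b = \<Theta>" "proj E b = x"
      using blift assms by (metis in_fibre)
    then show "\<Theta> \<in> \<kappa> ` fibre E x" by (auto simp: in_fibre)
  qed (auto simp: in_fibre)
qed

text \<open>Algebraic identities are checked on matching representatives, and transporters make the
  matching continuous. Since the action is isometric, the preimage of a norm ball is a norm ball of
  \<open>E\<close>, which gives upper semicontinuity of the quotient norm.\<close>

lemma fell_bundle_quot: "fell_bundle Q EQ"
proof (intro fell_bundle.intro usc_banach_bundle.intro fell_bundle_axioms.intro topological_groupoid_quot)
  interpret Q: topological_groupoid Q by (rule topological_groupoid_quot)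
  have qcont: "continuous_map (btop EQ) (btop EQ) F"
    if "continuous_map (btop E) (btop E) f" "\<And>x. x \<in> points E \<Longrightarrow> F (\<kappa> x) = \<kappa> (f x)" for f F
    by (rule open_quotient_continuous[OF open_quotient_borb], rule continuous_map_eq[OF continuous_borb[OF that(1)]])
      (simp add: that(2) points_def)
  show "continuous_map (btop EQ) (gtop Q) (proj EQ)"
    by (rule open_quotient_continuous[OF open_quotient_borb],
        rule continuous_map_eq[OF continuous_orb[OF bdl.fell.proj_continuous]])
      (simp add: points_def)
  show "continuous_map (btop EQ) (btop EQ) (bsmul EQ k)" for k
    by (rule qcont[OF bdl.fell.smul_continuous]) simp
  show "continuous_map (btop EQ) (btop EQ) (bstar EQ)"
    by (rule qcont[OF bdl.fell.star_continuous]) simp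
  have ims: "\<kappa> ` {b \<in> points E. \<kappa> b \<in> U} = U" if "U \<subseteq> points EQ" for U
    using that by (auto simp: points_quot)
  have pre: "openin (btop E) {b \<in> points E. \<kappa> b \<in> U}" if "openin (btop EQ) U" for U
    using that openin_continuous_map_preimage[of "btop E" "btop EQ" \<kappa> U] open_quotient_borb
    by (simp add: open_quotient_def points_def)
  show "open_map (btop EQ) (gtop Q) (proj EQ)"
    unfolding open_map_def
  proof (intro allI impI)
    fix U assume U: "openin (btop EQ) U"
    then have "U \<subseteq> points EQ" by (simp add: openin_subset points_def)
    then have "proj EQ ` U = proj EQ ` \<kappa> ` {b \<in> points E. \<kappa> b \<in> U}" by (simp add: ims)
    also have "\<dots> = \<pi> ` proj E ` {b \<in> points E. \<kappa> b \<in> U}"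
      unfolding image_image by (rule image_cong) auto
    finally have im: "proj EQ ` U = \<pi> ` proj E ` {b \<in> points E. \<kappa> b \<in> U}" .
    have "openin (gtop X) (proj E ` {b \<in> points E. \<kappa> b \<in> U})"
      using pre[OF U] bdl.fell.proj_open unfolding open_map_def by blast
    then show "openin (gtop Q) (proj EQ ` U)"
      unfolding im using open_quotient_orb unfolding open_quotient_def open_map_def by blast
  qed
  show "proj EQ ` points EQ = topspace (gtop Q)"
  proof -
    have "proj EQ ` \<kappa> ` points E = \<pi> ` proj E ` points E"
      unfolding image_image by (rule image_cong) auto
    then show ?thesis
      using bdl.fell.proj_surj by (simp add: points_quot gtop_quot topspace_quotient_topology)
  qed
  show "complex_banach (fibre_space EQ \<xi>)" if "\<xi> \<in> topspace (gtop Q)" for \<xi>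
  proof -
    have "\<xi> \<in> arrows Q" using that by (simp add: arrows_def)
    then obtain x where x: "x \<in> arrows X" "\<xi> = \<pi> x" by (auto simp: arrows_quot)
    show ?thesis unfolding x(2)
      by (rule complex_banach_transport[OF bdl.fell.fibre_banach[of x], of \<kappa>])
        (use x bij_betw_fibre_quot[of x] in \<open>auto simp: arrows_def in_fibre\<close>)
  qed
  have "{b \<in> points E. \<kappa> b \<in> {\<Theta> \<in> points EQ. bnorm EQ \<Theta> < r}} = {b \<in> points E. bnorm E b < r}" for r
    by auto
  then show "openin (btop EQ) {\<Theta> \<in> points EQ. bnorm EQ \<Theta> < r}" for r
    using bdl.fell.norm_usc[of r] unfolding btop_quot openin_quotient_topology points_def[symmetric]
    by (auto simp: points_quot)
  show "continuous_map (subtopology (prod_topology (btop EQ) (btop EQ)) {(a, b). proj EQ a = proj EQ b})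
      (btop EQ) (\<lambda>(a, b). badd EQ a b)"
  proof (rule open_quotient_lift2[OF open_quotient_borb open_quotient_borb])
    define D where "D = subtopology (prod_topology (btop E) (btop E)) {p. (\<kappa> (fst p), \<kappa> (snd p)) \<in> {(a, b). proj EQ a = proj EQ b}}"
    have DD: "fst p \<in> points E" "snd p \<in> points E" "\<pi> (proj E (fst p)) = \<pi> (proj E (snd p))"
      if "p \<in> topspace D" for p
      using that by (auto simp: D_def points_def[symmetric])
    have cont: "continuous_map D (btop E) fst" "continuous_map D (btop E) snd"
      by (simp_all add: D_def continuous_map_fst_sub continuous_map_snd_sub)
    \<comment> \<open>Before vectors over equivalent arrows are added, the first one is moved into
      the fibre of the second.\<close>
    have "continuous_map D (btop EQ)
        (\<lambda>p. \<kappa> (badd E (act (fst p) (transporter (proj E (fst p)) (proj E (snd p)))) (snd p)))"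
      by (intro continuous_borb bdl.fell.continuous_badd bdl.continuous_bact continuous_transporter
          bdl.fell.continuous_proj cont)
        (use DD in simp_all)
    then have "continuous_map D (btop EQ) (\<lambda>p. case (\<kappa> (fst p), \<kappa> (snd p)) of (x, y) \<Rightarrow> badd EQ x y)"
    proof (rule continuous_map_eq)
      fix p assume p: "p \<in> topspace D"
      let ?x = "act (fst p) (transporter (proj E (fst p)) (proj E (snd p)))"
      have "?x \<in> points E" "\<kappa> ?x = \<kappa> (fst p)" "proj E ?x = proj E (snd p)"
        using DD[OF p] by simp_all
      then show "\<kappa> (badd E ?x (snd p)) = (case (\<kappa> (fst p), \<kappa> (snd p)) of (x, y) \<Rightarrow> badd EQ x y)"
        using DD[OF p] badd_quot[of ?x "snd p"] by simp
    qed
    then show "continuous_map (subtopology (prod_topology (btop E) (btop E))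
        {p. (\<kappa> (fst p), \<kappa> (snd p)) \<in> {(a, b). proj EQ a = proj EQ b}}) (btop EQ)
        (\<lambda>p. case (\<kappa> (fst p), \<kappa> (snd p)) of (x, y) \<Rightarrow> badd EQ x y)"
      unfolding D_def .
  qed
  show "continuous_map (subtopology (prod_topology (btop EQ) (btop EQ)) (bcomposable Q EQ))
      (btop EQ) (\<lambda>(a, b). a \<odot>\<^bsub>EQ\<^esub> b)"
  proof (rule open_quotient_lift2[OF open_quotient_borb open_quotient_borb])
    let ?D = "subtopology (prod_topology (btop E) (btop E)) {p. (\<kappa> (fst p), \<kappa> (snd p)) \<in> bcomposable Q EQ}"
    have D: "fst p \<in> points E" "snd p \<in> points E" "\<pi> (src X (proj E (fst p))) = \<pi> (rng X (proj E (snd p)))"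
      if "p \<in> topspace ?D" for p
      using that by (auto simp: points_def[symmetric] bcomposable_def composable_def)
    have "continuous_map ?D (btop EQ)
        (\<lambda>p. \<kappa> (act (fst p) (transporter (src X (proj E (fst p))) (rng X (proj E (snd p)))) \<odot>\<^bsub>E\<^esub> snd p))"
      by (intro continuous_borb bdl.fell.continuous_bmult bdl.continuous_bact continuous_transporter
          bdl.fell.continuous_proj continuous_map_fst_sub continuous_map_snd_sub
          X.continuous_src X.continuous_rng)
        (use D in simp_all)
    then show "continuous_map ?D (btop EQ) (\<lambda>p. case (\<kappa> (fst p), \<kappa> (snd p)) of (x, y) \<Rightarrow> x \<odot>\<^bsub>EQ\<^esub> y)"
    proof (rule continuous_map_eq)
      fix p assume p: "p \<in> topspace ?D"
      let ?x = "act (fst p) (transporter (src X (proj E (fst p))) (rng X (proj E (snd p))))"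
      have "?x \<in> points E" "\<kappa> ?x = \<kappa> (fst p)" "src X (proj E ?x) = rng X (proj E (snd p))"
        using D[OF p] by simp_all
      then show "\<kappa> (?x \<odot>\<^bsub>E\<^esub> snd p) = (case (\<kappa> (fst p), \<kappa> (snd p)) of (x, y) \<Rightarrow> x \<odot>\<^bsub>EQ\<^esub> y)"
        using D[OF p] bmult_quot[of ?x "snd p"] by simp
    qed
  qed
  show "limitin (btop EQ) (\<lambda>b. b) (bzero EQ \<xi>) F"
    if \<xi>: "\<xi> \<in> topspace (gtop Q)" and F: "F \<le> principal (points EQ)"
      and lim: "limitin (gtop Q) (proj EQ) \<xi> F" "(bnorm EQ \<longlongrightarrow> 0) F" for \<xi> F
  proof (rule zero_limit_of_neighbourhoods[OF \<xi> F lim])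
    have "\<xi> \<in> arrows Q" using \<xi> by (simp add: arrows_def)
    then obtain x where x: "x \<in> arrows X" "\<xi> = \<pi> x" by (auto simp: arrows_quot)
    then have xt: "x \<in> topspace (gtop X)" by (simp add: arrows_def)
    show "bzero EQ \<xi> \<in> points EQ" using x xt by simp
    fix U assume U: "openin (btop EQ) U" "bzero EQ \<xi> \<in> U"
    have "bzero E x \<in> {b \<in> points E. \<kappa> b \<in> U}" using U x xt by simp
    with pre[OF U(1)] obtain V e where V: "openin (gtop X) V" "x \<in> V" "e > 0"
        "\<And>b. \<lbrakk>b \<in> points E; proj E b \<in> V; bnorm E b < e\<rbrakk> \<Longrightarrow> b \<in> {b \<in> points E. \<kappa> b \<in> U}"
      by (rule bdl.fell.zero_neighbourhood[OF xt]) (rule that)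
    show "\<exists>V e. openin (gtop Q) V \<and> \<xi> \<in> V \<and> e > 0 \<and>
        (\<forall>b. b \<in> points EQ \<and> proj EQ b \<in> V \<and> bnorm EQ b < e \<longrightarrow> b \<in> U)"
    proof (intro exI conjI allI impI)
      show "openin (gtop Q) (\<pi> ` V)" using V(1) open_quotient_orb unfolding open_quotient_def open_map_def by blast
      show "\<xi> \<in> \<pi> ` V" using V(2) x by blast
      show "e > 0" by fact
      fix \<Theta> assume \<Theta>: "\<Theta> \<in> points EQ \<and> proj EQ \<Theta> \<in> \<pi> ` V \<and> bnorm EQ \<Theta> < e"
      then obtain v where v: "v \<in> V" "proj EQ \<Theta> = \<pi> v" by blast
      have "v \<in> arrows X" using v V(1) openin_subset by (fastforce simp: arrows_def)
      \<comment> \<open>The orbit is represented by its member over \<open>v\<close> itself; it has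
        the same norm as the orbit, so the neighbourhood found in \<open>E\<close> applies.\<close>
      then obtain b where b: "b \<in> points E" "\<kappa> b = \<Theta>" "proj E b = v" using blift \<Theta> v(2) by blast
      then show "\<Theta> \<in> U" using V(4)[of b] \<Theta> v(1) by auto
    qed
  qed
  have lift2: "\<exists>b c. b \<in> points E \<and> c \<in> points E \<and> \<kappa> b = \<Theta> \<and> \<kappa> c = \<Xi> \<and> src X (proj E b) = rng X (proj E c)"
    if bc: "(\<Theta>, \<Xi>) \<in> bcomposable Q EQ" for \<Theta> \<Xi>
  proof -
    have bc': "\<Theta> \<in> points EQ" "\<Xi> \<in> points EQ" "src Q (proj EQ \<Theta>) = rng Q (proj EQ \<Xi>)"
      using bc by (simp_all add: bcomposable_def composable_def)
    obtain c where c: "c \<in> points E" "\<Xi> = \<kappa> c" using bc'(2) by (auto simp: points_quot)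
    then obtain b where "b \<in> points E" "\<kappa> b = \<Theta>" "src X (proj E b) = rng X (proj E c)"
      using blift_src[of \<Theta> "rng X (proj E c)"] bc' by auto
    then show ?thesis using c by blast
  qed
  show "proj EQ (\<Theta> \<odot>\<^bsub>EQ\<^esub> \<Xi>) = proj EQ \<Theta> \<cdot>\<^bsub>Q\<^esub> proj EQ \<Xi>" "bnorm EQ (\<Theta> \<odot>\<^bsub>EQ\<^esub> \<Xi>) \<le> bnorm EQ \<Theta> * bnorm EQ \<Xi>"
    "bstar EQ (\<Theta> \<odot>\<^bsub>EQ\<^esub> \<Xi>) = bstar EQ \<Xi> \<odot>\<^bsub>EQ\<^esub> bstar EQ \<Theta>"
    "bsmul EQ k \<Theta> \<odot>\<^bsub>EQ\<^esub> \<Xi> = bsmul EQ k (\<Theta> \<odot>\<^bsub>EQ\<^esub> \<Xi>)" "\<Theta> \<odot>\<^bsub>EQ\<^esub> bsmul EQ k \<Xi> = bsmul EQ k (\<Theta> \<odot>\<^bsub>EQ\<^esub> \<Xi>)"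
    if "(\<Theta>, \<Xi>) \<in> bcomposable Q EQ" for \<Theta> \<Xi> k
    using lift2[OF that]
    by (auto simp: bdl.fell.bnorm_bmult bdl.fell.bstar_bmult bdl.fell.bmult_bsmul)
  show "badd EQ \<Theta> \<Theta>' \<odot>\<^bsub>EQ\<^esub> \<Xi> = badd EQ (\<Theta> \<odot>\<^bsub>EQ\<^esub> \<Xi>) (\<Theta>' \<odot>\<^bsub>EQ\<^esub> \<Xi>)"
    if bc: "(\<Theta>, \<Xi>) \<in> bcomposable Q EQ" and th': "\<Theta>' \<in> fibre EQ (proj EQ \<Theta>)" for \<Theta> \<Theta>' \<Xi>
  proof -
    obtain b c where b: "b \<in> points E" "c \<in> points E" "\<kappa> b = \<Theta>" "\<kappa> c = \<Xi>"
      "src X (proj E b) = rng X (proj E c)" using lift2[OF bc] by blast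
    then obtain b' where "b' \<in> points E" "\<kappa> b' = \<Theta>'" "proj E b' = proj E b"
      using blift_fibre[of b \<Theta>'] th' by blast
    then show ?thesis using b by (auto simp: bdl.fell.bmult_badd)
  qed
  show "\<Theta> \<odot>\<^bsub>EQ\<^esub> badd EQ \<Xi> \<Xi>' = badd EQ (\<Theta> \<odot>\<^bsub>EQ\<^esub> \<Xi>) (\<Theta> \<odot>\<^bsub>EQ\<^esub> \<Xi>')"
    if bc: "(\<Theta>, \<Xi>) \<in> bcomposable Q EQ" and xi': "\<Xi>' \<in> fibre EQ (proj EQ \<Xi>)" for \<Theta> \<Xi> \<Xi>'
  proof -
    obtain b c where b: "b \<in> points E" "c \<in> points E" "\<kappa> b = \<Theta>" "\<kappa> c = \<Xi>"
      "src X (proj E b) = rng X (proj E c)" using lift2[OF bc] by blast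
    then obtain c' where "c' \<in> points E" "\<kappa> c' = \<Xi>'" "proj E c' = proj E c"
      using blift_fibre[of c \<Xi>'] xi' by blast
    then show ?thesis using b by (auto simp: bdl.fell.bmult_badd)
  qed
  show "(\<Theta> \<odot>\<^bsub>EQ\<^esub> \<Xi>) \<odot>\<^bsub>EQ\<^esub> \<Upsilon> = \<Theta> \<odot>\<^bsub>EQ\<^esub> (\<Xi> \<odot>\<^bsub>EQ\<^esub> \<Upsilon>)"
    if bc: "(\<Theta>, \<Xi>) \<in> bcomposable Q EQ" "(\<Xi>, \<Upsilon>) \<in> bcomposable Q EQ" for \<Theta> \<Xi> \<Upsilon>
  proof -
    obtain c d where c: "c \<in> points E" "d \<in> points E" "\<kappa> c = \<Xi>" "\<kappa> d = \<Upsilon>"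
      "src X (proj E c) = rng X (proj E d)" using lift2[OF bc(2)] by blast
    then have "src Q (proj EQ \<Theta>) = \<pi> (rng X (proj E c))" "\<Theta> \<in> points EQ"
      using bc(1) c(1) by (simp_all add: bcomposable_def composable_def c(3)[symmetric])
    then obtain b where b: "b \<in> points E" "\<kappa> b = \<Theta>" "src X (proj E b) = rng X (proj E c)"
      using blift_src[of \<Theta> "rng X (proj E c)"] c(1) by auto
    have "(\<kappa> b \<odot>\<^bsub>EQ\<^esub> \<kappa> c) \<odot>\<^bsub>EQ\<^esub> \<kappa> d = \<kappa> b \<odot>\<^bsub>EQ\<^esub> (\<kappa> c \<odot>\<^bsub>EQ\<^esub> \<kappa> d)"
      using b(1,3) c(1,2,5) by (simp add: bdl.fell.bmult_assoc)
    then show ?thesis unfolding b(2) c(3,4) .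
  qed
  fix \<Theta> assume "\<Theta> \<in> points EQ"
  then obtain b where b: "b \<in> points E" "\<Theta> = \<kappa> b" by (auto simp: points_quot)
  show "proj EQ (bstar EQ \<Theta>) = ginv Q (proj EQ \<Theta>)" "bstar EQ (bsmul EQ k \<Theta>) = bsmul EQ (cnj k) (bstar EQ \<Theta>)"
    "bstar EQ (bstar EQ \<Theta>) = \<Theta>" "bnorm EQ (bstar EQ \<Theta> \<odot>\<^bsub>EQ\<^esub> \<Theta>) = (bnorm EQ \<Theta>)\<^sup>2"
    "(bnorm EQ \<Theta>)\<^sup>2 = (bnorm EQ (bstar EQ \<Theta>))\<^sup>2" for k
    using b by (simp_all add: bdl.fell.star_smul bdl.fell.norm_star_mult)
  show "bstar EQ (badd EQ \<Theta> \<Theta>') = badd EQ (bstar EQ \<Theta>) (bstar EQ \<Theta>')"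
    if th': "\<Theta>' \<in> fibre EQ (proj EQ \<Theta>)" for \<Theta>'
  proof -
    obtain b' where "b' \<in> points E" "\<kappa> b' = \<Theta>'" "proj E b' = proj E b"
      using blift_fibre[of b \<Theta>'] th' b by blast
    then show ?thesis using b by (auto simp: bdl.fell.bstar_badd)
  qed
  show "cstar_positive (fibre_alg EQ (src Q (proj EQ \<Theta>))) (bstar EQ \<Theta> \<odot>\<^bsub>EQ\<^esub> \<Theta>)"
  proof -
    obtain c where c: "c \<in> points E" "proj E c = src X (proj E b)" "bstar E b \<odot>\<^bsub>E\<^esub> b = bstar E c \<odot>\<^bsub>E\<^esub> c"
      using bdl.fell.star_mult_positive'[OF b(1)] .
    then show ?thesis
      unfolding cstar_positive_def using b
      by (intro bexI[of _ "\<kappa> c"]) (simp_all add: in_fibre)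
  qed
qed

text \<open>The fibres over composable lifts map bijectively onto the given quotient fibres and
  products go to products, so the closed span in \<open>E\<close> is simply transported.\<close>

lemma saturated_quot:
  assumes "saturated X E"
  shows "saturated Q EQ"
  unfolding saturated_def
proof (intro ballI, clarify)
  fix \<xi> \<eta> assume "(\<xi>, \<eta>) \<in> composable Q"
  then obtain y where y: "y \<in> arrows X" "\<eta> = \<pi> y" "\<xi> \<in> arrows Q" "src Q \<xi> = \<pi> (rng X y)"
    by (auto simp: composable_def arrows_quot)
  then obtain x where x: "x \<in> arrows X" "\<pi> x = \<xi>" "src X x = rng X y"
    using lift_src[of \<xi> "rng X y"] by auto
  let ?S = "{a \<odot>\<^bsub>E\<^esub> b |a b. a \<in> fibre E x \<and> b \<in> fibre E y}"
  have xy: "x \<cdot>\<^bsub>X\<^esub> y \<in> topspace (gtop X)" using x y X.mul_simps(1)[of x y] by (simp add: arrows_def)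
  have "closed_span (fibre_space EQ (\<pi> (x \<cdot>\<^bsub>X\<^esub> y))) (\<kappa> ` ?S) = \<kappa> ` closed_span (fibre_space E (x \<cdot>\<^bsub>X\<^esub> y)) ?S"
    by (rule closed_span_transport[OF bdl.fell.fibre_banach[OF xy]])
      (use x y xy bij_betw_fibre_quot[of "x \<cdot>\<^bsub>X\<^esub> y"] in \<open>auto simp: in_fibre\<close>)
  moreover have "closed_span (fibre_space E (x \<cdot>\<^bsub>X\<^esub> y)) ?S = fibre E (x \<cdot>\<^bsub>X\<^esub> y)"
    using bdl.fell.saturatedD[OF assms] x y by simp
  moreover have "\<kappa> ` fibre E (x \<cdot>\<^bsub>X\<^esub> y) = fibre EQ (\<pi> (x \<cdot>\<^bsub>X\<^esub> y))"
    using bij_betw_fibre_quot[of "x \<cdot>\<^bsub>X\<^esub> y"] x y by (simp add: bij_betw_def)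
  moreover have "\<kappa> ` ?S = {a \<odot>\<^bsub>EQ\<^esub> b |a b. a \<in> fibre EQ \<xi> \<and> b \<in> fibre EQ \<eta>}"
  proof (intro equalityI subsetI)
    fix c assume "c \<in> \<kappa> ` ?S"
    then obtain a b where ab: "c = \<kappa> (a \<odot>\<^bsub>E\<^esub> b)" "a \<in> points E" "b \<in> points E" "proj E a = x" "proj E b = y"
      by (auto simp: in_fibre)
    then have "c = \<kappa> a \<odot>\<^bsub>EQ\<^esub> \<kappa> b" using x by simp
    moreover have "\<kappa> a \<in> fibre EQ \<xi>" "\<kappa> b \<in> fibre EQ \<eta>" using ab x y by (auto simp: in_fibre)
    ultimately show "c \<in> {a \<odot>\<^bsub>EQ\<^esub> b |a b. a \<in> fibre EQ \<xi> \<and> b \<in> fibre EQ \<eta>}" by blast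
  next
    fix c assume "c \<in> {a \<odot>\<^bsub>EQ\<^esub> b |a b. a \<in> fibre EQ \<xi> \<and> b \<in> fibre EQ \<eta>}"
    then obtain \<Theta> \<Xi> where c: "c = \<Theta> \<odot>\<^bsub>EQ\<^esub> \<Xi>" "\<Theta> \<in> points EQ" "\<Xi> \<in> points EQ" "proj EQ \<Theta> = \<pi> x" "proj EQ \<Xi> = \<pi> y"
      using x y by (auto simp: in_fibre)
    obtain a where a: "a \<in> points E" "\<kappa> a = \<Theta>" "proj E a = x" using blift[OF c(2) x(1) c(4)] .
    obtain b where b: "b \<in> points E" "\<kappa> b = \<Xi>" "proj E b = y" using blift[OF c(3) y(1) c(5)] .
    have "c = \<kappa> (a \<odot>\<^bsub>E\<^esub> b)" using a b c x by auto
    then show "c \<in> \<kappa> ` ?S" using a b by (auto simp: in_fibre)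
  qed
  ultimately show "closed_span (fibre_space EQ (\<xi> \<cdot>\<^bsub>Q\<^esub> \<eta>)) {a \<odot>\<^bsub>EQ\<^esub> b |a b. a \<in> fibre EQ \<xi> \<and> b \<in> fibre EQ \<eta>}
      = fibre EQ (\<xi> \<cdot>\<^bsub>Q\<^esub> \<eta>)"
    using x y by auto
qed

end


section \<open>Self-similar product Fell bundles\<close>

locale self_similar_left_product_bundle =
  self_similar_left_product H X \<alpha> + bdl: self_similar_left_bundle H X \<alpha> E act
  for H :: "'h groupoid" and X :: "'x groupoid" and \<alpha> :: "('h, 'x) left_ss"
    and E :: "('b, 'x) fell_bundle" and act :: "'h \<Rightarrow> 'b \<Rightarrow> 'b"
begin

abbreviation A where "A \<equiv> lprod_bundle X E H \<alpha> act"

lemma lprod_bundle_simps [simp]: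
  "proj A (b, h) = (proj E b, h)" "badd A (b, h) (c, k) = (badd E b c, h)"
  "bzero A (x, h) = (bzero E x, h)" "bsmul A w (b, h) = (bsmul E w b, h)" "bnorm A (b, h) = bnorm E b"
  "(b, h) \<odot>\<^bsub>A\<^esub> (c, k) = (b \<odot>\<^bsub>E\<^esub> act h c, (h \<triangleleft>\<^bsub>\<alpha>\<^esub> proj E c) \<cdot>\<^bsub>H\<^esub> k)"
  "bstar A (b, h) = (act (ginv H h) (bstar E b), ginv H h \<triangleleft>\<^bsub>\<alpha>\<^esub> proj E (bstar E b))"
  by (simp_all add: lprod_bundle_def)

lemma btop_lprod:
  "btop A = subtopology (prod_topology (btop E) (gtop H)) {p. (proj E (fst p), snd p) \<in> arrows K}"
  by (simp add: lprod_bundle_def case_prod_unfold)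

lemma points_lprod:
  "(b, h) \<in> points A \<longleftrightarrow> b \<in> points E \<and> h \<in> arrows H \<and> lmom \<alpha> (src X (proj E b)) = rng H h"
  by (auto simp: points_def btop_lprod arrows_lprod bdl.fell.proj_arrow[unfolded points_def])
    (simp_all add: arrows_def)

lemma continuous_lprod_bundle_iff:
  "continuous_map T (btop A) (\<lambda>p. (f p, g p)) \<longleftrightarrow>
    continuous_map T (btop E) f \<and> continuous_map T (gtop H) g \<and> (\<forall>p\<in>topspace T. (f p, g p) \<in> points A)"
proof -
  have "continuous_map T (btop A) (\<lambda>p. (f p, g p)) \<longleftrightarrow>
    continuous_map T (btop E) f \<and> continuous_map T (gtop H) g \<and>
    (\<forall>p\<in>topspace T. (proj E (f p), g p) \<in> arrows K)"
    by (auto simp: btop_lprod continuous_map_in_subtopology continuous_map_pairwise o_def)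
  moreover have "(proj E (f p), g p) \<in> arrows K \<longleftrightarrow> (f p, g p) \<in> points A"
    if "continuous_map T (btop E) f" "continuous_map T (gtop H) g" "p \<in> topspace T" for p
    using bdl.fell.continuous_point[OF that(1,3)] H.continuous_arrow[OF that(2,3)]
    by (simp add: arrows_lprod points_lprod)
  ultimately show ?thesis by blast
qed

lemma continuous_lprod_bundle_proj:
  "continuous_map T (btop A) f \<Longrightarrow> continuous_map T (btop E) (\<lambda>p. fst (f p))"
  "continuous_map T (btop A) f \<Longrightarrow> continuous_map T (gtop H) (\<lambda>p. snd (f p))"
  using continuous_lprod_bundle_iff[of T "\<lambda>p. fst (f p)" "\<lambda>p. snd (f p)"] by simp_all

text \<open>The projection is that of \<open>E\<close> times the identity of \<open>H\<close>,
  restricted to a full preimage; continuity, openness and surjectivity come together.\<close>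

lemma open_quotient_proj_lprod: "open_quotient (btop A) (gtop K) (proj A)"
proof -
  have "open_quotient (btop E) (gtop X) (proj E)"
    using bdl.fell.proj_continuous bdl.fell.proj_open bdl.fell.proj_surj
    by (simp add: open_quotient_def points_def)
  from open_quotient_restrict[OF open_quotient_prod[OF this open_quotient_id[of "gtop H"]], of "arrows K"]
  show ?thesis by (simp add: btop_lprod gtop_lprod[symmetric] lprod_bundle_def case_prod_unfold)
qed

lemma composable_lprod_bundle:
  "((b, h), (c, k)) \<in> bcomposable K A \<longleftrightarrow>
    b \<in> points E \<and> h \<in> arrows H \<and> lmom \<alpha> (src X (proj E b)) = rng H h \<and>
    c \<in> points E \<and> k \<in> arrows H \<and> lmom \<alpha> (src X (proj E c)) = rng H k \<and>
    src H h = lmom \<alpha> (rng X (proj E c)) \<and> src X (proj E b) = h \<triangleright>\<^bsub>\<alpha>\<^esub> rng X (proj E c)"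
  using composable_lprod[of "proj E b" h "proj E c" k]
  by (auto simp: bcomposable_def points_lprod composable_def arrows_lprod)

lemma bij_betw_fibre_lprod:
  assumes "(x, h) \<in> arrows K"
  shows "bij_betw (\<lambda>b. (b, h)) (fibre E x) (fibre A (x, h))"
  by (rule bij_betw_byWitness[of _ fst])
    (use assms in \<open>auto simp: in_fibre points_lprod arrows_lprod\<close>)

lemma bstar_lprod_point:
  assumes "(b, h) \<in> points A"
  shows "bstar A (b, h) \<in> points A" "proj A (bstar A (b, h)) = ginv K (proj E b, h)"
  using assms topological_groupoid.inv_closed[OF topological_groupoid_lprod, of "(proj E b, h)"]
  by (auto simp: points_lprod inv_lprod arrows_lprod)

lemma bmult_lprod_point:
  assumes "(p, q) \<in> bcomposable K A"
  shows "p \<odot>\<^bsub>A\<^esub> q \<in> points A" "proj A (p \<odot>\<^bsub>A\<^esub> q) = proj A p \<cdot>\<^bsub>K\<^esub> proj A q"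
proof -
  obtain b h c k where p: "p = (b, h)" "q = (c, k)" by fastforce
  note c = assms[unfolded p composable_lprod_bundle]
  show "p \<odot>\<^bsub>A\<^esub> q \<in> points A" using c unfolding p by (simp add: points_lprod)
  show "proj A (p \<odot>\<^bsub>A\<^esub> q) = proj A p \<cdot>\<^bsub>K\<^esub> proj A q" using c unfolding p by (simp add: mult_lprod)
qed

text \<open>The second coordinate only labels the fibres, so the analytic axioms are those of
  \<open>E\<close>. The action enters product and involution, where its being isometric preserves
  the norm conditions.\<close>

lemma fell_bundle_lprod: "fell_bundle K A"
proof (intro fell_bundle.intro usc_banach_bundle.intro fell_bundle_axioms.intro topological_groupoid_lprod)
  interpret K: topological_groupoid K by (rule topological_groupoid_lprod)
  show "continuous_map (btop A) (gtop K) (proj A)" "open_map (btop A) (gtop K) (proj A)"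
    "proj A ` points A = topspace (gtop K)"
    using open_quotient_proj_lprod by (simp_all add: open_quotient_def points_def)
  have pts: "fst p \<in> points E" "snd p \<in> arrows H" "lmom \<alpha> (src X (proj E (fst p))) = rng H (snd p)"
    if "p \<in> points A" for p
    using that by (cases p; simp add: points_lprod)+
  note idc = continuous_lprod_bundle_proj[OF continuous_map_id[unfolded id_def]]
  show "complex_banach (fibre_space A \<xi>)" if "\<xi> \<in> topspace (gtop K)" for \<xi>
  proof -
    obtain x h where x: "\<xi> = (x, h)" by fastforce
    then have xh: "(x, h) \<in> arrows K" using that by (simp add: arrows_def)
    then have xt: "x \<in> topspace (gtop X)" unfolding arrows_lprod by (simp add: arrows_def)
    show ?thesis unfolding x
      by (rule complex_banach_transport[OF bdl.fell.fibre_banach[OF xt] bij_betw_fibre_lprod[OF xh, folded fibre_space_simps(1)[of E x] fibre_space_simps(1)[of A]]])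
        simp_all
  qed
  show "openin (btop A) {p \<in> points A. bnorm A p < r}" for r
  proof -
    have "openin (btop A) {p \<in> topspace (btop A). fst p \<in> {b \<in> points E. bnorm E b < r}}"
      by (rule openin_continuous_map_preimage[OF _ bdl.fell.norm_usc]) (use idc in simp)
    moreover have "{p \<in> topspace (btop A). fst p \<in> {b \<in> points E. bnorm E b < r}} = {p \<in> points A. bnorm A p < r}"
      by (auto simp: points_def[symmetric] pts) (simp_all add: points_lprod)
    ultimately show ?thesis by simp
  qed
  show "continuous_map (subtopology (prod_topology (btop A) (btop A)) {(a, b). proj A a = proj A b}) (btop A)
      (\<lambda>(a, b). badd A a b)"
  proof -
    define D where "D = subtopology (prod_topology (btop A) (btop A)) {(a, b). proj A a = proj A b}"
    have DD: "fst p \<in> points A" "snd p \<in> points A" "proj E (fst (fst p)) = proj E (fst (snd p))"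
      "snd (fst p) = snd (snd p)" if "p \<in> topspace D" for p
      using that by (auto simp: D_def points_def[symmetric])
    have c: "continuous_map D (btop A) fst" "continuous_map D (btop A) snd"
      by (simp_all add: D_def continuous_map_fst_sub continuous_map_snd_sub)
    note cc = continuous_lprod_bundle_proj[OF c(1)] continuous_lprod_bundle_proj[OF c(2)]
    have "continuous_map D (btop A) (\<lambda>p. (badd E (fst (fst p)) (fst (snd p)), snd (fst p)))"
      unfolding continuous_lprod_bundle_iff
      by (intro conjI bdl.fell.continuous_badd cc ballI)
        (use DD pts in \<open>simp_all add: points_lprod\<close>)
    then show ?thesis unfolding D_def by (rule continuous_map_eq) auto
  qed
  show "continuous_map (btop A) (btop A) (bsmul A w)" for w
  proof -
    have "continuous_map (btop A) (btop A) (\<lambda>p. (bsmul E w (fst p), snd p))"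
      unfolding continuous_lprod_bundle_iff
      using continuous_map_compose[OF idc(1) bdl.fell.smul_continuous[of w]] idc(2)
      by (auto simp: points_def[symmetric] points_lprod o_def)
    then show ?thesis by (rule continuous_map_eq) auto
  qed
  show "continuous_map (btop A) (btop A) (bstar A)"
  proof -
    have "continuous_map (btop A) (btop A)
        (\<lambda>p. (act (ginv H (snd p)) (bstar E (fst p)), ginv H (snd p) \<triangleleft>\<^bsub>\<alpha>\<^esub> proj E (bstar E (fst p))))"
      unfolding continuous_lprod_bundle_iff
      by (intro conjI bdl.continuous_bact continuous_lres H.continuous_inv bdl.fell.continuous_bstar
          bdl.fell.continuous_proj ballI)
        (use idc pts bstar_lprod_point(1) in \<open>auto simp: points_def[symmetric]\<close>)
    then show ?thesis by (rule continuous_map_eq) auto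
  qed
  show "continuous_map (subtopology (prod_topology (btop A) (btop A)) (bcomposable K A)) (btop A)
      (\<lambda>(a, b). a \<odot>\<^bsub>A\<^esub> b)"
  proof -
    define D where "D = subtopology (prod_topology (btop A) (btop A)) (bcomposable K A)"
    have DD: "fst (fst p) \<in> points E" "fst (snd p) \<in> points E" "snd (fst p) \<in> arrows H" "snd (snd p) \<in> arrows H"
      "src H (snd (fst p)) = lmom \<alpha> (rng X (proj E (fst (snd p))))"
      "src X (proj E (fst (fst p))) = snd (fst p) \<triangleright>\<^bsub>\<alpha>\<^esub> rng X (proj E (fst (snd p)))"
      "lmom \<alpha> (src X (proj E (fst (snd p)))) = rng H (snd (snd p))"
      if "p \<in> topspace D" for p
      using that composable_lprod_bundle[of "fst (fst p)" "snd (fst p)" "fst (snd p)" "snd (snd p)"]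
      by (auto simp: D_def)
    have c: "continuous_map D (btop A) fst" "continuous_map D (btop A) snd"
      by (simp_all add: D_def continuous_map_fst_sub continuous_map_snd_sub)
    note cc = continuous_lprod_bundle_proj[OF c(1)] continuous_lprod_bundle_proj[OF c(2)]
    have "continuous_map D (btop A) (\<lambda>p. (fst (fst p) \<odot>\<^bsub>E\<^esub> act (snd (fst p)) (fst (snd p)),
        (snd (fst p) \<triangleleft>\<^bsub>\<alpha>\<^esub> proj E (fst (snd p))) \<cdot>\<^bsub>H\<^esub> snd (snd p)))"
      unfolding continuous_lprod_bundle_iff
      by (intro conjI bdl.fell.continuous_bmult bdl.continuous_bact H.continuous_mult continuous_lres
          bdl.fell.continuous_proj cc ballI)
        (use DD in \<open>simp_all add: points_lprod\<close>)
    then show ?thesis unfolding D_def by (rule continuous_map_eq) auto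
  qed
  show "limitin (btop A) (\<lambda>b. b) (bzero A \<xi>) F"
    if \<xi>: "\<xi> \<in> topspace (gtop K)" and F: "F \<le> principal (points A)"
      and lim: "limitin (gtop K) (proj A) \<xi> F" "(bnorm A \<longlongrightarrow> 0) F" for \<xi> F
  proof (rule zero_limit_of_neighbourhoods[OF \<xi> F lim])
    obtain x h where x: "\<xi> = (x, h)" by fastforce
    then have xh: "(x, h) \<in> arrows K" using \<xi> by (simp add: arrows_def)
    then have xt: "x \<in> topspace (gtop X)" unfolding arrows_lprod by (simp add: arrows_def)
    show "bzero A \<xi> \<in> points A" using xh xt by (simp add: x points_lprod arrows_lprod)
    fix U assume U: "openin (btop A) U" "bzero A \<xi> \<in> U"
    then obtain W where W: "openin (prod_topology (btop E) (gtop H)) W"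
        "U = W \<inter> {p. (proj E (fst p), snd p) \<in> arrows K}"
      unfolding btop_lprod openin_subtopology by blast
    have "(bzero E x, h) \<in> W" using U(2) W(2) by (simp add: x)
    then obtain U1 U2 where U12: "openin (btop E) U1" "openin (gtop H) U2" "bzero E x \<in> U1" "h \<in> U2" "U1 \<times> U2 \<subseteq> W"
      using W(1) unfolding openin_prod_topology_alt by metis
    obtain V e where V: "openin (gtop X) V" "x \<in> V" "e > 0"
        "\<And>b. \<lbrakk>b \<in> points E; proj E b \<in> V; bnorm E b < e\<rbrakk> \<Longrightarrow> b \<in> U1"
      by (rule bdl.fell.zero_neighbourhood[OF xt U12(1,3)]) (rule that)
    show "\<exists>V e. openin (gtop K) V \<and> \<xi> \<in> V \<and> e > 0 \<and>
        (\<forall>b. b \<in> points A \<and> proj A b \<in> V \<and> bnorm A b < e \<longrightarrow> b \<in> U)"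
    proof (intro exI conjI allI impI)
      \<comment> \<open>Norm and first coordinate are controlled by \<open>V\<close> and
        \<open>e\<close>; the second coordinate has to be confined to \<open>U2\<close> by the
        neighbourhood in \<open>K\<close>.\<close>
      show "openin (gtop K) (V \<times> U2 \<inter> arrows K)"
        unfolding gtop_lprod by (simp add: openin_subtopology_Int openin_prod_Times_iff V(1) U12(2))
      show "\<xi> \<in> V \<times> U2 \<inter> arrows K" using xh V(2) U12(4) x by simp
      show "e > 0" by fact
      fix p assume "p \<in> points A \<and> proj A p \<in> V \<times> U2 \<inter> arrows K \<and> bnorm A p < e"
      then have "fst p \<in> U1" "snd p \<in> U2" "(proj E (fst p), snd p) \<in> arrows K"
        using V(4)[of "fst p"] pts(1)[of p] by (cases p; auto)+
      then show "p \<in> U" using U12(5) W(2) by (cases p) auto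
    qed
  qed
  show "proj A (p \<odot>\<^bsub>A\<^esub> q) = proj A p \<cdot>\<^bsub>K\<^esub> proj A q" if "(p, q) \<in> bcomposable K A" for p q
    using bmult_lprod_point(2)[OF that] .
  show "bnorm A (p \<odot>\<^bsub>A\<^esub> q) \<le> bnorm A p * bnorm A q"
    "bsmul A w p \<odot>\<^bsub>A\<^esub> q = bsmul A w (p \<odot>\<^bsub>A\<^esub> q)" "p \<odot>\<^bsub>A\<^esub> bsmul A w q = bsmul A w (p \<odot>\<^bsub>A\<^esub> q)"
    if pq: "(p, q) \<in> bcomposable K A" for p q w
  proof -
    obtain b h c k where p: "p = (b, h)" "q = (c, k)" by fastforce
    note c = pq[unfolded p composable_lprod_bundle]
    show "bnorm A (p \<odot>\<^bsub>A\<^esub> q) \<le> bnorm A p * bnorm A q"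
      using c bdl.fell.bnorm_bmult[of b "act h c"] unfolding p by simp
    show "bsmul A w p \<odot>\<^bsub>A\<^esub> q = bsmul A w (p \<odot>\<^bsub>A\<^esub> q)" "p \<odot>\<^bsub>A\<^esub> bsmul A w q = bsmul A w (p \<odot>\<^bsub>A\<^esub> q)"
      using c unfolding p by (simp_all add: bdl.fell.bmult_bsmul bdl.bact_bsmul)
  qed
  show "badd A p p' \<odot>\<^bsub>A\<^esub> q = badd A (p \<odot>\<^bsub>A\<^esub> q) (p' \<odot>\<^bsub>A\<^esub> q)"
    if pq: "(p, q) \<in> bcomposable K A" "p' \<in> fibre A (proj A p)" for p p' q
  proof -
    obtain b h c k b' h' where p: "p = (b, h)" "q = (c, k)" "p' = (b', h')" by (metis surj_pair)
    note c = pq(1)[unfolded p composable_lprod_bundle]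
    have "b' \<in> points E" "proj E b' = proj E b" "h' = h"
      using pq(2) unfolding p by (auto simp: in_fibre points_lprod)
    then show ?thesis using c unfolding p by (simp add: bdl.fell.bmult_badd)
  qed
  show "p \<odot>\<^bsub>A\<^esub> badd A q q' = badd A (p \<odot>\<^bsub>A\<^esub> q) (p \<odot>\<^bsub>A\<^esub> q')"
    if pq: "(p, q) \<in> bcomposable K A" "q' \<in> fibre A (proj A q)" for p q q'
  proof -
    obtain b h c k c' k' where p: "p = (b, h)" "q = (c, k)" "q' = (c', k')" by (metis surj_pair)
    note c = pq(1)[unfolded p composable_lprod_bundle]
    have c': "c' \<in> points E" "proj E c' = proj E c" "k' = k"
      using pq(2) unfolding p by (auto simp: in_fibre points_lprod)
    have "b \<odot>\<^bsub>E\<^esub> badd E (act h c) (act h c') = badd E (b \<odot>\<^bsub>E\<^esub> act h c) (b \<odot>\<^bsub>E\<^esub> act h c')"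
      using c c' by (intro bdl.fell.bmult_badd) simp_all
    then show ?thesis using c c' unfolding p by (simp add: bdl.bact_badd)
  qed
  show "(p \<odot>\<^bsub>A\<^esub> q) \<odot>\<^bsub>A\<^esub> r = p \<odot>\<^bsub>A\<^esub> (q \<odot>\<^bsub>A\<^esub> r)"
    if pq: "(p, q) \<in> bcomposable K A" and qr: "(q, r) \<in> bcomposable K A" for p q r
  proof -
    obtain b h c k d l where p: "p = (b, h)" "q = (c, k)" "r = (d, l)" by (metis surj_pair)
    note c = pq[unfolded p composable_lprod_bundle] and d = qr[unfolded p composable_lprod_bundle]
    show ?thesis
      using c d unfolding p
      by (simp add: bdl.fell.bmult_assoc bdl.bact_bmult bdl.mult_bact mult_lres H.assoc)
  qed
  show "proj A (bstar A p) = ginv K (proj A p)" if "p \<in> points A" for p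
    using that bstar_lprod_point(2) by (cases p) simp
  show "bstar A (badd A p q) = badd A (bstar A p) (bstar A q)" if "p \<in> points A" "q \<in> fibre A (proj A p)" for p q
  proof -
    obtain b h c k where p: "p = (b, h)" "q = (c, k)" by fastforce
    have c: "b \<in> points E" "h \<in> arrows H" "lmom \<alpha> (src X (proj E b)) = rng H h"
      "c \<in> points E" "proj E c = proj E b" "k = h"
      using that unfolding p by (auto simp: in_fibre points_lprod)
    have "act (ginv H h) (badd E (bstar E b) (bstar E c))
        = badd E (act (ginv H h) (bstar E b)) (act (ginv H h) (bstar E c))"
      using c by (intro bdl.bact_badd) simp_all
    then show ?thesis using c unfolding p by (simp add: bdl.fell.bstar_badd)
  qed
  show "bstar A (p \<odot>\<^bsub>A\<^esub> q) = bstar A q \<odot>\<^bsub>A\<^esub> bstar A p" if pq: "(p, q) \<in> bcomposable K A" for p q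
  proof -
    obtain b h c k where p: "p = (b, h)" "q = (c, k)" by fastforce
    note c = pq[unfolded p composable_lprod_bundle]
    let ?y = "proj E c"
    have hy: "h \<triangleleft>\<^bsub>\<alpha>\<^esub> ?y \<in> arrows H" "src H (h \<triangleleft>\<^bsub>\<alpha>\<^esub> ?y) = rng H k"
      using c by simp_all
    have yy: "ginv X ?y \<in> arrows X" "src H (h \<triangleleft>\<^bsub>\<alpha>\<^esub> ?y) = lmom \<alpha> (rng X (ginv X ?y))"
      using c by simp_all
    \<comment> \<open>The inverse of the product is expanded and L6 applied; the residual of
      \<open>h\<close> then cancels against its inverse, both in the translate and in the
      residual.\<close>
    have "ginv H ((h \<triangleleft>\<^bsub>\<alpha>\<^esub> ?y) \<cdot>\<^bsub>H\<^esub> k) \<triangleleft>\<^bsub>\<alpha>\<^esub> ((h \<triangleleft>\<^bsub>\<alpha>\<^esub> ?y) \<triangleright>\<^bsub>\<alpha>\<^esub> ginv X ?y)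
        = (ginv H k \<triangleleft>\<^bsub>\<alpha>\<^esub> (ginv H (h \<triangleleft>\<^bsub>\<alpha>\<^esub> ?y) \<triangleright>\<^bsub>\<alpha>\<^esub> ((h \<triangleleft>\<^bsub>\<alpha>\<^esub> ?y) \<triangleright>\<^bsub>\<alpha>\<^esub> ginv X ?y))) \<cdot>\<^bsub>H\<^esub> (ginv H (h \<triangleleft>\<^bsub>\<alpha>\<^esub> ?y) \<triangleleft>\<^bsub>\<alpha>\<^esub> ((h \<triangleleft>\<^bsub>\<alpha>\<^esub> ?y) \<triangleright>\<^bsub>\<alpha>\<^esub> ginv X ?y))"
      using c hy by (subst mult_lres[symmetric]) (simp_all add: H.inv_mult)
    also have "ginv H (h \<triangleleft>\<^bsub>\<alpha>\<^esub> ?y) \<triangleright>\<^bsub>\<alpha>\<^esub> ((h \<triangleleft>\<^bsub>\<alpha>\<^esub> ?y) \<triangleright>\<^bsub>\<alpha>\<^esub> ginv X ?y) = ginv X ?y"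
      using c hy(1) yy by (intro inv_lact_lact)
    also have "ginv H (h \<triangleleft>\<^bsub>\<alpha>\<^esub> ?y) \<triangleleft>\<^bsub>\<alpha>\<^esub> ((h \<triangleleft>\<^bsub>\<alpha>\<^esub> ?y) \<triangleright>\<^bsub>\<alpha>\<^esub> ginv X ?y) = ginv H h"
      using inv_lres[OF hy(1) yy] c by simp
    finally have res: "ginv H ((h \<triangleleft>\<^bsub>\<alpha>\<^esub> ?y) \<cdot>\<^bsub>H\<^esub> k) \<triangleleft>\<^bsub>\<alpha>\<^esub> ((h \<triangleleft>\<^bsub>\<alpha>\<^esub> ?y) \<triangleright>\<^bsub>\<alpha>\<^esub> ginv X ?y) = (ginv H k \<triangleleft>\<^bsub>\<alpha>\<^esub> ginv X ?y) \<cdot>\<^bsub>H\<^esub> ginv H h" .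
    have 1: "act (ginv H ((h \<triangleleft>\<^bsub>\<alpha>\<^esub> ?y) \<cdot>\<^bsub>H\<^esub> k)) (act (h \<triangleleft>\<^bsub>\<alpha>\<^esub> ?y) (bstar E c)) = act (ginv H k) (bstar E c)"
      using c hy by (simp add: H.inv_mult bdl.mult_bact[symmetric])
    have "act (ginv H ((h \<triangleleft>\<^bsub>\<alpha>\<^esub> ?y) \<cdot>\<^bsub>H\<^esub> k)) (bstar E (b \<odot>\<^bsub>E\<^esub> act h c))
        = act (ginv H ((h \<triangleleft>\<^bsub>\<alpha>\<^esub> ?y) \<cdot>\<^bsub>H\<^esub> k)) (act (h \<triangleleft>\<^bsub>\<alpha>\<^esub> ?y) (bstar E c) \<odot>\<^bsub>E\<^esub> bstar E b)"
      using c by (simp add: bdl.fell.bstar_bmult bdl.bact_bstar)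
    also have "\<dots> = act (ginv H ((h \<triangleleft>\<^bsub>\<alpha>\<^esub> ?y) \<cdot>\<^bsub>H\<^esub> k)) (act (h \<triangleleft>\<^bsub>\<alpha>\<^esub> ?y) (bstar E c)) \<odot>\<^bsub>E\<^esub>
        act (ginv H ((h \<triangleleft>\<^bsub>\<alpha>\<^esub> ?y) \<cdot>\<^bsub>H\<^esub> k) \<triangleleft>\<^bsub>\<alpha>\<^esub> ((h \<triangleleft>\<^bsub>\<alpha>\<^esub> ?y) \<triangleright>\<^bsub>\<alpha>\<^esub> ginv X ?y)) (bstar E b)"
      using c hy by (subst bdl.bact_bmult) simp_all
    also have "\<dots> = act (ginv H k) (bstar E c) \<odot>\<^bsub>E\<^esub> act (ginv H k \<triangleleft>\<^bsub>\<alpha>\<^esub> ginv X ?y) (act (ginv H h) (bstar E b))"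
      unfolding 1 res using c by (subst bdl.mult_bact) simp_all
    finally have first: "fst (bstar A (p \<odot>\<^bsub>A\<^esub> q)) = fst (bstar A q \<odot>\<^bsub>A\<^esub> bstar A p)"
      unfolding p using c by simp
    \<comment> \<open>The second coordinates are part of the projections to \<open>K\<close>, and
      there the rule for the inverse of a product is already available.\<close>
    have a: "proj A p \<in> arrows K" "proj A q \<in> arrows K" "src K (proj A p) = rng K (proj A q)"
      using pq by (auto simp: bcomposable_def composable_def)
    have pts': "p \<in> points A" "q \<in> points A" using pq by (auto simp: bcomposable_def)
    have st: "proj A (bstar A p) = ginv K (proj A p)" "proj A (bstar A q) = ginv K (proj A q)"
      using pts' bstar_lprod_point(2) unfolding p by simp_all
    have "(bstar A q, bstar A p) \<in> bcomposable K A"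
    proof -
      have "bstar A p \<in> points A" "bstar A q \<in> points A"
        using pts' bstar_lprod_point(1)[of b h] bstar_lprod_point(1)[of c k] unfolding p by blast+
      then show ?thesis using a by (simp add: bcomposable_def composable_def st)
    qed
    then have "proj A (bstar A q \<odot>\<^bsub>A\<^esub> bstar A p) = ginv K (proj A q) \<cdot>\<^bsub>K\<^esub> ginv K (proj A p)"
      using bmult_lprod_point(2) st by simp
    moreover have "proj A (bstar A (p \<odot>\<^bsub>A\<^esub> q)) = ginv K (proj A p \<cdot>\<^bsub>K\<^esub> proj A q)"
      using bmult_lprod_point[OF pq] bstar_lprod_point(2)[of "fst (p \<odot>\<^bsub>A\<^esub> q)" "snd (p \<odot>\<^bsub>A\<^esub> q)"]
      by (metis lprod_bundle_simps(1) prod.collapse)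
    ultimately have "proj A (bstar A (p \<odot>\<^bsub>A\<^esub> q)) = proj A (bstar A q \<odot>\<^bsub>A\<^esub> bstar A p)"
      using a K.inv_mult by simp
    then have "snd (bstar A (p \<odot>\<^bsub>A\<^esub> q)) = snd (bstar A q \<odot>\<^bsub>A\<^esub> bstar A p)"
      by (metis lprod_bundle_simps(1) prod.collapse snd_conv)
    then show ?thesis using first by (simp add: prod_eq_iff)
  qed
  fix p assume p_pt: "p \<in> points A"
  obtain b h where p: "p = (b, h)" by fastforce
  have c: "b \<in> points E" "h \<in> arrows H" "lmom \<alpha> (src X (proj E b)) = rng H h"
    using p_pt unfolding p by (simp_all add: points_lprod)
  show "bstar A (bsmul A w p) = bsmul A (cnj w) (bstar A p)" for w
    using c unfolding p by (simp add: bdl.fell.star_smul bdl.bact_bsmul)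
  show "(bnorm A p)\<^sup>2 = (bnorm A (bstar A p))\<^sup>2" using c unfolding p by simp
  have mult: "act (ginv H h) (bstar E b) \<odot>\<^bsub>E\<^esub> act (ginv H h \<triangleleft>\<^bsub>\<alpha>\<^esub> ginv X (proj E b)) b = act (ginv H h) (bstar E b \<odot>\<^bsub>E\<^esub> b)"
    using c by (subst bdl.bact_bmult) simp_all
  show "bnorm A (bstar A p \<odot>\<^bsub>A\<^esub> p) = (bnorm A p)\<^sup>2"
    using c mult bdl.fell.norm_star_mult[of b] unfolding p by simp
  show "bstar A (bstar A p) = p"
  proof -
    have "fst (bstar A (bstar A p)) = b"
      using c bdl.bact_bstar[of "ginv H h" "bstar E b"]
        bdl.inv_bact_bact(1)[of "ginv H h \<triangleleft>\<^bsub>\<alpha>\<^esub> ginv X (proj E b)" b]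
      unfolding p by simp
    moreover have "proj A (bstar A (bstar A p)) = proj A p"
      using bstar_lprod_point(2)[of b h] p_pt p bstar_lprod_point(1)[of b h]
        bstar_lprod_point(2)[of "fst (bstar A p)" "snd (bstar A p)"]
        K.inv_inv[of "(proj E b, h)"] c
      by (metis arrows_lprod bdl.fell.proj_arrow lprod_bundle_simps(1) prod.collapse)
    ultimately show ?thesis
      unfolding p by (metis lprod_bundle_simps(1) prod.collapse snd_conv)
  qed
  show "cstar_positive (fibre_alg A (src K (proj A p))) (bstar A p \<odot>\<^bsub>A\<^esub> p)"
  proof -
    obtain d where d: "d \<in> points E" "proj E d = src X (proj E b)" "bstar E b \<odot>\<^bsub>E\<^esub> b = bstar E d \<odot>\<^bsub>E\<^esub> d"
      using c(1) by (rule bdl.fell.star_mult_positive') (rule that)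
    let ?u = "src X (proj E b)"
    have u: "?u \<in> units X" "proj E d \<in> units X" using c d by simp_all
    have sp: "src K (proj A p) = (ginv H h \<triangleright>\<^bsub>\<alpha>\<^esub> ?u, src H h)"
      using c unfolding p by (simp add: src_lprod arrows_lprod)
    have hd: "act (ginv H h) d \<in> points E" "proj E (act (ginv H h) d) = ginv H h \<triangleright>\<^bsub>\<alpha>\<^esub> ?u"
      "ginv H h \<triangleright>\<^bsub>\<alpha>\<^esub> ?u \<in> units X" using c d u by simp_all
    \<comment> \<open>On a unit fibre the inverse of \<open>h\<close> respects products and
      adjoints, so it takes the factorization by \<open>d\<close> to one in the fibre over the
      source of the projection of \<open>p\<close>.\<close>
    have star: "bstar E (act (ginv H h) d) = act (ginv H h) (bstar E d)"
      using c d u bdl.bact_bstar[of "ginv H h" d] by simp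
    have sq: "act (ginv H h) (bstar E d) \<odot>\<^bsub>E\<^esub> act (ginv H h) d = act (ginv H h) (bstar E d \<odot>\<^bsub>E\<^esub> d)"
      using c d u by (subst bdl.bact_bmult) simp_all
    have "bstar A p \<odot>\<^bsub>A\<^esub> p = (act (ginv H h) (bstar E b \<odot>\<^bsub>E\<^esub> b), src H h)"
      using c mult lres_lres_inv[of "ginv H h" "ginv X (proj E b)"] unfolding p by simp
    moreover have "bstar A (act (ginv H h) d, src H h) \<odot>\<^bsub>A\<^esub> (act (ginv H h) d, src H h)
        = (act (ginv H h) (bstar E d \<odot>\<^bsub>E\<^esub> d), src H h)"
      using c d u hd star sq H.mul_simps(4)[of "src H h"] by simp
    moreover have "(act (ginv H h) d, src H h) \<in> fibre A (src K (proj A p))"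
      using c hd unfolding sp by (simp add: in_fibre points_lprod)
    ultimately show ?thesis
      unfolding cstar_positive_def using d(3)
      by (intro bexI[of _ "(act (ginv H h) d, src H h)"]) simp_all
  qed
qed

text \<open>Acting by \<open>h\<close> is a bijection from the fibre over \<open>y\<close> to the
  fibre over \<open>h \<triangleright> y\<close>. The products in \<open>A\<close> are thus the
  products in \<open>E\<close> of the fibres over \<open>x\<close> and
  \<open>h \<triangleright> y\<close>, all with the same second coordinate.\<close>

lemma saturated_lprod:
  assumes "saturated X E"
  shows "saturated K A"
  unfolding saturated_def
proof (intro ballI, clarify)
  fix x h y k assume "((x, h), (y, k)) \<in> composable K"
  then have xy: "(x, h) \<in> arrows K" "(y, k) \<in> arrows K" "src H h = lmom \<alpha> (rng X y)" "src X x = h \<triangleright>\<^bsub>\<alpha>\<^esub> rng X y"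
    using composable_lprod[of x h y k] by (simp_all add: composable_def)
  then have a: "x \<in> arrows X" "y \<in> arrows X" "h \<in> arrows H" "k \<in> arrows H" "lmom \<alpha> (src X y) = rng H k"
    "lmom \<alpha> (src X x) = rng H h"
    by (simp_all add: arrows_lprod)
  let ?z = "x \<cdot>\<^bsub>X\<^esub> (h \<triangleright>\<^bsub>\<alpha>\<^esub> y)" and ?l = "(h \<triangleleft>\<^bsub>\<alpha>\<^esub> y) \<cdot>\<^bsub>H\<^esub> k"
  let ?S = "{a \<odot>\<^bsub>E\<^esub> b |a b. a \<in> fibre E x \<and> b \<in> fibre E (h \<triangleright>\<^bsub>\<alpha>\<^esub> y)}"
  have z: "?z \<in> arrows X" "?z \<in> topspace (gtop X)" "(?z, ?l) \<in> arrows K"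
    using a xy X.mul_simps(1)[of x "h \<triangleright>\<^bsub>\<alpha>\<^esub> y"] by (simp_all add: arrows_def[symmetric] arrows_lprod)
  have "closed_span (fibre_space A (?z, ?l)) ((\<lambda>b. (b, ?l)) ` ?S) = (\<lambda>b. (b, ?l)) ` closed_span (fibre_space E ?z) ?S"
    by (rule closed_span_transport[OF bdl.fell.fibre_banach[OF z(2)]])
      (use a xy bij_betw_fibre_lprod[OF z(3)] in \<open>auto simp: in_fibre\<close>)
  moreover have "closed_span (fibre_space E ?z) ?S = fibre E ?z"
    using bdl.fell.saturatedD[OF assms] a xy by simp
  moreover have "(\<lambda>b. (b, ?l)) ` fibre E ?z = fibre A (?z, ?l)"
    using bij_betw_fibre_lprod[OF z(3)] by (simp add: bij_betw_def)
  moreover have "(\<lambda>b. (b, ?l)) ` ?S = {p \<odot>\<^bsub>A\<^esub> q |p q. p \<in> fibre A (x, h) \<and> q \<in> fibre A (y, k)}"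
  proof (intro equalityI subsetI)
    fix c assume "c \<in> (\<lambda>b. (b, ?l)) ` ?S"
    then obtain b d where bd: "c = (b \<odot>\<^bsub>E\<^esub> d, ?l)" "b \<in> points E" "d \<in> points E" "proj E b = x" "proj E d = h \<triangleright>\<^bsub>\<alpha>\<^esub> y"
      by (auto simp: in_fibre)
    let ?d = "act (ginv H h) d"
    have d: "?d \<in> points E" "proj E ?d = y" "act h ?d = d" using bd a xy by simp_all
    have "c = (b, h) \<odot>\<^bsub>A\<^esub> (?d, k)" using bd d by simp
    moreover have "(b, h) \<in> fibre A (x, h)" "(?d, k) \<in> fibre A (y, k)"
      using bd(2,4) d(1,2) a by (simp_all add: in_fibre points_lprod)
    ultimately show "c \<in> {p \<odot>\<^bsub>A\<^esub> q |p q. p \<in> fibre A (x, h) \<and> q \<in> fibre A (y, k)}" by blast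
  next
    fix c assume "c \<in> {p \<odot>\<^bsub>A\<^esub> q |p q. p \<in> fibre A (x, h) \<and> q \<in> fibre A (y, k)}"
    then obtain b d where bd: "c = (b, h) \<odot>\<^bsub>A\<^esub> (d, k)" "b \<in> points E" "d \<in> points E" "proj E b = x" "proj E d = y"
      by (auto simp: in_fibre points_lprod)
    then have "c = (b \<odot>\<^bsub>E\<^esub> act h d, ?l)" "b \<in> fibre E x" "act h d \<in> fibre E (h \<triangleright>\<^bsub>\<alpha>\<^esub> y)"
      using a xy by (simp_all add: in_fibre)
    then show "c \<in> (\<lambda>b. (b, ?l)) ` ?S" by blast
  qed
  ultimately show "closed_span (fibre_space A ((x, h) \<cdot>\<^bsub>K\<^esub> (y, k))) {p \<odot>\<^bsub>A\<^esub> q |p q. p \<in> fibre A (x, h) \<and> q \<in> fibre A (y, k)}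
      = fibre A ((x, h) \<cdot>\<^bsub>K\<^esub> (y, k))"
    by (simp add: mult_lprod)
qed

end


section \<open>Para-equivalences\<close>

locale self_similar_para_equivalence =
  X: topological_groupoid X + H: topological_groupoid H + G: topological_groupoid G +
  left: self_similar_left H X \<alpha> + right: free_proper_right_action G X \<beta>
  for H :: "'h groupoid" and G :: "'g groupoid" and X :: "'x groupoid"
    and \<alpha> :: "('h, 'x) left_ss" and \<beta> :: "('g, 'x) right_ss" +
  assumes free_left: "free_laction H (gtop X) (lrho X \<alpha>) (lact \<alpha>)"
    and proper_left: "proper_laction H (gtop X) (lrho X \<alpha>) (lact \<alpha>)"
    and open_source_left: "open_source H"
    and open_source_middle: "open_source X"
    and in_tune: "in_tune H G X \<alpha> \<beta>"
begin

text \<open>Gives the left action the orbit maps, the closed orbit relation and the transporters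
  constructed for right actions. The proper maps of the two pictures differ by an exchange of
  coordinates, a homeomorphism of the domains.\<close>

sublocale dual: free_proper_right_action "op_groupoid H" "op_groupoid X" "op_left \<alpha>"
proof (rule free_proper_right_action.intro[OF left.op_self_similar_right])
  have swap: "homeomorphic_map (rdom_top (op_groupoid H) (gtop X) (lrho X \<alpha>))
      (ldom_top H (gtop X) (lrho X \<alpha>)) (\<lambda>p. (snd p, fst p))"
    unfolding homeomorphic_map_maps homeomorphic_maps_def
    by (rule exI[of _ "\<lambda>p. (snd p, fst p)"])
      (auto simp: rdom_top_def ldom_top_def rdom_def ldom_def continuous_map_in_subtopology
        intro!: continuous_map_pairedI continuous_map_fst_sub continuous_map_snd_sub)
  have "proper_map (rdom_top (op_groupoid H) (gtop X) (lrho X \<alpha>)) (prod_topology (gtop X) (gtop X))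
      ((\<lambda>(k, z). (k \<triangleright>\<^bsub>\<alpha>\<^esub> z, z)) \<circ> (\<lambda>p. (snd p, fst p)))"
    by (rule proper_map_compose[OF homeomorphic_imp_proper_map[OF swap]])
      (use proper_left in \<open>simp add: proper_laction_def\<close>)
  moreover have "(\<lambda>(k, z). (k \<triangleright>\<^bsub>\<alpha>\<^esub> z, z)) \<circ> (\<lambda>p. (snd p, fst p)) = (\<lambda>(z, k). (k \<triangleright>\<^bsub>\<alpha>\<^esub> z, z))"
    by (auto simp: fun_eq_iff)
  ultimately have "proper_map (rdom_top (op_groupoid H) (gtop X) (lrho X \<alpha>)) (prod_topology (gtop X) (gtop X))
      (\<lambda>(z, k). (k \<triangleright>\<^bsub>\<alpha>\<^esub> z, z))" by simp
  then show "free_proper_right_action_axioms (op_groupoid H) (op_groupoid X) (op_left \<alpha>)"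
    by unfold_locales
      (use free_left H.op_open_source[OF open_source_left] in
        \<open>auto simp: proper_raction_def free_raction_def free_laction_def\<close>)
qed

lemma horb_op [simp]: "gorb (op_groupoid H) (op_groupoid X) (op_left \<alpha>) = horb H X \<alpha>"
  unfolding gorb_def horb_def rorbit_def lorbit_def by (auto simp: fun_eq_iff)

lemmas dual_simps = op_groupoid_simps op_left_simps X.op_units H.op_units horb_op

lemmas horb_lact [simp] = dual.orb_ract[unfolded dual_simps]
lemmas ltransporter_lact [simp] = dual.transporter_ract[unfolded dual_simps]
lemmas ltransporter [simp] = dual.transporter[unfolded dual_simps]
lemmas continuous_ltransporter = dual.continuous_transporter[unfolded dual_simps]
lemmas closedin_horbit_relation = dual.closedin_orbit_relation[unfolded dual_simps]

abbreviation horbit ("\<eta>") where "\<eta> \<equiv> horb H X \<alpha>"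

lemma tune:
  assumes "h \<in> arrows H" "x \<in> arrows X" "t \<in> arrows G" "src H h = lmom \<alpha> (rng X x)" "rng G t = rmom \<beta> (src X x)"
  shows "rmom \<beta> (src X (h \<triangleright>\<^bsub>\<alpha>\<^esub> x)) = rmom \<beta> (src X x)" "lmom \<alpha> (rng X (x \<blacktriangleleft>\<^bsub>\<beta>\<^esub> t)) = lmom \<alpha> (rng X x)"
    "h \<triangleright>\<^bsub>\<alpha>\<^esub> (x \<blacktriangleleft>\<^bsub>\<beta>\<^esub> t) = (h \<triangleright>\<^bsub>\<alpha>\<^esub> x) \<blacktriangleleft>\<^bsub>\<beta>\<^esub> t" "(h \<triangleright>\<^bsub>\<alpha>\<^esub> x) \<blacktriangleright>\<^bsub>\<beta>\<^esub> t = x \<blacktriangleright>\<^bsub>\<beta>\<^esub> t" "h \<triangleleft>\<^bsub>\<alpha>\<^esub> (x \<blacktriangleleft>\<^bsub>\<beta>\<^esub> t) = h \<triangleleft>\<^bsub>\<alpha>\<^esub> x"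
proof -
  have "(h, x) \<in> ldom H (gtop X) (lrho X \<alpha>) \<and> (x, t) \<in> rdom G (gtop X) (rsigma X \<beta>)"
    using assms by (simp add: left.ldom_act right.rdom_act)
  with in_tune have "rsigma X \<beta> (h \<triangleright>\<^bsub>\<alpha>\<^esub> x) = rsigma X \<beta> x \<and> lrho X \<alpha> (x \<blacktriangleleft>\<^bsub>\<beta>\<^esub> t) = lrho X \<alpha> x \<and>
      h \<triangleright>\<^bsub>\<alpha>\<^esub> (x \<blacktriangleleft>\<^bsub>\<beta>\<^esub> t) = (h \<triangleright>\<^bsub>\<alpha>\<^esub> x) \<blacktriangleleft>\<^bsub>\<beta>\<^esub> t \<and> (h \<triangleright>\<^bsub>\<alpha>\<^esub> x) \<blacktriangleright>\<^bsub>\<beta>\<^esub> t = x \<blacktriangleright>\<^bsub>\<beta>\<^esub> t \<and> h \<triangleleft>\<^bsub>\<alpha>\<^esub> (x \<blacktriangleleft>\<^bsub>\<beta>\<^esub> t) = h \<triangleleft>\<^bsub>\<alpha>\<^esub> x"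
    unfolding in_tune_def by blast
  then show "rmom \<beta> (src X (h \<triangleright>\<^bsub>\<alpha>\<^esub> x)) = rmom \<beta> (src X x)" "lmom \<alpha> (rng X (x \<blacktriangleleft>\<^bsub>\<beta>\<^esub> t)) = lmom \<alpha> (rng X x)"
    "h \<triangleright>\<^bsub>\<alpha>\<^esub> (x \<blacktriangleleft>\<^bsub>\<beta>\<^esub> t) = (h \<triangleright>\<^bsub>\<alpha>\<^esub> x) \<blacktriangleleft>\<^bsub>\<beta>\<^esub> t" "(h \<triangleright>\<^bsub>\<alpha>\<^esub> x) \<blacktriangleright>\<^bsub>\<beta>\<^esub> t = x \<blacktriangleright>\<^bsub>\<beta>\<^esub> t" "h \<triangleleft>\<^bsub>\<alpha>\<^esub> (x \<blacktriangleleft>\<^bsub>\<beta>\<^esub> t) = h \<triangleleft>\<^bsub>\<alpha>\<^esub> x"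
    unfolding rsigma_def lrho_def by blast+
qed

lemmas tune_simps [simp] = tune(3-5)

text \<open>Simplification rewrites the source of \<open>h \<triangleright> x\<close> as a translate
  of a unit. The first two conditions of being in tune are therefore needed on units, here on the
  left and next on the right.\<close>

lemma rmom_lact [simp]:
  assumes "h \<in> arrows H" "u \<in> units X" "src H h = lmom \<alpha> u"
  shows "rmom \<beta> (h \<triangleright>\<^bsub>\<alpha>\<^esub> u) = rmom \<beta> u"
  using tune(1)[of h u "rmom \<beta> u"] assms by simp

lemma lmom_ract [simp]:
  assumes "t \<in> arrows G" "u \<in> units X" "rng G t = rmom \<beta> u"
  shows "lmom \<alpha> (u \<blacktriangleleft>\<^bsub>\<beta>\<^esub> t) = lmom \<alpha> u"
  using tune(2)[of "lmom \<alpha> u" u t] assms by simp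

text \<open>Being in tune lets the arrow that relates \<open>x\<close> and \<open>y\<close> pass
  through \<open>h\<close>.\<close>

lemma orb_lact:
  assumes "\<pi> x = \<pi> y" "x \<in> arrows X" "y \<in> arrows X" "h \<in> arrows H" "src H h = lmom \<alpha> (rng X x)"
  shows "\<pi> (h \<triangleright>\<^bsub>\<alpha>\<^esub> x) = \<pi> (h \<triangleright>\<^bsub>\<alpha>\<^esub> y)"
proof -
  obtain t where "t \<in> arrows G" "rng G t = rmom \<beta> (src X x)" "y = x \<blacktriangleleft>\<^bsub>\<beta>\<^esub> t"
    using right.orb_eqE[OF assms(1-3)] by blast
  then show ?thesis using assms by simp
qed

section \<open>The induced action of H on X/G\<close>

abbreviation \<alpha>Q where "\<alpha>Q \<equiv> lact_on_rquot G X \<alpha> \<beta>"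
abbreviation Q where "Q \<equiv> rquot X G \<beta>"
abbreviation K where "K \<equiv> lprod_groupoid Q H \<alpha>Q"

lemma the_elem_orb:
  assumes "x \<in> arrows X"
    and "\<And>t. \<lbrakk>t \<in> arrows G; rng G t = rmom \<beta> (src X x)\<rbrakk> \<Longrightarrow> F (x \<blacktriangleleft>\<^bsub>\<beta>\<^esub> t) = F x"
  shows "the_elem (F ` \<pi> x) = F x"
  by (rule the_elem_image_eq) (use assms in \<open>auto elim: right.in_orbE\<close>)

lemma lmom_quot [simp]: "x \<in> arrows X \<Longrightarrow> lmom \<alpha>Q (\<pi> x) = lmom \<alpha> (rng X x)"
  using the_elem_orb[of x "lrho X \<alpha>"] by (simp add: lact_on_rquot_def lrho_def)

lemma lact_quot [simp]:
  "\<lbrakk>x \<in> arrows X; h \<in> arrows H; src H h = lmom \<alpha> (rng X x)\<rbrakk>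
    \<Longrightarrow> lact \<alpha>Q h (\<pi> x) = \<pi> (h \<triangleright>\<^bsub>\<alpha>\<^esub> x)"
  using the_elem_orb[of x "\<lambda>x. \<pi> (h \<triangleright>\<^bsub>\<alpha>\<^esub> x)"] by (simp add: lact_on_rquot_def)

lemma lres_quot [simp]:
  "\<lbrakk>x \<in> arrows X; h \<in> arrows H; src H h = lmom \<alpha> (rng X x)\<rbrakk> \<Longrightarrow> lres \<alpha>Q h (\<pi> x) = h \<triangleleft>\<^bsub>\<alpha>\<^esub> x"
  using the_elem_orb[of x "\<lambda>x. h \<triangleleft>\<^bsub>\<alpha>\<^esub> x"] by (simp add: lact_on_rquot_def)

lemma ldom_quot [simp]:
  assumes "x \<in> arrows X"
  shows "(h, \<pi> x) \<in> ldom H (gtop Q) (lrho Q \<alpha>Q) \<longleftrightarrow> h \<in> arrows H \<and> src H h = lmom \<alpha> (rng X x)"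
proof -
  have "lrho Q \<alpha>Q (\<pi> x) = lmom \<alpha> (rng X x)" using assms by (simp add: lrho_def)
  moreover have "\<pi> x \<in> topspace (gtop Q)" using right.orb_arrow[OF assms] unfolding arrows_def .
  ultimately show ?thesis by (simp add: ldom_iff)
qed

text \<open>Being in tune makes residuals constant on orbits and translates compatible with them, so
  L1 to L6 are inherited from \<open>X\<close>. For a composable pair of orbits the second is
  represented first, and the first is lifted to match it.\<close>

lemma self_similar_left_quot: "self_similar_left H Q \<alpha>Q"
proof (intro self_similar_left.intro self_similar_left_axioms.intro H.topological_groupoid_axioms
    right.topological_groupoid_quot)
  show "continuous_map (unit_top Q) (unit_top H) (lmom \<alpha>Q)"
    unfolding unit_top_def[of Q]
  proof (rule open_quotient_lift[OF right.open_quotient_orb])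
    let ?D = "subtopology (gtop X) {x. \<pi> x \<in> units Q}"
    have "continuous_map ?D (unit_top H) (\<lambda>x. lmom \<alpha> (rng X x))"
      unfolding H.continuous_unit_top
      by (auto intro!: left.continuous_lmom X.continuous_rng continuous_map_from_subtopology
          simp: arrows_def[symmetric])
    then show "continuous_map ?D (unit_top H) (\<lambda>x. lmom \<alpha>Q (\<pi> x))"
      by (rule continuous_map_eq) (auto simp: arrows_def[symmetric])
  qed
  show "lmom \<alpha>Q ` units Q = units H"
  proof -
    have "lmom \<alpha>Q ` \<pi> ` units X = lmom \<alpha> ` units X"
      unfolding image_image by (rule image_cong) auto
    then show ?thesis using left.mom_surj by (simp add: right.units_quot)
  qed
  let ?D = "subtopology (prod_topology (gtop H) (gtop X))
      {p. (fst p, \<pi> (snd p)) \<in> ldom H (gtop Q) (lrho Q \<alpha>Q)}"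
  have D: "fst p \<in> arrows H" "snd p \<in> arrows X" "src H (fst p) = lmom \<alpha> (rng X (snd p))"
    if "p \<in> topspace ?D" for p
    using that by (auto simp: arrows_def[symmetric])
  show "continuous_map (ldom_top H (gtop Q) (lrho Q \<alpha>Q)) (gtop Q) (\<lambda>(h, x). lact \<alpha>Q h x)"
    unfolding ldom_top_def
  proof (rule open_quotient_lift2[OF open_quotient_id right.open_quotient_orb])
    have "continuous_map ?D (gtop Q) (\<lambda>p. \<pi> (fst p \<triangleright>\<^bsub>\<alpha>\<^esub> snd p))"
      by (intro right.continuous_orb left.continuous_lact continuous_map_fst_sub continuous_map_snd_sub)
        (use D in blast)
    then show "continuous_map ?D (gtop Q) (\<lambda>p. case (fst p, \<pi> (snd p)) of (h, x) \<Rightarrow> lact \<alpha>Q h x)"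
    proof (rule continuous_map_eq)
      fix p assume "p \<in> topspace ?D"
      from D[OF this] show "\<pi> (fst p \<triangleright>\<^bsub>\<alpha>\<^esub> snd p) = (case (fst p, \<pi> (snd p)) of (h, x) \<Rightarrow> lact \<alpha>Q h x)" by simp
    qed
  qed
  show "continuous_map (ldom_top H (gtop Q) (lrho Q \<alpha>Q)) (gtop H) (\<lambda>(h, x). lres \<alpha>Q h x)"
    unfolding ldom_top_def
  proof (rule open_quotient_lift2[OF open_quotient_id right.open_quotient_orb])
    have "continuous_map ?D (gtop H) (\<lambda>p. fst p \<triangleleft>\<^bsub>\<alpha>\<^esub> snd p)"
      by (intro left.continuous_lres continuous_map_fst_sub continuous_map_snd_sub)
        (use D in blast)
    then show "continuous_map ?D (gtop H) (\<lambda>p. case (fst p, \<pi> (snd p)) of (h, x) \<Rightarrow> lres \<alpha>Q h x)"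
    proof (rule continuous_map_eq)
      fix p assume "p \<in> topspace ?D"
      from D[OF this] show "fst p \<triangleleft>\<^bsub>\<alpha>\<^esub> snd p = (case (fst p, \<pi> (snd p)) of (h, x) \<Rightarrow> lres \<alpha>Q h x)" by simp
    qed
  qed
  have dom: "\<exists>x. x \<in> arrows X \<and> \<xi> = \<pi> x \<and> h \<in> arrows H \<and> src H h = lmom \<alpha> (rng X x)"
    if "(h, \<xi>) \<in> ldom H (gtop Q) (lrho Q \<alpha>Q)" for h \<xi>
  proof -
    have "\<xi> \<in> arrows Q" using that by (simp add: ldom_iff arrows_def)
    then show ?thesis using that by (auto simp: right.arrows_quot)
  qed
  show "lact \<alpha>Q (lrho Q \<alpha>Q \<xi>) \<xi> = \<xi>" if "\<xi> \<in> arrows Q" for \<xi>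
    using that by (auto simp: right.arrows_quot lrho_def)
  show "rng H h = lrho Q \<alpha>Q (lact \<alpha>Q h \<xi>)" "src H (lres \<alpha>Q h \<xi>) = lrho Q \<alpha>Q (ginv Q \<xi>)"
    "rng H (lres \<alpha>Q h \<xi>) = lrho Q \<alpha>Q (ginv Q (lact \<alpha>Q h \<xi>))"
    if "(h, \<xi>) \<in> ldom H (gtop Q) (lrho Q \<alpha>Q)" for h \<xi>
    using dom[OF that] by (auto simp: lrho_def)
  show "lres \<alpha>Q h v = h" if hv: "(h, v) \<in> ldom H (gtop Q) (lrho Q \<alpha>Q)" "v \<in> units Q" for h v
  proof -
    obtain x where x: "x \<in> arrows X" "v = \<pi> x" "h \<in> arrows H" "src H h = lmom \<alpha> (rng X x)"
      using dom[OF hv(1)] by blast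
    \<comment> \<open>A representative of a unit orbit is itself a unit, so the rule for residuals
      at units applies to it.\<close>
    then have "x \<in> units X" using hv(2) right.orb_unitD[of x] by (simp add: right.units_quot)
    then show ?thesis using x by simp
  qed
  have dom2: "\<exists>x y. x \<in> arrows X \<and> \<xi> = \<pi> x \<and> h \<in> arrows H \<and> src H h = lmom \<alpha> (rng X x) \<and>
      y \<in> arrows X \<and> \<zeta> = \<pi> y \<and> src X x = rng X y"
    if dm: "(h, \<xi>) \<in> ldom H (gtop Q) (lrho Q \<alpha>Q)" and cp: "(\<xi>, \<zeta>) \<in> composable Q" for h \<xi> \<zeta>
  proof -
    obtain y where y: "y \<in> arrows X" "\<zeta> = \<pi> y" "src Q \<xi> = \<pi> (rng X y)" "\<xi> \<in> arrows Q"
      using cp by (auto simp: composable_def right.arrows_quot)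
    have u: "rng X y \<in> units X" using y(1) by simp
    obtain x where x: "x \<in> arrows X" "\<pi> x = \<xi>" "src X x = rng X y"
      by (rule right.lift_src[OF y(4) u y(3)])
    have "h \<in> arrows H \<and> src H h = lmom \<alpha> (rng X x)" using dm ldom_quot[OF x(1)] x(2) by simp
    then show ?thesis using x y by blast
  qed
  show "src Q (lact \<alpha>Q h \<xi>) = rng Q (lact \<alpha>Q (lres \<alpha>Q h \<xi>) \<zeta>)"
    "lres \<alpha>Q h (\<xi> \<cdot>\<^bsub>Q\<^esub> \<zeta>) = lres \<alpha>Q (lres \<alpha>Q h \<xi>) \<zeta>"
    "lact \<alpha>Q h (\<xi> \<cdot>\<^bsub>Q\<^esub> \<zeta>) = lact \<alpha>Q h \<xi> \<cdot>\<^bsub>Q\<^esub> lact \<alpha>Q (lres \<alpha>Q h \<xi>) \<zeta>"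
    if "(h, \<xi>) \<in> ldom H (gtop Q) (lrho Q \<alpha>Q)" "(\<xi>, \<zeta>) \<in> composable Q" for h \<xi> \<zeta>
    using dom2[OF that] by auto
  show "lact \<alpha>Q (h \<cdot>\<^bsub>H\<^esub> k) \<xi> = lact \<alpha>Q h (lact \<alpha>Q k \<xi>)"
    "lres \<alpha>Q (h \<cdot>\<^bsub>H\<^esub> k) \<xi> = lres \<alpha>Q h (lact \<alpha>Q k \<xi>) \<cdot>\<^bsub>H\<^esub> lres \<alpha>Q k \<xi>"
    if "(h, k) \<in> composable H" "(k, \<xi>) \<in> ldom H (gtop Q) (lrho Q \<alpha>Q)" for h k \<xi>
    using dom[OF that(2)] that(1) by (auto simp: H.composable_iff left.mult_lact left.mult_lres)
qed

sublocale quot: self_similar_left_product H Q \<alpha>Q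
  by (intro self_similar_left_product.intro self_similar_left_quot)

sublocale K: topological_groupoid K
  by (rule quot.topological_groupoid_lprod)

lemma arrows_K [simp]:
  "x \<in> arrows X \<Longrightarrow> (\<pi> x, h) \<in> arrows K \<longleftrightarrow> h \<in> arrows H \<and> lmom \<alpha> (src X x) = rng H h"
  by (simp add: quot.arrows_lprod)

lemma in_arrows_KE:
  assumes "k \<in> arrows K"
  obtains x h where "k = (\<pi> x, h)" "x \<in> arrows X" "h \<in> arrows H" "lmom \<alpha> (src X x) = rng H h"
proof -
  obtain \<xi> h where k: "k = (\<xi>, h)" by fastforce
  then obtain x where x: "x \<in> arrows X" "\<xi> = \<pi> x"
    using assms by (auto simp: quot.arrows_lprod right.arrows_quot)
  then show thesis using that[of x h] k assms by simp
qed

lemma fr_eq [simp]: "x \<in> arrows X \<Longrightarrow> fr G X \<alpha> \<beta> x = (\<pi> (rng X x), lmom \<alpha> (rng X x))"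
  by (simp add: fr_def lprod_unit_def)

lemma fs_eq_iff: "fs H X \<alpha> \<beta> x = fs H X \<alpha> \<beta> y \<longleftrightarrow> \<eta> (src X x) = \<eta> (src X y)"
  by (auto simp: fs_def rprod_unit_def)

lemma rng_K [simp]: "x \<in> arrows X \<Longrightarrow> rng K (\<pi> x, h) = (\<pi> (rng X x), lmom \<alpha> (rng X x))"
  by (simp add: quot.rng_lprod)

lemma src_K [simp]:
  "\<lbrakk>x \<in> arrows X; h \<in> arrows H; lmom \<alpha> (src X x) = rng H h\<rbrakk>
    \<Longrightarrow> src K (\<pi> x, h) = (\<pi> (ginv H h \<triangleright>\<^bsub>\<alpha>\<^esub> src X x), src H h)"
  using quot.src_lprod[of "\<pi> x" h] by simp

lemma src_K_eq_fr:
  assumes "x \<in> arrows X" "h \<in> arrows H" "lmom \<alpha> (src X x) = rng H h" "y \<in> arrows X"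
    "src H h = lmom \<alpha> (rng X y)" "src X x = h \<triangleright>\<^bsub>\<alpha>\<^esub> rng X y"
  shows "src K (\<pi> x, h) = fr G X \<alpha> \<beta> y"
  using assms by simp

text \<open>The source condition only says that two units lie in one \<open>G\<close>-orbit. Acting
  by \<open>h\<close> preserves this, and then the orbit in the first coordinate can be lifted to
  the exact source \<open>h \<triangleright> rng X y\<close>. Computations with the action on
  \<open>X\<close> start from such a representative.\<close>

lemma K_representative:
  assumes "k \<in> arrows K" "y \<in> arrows X" "src K k = fr G X \<alpha> \<beta> y"
  obtains x h where "k = (\<pi> x, h)" "x \<in> arrows X" "h \<in> arrows H" "lmom \<alpha> (src X x) = rng H h"
    "src H h = lmom \<alpha> (rng X y)" "src X x = h \<triangleright>\<^bsub>\<alpha>\<^esub> rng X y"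
proof -
  obtain z h where k: "k = (\<pi> z, h)" "z \<in> arrows X" "h \<in> arrows H" "lmom \<alpha> (src X z) = rng H h"
    using in_arrows_KE[OF assms(1)] .
  then have e: "\<pi> (ginv H h \<triangleright>\<^bsub>\<alpha>\<^esub> src X z) = \<pi> (rng X y)" "src H h = lmom \<alpha> (rng X y)"
    using assms by simp_all
  have "\<pi> (h \<triangleright>\<^bsub>\<alpha>\<^esub> ginv H h \<triangleright>\<^bsub>\<alpha>\<^esub> src X z) = \<pi> (h \<triangleright>\<^bsub>\<alpha>\<^esub> rng X y)"
    by (rule orb_lact[OF e(1)]) (use k assms in simp_all)
  then have "src Q (\<pi> z) = \<pi> (h \<triangleright>\<^bsub>\<alpha>\<^esub> rng X y)" using k by simp
  then obtain x where x: "x \<in> arrows X" "\<pi> x = \<pi> z" "src X x = h \<triangleright>\<^bsub>\<alpha>\<^esub> rng X y"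
    by (rule right.lift_src[rotated 2]) (use k e assms that in simp_all)
  have "lmom \<alpha> (src X x) = rng H h" using x(3) k(3) e(2) assms(2) by simp
  then show thesis using that[of x h] x k e by simp
qed

section \<open>The action of the product groupoid on X\<close>

abbreviation PL where "PL \<equiv> para_lact X \<alpha>"

text \<open>The definite description selects \<open>x\<close>, since an orbit has only one member
  with a given source.\<close>

lemma para_lact_eq:
  assumes "x \<in> arrows X" "h \<in> arrows H" "y \<in> arrows X" "src H h = lmom \<alpha> (rng X y)" "src X x = h \<triangleright>\<^bsub>\<alpha>\<^esub> rng X y"
  shows "PL (\<pi> x, h) y = x \<cdot>\<^bsub>X\<^esub> (h \<triangleright>\<^bsub>\<alpha>\<^esub> y)"
proof -
  have "(THE x'. x' \<in> \<pi> x \<and> src X x' = rng X (h \<triangleright>\<^bsub>\<alpha>\<^esub> y)) = x"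
  proof (rule the_equality)
    show "x \<in> \<pi> x \<and> src X x = rng X (h \<triangleright>\<^bsub>\<alpha>\<^esub> y)" using assms by simp
    fix x' assume x': "x' \<in> \<pi> x \<and> src X x' = rng X (h \<triangleright>\<^bsub>\<alpha>\<^esub> y)"
    then have "x' \<in> arrows X" "\<pi> x' = \<pi> x" using assms(1) by (auto elim: right.in_orbE)
    then show "x' = x" using right.orb_src_unique[of x' x] x' assms by simp
  qed
  then show ?thesis by (simp add: para_lact_def)
qed

lemma open_quotient_K:
  "open_quotient (subtopology (prod_topology (gtop X) (gtop H)) {p. (\<pi> (fst p), snd p) \<in> arrows K})
    (gtop K) (\<lambda>p. (\<pi> (fst p), snd p))"
  using open_quotient_restrict[OF open_quotient_prod[OF right.open_quotient_orb open_quotient_id[of "gtop H"]], where S = "arrows K"]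
  by (simp add: quot.gtop_lprod[symmetric])

lemma continuous_fr: "continuous_map (gtop X) (unit_top K) (fr G X \<alpha> \<beta>)"
proof -
  have "continuous_map (gtop X) (unit_top K) (\<lambda>x. (\<pi> (rng X x), lmom \<alpha> (rng X x)))"
    unfolding K.continuous_unit_top quot.continuous_lprod_iff
    by (auto intro!: right.continuous_orb X.continuous_rng left.continuous_lmom
        simp: arrows_def[symmetric] quot.units_lprod right.units_quot image_iff)
  then show ?thesis by (rule continuous_map_eq) (simp add: arrows_def)
qed

lemma groupoid_left_space: "groupoid_left_space K (gtop X) (fr G X \<alpha> \<beta>) PL"
proof (intro groupoid_left_space.intro groupoid_left_space_axioms.intro K.topological_groupoid_axioms
    continuous_fr)
  have dom: "\<exists>x h. k = (\<pi> x, h) \<and> x \<in> arrows X \<and> h \<in> arrows H \<and> lmom \<alpha> (src X x) = rng H h \<and>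
    src H h = lmom \<alpha> (rng X y) \<and> src X x = h \<triangleright>\<^bsub>\<alpha>\<^esub> rng X y \<and> y \<in> arrows X"
    if ky: "(k, y) \<in> ldom K (gtop X) (fr G X \<alpha> \<beta>)" for k y
  proof -
    have y: "k \<in> arrows K" "y \<in> arrows X" "src K k = fr G X \<alpha> \<beta> y"
      using ky by (simp_all add: ldom_iff arrows_def)
    then obtain x h where "k = (\<pi> x, h)" "x \<in> arrows X" "h \<in> arrows H" "lmom \<alpha> (src X x) = rng H h"
      "src H h = lmom \<alpha> (rng X y)" "src X x = h \<triangleright>\<^bsub>\<alpha>\<^esub> rng X y"
      by (rule K_representative)
    then show ?thesis using y(2) by blast
  qed
  show "continuous_map (ldom_top K (gtop X) (fr G X \<alpha> \<beta>)) (gtop X) (\<lambda>(k, z). PL k z)"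
    unfolding ldom_top_def
  proof (rule open_quotient_lift2[OF open_quotient_K open_quotient_id])
    define D where "D = subtopology (prod_topology (subtopology (prod_topology (gtop X) (gtop H))
        {p. (\<pi> (fst p), snd p) \<in> arrows K}) (gtop X))
      {p. ((\<pi> (fst (fst p)), snd (fst p)), snd p) \<in> ldom K (gtop X) (fr G X \<alpha> \<beta>)}"
    have D: "fst (fst p) \<in> arrows X" "snd (fst p) \<in> arrows H" "snd p \<in> arrows X"
      "src H (snd (fst p)) = lmom \<alpha> (rng X (snd p))" "\<pi> (src X (fst (fst p))) = \<pi> (snd (fst p) \<triangleright>\<^bsub>\<alpha>\<^esub> rng X (snd p))"
      if "p \<in> topspace D" for p
    proof -
      show a: "fst (fst p) \<in> arrows X" "snd (fst p) \<in> arrows H" "snd p \<in> arrows X"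
        using that unfolding D_def by (auto simp: arrows_def[symmetric])
      have "((\<pi> (fst (fst p)), snd (fst p)), snd p) \<in> ldom K (gtop X) (fr G X \<alpha> \<beta>)"
        using that by (simp add: D_def)
      from dom[OF this] obtain x where x: "\<pi> (fst (fst p)) = \<pi> x" "x \<in> arrows X"
        "src H (snd (fst p)) = lmom \<alpha> (rng X (snd p))" "src X x = snd (fst p) \<triangleright>\<^bsub>\<alpha>\<^esub> rng X (snd p)"
        by auto
      then show "src H (snd (fst p)) = lmom \<alpha> (rng X (snd p))" by simp
      show "\<pi> (src X (fst (fst p))) = \<pi> (snd (fst p) \<triangleright>\<^bsub>\<alpha>\<^esub> rng X (snd p))"
        using x a(1) by (metis right.src_quot)
    qed
    have "continuous_map D (prod_topology (gtop X) (gtop H)) fst" "continuous_map D (gtop X) snd"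
      unfolding D_def using continuous_map_fst_sub continuous_map_snd_sub
      by (auto intro: continuous_map_into_fulltopology)
    then have c: "continuous_map D (gtop X) (\<lambda>p. fst (fst p))" "continuous_map D (gtop H) (\<lambda>p. snd (fst p))"
      "continuous_map D (gtop X) (\<lambda>p. snd p)"
      using continuous_map_fst_comp continuous_map_snd_comp by auto
    \<comment> \<open>The representative is moved to the source that the second factor requires; the
      transporter makes the choice continuous.\<close>
    let ?x = "\<lambda>p. fst (fst p) \<blacktriangleleft>\<^bsub>\<beta>\<^esub> right.transporter (src X (fst (fst p))) (snd (fst p) \<triangleright>\<^bsub>\<alpha>\<^esub> rng X (snd p))"
    have "continuous_map D (gtop X) (\<lambda>p. ?x p \<cdot>\<^bsub>X\<^esub> (snd (fst p) \<triangleright>\<^bsub>\<alpha>\<^esub> snd p))"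
      by (intro X.continuous_mult right.continuous_ract right.continuous_transporter X.continuous_src
          left.continuous_lact X.continuous_rng c) (use D in simp_all)
    then have "continuous_map D (gtop X) (\<lambda>p. PL (\<pi> (fst (fst p)), snd (fst p)) (snd p))"
    proof (rule continuous_map_eq)
      fix p assume "p \<in> topspace D"
      note D = D[OF this]
      have "?x p \<in> arrows X" "\<pi> (?x p) = \<pi> (fst (fst p))" "src X (?x p) = snd (fst p) \<triangleright>\<^bsub>\<alpha>\<^esub> rng X (snd p)"
        using D by simp_all
      then show "?x p \<cdot>\<^bsub>X\<^esub> (snd (fst p) \<triangleright>\<^bsub>\<alpha>\<^esub> snd p) = PL (\<pi> (fst (fst p)), snd (fst p)) (snd p)"
        using para_lact_eq[of "?x p" "snd (fst p)" "snd p"] D by simp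
    qed
    then show "continuous_map (subtopology (prod_topology (subtopology (prod_topology (gtop X) (gtop H))
        {p. (\<pi> (fst p), snd p) \<in> arrows K}) (gtop X))
      {p. ((\<pi> (fst (fst p)), snd (fst p)), snd p) \<in> ldom K (gtop X) (fr G X \<alpha> \<beta>)}) (gtop X)
      (\<lambda>p. case ((\<pi> (fst (fst p)), snd (fst p)), snd p) of (k, z) \<Rightarrow> PL k z)"
      unfolding D_def by simp
  qed
  show "fr G X \<alpha> \<beta> (PL k z) = rng K k" if "(k, z) \<in> ldom K (gtop X) (fr G X \<alpha> \<beta>)" for k z
    using dom[OF that] by (auto simp: para_lact_eq)
  show "PL (fr G X \<alpha> \<beta> z) z = z" if "z \<in> topspace (gtop X)" for z
    using that para_lact_eq[of "rng X z" "lmom \<alpha> (rng X z)" z] by (simp add: arrows_def[symmetric])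
  show "PL k' (PL k z) = PL (k' \<cdot>\<^bsub>K\<^esub> k) z"
    if kk: "(k', k) \<in> composable K" and kz: "(k, z) \<in> ldom K (gtop X) (fr G X \<alpha> \<beta>)" for k' k z
  proof -
    obtain x h where x: "k = (\<pi> x, h)" "x \<in> arrows X" "h \<in> arrows H" "lmom \<alpha> (src X x) = rng H h"
      "src H h = lmom \<alpha> (rng X z)" "src X x = h \<triangleright>\<^bsub>\<alpha>\<^esub> rng X z" "z \<in> arrows X"
      using dom[OF kz] by blast
    have "k' \<in> arrows K" "src K k' = fr G X \<alpha> \<beta> x" using kk x by (simp_all add: composable_def)
    then obtain x' h' where x': "k' = (\<pi> x', h')" "x' \<in> arrows X" "h' \<in> arrows H" "lmom \<alpha> (src X x') = rng H h'"
      "src H h' = lmom \<alpha> (rng X x)" "src X x' = h' \<triangleright>\<^bsub>\<alpha>\<^esub> rng X x"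
      using x(2) by (auto elim: K_representative)
    have "k' \<cdot>\<^bsub>K\<^esub> k = (\<pi> (x' \<cdot>\<^bsub>X\<^esub> (h' \<triangleright>\<^bsub>\<alpha>\<^esub> x)), (h' \<triangleleft>\<^bsub>\<alpha>\<^esub> x) \<cdot>\<^bsub>H\<^esub> h)"
      unfolding x'(1) x(1) using x x' by (simp add: quot.mult_lprod)
    moreover have "PL (\<pi> (x' \<cdot>\<^bsub>X\<^esub> (h' \<triangleright>\<^bsub>\<alpha>\<^esub> x)), (h' \<triangleleft>\<^bsub>\<alpha>\<^esub> x) \<cdot>\<^bsub>H\<^esub> h) z = x' \<cdot>\<^bsub>X\<^esub> (h' \<triangleright>\<^bsub>\<alpha>\<^esub> x) \<cdot>\<^bsub>X\<^esub> (((h' \<triangleleft>\<^bsub>\<alpha>\<^esub> x) \<cdot>\<^bsub>H\<^esub> h) \<triangleright>\<^bsub>\<alpha>\<^esub> z)"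
      by (rule para_lact_eq) (use x x' in \<open>simp_all add: left.mult_lact\<close>)
    moreover have "PL k' (PL k z) = x' \<cdot>\<^bsub>X\<^esub> (h' \<triangleright>\<^bsub>\<alpha>\<^esub> (x \<cdot>\<^bsub>X\<^esub> (h \<triangleright>\<^bsub>\<alpha>\<^esub> z)))"
      unfolding x'(1) x(1) using x x' by (simp add: para_lact_eq)
    ultimately show ?thesis using x x' by (simp add: X.assoc left.mult_lact)
  qed
qed

sublocale Kspace: groupoid_left_space K "gtop X" "fr G X \<alpha> \<beta>" PL
  by (rule groupoid_left_space)

lemma fs_para_lact:
  assumes "(k, z) \<in> ldom K (gtop X) (fr G X \<alpha> \<beta>)"
  shows "fs H X \<alpha> \<beta> (PL k z) = fs H X \<alpha> \<beta> z"
proof -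
  have "k \<in> arrows K" "z \<in> arrows X" "src K k = fr G X \<alpha> \<beta> z"
    using assms by (simp_all add: ldom_iff arrows_def)
  then obtain x h where "k = (\<pi> x, h)" "x \<in> arrows X" "h \<in> arrows H" "lmom \<alpha> (src X x) = rng H h"
      "src H h = lmom \<alpha> (rng X z)" "src X x = h \<triangleright>\<^bsub>\<alpha>\<^esub> rng X z"
    by (rule K_representative)
  then show ?thesis using \<open>z \<in> arrows X\<close> by (simp add: fs_eq_iff para_lact_eq)
qed

text \<open>The element of \<open>K\<close> that carries \<open>z\<close> to \<open>y\<close>. Let
  \<open>t\<close> be the arrow of \<open>H\<close> moving \<open>src X z\<close> to
  \<open>src X y\<close>. Passing to \<open>h = t \<triangleleft> ginv X z\<close> gives
  \<open>h \<triangleleft> z = t\<close>, so \<open>h \<triangleright> z\<close> has the source of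
  \<open>y\<close> and the first coordinate is forced. The projection of the left inner product of
  vectors over \<open>y\<close> and \<open>z\<close> is this same element.\<close>

definition Ktransporter where
  "Ktransporter y z = (let h = dual.transporter (src X z) (src X y) \<triangleleft>\<^bsub>\<alpha>\<^esub> ginv X z
    in (\<pi> (y \<cdot>\<^bsub>X\<^esub> ginv X (h \<triangleright>\<^bsub>\<alpha>\<^esub> z)), h))"

lemma Ktransporter:
  assumes "y \<in> arrows X" "z \<in> arrows X" "\<eta> (src X y) = \<eta> (src X z)"
  shows "Ktransporter y z \<in> arrows K" "src K (Ktransporter y z) = fr G X \<alpha> \<beta> z"
    "PL (Ktransporter y z) z = y"
proof -
  let ?h = "dual.transporter (src X z) (src X y)"
  have h: "?h \<in> arrows H" "src H ?h = lmom \<alpha> (src X z)" "?h \<triangleright>\<^bsub>\<alpha>\<^esub> src X z = src X y"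
    using assms ltransporter[of "src X z" "src X y"] by simp_all
  let ?k = "?h \<triangleleft>\<^bsub>\<alpha>\<^esub> ginv X z" and ?x = "y \<cdot>\<^bsub>X\<^esub> ginv X ((?h \<triangleleft>\<^bsub>\<alpha>\<^esub> ginv X z) \<triangleright>\<^bsub>\<alpha>\<^esub> z)"
  have k: "?k \<in> arrows H" "src H ?k = lmom \<alpha> (rng X z)" "?k \<triangleleft>\<^bsub>\<alpha>\<^esub> z = ?h"
    using h assms left.lres_lres_inv[of ?h "ginv X z"] by simp_all
  have kz: "?k \<triangleright>\<^bsub>\<alpha>\<^esub> z \<in> arrows X" "src X (?k \<triangleright>\<^bsub>\<alpha>\<^esub> z) = src X y" using h k assms by simp_all
  have x: "?x \<in> arrows X" "src X ?x = ?k \<triangleright>\<^bsub>\<alpha>\<^esub> rng X z" using k kz assms by simp_all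
  have l: "lmom \<alpha> (src X ?x) = rng H ?k" unfolding x(2) using k assms by simp
  show "Ktransporter y z \<in> arrows K"
    unfolding Ktransporter_def Let_def by (rule iffD2[OF arrows_K[OF x(1)]], intro conjI k(1) l)
  show "src K (Ktransporter y z) = fr G X \<alpha> \<beta> z"
    unfolding Ktransporter_def Let_def by (rule src_K_eq_fr[OF x(1) k(1) l assms(2) k(2) x(2)])
  show "PL (Ktransporter y z) z = y"
    unfolding Ktransporter_def Let_def
    using para_lact_eq[OF x(1) k(1) assms(2) k(2) x(2)] kz assms by simp
qed

lemma Ktransporter_para_lact:
  assumes "(k, z) \<in> ldom K (gtop X) (fr G X \<alpha> \<beta>)"
  shows "Ktransporter (PL k z) z = k"
proof -
  have "k \<in> arrows K" "z \<in> arrows X" "src K k = fr G X \<alpha> \<beta> z"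
    using assms by (simp_all add: ldom_iff arrows_def)
  then obtain x h where x: "k = (\<pi> x, h)" "x \<in> arrows X" "h \<in> arrows H" "lmom \<alpha> (src X x) = rng H h"
      "src H h = lmom \<alpha> (rng X z)" "src X x = h \<triangleright>\<^bsub>\<alpha>\<^esub> rng X z"
    by (rule K_representative)
  have "dual.transporter (src X z) (src X (x \<cdot>\<^bsub>X\<^esub> (h \<triangleright>\<^bsub>\<alpha>\<^esub> z))) = h \<triangleleft>\<^bsub>\<alpha>\<^esub> z"
    using x \<open>z \<in> arrows X\<close> ltransporter_lact[of "h \<triangleleft>\<^bsub>\<alpha>\<^esub> z" "src X z"] by simp
  then show ?thesis
    using x \<open>z \<in> arrows X\<close> by (simp add: para_lact_eq Ktransporter_def)
qed

text \<open>Invariance of \<open>fs\<close> gives one inclusion, and \<open>Ktransporter\<close> the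
  other.\<close>

lemma lorbit_para:
  assumes "z \<in> arrows X"
  shows "lorbit K (fr G X \<alpha> \<beta>) PL z = {y \<in> arrows X. fs H X \<alpha> \<beta> y = fs H X \<alpha> \<beta> z}"
proof (intro equalityI subsetI)
  fix y assume "y \<in> lorbit K (fr G X \<alpha> \<beta>) PL z"
  then obtain k where k: "y = PL k z" "(k, z) \<in> ldom K (gtop X) (fr G X \<alpha> \<beta>)"
    using assms by (auto simp: lorbit_def ldom_iff arrows_def)
  have "y \<in> arrows X"
    using continuous_map_image_subset_topspace[OF Kspace.act_continuous] k
    by (force simp: ldom_top_def arrows_def ldom_iff)
  then show "y \<in> {y \<in> arrows X. fs H X \<alpha> \<beta> y = fs H X \<alpha> \<beta> z}" using fs_para_lact[OF k(2)] k(1) by simp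
next
  fix y assume "y \<in> {y \<in> arrows X. fs H X \<alpha> \<beta> y = fs H X \<alpha> \<beta> z}"
  then have "y \<in> arrows X" "\<eta> (src X y) = \<eta> (src X z)" by (auto simp: fs_eq_iff)
  then show "y \<in> lorbit K (fr G X \<alpha> \<beta>) PL z"
    unfolding lorbit_def mem_Collect_eq using Ktransporter[of y z] assms
    by (intro exI[of _ "Ktransporter y z"]) simp
qed

text \<open>An element fixing \<open>z\<close> and the unit over \<open>z\<close> both carry
  \<open>z\<close> to itself, and \<open>Ktransporter\<close> recovers either of them from
  this.\<close>

lemma free_para_lact: "free_laction K (gtop X) (fr G X \<alpha> \<beta>) PL"
  unfolding free_laction_def
proof clarify
  fix \<xi> h z assume dom: "((\<xi>, h), z) \<in> ldom K (gtop X) (fr G X \<alpha> \<beta>)" and e: "PL (\<xi>, h) z = z"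
  then have z: "z \<in> arrows X" by (simp add: ldom_iff arrows_def)
  then have "(fr G X \<alpha> \<beta> z, z) \<in> ldom K (gtop X) (fr G X \<alpha> \<beta>)"
    using K.unit_arrow Kspace.momentum_continuous K.continuous_unit_top[of "gtop X" "fr G X \<alpha> \<beta>"]
    by (auto simp: ldom_iff arrows_def)
  moreover have "PL (fr G X \<alpha> \<beta> z) z = z" using z Kspace.act_unit by (simp add: arrows_def)
  ultimately have "(\<xi>, h) = fr G X \<alpha> \<beta> z"
    using Ktransporter_para_lact e dom by metis
  then show "(\<xi>, h) \<in> units K"
    using z Kspace.momentum_continuous K.continuous_unit_top[of "gtop X" "fr G X \<alpha> \<beta>"]
    by (auto simp: arrows_def)
qed

text \<open>\<open>Ktransporter\<close> recovers the acting element from \<open>y\<close> and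
  \<open>z\<close> and is continuous on the closed set of pairs whose sources lie in one
  \<open>H\<close>-orbit. The action map is therefore a homeomorphism onto a closed set.\<close>

lemma proper_para_lact: "proper_laction K (gtop X) (fr G X \<alpha> \<beta>) PL"
  unfolding proper_laction_def
proof (rule proper_map_of_continuous_inverse)
  let ?XX = "prod_topology (gtop X) (gtop X)"
  let ?S = "{p \<in> topspace ?XX. \<eta> (src X (fst p)) = \<eta> (src X (snd p))}"
  have dom: "topspace (ldom_top K (gtop X) (fr G X \<alpha> \<beta>)) = ldom K (gtop X) (fr G X \<alpha> \<beta>)"
    by (auto simp: ldom_top_def ldom_def arrows_def)
  have PLa: "PL k z \<in> arrows X" if "(k, z) \<in> ldom K (gtop X) (fr G X \<alpha> \<beta>)" for k z
    using continuous_map_image_subset_topspace[OF Kspace.act_continuous] that unfolding dom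
    by (force simp: arrows_def)
  show "(\<lambda>(k, z). (PL k z, z)) \<in> topspace (ldom_top K (gtop X) (fr G X \<alpha> \<beta>)) \<rightarrow> ?S"
    unfolding dom using PLa fs_para_lact by (auto simp: fs_eq_iff arrows_def[symmetric] ldom_iff)
  \<comment> \<open>The closed orbit relation of \<open>H\<close>, pulled back along the source
    maps.\<close>
  have "closedin ?XX {p \<in> topspace ?XX. (src X (fst p), src X (snd p)) \<in>
      {p \<in> topspace ?XX. \<eta> (fst p) = \<eta> (snd p)}}"
    by (rule closedin_continuous_map_preimage[OF _ closedin_horbit_relation])
      (intro continuous_map_pairedI X.continuous_src continuous_map_fst continuous_map_snd)
  moreover have "{p \<in> topspace ?XX. (src X (fst p), src X (snd p)) \<in>
      {p \<in> topspace ?XX. \<eta> (fst p) = \<eta> (snd p)}} = ?S"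
    by (auto simp: arrows_def[symmetric])
  ultimately show "closedin ?XX ?S" by simp
  let ?g = "\<lambda>p. (Ktransporter (fst p) (snd p), snd p)"
  define D where "D = subtopology ?XX ?S"
  have D: "fst p \<in> arrows X" "snd p \<in> arrows X" "\<eta> (src X (fst p)) = \<eta> (src X (snd p))" if "p \<in> topspace D" for p
    using that by (auto simp: D_def arrows_def)
  have c: "continuous_map D (gtop X) fst" "continuous_map D (gtop X) snd"
    by (simp_all add: D_def continuous_map_fst_sub continuous_map_snd_sub)
  let ?h = "\<lambda>p. dual.transporter (src X (snd p)) (src X (fst p)) \<triangleleft>\<^bsub>\<alpha>\<^esub> ginv X (snd p)"
  have T: "dual.transporter (src X z) (src X y) \<in> arrows H"
      "src H (dual.transporter (src X z) (src X y)) = lmom \<alpha> (src X z)"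
      "dual.transporter (src X z) (src X y) \<triangleright>\<^bsub>\<alpha>\<^esub> src X z = src X y"
    if "y \<in> arrows X" "z \<in> arrows X" "\<eta> (src X y) = \<eta> (src X z)" for y z
    using that ltransporter[of "src X z" "src X y"] by simp_all
  have h: "?h p \<in> arrows H" "src H (?h p) = lmom \<alpha> (rng X (snd p))" "(?h p) \<triangleleft>\<^bsub>\<alpha>\<^esub> snd p =
      dual.transporter (src X (snd p)) (src X (fst p))" if "p \<in> topspace D" for p
    using T[OF D[OF that]] D[OF that]
      left.lres_lres_inv[of "dual.transporter (src X (snd p)) (src X (fst p))" "ginv X (snd p)"] by simp_all
  have ch: "continuous_map D (gtop H) ?h"
    by (intro left.continuous_lres continuous_ltransporter X.continuous_src X.continuous_inv c)
      (use D T in simp_all)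
  have "continuous_map D (gtop K) (\<lambda>p. (\<pi> (fst p \<cdot>\<^bsub>X\<^esub> ginv X (?h p \<triangleright>\<^bsub>\<alpha>\<^esub> snd p)), ?h p))"
    unfolding quot.continuous_lprod_iff
  proof (intro conjI ch ballI)
    show "continuous_map D (gtop Q) (\<lambda>p. \<pi> (fst p \<cdot>\<^bsub>X\<^esub> ginv X (?h p \<triangleright>\<^bsub>\<alpha>\<^esub> snd p)))"
      by (intro right.continuous_orb X.continuous_mult X.continuous_inv left.continuous_lact ch c)
        (use D T h in simp_all)
    show "(\<pi> (fst p \<cdot>\<^bsub>X\<^esub> ginv X (?h p \<triangleright>\<^bsub>\<alpha>\<^esub> snd p)), ?h p) \<in> arrows K" if "p \<in> topspace D" for p
      using Ktransporter(1)[OF D[OF that]] by (simp add: Ktransporter_def Let_def)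
  qed
  then have "continuous_map D (gtop K) (\<lambda>p. Ktransporter (fst p) (snd p))"
    by (simp add: Ktransporter_def Let_def)
  then have "continuous_map D (ldom_top K (gtop X) (fr G X \<alpha> \<beta>)) ?g"
    unfolding ldom_top_def continuous_map_in_subtopology
    using c(2) D Ktransporter by (auto intro!: continuous_map_pairedI simp: ldom_iff arrows_def[symmetric])
  then show "continuous_map (subtopology ?XX ?S) (ldom_top K (gtop X) (fr G X \<alpha> \<beta>)) ?g"
    by (simp add: D_def)
  show "?g (case q of (k, z) \<Rightarrow> (PL k z, z)) = q" if "q \<in> topspace (ldom_top K (gtop X) (fr G X \<alpha> \<beta>))" for q
    using that unfolding dom by (cases q) (simp add: Ktransporter_para_lact)
  show "(case ?g p of (k, z) \<Rightarrow> (PL k z, z)) = p" if "p \<in> ?S" for p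
    using that Ktransporter(3)[of "fst p" "snd p"] by (auto simp: arrows_def)
qed

text \<open>The ranges of an open \<open>U\<close> are the trace of some open \<open>V\<close> on
  the units, by openness of the range map of \<open>X\<close>. A member of \<open>V\<close>
  equivalent to a unit is a unit, so the image of \<open>U\<close> is cut out of the units of
  \<open>K\<close> by the open condition that the first coordinate lies in the image of
  \<open>V\<close>.\<close>

lemma open_quotient_fr: "open_quotient (gtop X) (unit_top K) (fr G X \<alpha> \<beta>)"
  unfolding open_quotient_def
proof (intro conjI continuous_fr)
  show "fr G X \<alpha> \<beta> ` topspace (gtop X) = topspace (unit_top K)"
  proof -
    have "fr G X \<alpha> \<beta> ` arrows X = (\<lambda>u. (u, lmom \<alpha>Q u)) ` \<pi> ` units X"
    proof (intro equalityI subsetI)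
      fix k assume "k \<in> (\<lambda>u. (u, lmom \<alpha>Q u)) ` \<pi> ` units X"
      then obtain u where "u \<in> units X" "k = fr G X \<alpha> \<beta> u" by auto
      then show "k \<in> fr G X \<alpha> \<beta> ` arrows X" using X.unit_arrow by blast
    next
      fix k assume "k \<in> fr G X \<alpha> \<beta> ` arrows X"
      then obtain x where "x \<in> arrows X" "k = (\<pi> (rng X x), lmom \<alpha>Q (\<pi> (rng X x)))" by auto
      then show "k \<in> (\<lambda>u. (u, lmom \<alpha>Q u)) ` \<pi> ` units X" using X.rng_in_units by blast
    qed
    then show ?thesis
      using K.units_arrows by (simp add: quot.units_lprod right.units_quot arrows_def[symmetric])
  qed
  show "open_map (gtop X) (unit_top K) (fr G X \<alpha> \<beta>)"
    unfolding open_map_def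
  proof (intro allI impI)
    fix U assume U: "openin (gtop X) U"
    then have UX: "U \<subseteq> arrows X" by (simp add: openin_subset arrows_def)
    have "openin (unit_top X) (rng X ` U)"
      using X.open_range[OF open_source_middle] U unfolding open_map_def by blast
    then obtain V where V: "openin (gtop X) V" "rng X ` U = V \<inter> units X"
      by (auto simp: unit_top_def openin_subtopology)
    then have VX: "V \<subseteq> arrows X" by (simp add: openin_subset arrows_def)
    have "openin (gtop Q) (\<pi> ` V)"
      using V(1) right.open_quotient_orb unfolding open_quotient_def open_map_def by blast
    then have "openin (prod_topology (gtop Q) (gtop H)) (\<pi> ` V \<times> arrows H)"
      by (simp add: openin_prod_Times_iff arrows_def)
    moreover have "unit_top K = subtopology (prod_topology (gtop Q) (gtop H)) (units K)"
      using K.units_arrows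
      by (simp add: unit_top_def quot.gtop_lprod subtopology_subtopology inf.absorb2)
    ultimately have "openin (unit_top K) (units K \<inter> (\<pi> ` V \<times> arrows H))"
      by (metis Int_commute openin_subtopology)
    moreover have "units K \<inter> (\<pi> ` V \<times> arrows H) = fr G X \<alpha> \<beta> ` U"
    proof (intro equalityI subsetI)
      fix k assume "k \<in> units K \<inter> (\<pi> ` V \<times> arrows H)"
      then have k: "k \<in> (\<lambda>u. (u, lmom \<alpha>Q u)) ` \<pi> ` units X" "fst k \<in> \<pi> ` V"
        by (auto simp: quot.units_lprod right.units_quot)
      from k(1) obtain u where u: "u \<in> units X" "k = (\<pi> u, lmom \<alpha>Q (\<pi> u))" by blast
      with k(2) obtain v where uv: "u \<in> units X" "k = (\<pi> u, lmom \<alpha>Q (\<pi> u))" "v \<in> V" "\<pi> u = \<pi> v" by auto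
      then have "v \<in> units X" using right.orb_unitD[of v] VX by (metis imageI subsetD)
      then obtain x where "x \<in> U" "v = rng X x" using V(2) uv(3) by blast
      then show "k \<in> fr G X \<alpha> \<beta> ` U" using uv UX by (auto intro!: image_eqI[of _ _ x])
    next
      fix k assume "k \<in> fr G X \<alpha> \<beta> ` U"
      then obtain x where x: "x \<in> U" "x \<in> arrows X" "k = (\<pi> (rng X x), lmom \<alpha>Q (\<pi> (rng X x)))"
        using UX by auto
      then have "rng X x \<in> V" "rng X x \<in> units X" using V(2) by auto
      then show "k \<in> units K \<inter> (\<pi> ` V \<times> arrows H)"
        using x by (auto simp: quot.units_lprod right.units_quot)
    qed
    ultimately show "openin (unit_top K) (fr G X \<alpha> \<beta> ` U)" by simp
  qed
qed

end


section \<open>The left half of the Fell bundle equivalence\<close>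

text \<open>The formula of \<open>lm\<close> in the theorem, named so that its theory can be
  developed inside a locale; \<open>bundle_lip\<close> does the same for \<open>lip\<close>.\<close>

definition bundle_lact ::
  "'x groupoid \<Rightarrow> ('b, 'x) fell_bundle \<Rightarrow> ('h \<Rightarrow> 'b \<Rightarrow> 'b) \<Rightarrow> 'b set \<times> 'h \<Rightarrow> 'b \<Rightarrow> 'b"
  where "bundle_lact X E lb = (\<lambda>(\<Theta>, h) b.
    let a = (THE a. a \<in> \<Theta> \<and> src X (proj E a) = rng X (proj E (lb h b))) in a \<odot>\<^bsub>E\<^esub> lb h b)"

definition bundle_lip ::
  "'h groupoid \<Rightarrow> 'g groupoid \<Rightarrow> 'x groupoid \<Rightarrow> ('h, 'x) left_ss \<Rightarrow> ('g, 'x) right_ss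
    \<Rightarrow> ('b, 'x) fell_bundle \<Rightarrow> ('h \<Rightarrow> 'b \<Rightarrow> 'b) \<Rightarrow> ('b \<Rightarrow> 'g \<Rightarrow> 'b) \<Rightarrow> 'b \<Rightarrow> 'b \<Rightarrow> 'b set \<times> 'h"
  where "bundle_lip H G X \<alpha> \<beta> E lb rb = (\<lambda>a b.
    let h = (THE h. h \<in> arrows H \<and> src H h = lrho X \<alpha> (src X (proj E b))
                  \<and> src X (proj E a) = h \<triangleright>\<^bsub>\<alpha>\<^esub> src X (proj E b))
    in (bgorb G X \<beta> E rb (a \<odot>\<^bsub>E\<^esub> lb h (bstar E b)), h \<triangleleft>\<^bsub>\<alpha>\<^esub> proj E (bstar E b)))"

locale self_similar_bundle_equivalence =
  self_similar_para_equivalence H G X \<alpha> \<beta> +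
  lbdl: self_similar_left_bundle H X \<alpha> E lb + rbdl: free_proper_right_bundle G X \<beta> E rb
  for H :: "'h groupoid" and G :: "'g groupoid" and X :: "'x groupoid"
    and \<alpha> :: "('h, 'x) left_ss" and \<beta> :: "('g, 'x) right_ss"
    and E :: "('b, 'x) fell_bundle" and lb :: "'h \<Rightarrow> 'b \<Rightarrow> 'b" and rb :: "'b \<Rightarrow> 'g \<Rightarrow> 'b" +
  assumes saturated: "saturated X E"
    and bact_commute: "\<lbrakk>h \<in> arrows H; b \<in> points E; t \<in> arrows G;
        src H h = lmom \<alpha> (rng X (proj E b)); rng G t = rmom \<beta> (src X (proj E b))\<rbrakk>
      \<Longrightarrow> lb h (rb b t) = rb (lb h b) t"
begin

abbreviation borbit ("\<kappa>") where "\<kappa> \<equiv> bgorb G X \<beta> E rb"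
abbreviation EQ where "EQ \<equiv> rquot_bundle X E G \<beta> rb"
abbreviation lbQ where "lbQ \<equiv> bact_on_rquot G X \<beta> E lb rb"
abbreviation A where "A \<equiv> lprod_bundle Q EQ H \<alpha>Q lbQ"
abbreviation LM where "LM \<equiv> bundle_lact X E lb"
abbreviation LIP where "LIP \<equiv> bundle_lip H G X \<alpha> \<beta> E lb rb"

lemma bact_quot [simp]:
  "\<lbrakk>b \<in> points E; h \<in> arrows H; src H h = lmom \<alpha> (rng X (proj E b))\<rbrakk> \<Longrightarrow> lbQ h (\<kappa> b) = \<kappa> (lb h b)"
  using rbdl.the_elem_borb[of b "\<lambda>b. \<kappa> (lb h b)"] by (simp add: bact_on_rquot_def bact_commute)

lemma bldom_quot:
  "b \<in> points E \<Longrightarrow> (h, \<kappa> b) \<in> bldom H Q \<alpha>Q EQ \<longleftrightarrow> h \<in> arrows H \<and> src H h = lmom \<alpha> (rng X (proj E b))"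
  using rbdl.borb_point[of b] unfolding bldom_def points_def by (auto simp: ldom_iff lrho_def points_def[symmetric])

text \<open>Commutation of the two actions on the bundle lets \<open>H\<close> act on orbits. The
  rules are those for representatives; for multiplicativity the second factor is represented first
  and the first is lifted to match.\<close>

lemma self_similar_left_bundle_quot: "self_similar_left_bundle H Q \<alpha>Q EQ lbQ"
proof (intro self_similar_left_bundle.intro self_similar_left_bundle_axioms.intro
    self_similar_left_quot rbdl.fell_bundle_quot)
  let ?m = "\<lambda>b. lrho Q \<alpha>Q (proj EQ b)"
  show "continuous_map (ldom_top H (btop EQ) ?m) (btop EQ) (\<lambda>(h, b). lbQ h b)"
    unfolding ldom_top_def
  proof (rule open_quotient_lift2[OF open_quotient_id rbdl.open_quotient_borb])
    let ?D = "subtopology (prod_topology (gtop H) (btop E)) {p. (fst p, \<kappa> (snd p)) \<in> ldom H (btop EQ) ?m}"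
    have D: "fst p \<in> arrows H" "snd p \<in> points E" "src H (fst p) = lmom \<alpha> (rng X (proj E (snd p)))"
      if "p \<in> topspace ?D" for p
    proof -
      have "snd p \<in> points E" "(fst p, \<kappa> (snd p)) \<in> bldom H Q \<alpha>Q EQ"
        using that by (auto simp: bldom_def points_def)
      then show "fst p \<in> arrows H" "snd p \<in> points E" "src H (fst p) = lmom \<alpha> (rng X (proj E (snd p)))"
        using bldom_quot by blast+
    qed
    have "continuous_map ?D (btop EQ) (\<lambda>p. \<kappa> (lb (fst p) (snd p)))"
      by (intro rbdl.continuous_borb lbdl.continuous_bact continuous_map_fst_sub continuous_map_snd_sub)
        (use D in blast)
    then show "continuous_map ?D (btop EQ) (\<lambda>p. case (fst p, \<kappa> (snd p)) of (h, b) \<Rightarrow> lbQ h b)"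
    proof (rule continuous_map_eq)
      fix p assume "p \<in> topspace ?D"
      from D[OF this] show "\<kappa> (lb (fst p) (snd p)) = (case (fst p, \<kappa> (snd p)) of (h, b) \<Rightarrow> lbQ h b)" by simp
    qed
  qed
  have dom: "\<exists>b. b \<in> points E \<and> \<Theta> = \<kappa> b \<and> h \<in> arrows H \<and> src H h = lmom \<alpha> (rng X (proj E b))"
    if "(h, \<Theta>) \<in> bldom H Q \<alpha>Q EQ" for h \<Theta>
  proof -
    have "\<Theta> \<in> points EQ" using that by (simp add: bldom_def ldom_iff points_def)
    then show ?thesis using that bldom_quot by (auto simp: rbdl.points_quot)
  qed
  show "proj EQ (lbQ h \<Theta>) = lact \<alpha>Q h (proj EQ \<Theta>)" "lbQ h (bsmul EQ w \<Theta>) = bsmul EQ w (lbQ h \<Theta>)"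
    "bstar EQ (lbQ h \<Theta>) = lbQ (lres \<alpha>Q h (proj EQ \<Theta>)) (bstar EQ \<Theta>)"
    if "(h, \<Theta>) \<in> bldom H Q \<alpha>Q EQ" for h \<Theta> w
    using dom[OF that] by (auto simp: lbdl.bact_bsmul lbdl.bact_bstar)
  show "lbQ h (badd EQ \<Theta> \<Xi>) = badd EQ (lbQ h \<Theta>) (lbQ h \<Xi>)"
    if h\<Theta>: "(h, \<Theta>) \<in> bldom H Q \<alpha>Q EQ" and \<Xi>: "\<Xi> \<in> fibre EQ (proj EQ \<Theta>)" for h \<Theta> \<Xi>
  proof -
    obtain b where b: "b \<in> points E" "\<Theta> = \<kappa> b" "h \<in> arrows H" "src H h = lmom \<alpha> (rng X (proj E b))"
      using dom[OF h\<Theta>] by blast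
    obtain c where "c \<in> points E" "\<kappa> c = \<Xi>" "proj E c = proj E b"
      using rbdl.blift_fibre[of b \<Xi>] b \<Xi> by blast
    then show ?thesis using b by (auto simp: lbdl.bact_badd)
  qed
  show "lbQ k (lbQ h \<Theta>) = lbQ (k \<cdot>\<^bsub>H\<^esub> h) \<Theta>"
    if "(k, h) \<in> composable H" "(h, \<Theta>) \<in> bldom H Q \<alpha>Q EQ" for k h \<Theta>
    using dom[OF that(2)] that(1) by (auto simp: H.composable_iff lbdl.mult_bact)
  show "lbQ (lrho Q \<alpha>Q (proj EQ \<Theta>)) \<Theta> = \<Theta>" if "\<Theta> \<in> points EQ" for \<Theta>
    using that by (auto simp: rbdl.points_quot lrho_def)
  show "lbQ h (\<Theta> \<odot>\<^bsub>EQ\<^esub> \<Xi>) = lbQ h \<Theta> \<odot>\<^bsub>EQ\<^esub> lbQ (lres \<alpha>Q h (proj EQ \<Theta>)) \<Xi>"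
    if h\<Theta>: "(h, \<Theta>) \<in> bldom H Q \<alpha>Q EQ" and c: "(\<Theta>, \<Xi>) \<in> bcomposable Q EQ" for h \<Theta> \<Xi>
  proof -
    have c': "\<Theta> \<in> points EQ" "\<Xi> \<in> points EQ" "src Q (proj EQ \<Theta>) = rng Q (proj EQ \<Xi>)"
      using c by (simp_all add: bcomposable_def composable_def)
    obtain d where d: "d \<in> points E" "\<Xi> = \<kappa> d" using c'(2) by (auto simp: rbdl.points_quot)
    have "rng X (proj E d) \<in> units X" "src Q (proj EQ \<Theta>) = \<pi> (rng X (proj E d))"
      using d c' by simp_all
    then obtain b where b: "b \<in> points E" "\<kappa> b = \<Theta>" "src X (proj E b) = rng X (proj E d)"
      using rbdl.blift_src[OF c'(1)] by blast
    have "h \<in> arrows H" "src H h = lmom \<alpha> (rng X (proj E b))"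
      using h\<Theta> bldom_quot[OF b(1)] b(2) by simp_all
    then show ?thesis using b d by (auto simp: lbdl.bact_bmult)
  qed
qed

section \<open>Matching representatives and the left action on the bundle\<close>

sublocale prodb: self_similar_left_product_bundle H Q \<alpha>Q EQ lbQ
  by (intro self_similar_left_product_bundle.intro quot.self_similar_left_product_axioms
      self_similar_left_bundle_quot)

lemma fell_bundle_A: "fell_bundle K A" by (rule prodb.fell_bundle_lprod)

lemma saturated_A: "saturated K A"
  by (rule prodb.saturated_lprod[OF rbdl.saturated_quot[OF saturated]])

lemma points_A [simp]:
  "b \<in> points E \<Longrightarrow> (\<kappa> b, h) \<in> points A \<longleftrightarrow> h \<in> arrows H \<and> lmom \<alpha> (src X (proj E b)) = rng H h"
  by (simp add: prodb.points_lprod)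

text \<open>The base arrow is put into the form given by \<open>K_representative\<close>, and the
  orbit of vectors has a member over exactly that representative.\<close>

lemma A_representative:
  assumes "p \<in> points A" "y \<in> arrows X" "src K (proj A p) = fr G X \<alpha> \<beta> y"
  obtains a h where "p = (\<kappa> a, h)" "a \<in> points E" "h \<in> arrows H" "lmom \<alpha> (src X (proj E a)) = rng H h"
    "src H h = lmom \<alpha> (rng X y)" "src X (proj E a) = h \<triangleright>\<^bsub>\<alpha>\<^esub> rng X y"
proof -
  obtain \<Theta> h where p: "p = (\<Theta>, h)" by fastforce
  have \<Theta>: "\<Theta> \<in> points EQ" using assms(1) by (simp add: p prodb.points_lprod)
  have "proj A p \<in> arrows K"
    using fell_bundle.proj_arrow[OF fell_bundle_A assms(1)] .
  then obtain x h' where x: "proj A p = (\<pi> x, h')" "x \<in> arrows X" "h' \<in> arrows H" "lmom \<alpha> (src X x) = rng H h'"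
    "src H h' = lmom \<alpha> (rng X y)" "src X x = h' \<triangleright>\<^bsub>\<alpha>\<^esub> rng X y"
    using assms(2,3) by (rule K_representative)
  then have "proj EQ \<Theta> = \<pi> x" "h' = h" by (simp_all add: p)
  moreover obtain a where "a \<in> points E" "\<kappa> a = \<Theta>" "proj E a = x"
    using rbdl.blift[OF \<Theta> x(2)] \<open>proj EQ \<Theta> = \<pi> x\<close> by blast
  ultimately show thesis using that[of a h] x p by simp
qed

lemma src_A_eq_fr:
  assumes "a \<in> points E" "h \<in> arrows H" "lmom \<alpha> (src X (proj E a)) = rng H h" "y \<in> arrows X"
    "src H h = lmom \<alpha> (rng X y)" "src X (proj E a) = h \<triangleright>\<^bsub>\<alpha>\<^esub> rng X y"
  shows "src K (proj A (\<kappa> a, h)) = fr G X \<alpha> \<beta> y"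
  using src_K_eq_fr[of "proj E a" h y] assms by simp

lemma bundle_lact_unique:
  assumes "(\<Theta>, h) \<in> points A" "b \<in> points E" "src K (proj A (\<Theta>, h)) = fr G X \<alpha> \<beta> (proj E b)"
  shows "\<exists>!a. a \<in> \<Theta> \<and> src X (proj E a) = rng X (proj E (lb h b))"
proof -
  obtain a h' where a: "(\<Theta>, h) = (\<kappa> a, h')" "a \<in> points E" "h' \<in> arrows H" "lmom \<alpha> (src X (proj E a)) = rng H h'"
    "src H h' = lmom \<alpha> (rng X (proj E b))" "src X (proj E a) = h' \<triangleright>\<^bsub>\<alpha>\<^esub> rng X (proj E b)"
    using A_representative[OF assms(1) _ assms(3)] assms(2) lbdl.fell.proj_arrow by metis
  show ?thesis
  proof (rule ex1I[of _ a])
    show "a \<in> \<Theta> \<and> src X (proj E a) = rng X (proj E (lb h b))" using a assms(2) by simp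
    fix c assume c: "c \<in> \<Theta> \<and> src X (proj E c) = rng X (proj E (lb h b))"
    then have "c \<in> \<kappa> a" using a(1) by simp
    then have "c \<in> points E" "\<kappa> c = \<kappa> a" using a(2) by (auto elim: rbdl.in_borbE)
    then show "c = a" using rbdl.borb_proj_unique[of c a] a c assms(2) by simp
  qed
qed

lemma bundle_lact_eq:
  assumes "a \<in> points E" "h \<in> arrows H" "b \<in> points E" "src H h = lmom \<alpha> (rng X (proj E b))"
    "src X (proj E a) = h \<triangleright>\<^bsub>\<alpha>\<^esub> rng X (proj E b)"
  shows "LM (\<kappa> a, h) b = a \<odot>\<^bsub>E\<^esub> lb h b"
proof -
  have "lmom \<alpha> (src X (proj E a)) = rng H h" using assms by simp
  then have "\<exists>!a'. a' \<in> \<kappa> a \<and> src X (proj E a') = rng X (proj E (lb h b))"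
    using assms src_A_eq_fr[of a h "proj E b"] by (intro bundle_lact_unique) simp_all
  moreover have "a \<in> \<kappa> a \<and> src X (proj E a) = rng X (proj E (lb h b))" using assms by simp
  ultimately have "(THE a'. a' \<in> \<kappa> a \<and> src X (proj E a') = rng X (proj E (lb h b))) = a"
    by (rule the1_equality)
  then show ?thesis by (simp add: bundle_lact_def)
qed

lemma open_quotient_A:
  "open_quotient (subtopology (prod_topology (btop E) (gtop H)) {p. (\<kappa> (fst p), snd p) \<in> points A})
    (btop A) (\<lambda>p. (\<kappa> (fst p), snd p))"
proof -
  have "btop A = subtopology (prod_topology (btop EQ) (gtop H)) (points A)"
    unfolding prodb.btop_lprod by (subst subtopology_restrict[symmetric])
      (auto intro!: arg_cong2[where f = subtopology] simp: points_def prodb.btop_lprod)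
  then show ?thesis
    using open_quotient_restrict[OF open_quotient_prod[OF rbdl.open_quotient_borb open_quotient_id[of "gtop H"]],
        where S = "points A"] by simp
qed

lemma bundle_lact_continuous:
  "continuous_map
    (subtopology (prod_topology (btop A) (btop E)) {(a, m). src K (proj A a) = fr G X \<alpha> \<beta> (proj E m)})
    (btop E) (\<lambda>(a, m). LM a m)"
proof (rule open_quotient_lift2[OF open_quotient_A open_quotient_id])
  define D where "D = subtopology (prod_topology (subtopology (prod_topology (btop E) (gtop H))
      {p. (\<kappa> (fst p), snd p) \<in> points A}) (btop E))
    {p. ((\<kappa> (fst (fst p)), snd (fst p)), snd p) \<in> {(a, m). src K (proj A a) = fr G X \<alpha> \<beta> (proj E m)}}"
  have D: "fst (fst p) \<in> points E" "snd (fst p) \<in> arrows H" "snd p \<in> points E"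
    "src H (snd (fst p)) = lmom \<alpha> (rng X (proj E (snd p)))"
    "\<pi> (src X (proj E (fst (fst p)))) = \<pi> (snd (fst p) \<triangleright>\<^bsub>\<alpha>\<^esub> rng X (proj E (snd p)))"
    if p: "p \<in> topspace D" for p
  proof -
    show a: "fst (fst p) \<in> points E" "snd (fst p) \<in> arrows H" "snd p \<in> points E"
      using p unfolding D_def by (auto simp: arrows_def[symmetric] points_def)
    have "(\<kappa> (fst (fst p)), snd (fst p)) \<in> points A"
      "src K (proj A (\<kappa> (fst (fst p)), snd (fst p))) = fr G X \<alpha> \<beta> (proj E (snd p))"
      using p unfolding D_def by auto
    then obtain c h where c: "(\<kappa> (fst (fst p)), snd (fst p)) = (\<kappa> c, h)" "c \<in> points E" "h \<in> arrows H"
      "lmom \<alpha> (src X (proj E c)) = rng H h" "src H h = lmom \<alpha> (rng X (proj E (snd p)))"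
      "src X (proj E c) = h \<triangleright>\<^bsub>\<alpha>\<^esub> rng X (proj E (snd p))"
      using A_representative[OF _ lbdl.fell.proj_arrow[OF a(3)]] by metis
    then show "src H (snd (fst p)) = lmom \<alpha> (rng X (proj E (snd p)))" by simp
    have "\<pi> (proj E (fst (fst p))) = \<pi> (proj E c)" using c(1,2) a(1) by (metis rbdl.proj_quot prod.inject)
    then have "\<pi> (src X (proj E (fst (fst p)))) = \<pi> (src X (proj E c))"
      using a(1) c(2) by (metis right.src_quot lbdl.fell.proj_arrow)
    then show "\<pi> (src X (proj E (fst (fst p)))) = \<pi> (snd (fst p) \<triangleright>\<^bsub>\<alpha>\<^esub> rng X (proj E (snd p)))"
      using c by simp
  qed
  have "continuous_map D (prod_topology (btop E) (gtop H)) fst" "continuous_map D (btop E) snd"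
    unfolding D_def using continuous_map_fst_sub continuous_map_snd_sub
    by (auto intro: continuous_map_into_fulltopology)
  then have c: "continuous_map D (btop E) (\<lambda>p. fst (fst p))" "continuous_map D (gtop H) (\<lambda>p. snd (fst p))"
    "continuous_map D (btop E) (\<lambda>p. snd p)"
    using continuous_map_fst_comp continuous_map_snd_comp by auto
  \<comment> \<open>The arrow of \<open>G\<close> that moves the source of the first vector to the
    range required by the second.\<close>
  let ?t = "\<lambda>p. right.transporter (src X (proj E (fst (fst p)))) (snd (fst p) \<triangleright>\<^bsub>\<alpha>\<^esub> rng X (proj E (snd p)))"
  have "continuous_map D (btop E) (\<lambda>p. rb (fst (fst p)) (?t p) \<odot>\<^bsub>E\<^esub> lb (snd (fst p)) (snd p))"
    by (intro lbdl.fell.continuous_bmult rbdl.bdl.continuous_bact right.continuous_transporter X.continuous_src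
        lbdl.fell.continuous_proj lbdl.continuous_bact left.continuous_lact X.continuous_rng c)
      (use D in simp_all)
  then have "continuous_map D (btop E) (\<lambda>p. LM (\<kappa> (fst (fst p)), snd (fst p)) (snd p))"
  proof (rule continuous_map_eq)
    fix p assume "p \<in> topspace D"
    note D = D[OF this]
    let ?x = "rb (fst (fst p)) (?t p)"
    have "?x \<in> points E" "\<kappa> ?x = \<kappa> (fst (fst p))" "src X (proj E ?x) = snd (fst p) \<triangleright>\<^bsub>\<alpha>\<^esub> rng X (proj E (snd p))"
      using D by simp_all
    then show "?x \<odot>\<^bsub>E\<^esub> lb (snd (fst p)) (snd p) = LM (\<kappa> (fst (fst p)), snd (fst p)) (snd p)"
      using bundle_lact_eq[of ?x "snd (fst p)" "snd p"] D by simp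
  qed
  then show "continuous_map (subtopology (prod_topology (subtopology (prod_topology (btop E) (gtop H))
      {p. (\<kappa> (fst p), snd p) \<in> points A}) (btop E))
    {p. ((\<kappa> (fst (fst p)), snd (fst p)), snd p) \<in> {(a, m). src K (proj A a) = fr G X \<alpha> \<beta> (proj E m)}}) (btop E)
    (\<lambda>p. case ((\<kappa> (fst (fst p)), snd (fst p)), snd p) of (a, m) \<Rightarrow> LM a m)"
    unfolding D_def by simp
qed

lemma bundle_lact_facts:
  assumes "p \<in> points A" "m \<in> points E" "src K (proj A p) = fr G X \<alpha> \<beta> (proj E m)"
  shows "LM p m \<in> points E" "proj E (LM p m) = PL (proj A p) (proj E m)"
    "bnorm E (LM p m) \<le> bnorm A p * bnorm E m"
    "LM p (bsmul E k m) = bsmul E k (LM p m)" "LM (bsmul A k p) m = bsmul E k (LM p m)"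
proof -
  obtain a h where a: "p = (\<kappa> a, h)" "a \<in> points E" "h \<in> arrows H" "lmom \<alpha> (src X (proj E a)) = rng H h"
    "src H h = lmom \<alpha> (rng X (proj E m))" "src X (proj E a) = h \<triangleright>\<^bsub>\<alpha>\<^esub> rng X (proj E m)"
    using assms(1) lbdl.fell.proj_arrow[OF assms(2)] assms(3) by (rule A_representative)
  have e: "LM p m = a \<odot>\<^bsub>E\<^esub> lb h m" unfolding a(1) by (rule bundle_lact_eq) (use a assms in simp_all)
  show "LM p m \<in> points E" "proj E (LM p m) = PL (proj A p) (proj E m)"
    unfolding e using a assms(2) para_lact_eq[of "proj E a" h "proj E m"] by simp_all
  show "bnorm E (LM p m) \<le> bnorm A p * bnorm E m"
    unfolding e using a assms(2) lbdl.fell.bnorm_bmult[of a "lb h m"] by simp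
  show "LM p (bsmul E k m) = bsmul E k (LM p m)" "LM (bsmul A k p) m = bsmul E k (LM p m)"
    unfolding e using a assms(2) bundle_lact_eq[of a h "bsmul E k m"] bundle_lact_eq[of "bsmul E k a" h m]
    by (simp_all add: lbdl.fell.bmult_bsmul lbdl.bact_bsmul)
qed

text \<open>\<open>q\<close> is represented to match \<open>m\<close>, and \<open>p\<close> to match
  that representative. What remains is associativity in \<open>E\<close> together with the product
  rule of the action.\<close>

lemma bundle_lact_assoc:
  assumes pq: "(p, q) \<in> bcomposable K A" and m: "m \<in> points E" "src K (proj A q) = fr G X \<alpha> \<beta> (proj E m)"
  shows "LM p (LM q m) = LM (p \<odot>\<^bsub>A\<^esub> q) m"
proof -
  have pq': "p \<in> points A" "q \<in> points A" "src K (proj A p) = rng K (proj A q)"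
    using pq by (simp_all add: bcomposable_def composable_def)
  obtain a h where a: "q = (\<kappa> a, h)" "a \<in> points E" "h \<in> arrows H" "lmom \<alpha> (src X (proj E a)) = rng H h"
    "src H h = lmom \<alpha> (rng X (proj E m))" "src X (proj E a) = h \<triangleright>\<^bsub>\<alpha>\<^esub> rng X (proj E m)"
    using pq'(2) lbdl.fell.proj_arrow[OF m(1)] m(2) by (rule A_representative)
  have "src K (proj A p) = fr G X \<alpha> \<beta> (proj E a)" using pq'(3) a(1,2) by simp
  with pq'(1) lbdl.fell.proj_arrow[OF a(2)] obtain b k where
    b: "p = (\<kappa> b, k)" "b \<in> points E" "k \<in> arrows H" "lmom \<alpha> (src X (proj E b)) = rng H k"
    "src H k = lmom \<alpha> (rng X (proj E a))" "src X (proj E b) = k \<triangleright>\<^bsub>\<alpha>\<^esub> rng X (proj E a)"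
    by (rule A_representative)
  have "LM (\<kappa> b, k) (LM (\<kappa> a, h) m) = b \<odot>\<^bsub>E\<^esub> lb k (a \<odot>\<^bsub>E\<^esub> lb h m)"
    using a b m by (simp add: bundle_lact_eq)
  moreover have "(\<kappa> b, k) \<odot>\<^bsub>A\<^esub> (\<kappa> a, h) = (\<kappa> (b \<odot>\<^bsub>E\<^esub> lb k a), (k \<triangleleft>\<^bsub>\<alpha>\<^esub> proj E a) \<cdot>\<^bsub>H\<^esub> h)"
    using a b by simp
  moreover have "LM (\<kappa> (b \<odot>\<^bsub>E\<^esub> lb k a), (k \<triangleleft>\<^bsub>\<alpha>\<^esub> proj E a) \<cdot>\<^bsub>H\<^esub> h) m = (b \<odot>\<^bsub>E\<^esub> lb k a) \<odot>\<^bsub>E\<^esub> lb ((k \<triangleleft>\<^bsub>\<alpha>\<^esub> proj E a) \<cdot>\<^bsub>H\<^esub> h) m"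
    by (rule bundle_lact_eq) (use a b m in \<open>simp_all add: left.mult_lact\<close>)
  ultimately show ?thesis
    unfolding a(1) b(1) using a b m
    by (simp add: lbdl.bact_bmult lbdl.mult_bact lbdl.fell.bmult_assoc)
qed

section \<open>The left inner product\<close>

lemma lip_element_unique:
  assumes "a \<in> points E" "b \<in> points E" "fs H X \<alpha> \<beta> (proj E a) = fs H X \<alpha> \<beta> (proj E b)"
  shows "\<exists>!h. h \<in> arrows H \<and> src H h = lrho X \<alpha> (src X (proj E b)) \<and> src X (proj E a) = h \<triangleright>\<^bsub>\<alpha>\<^esub> src X (proj E b)"
proof -
  let ?u = "src X (proj E b)" and ?v = "src X (proj E a)"
  have uv: "?u \<in> units X" "?v \<in> units X" "\<eta> ?u = \<eta> ?v" using assms by (simp_all add: fs_eq_iff)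
  show ?thesis
  proof (rule ex1I[of _ "dual.transporter ?u ?v"])
    show "dual.transporter ?u ?v \<in> arrows H \<and> src H (dual.transporter ?u ?v) = lrho X \<alpha> ?u \<and>
        ?v = dual.transporter ?u ?v \<triangleright>\<^bsub>\<alpha>\<^esub> ?u"
      using ltransporter[of ?u ?v] uv assms by (simp add: lrho_def)
    fix h assume h: "h \<in> arrows H \<and> src H h = lrho X \<alpha> ?u \<and> ?v = h \<triangleright>\<^bsub>\<alpha>\<^esub> ?u"
    have "dual.transporter ?u (h \<triangleright>\<^bsub>\<alpha>\<^esub> ?u) = h"
      by (rule ltransporter_lact) (use h assms(2) in \<open>simp_all add: lrho_def\<close>)
    then show "h = dual.transporter ?u ?v" using h by simp
  qed
qed

lemma lip_element:
  assumes "a \<in> points E" "b \<in> points E" "fs H X \<alpha> \<beta> (proj E a) = fs H X \<alpha> \<beta> (proj E b)"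
  obtains h where "h \<in> arrows H" "src H h = lmom \<alpha> (src X (proj E b))" "src X (proj E a) = h \<triangleright>\<^bsub>\<alpha>\<^esub> src X (proj E b)"
  using lip_element_unique[OF assms] assms(2) by (auto simp: lrho_def)

lemma fs_eq:
  assumes "a \<in> points E" "b \<in> points E" "h \<in> arrows H" "src H h = lmom \<alpha> (src X (proj E b))"
    "src X (proj E a) = h \<triangleright>\<^bsub>\<alpha>\<^esub> src X (proj E b)"
  shows "fs H X \<alpha> \<beta> (proj E a) = fs H X \<alpha> \<beta> (proj E b)"
  using assms by (simp add: fs_eq_iff)

lemma lip_eq:
  assumes "a \<in> points E" "b \<in> points E" "h \<in> arrows H" "src H h = lmom \<alpha> (src X (proj E b))"
    "src X (proj E a) = h \<triangleright>\<^bsub>\<alpha>\<^esub> src X (proj E b)"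
  shows "LIP a b = (\<kappa> (a \<odot>\<^bsub>E\<^esub> lb h (bstar E b)), h \<triangleleft>\<^bsub>\<alpha>\<^esub> ginv X (proj E b))"
proof -
  have "(THE h. h \<in> arrows H \<and> src H h = lrho X \<alpha> (src X (proj E b)) \<and> src X (proj E a) = h \<triangleright>\<^bsub>\<alpha>\<^esub> src X (proj E b)) = h"
    by (rule the1_equality[OF lip_element_unique[OF assms(1,2) fs_eq[OF assms]]])
      (use assms in \<open>simp add: lrho_def\<close>)
  then show ?thesis using assms(2) by (simp add: bundle_lip_def)
qed

text \<open>
  The hypotheses say that \<open>h\<close> is the element of \<open>H\<close> entering the definition of the inner product of
  \<open>a\<close> and \<open>b\<close>.
\<close>

lemma lip_facts:
  assumes ab: "a \<in> points E" "b \<in> points E" and h: "h \<in> arrows H" "src H h = lmom \<alpha> (src X (proj E b))"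
    "src X (proj E a) = h \<triangleright>\<^bsub>\<alpha>\<^esub> src X (proj E b)"
  shows "LIP a b \<in> points A" "src K (proj A (LIP a b)) = fr G X \<alpha> \<beta> (proj E b)"
    "PL (proj A (LIP a b)) (proj E b) = proj E a"
    "bstar A (LIP a b) = LIP b a"
proof -
  let ?y = "proj E b" and ?x = "proj E a"
  \<comment> \<open>Chosen so that its residual at \<open>?y\<close> is \<open>h\<close>; it is the
    second coordinate of the inner product.\<close>
  let ?k = "h \<triangleleft>\<^bsub>\<alpha>\<^esub> ginv X ?y" and ?z = "proj E a \<cdot>\<^bsub>X\<^esub> (h \<triangleright>\<^bsub>\<alpha>\<^esub> ginv X (proj E b))"
  have k: "?k \<in> arrows H" "src H ?k = lmom \<alpha> (rng X ?y)" "?k \<triangleleft>\<^bsub>\<alpha>\<^esub> ?y = h"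
    using ab h left.lres_lres_inv[of h "ginv X ?y"] by simp_all
  have hy: "h \<triangleright>\<^bsub>\<alpha>\<^esub> ginv X ?y \<in> arrows X" "src X (h \<triangleright>\<^bsub>\<alpha>\<^esub> ginv X ?y) = ?k \<triangleright>\<^bsub>\<alpha>\<^esub> rng X ?y" using ab h by simp_all
  have z: "?z \<in> arrows X" "src X ?z = ?k \<triangleright>\<^bsub>\<alpha>\<^esub> rng X ?y" "lmom \<alpha> (src X ?z) = rng H ?k"
    using ab h hy k(1,2) by simp_all
  have c: "a \<odot>\<^bsub>E\<^esub> lb h (bstar E b) \<in> points E" "proj E (a \<odot>\<^bsub>E\<^esub> lb h (bstar E b)) = ?z"
    using ab h by simp_all
  have e: "LIP a b = (\<kappa> (a \<odot>\<^bsub>E\<^esub> lb h (bstar E b)), ?k)" using lip_eq[OF ab h] .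
  show "LIP a b \<in> points A" unfolding e points_A[OF c(1)] using c k z by simp
  show "src K (proj A (LIP a b)) = fr G X \<alpha> \<beta> ?y"
    unfolding e by (rule src_A_eq_fr) (use c k z ab in simp_all)
  have "(h \<triangleright>\<^bsub>\<alpha>\<^esub> ginv X ?y) \<cdot>\<^bsub>X\<^esub> (?k \<triangleright>\<^bsub>\<alpha>\<^esub> ?y) = h \<triangleright>\<^bsub>\<alpha>\<^esub> src X ?y"
    using ab h left.lact_mult[of h "ginv X ?y" ?y] by simp
  moreover have "PL (\<pi> ?z, ?k) ?y = ?z \<cdot>\<^bsub>X\<^esub> (?k \<triangleright>\<^bsub>\<alpha>\<^esub> ?y)"
    by (rule para_lact_eq) (use z k ab in simp_all)
  moreover have "?z \<cdot>\<^bsub>X\<^esub> (?k \<triangleright>\<^bsub>\<alpha>\<^esub> ?y) = ?x \<cdot>\<^bsub>X\<^esub> ((h \<triangleright>\<^bsub>\<alpha>\<^esub> ginv X ?y) \<cdot>\<^bsub>X\<^esub> (?k \<triangleright>\<^bsub>\<alpha>\<^esub> ?y))"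
    using ab h hy k(1,2) by (intro X.assoc) simp_all
  ultimately have "PL (\<pi> ?z, ?k) ?y = ?x" using ab h(3) X.mul_simps(5)[of ?x] by simp
  then show "PL (proj A (LIP a b)) ?y = ?x" unfolding e using c by simp
  have ih: "ginv H h \<in> arrows H" "src H (ginv H h) = lmom \<alpha> (src X ?x)" "src X ?y = ginv H h \<triangleright>\<^bsub>\<alpha>\<^esub> src X ?x"
    using ab h by simp_all
  have e': "LIP b a = (\<kappa> (b \<odot>\<^bsub>E\<^esub> lb (ginv H h) (bstar E a)), ginv H h \<triangleleft>\<^bsub>\<alpha>\<^esub> ginv X ?x)"
    using lip_eq[OF ab(2,1) ih] .
  have ky: "?k \<triangleright>\<^bsub>\<alpha>\<^esub> ?y \<in> arrows X" "src X (?k \<triangleright>\<^bsub>\<alpha>\<^esub> ?y) = h \<triangleright>\<^bsub>\<alpha>\<^esub> src X ?y" "rng X (?k \<triangleright>\<^bsub>\<alpha>\<^esub> ?y) = ?k \<triangleright>\<^bsub>\<alpha>\<^esub> rng X ?y"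
    using k ab by simp_all
  \<comment> \<open>The reason why the adjoint is again an inner product: the inverse of
    \<open>?k\<close> has the inverse of \<open>h\<close> as residual at
    \<open>?k \<triangleright> ?y\<close>, and that is the arrow belonging to the pair in reversed
    order.\<close>
  have kinv: "ginv H ?k \<triangleleft>\<^bsub>\<alpha>\<^esub> (?k \<triangleright>\<^bsub>\<alpha>\<^esub> ?y) = ginv H h"
    using left.inv_lres[of ?k ?y] k ab by simp
  have "bstar E (lb h (bstar E b)) = lb ?k b" using ab h lbdl.bact_bstar[of h "bstar E b"] by simp
  then have s: "bstar E (a \<odot>\<^bsub>E\<^esub> lb h (bstar E b)) = lb ?k b \<odot>\<^bsub>E\<^esub> bstar E a"
    using ab h by (simp add: lbdl.fell.bstar_bmult)
  have lk: "lb ?k b \<in> points E" "proj E (lb ?k b) = ?k \<triangleright>\<^bsub>\<alpha>\<^esub> ?y" using k ab by simp_all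
  have comp: "src X (proj E (lb ?k b)) = rng X (proj E (bstar E a))"
    unfolding lk(2) ky(2) using ab h(3) by simp
  have sp: "lb ?k b \<odot>\<^bsub>E\<^esub> bstar E a \<in> points E" "proj E (lb ?k b \<odot>\<^bsub>E\<^esub> bstar E a) = (?k \<triangleright>\<^bsub>\<alpha>\<^esub> ?y) \<cdot>\<^bsub>X\<^esub> ginv X ?x"
    using lk comp ab by simp_all
  have rg: "rng X ((?k \<triangleright>\<^bsub>\<alpha>\<^esub> ?y) \<cdot>\<^bsub>X\<^esub> ginv X ?x) = ?k \<triangleright>\<^bsub>\<alpha>\<^esub> rng X ?y"
    using ky(1,3) comp[unfolded lk(2)] ab by simp
  have mom: "src H (ginv H ?k) = lmom \<alpha> (rng X (proj E (lb ?k b \<odot>\<^bsub>E\<^esub> bstar E a)))"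
    unfolding sp(2) rg using k ab by simp
  have mom': "src H (ginv H ?k) = lmom \<alpha> (rng X (proj E (lb ?k b)))"
    unfolding lk(2) ky(3) using k ab by simp
  have "lb (ginv H ?k) (lb ?k b \<odot>\<^bsub>E\<^esub> bstar E a) = lb (ginv H ?k) (lb ?k b) \<odot>\<^bsub>E\<^esub> lb (ginv H ?k \<triangleleft>\<^bsub>\<alpha>\<^esub> (?k \<triangleright>\<^bsub>\<alpha>\<^esub> ?y)) (bstar E a)"
    using lbdl.bact_bmult[OF H.inv_simps(1)[OF k(1)] lk(1) mom' lbdl.fell.bstar_point(1)[OF ab(1)] comp]
    unfolding lk(2) .
  also have "lb (ginv H ?k) (lb ?k b) = b" using k(1,2) ab(2) by simp
  finally have first: "lb (ginv H ?k) (lb ?k b \<odot>\<^bsub>E\<^esub> bstar E a) = b \<odot>\<^bsub>E\<^esub> lb (ginv H h) (bstar E a)"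
    unfolding kinv .
  have "ginv H ?k \<triangleleft>\<^bsub>\<alpha>\<^esub> ((?k \<triangleright>\<^bsub>\<alpha>\<^esub> ?y) \<cdot>\<^bsub>X\<^esub> ginv X ?x) = (ginv H ?k \<triangleleft>\<^bsub>\<alpha>\<^esub> (?k \<triangleright>\<^bsub>\<alpha>\<^esub> ?y)) \<triangleleft>\<^bsub>\<alpha>\<^esub> ginv X ?x"
    using mom'[unfolded lk(2)] ky(1) comp[unfolded lk(2)] ab k(1)
    by (intro left.lres_mult) simp_all
  then have second: "ginv H ?k \<triangleleft>\<^bsub>\<alpha>\<^esub> ((?k \<triangleright>\<^bsub>\<alpha>\<^esub> ?y) \<cdot>\<^bsub>X\<^esub> ginv X ?x) = ginv H h \<triangleleft>\<^bsub>\<alpha>\<^esub> ginv X ?x" unfolding kinv .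
  have "bstar A (LIP a b) = (lbQ (ginv H ?k) (\<kappa> (lb ?k b \<odot>\<^bsub>E\<^esub> bstar E a)),
      lres \<alpha>Q (ginv H ?k) (proj EQ (\<kappa> (lb ?k b \<odot>\<^bsub>E\<^esub> bstar E a))))"
    unfolding e prodb.lprod_bundle_simps rbdl.bstar_quot[OF c(1)] s ..
  also have "\<dots> = (\<kappa> (b \<odot>\<^bsub>E\<^esub> lb (ginv H h) (bstar E a)), ginv H h \<triangleleft>\<^bsub>\<alpha>\<^esub> ginv X ?x)"
  proof -
    have "\<pi> ((?k \<triangleright>\<^bsub>\<alpha>\<^esub> ?y) \<cdot>\<^bsub>X\<^esub> ginv X ?x) \<in> arrows Q" using sp lbdl.fell.proj_arrow[OF sp(1)] by simp
    moreover have "lres \<alpha>Q (ginv H ?k) (\<pi> ((?k \<triangleright>\<^bsub>\<alpha>\<^esub> ?y) \<cdot>\<^bsub>X\<^esub> ginv X ?x)) = ginv H h \<triangleleft>\<^bsub>\<alpha>\<^esub> ginv X ?x"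
      unfolding second[symmetric]
      by (rule lres_quot) (use lbdl.fell.proj_arrow[OF sp(1)] sp(2) k(1) mom in simp_all)
    ultimately show ?thesis
      using bact_quot[OF sp(1) H.inv_simps(1)[OF k(1)] mom] first sp by simp
  qed
  finally show "bstar A (LIP a b) = LIP b a" unfolding e' .
qed

lemma lip_linear:
  assumes ab: "a \<in> points E" "b \<in> points E" and h: "h \<in> arrows H" "src H h = lmom \<alpha> (src X (proj E b))"
    "src X (proj E a) = h \<triangleright>\<^bsub>\<alpha>\<^esub> src X (proj E b)"
  shows "a' \<in> fibre E (proj E a) \<Longrightarrow> LIP (badd E a a') b = badd A (LIP a b) (LIP a' b)"
    "b' \<in> fibre E (proj E b) \<Longrightarrow> LIP a (badd E b b') = badd A (LIP a b) (LIP a b')"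
    "LIP (bsmul E k a) b = bsmul A k (LIP a b)" "LIP a (bsmul E k b) = bsmul A (cnj k) (LIP a b)"
proof -
  note e = lip_eq[OF ab h]
  show "LIP (badd E a a') b = badd A (LIP a b) (LIP a' b)" if "a' \<in> fibre E (proj E a)"
  proof -
    have a': "a' \<in> points E" "proj E a' = proj E a" using that by (simp_all add: in_fibre)
    then have "LIP a' b = (\<kappa> (a' \<odot>\<^bsub>E\<^esub> lb h (bstar E b)), h \<triangleleft>\<^bsub>\<alpha>\<^esub> ginv X (proj E b))"
      "LIP (badd E a a') b = (\<kappa> (badd E a a' \<odot>\<^bsub>E\<^esub> lb h (bstar E b)), h \<triangleleft>\<^bsub>\<alpha>\<^esub> ginv X (proj E b))"
      using ab h by (intro lip_eq; simp)+
    then show ?thesis unfolding e using a' ab h by (simp add: lbdl.fell.bmult_badd)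
  qed
  show "LIP a (badd E b b') = badd A (LIP a b) (LIP a b')" if "b' \<in> fibre E (proj E b)"
  proof -
    have b': "b' \<in> points E" "proj E b' = proj E b" using that by (simp_all add: in_fibre)
    then have "LIP a b' = (\<kappa> (a \<odot>\<^bsub>E\<^esub> lb h (bstar E b')), h \<triangleleft>\<^bsub>\<alpha>\<^esub> ginv X (proj E b'))"
      "LIP a (badd E b b') = (\<kappa> (a \<odot>\<^bsub>E\<^esub> lb h (bstar E (badd E b b'))), h \<triangleleft>\<^bsub>\<alpha>\<^esub> ginv X (proj E (badd E b b')))"
      using ab h by (intro lip_eq; simp)+
    moreover have "lb h (bstar E (badd E b b')) = badd E (lb h (bstar E b)) (lb h (bstar E b'))"
      using b' ab h lbdl.bact_badd[of h "bstar E b" "bstar E b'"] by (simp add: lbdl.fell.bstar_badd)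
    moreover have "a \<odot>\<^bsub>E\<^esub> badd E (lb h (bstar E b)) (lb h (bstar E b'))
        = badd E (a \<odot>\<^bsub>E\<^esub> lb h (bstar E b)) (a \<odot>\<^bsub>E\<^esub> lb h (bstar E b'))"
      using b' ab h by (intro lbdl.fell.bmult_badd) simp_all
    ultimately show ?thesis unfolding e using b' ab h by simp
  qed
  have "LIP (bsmul E k a) b = (\<kappa> (bsmul E k a \<odot>\<^bsub>E\<^esub> lb h (bstar E b)), h \<triangleleft>\<^bsub>\<alpha>\<^esub> ginv X (proj E b))"
    "LIP a (bsmul E k b) = (\<kappa> (a \<odot>\<^bsub>E\<^esub> lb h (bstar E (bsmul E k b))), h \<triangleleft>\<^bsub>\<alpha>\<^esub> ginv X (proj E (bsmul E k b)))"
    using ab h by (intro lip_eq; simp)+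
  then show "LIP (bsmul E k a) b = bsmul A k (LIP a b)" "LIP a (bsmul E k b) = bsmul A (cnj k) (LIP a b)"
    unfolding e using ab h by (simp_all add: lbdl.fell.bmult_bsmul lbdl.fell.star_smul lbdl.bact_bsmul)
qed

text \<open>If \<open>p\<close> is represented with second coordinate \<open>k\<close>, acting by it
  moves the source by the residual of \<open>k\<close> at the projection of \<open>m\<close>. The
  arrow of the new inner product is this residual times \<open>h\<close>; L6 and L3 split the second
  coordinate as the product in \<open>A\<close> prescribes.\<close>

lemma lip_bundle_lact:
  assumes p: "p \<in> points A" "m \<in> points E" "n \<in> points E" "src K (proj A p) = fr G X \<alpha> \<beta> (proj E m)"
    and h: "h \<in> arrows H" "src H h = lmom \<alpha> (src X (proj E n))" "src X (proj E m) = h \<triangleright>\<^bsub>\<alpha>\<^esub> src X (proj E n)"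
  shows "LIP (LM p m) n = p \<odot>\<^bsub>A\<^esub> LIP m n"
proof -
  let ?y = "proj E n" and ?x = "proj E m"
  obtain a k where a: "p = (\<kappa> a, k)" "a \<in> points E" "k \<in> arrows H" "lmom \<alpha> (src X (proj E a)) = rng H k"
    "src H k = lmom \<alpha> (rng X ?x)" "src X (proj E a) = k \<triangleright>\<^bsub>\<alpha>\<^esub> rng X ?x"
    using p(1) lbdl.fell.proj_arrow[OF p(2)] p(4) by (rule A_representative)
  have e: "LM p m = a \<odot>\<^bsub>E\<^esub> lb k m" unfolding a(1) by (rule bundle_lact_eq) (use a p in simp_all)
  have kx: "k \<triangleleft>\<^bsub>\<alpha>\<^esub> ?x \<in> arrows H" "src H (k \<triangleleft>\<^bsub>\<alpha>\<^esub> ?x) = rng H h" using a p h by simp_all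
  have c: "src X (proj E (a \<odot>\<^bsub>E\<^esub> lb k m)) = ((k \<triangleleft>\<^bsub>\<alpha>\<^esub> ?x) \<cdot>\<^bsub>H\<^esub> h) \<triangleright>\<^bsub>\<alpha>\<^esub> src X ?y"
    using a p h kx by (simp add: left.mult_lact)
  have "LIP (LM p m) n = (\<kappa> ((a \<odot>\<^bsub>E\<^esub> lb k m) \<odot>\<^bsub>E\<^esub> lb ((k \<triangleleft>\<^bsub>\<alpha>\<^esub> ?x) \<cdot>\<^bsub>H\<^esub> h) (bstar E n)), ((k \<triangleleft>\<^bsub>\<alpha>\<^esub> ?x) \<cdot>\<^bsub>H\<^esub> h) \<triangleleft>\<^bsub>\<alpha>\<^esub> ginv X ?y)"
    unfolding e by (rule lip_eq) (use a p h kx c in simp_all)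
  also have "(a \<odot>\<^bsub>E\<^esub> lb k m) \<odot>\<^bsub>E\<^esub> lb ((k \<triangleleft>\<^bsub>\<alpha>\<^esub> ?x) \<cdot>\<^bsub>H\<^esub> h) (bstar E n) = a \<odot>\<^bsub>E\<^esub> lb k (m \<odot>\<^bsub>E\<^esub> lb h (bstar E n))"
    using a p h kx by (simp add: lbdl.mult_bact lbdl.bact_bmult lbdl.fell.bmult_assoc left.mult_lact)
  also have "((k \<triangleleft>\<^bsub>\<alpha>\<^esub> ?x) \<cdot>\<^bsub>H\<^esub> h) \<triangleleft>\<^bsub>\<alpha>\<^esub> ginv X ?y = (k \<triangleleft>\<^bsub>\<alpha>\<^esub> (?x \<cdot>\<^bsub>X\<^esub> (h \<triangleright>\<^bsub>\<alpha>\<^esub> ginv X ?y))) \<cdot>\<^bsub>H\<^esub> (h \<triangleleft>\<^bsub>\<alpha>\<^esub> ginv X ?y)"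
    using a p h kx by (simp add: left.mult_lres)
  also have "(\<kappa> (a \<odot>\<^bsub>E\<^esub> lb k (m \<odot>\<^bsub>E\<^esub> lb h (bstar E n))), (k \<triangleleft>\<^bsub>\<alpha>\<^esub> (?x \<cdot>\<^bsub>X\<^esub> (h \<triangleright>\<^bsub>\<alpha>\<^esub> ginv X ?y))) \<cdot>\<^bsub>H\<^esub> (h \<triangleleft>\<^bsub>\<alpha>\<^esub> ginv X ?y))
      = p \<odot>\<^bsub>A\<^esub> LIP m n"
    unfolding a(1) lip_eq[OF p(2,3) h] using a(2-6) p(2,3) h by simp
  finally show ?thesis .
qed

section \<open>The module structure of a single fibre\<close>

lemma fibre_A_unit:
  assumes "z \<in> arrows X" "p \<in> fibre A (fr G X \<alpha> \<beta> z)"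
  obtains a where "a \<in> fibre E (rng X z)" "p = (\<kappa> a, lmom \<alpha> (rng X z))"
proof -
  obtain \<Theta> h where p: "p = (\<Theta>, h)" by fastforce
  then have \<Theta>: "\<Theta> \<in> points EQ" "proj EQ \<Theta> = \<pi> (rng X z)" "h = lmom \<alpha> (rng X z)"
    using assms by (simp_all add: in_fibre prodb.points_lprod)
  obtain a where "a \<in> points E" "\<kappa> a = \<Theta>" "proj E a = rng X z"
    by (rule rbdl.blift[OF \<Theta>(1) _ \<Theta>(2)]) (use assms in simp)
  then show thesis using that[of a] \<Theta> p by (simp add: in_fibre)
qed

lemma in_fibre_A_unit:
  assumes "z \<in> arrows X" "a \<in> fibre E (rng X z)"
  shows "(\<kappa> a, lmom \<alpha> (rng X z)) \<in> fibre A (fr G X \<alpha> \<beta> z)"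
  using assms by (simp add: in_fibre)

lemma bundle_lact_unit_fibre:
  assumes "z \<in> arrows X" "a \<in> fibre E (rng X z)" "x \<in> fibre E z"
  shows "LM (\<kappa> a, lmom \<alpha> (rng X z)) x = a \<odot>\<^bsub>E\<^esub> x"
  using assms bundle_lact_eq[of a "lmom \<alpha> (rng X z)" x] by (simp add: in_fibre)

text \<open>Vectors over the same arrow have equal sources, so the arrow of \<open>H\<close> is a
  unit and acts trivially. When the fibre of \<open>A\<close> is identified with the fibre of
  \<open>E\<close> over the range, this is the standard inner product of a fibre of a Fell
  bundle.\<close>

lemma lip_fibre:
  assumes "z \<in> arrows X" "x \<in> fibre E z" "y \<in> fibre E z"
  shows "LIP x y = (\<kappa> (x \<odot>\<^bsub>E\<^esub> bstar E y), lmom \<alpha> (rng X z))"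
  using assms lip_eq[of x y "lmom \<alpha> (src X z)"] by (simp add: in_fibre)

text \<open>Saturation at \<open>z\<close> and its inverse says that products span the fibre over
  the range densely, and every vector over the inverse is the adjoint of one over
  \<open>z\<close>.\<close>

lemma lip_full:
  assumes z: "z \<in> arrows X"
  shows "closed_span (fibre_alg A (fr G X \<alpha> \<beta> z)) {LIP x y |x y. x \<in> fibre E z \<and> y \<in> fibre E z}
    = fibre A (fr G X \<alpha> \<beta> z)"
proof -
  let ?\<phi> = "\<lambda>b. (\<kappa> b, lmom \<alpha> (rng X z))"
  let ?S = "{a \<odot>\<^bsub>E\<^esub> b |a b. a \<in> fibre E z \<and> b \<in> fibre E (ginv X z)}"
  have u: "rng X z \<in> arrows X" "rng X z \<in> topspace (gtop X)" using X.rng_arrow[OF z] by (simp_all add: arrows_def)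
  have bij: "bij_betw ?\<phi> (fibre E (rng X z)) (fibre A (fr G X \<alpha> \<beta> z))"
    unfolding bij_betw_def
  proof
    show "inj_on ?\<phi> (fibre E (rng X z))"
      using rbdl.bij_betw_fibre_quot[OF u(1)] by (auto simp: bij_betw_def inj_on_def)
    show "?\<phi> ` fibre E (rng X z) = fibre A (fr G X \<alpha> \<beta> z)"
      using in_fibre_A_unit[OF z] by (auto elim!: fibre_A_unit[OF z])
  qed
  have "closed_span (fibre_alg A (fr G X \<alpha> \<beta> z)) (?\<phi> ` ?S) = ?\<phi> ` closed_span (fibre_space E (rng X z)) ?S"
    by (rule closed_span_transport[OF lbdl.fell.fibre_banach[OF u(2)]])
      (use z u bij in \<open>auto simp: in_fibre\<close>)
  moreover have "closed_span (fibre_space E (rng X z)) ?S = fibre E (rng X z)"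
    using lbdl.fell.saturatedD[OF saturated z, of "ginv X z"] z by simp
  moreover have "?\<phi> ` fibre E (rng X z) = fibre A (fr G X \<alpha> \<beta> z)" using bij by (simp add: bij_betw_def)
  moreover have "?\<phi> ` ?S = {LIP x y |x y. x \<in> fibre E z \<and> y \<in> fibre E z}"
  proof (intro equalityI subsetI)
    fix c assume "c \<in> ?\<phi> ` ?S"
    then obtain a b where c: "c = ?\<phi> (a \<odot>\<^bsub>E\<^esub> b)" "a \<in> fibre E z" "b \<in> fibre E (ginv X z)" by blast
    then have b: "bstar E b \<in> fibre E z" using z by (simp add: in_fibre)
    then have "c = LIP a (bstar E b)" using lip_fibre[OF z c(2) b] c by (simp add: in_fibre)
    then show "c \<in> {LIP x y |x y. x \<in> fibre E z \<and> y \<in> fibre E z}" using c b by blast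
  next
    fix c assume "c \<in> {LIP x y |x y. x \<in> fibre E z \<and> y \<in> fibre E z}"
    then obtain x y where c: "c = LIP x y" "x \<in> fibre E z" "y \<in> fibre E z" by blast
    then have "bstar E y \<in> fibre E (ginv X z)" by (simp add: in_fibre)
    then show "c \<in> ?\<phi> ` ?S" using lip_fibre[OF z c(2,3)] c by blast
  qed
  ultimately show ?thesis by simp
qed

text \<open>The positivity axiom is applied to the adjoint of \<open>x\<close>; this turns
  \<open>x\<close> times its adjoint into a square with a factor over the range of
  \<open>z\<close>.\<close>

lemma lip_positive:
  assumes z: "z \<in> arrows X" and x: "x \<in> fibre E z"
  shows "cstar_positive (fibre_alg A (fr G X \<alpha> \<beta> z)) (LIP x x)"
proof -
  have x': "x \<in> points E" "proj E x = z" using x by (simp_all add: in_fibre)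
  obtain c where c: "c \<in> points E" "proj E c = src X (proj E (bstar E x))"
    "bstar E (bstar E x) \<odot>\<^bsub>E\<^esub> bstar E x = bstar E c \<odot>\<^bsub>E\<^esub> c"
    by (rule lbdl.fell.star_mult_positive'[of "bstar E x"]) (use x' that in auto)
  then have c': "c \<in> fibre E (rng X z)" "x \<odot>\<^bsub>E\<^esub> bstar E x = bstar E c \<odot>\<^bsub>E\<^esub> c" using x' z by (simp_all add: in_fibre)
  let ?c = "(\<kappa> c, lmom \<alpha> (rng X z))"
  have "bstar A ?c \<odot>\<^bsub>A\<^esub> ?c = (\<kappa> (bstar E c \<odot>\<^bsub>E\<^esub> c), lmom \<alpha> (rng X z))"
    using c' z H.mul_simps(4)[of "lmom \<alpha> (rng X z)"] by (simp add: in_fibre)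
  then show ?thesis
    unfolding cstar_positive_def
    using in_fibre_A_unit[OF z c'(1)] lip_fibre[OF z x x] c'(2)
    by (intro bexI[of _ ?c]) simp_all
qed

lemma bstar_unit_fibre:
  assumes "z \<in> arrows X" "a \<in> fibre E (rng X z)"
  shows "bstar A (\<kappa> a, lmom \<alpha> (rng X z)) = (\<kappa> (bstar E a), lmom \<alpha> (rng X z))"
  using assms by (simp add: in_fibre)

text \<open>On one fibre everything is multiplication in \<open>E\<close> by a vector over the
  range. Only facts about the left structure are collected, so that the list can also be read after
  reversal.\<close>

lemma unit_fibre_module:
  assumes z: "z \<in> arrows X" and p: "p \<in> fibre A (fr G X \<alpha> \<beta> z)" and x: "x \<in> fibre E z"
  shows "LM p x \<in> fibre E z" "LM p (bsmul E k x) = bsmul E k (LM p x)"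
    "LM (bsmul A k p) x = bsmul E k (LM p x)"
    "q \<in> fibre A (fr G X \<alpha> \<beta> z) \<Longrightarrow> LM (badd A p q) x = badd E (LM p x) (LM q x)"
    "q \<in> fibre A (fr G X \<alpha> \<beta> z) \<Longrightarrow> LM (p \<odot>\<^bsub>A\<^esub> q) x = LM p (LM q x)"
    "y \<in> fibre E z \<Longrightarrow> LM p (badd E x y) = badd E (LM p x) (LM p y)"
    "y \<in> fibre E z \<Longrightarrow> LIP (LM p x) y = p \<odot>\<^bsub>A\<^esub> LIP x y"
proof -
  obtain a where a: "a \<in> fibre E (rng X z)" "p = (\<kappa> a, lmom \<alpha> (rng X z))"
    using fibre_A_unit[OF z p] .
  have a': "a \<in> points E" "proj E a = rng X z" and x': "x \<in> points E" "proj E x = z"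
    using a x by (simp_all add: in_fibre)
  have e: "LM p x = a \<odot>\<^bsub>E\<^esub> x" unfolding a(2) by (rule bundle_lact_unit_fibre[OF z a(1) x])
  have zz: "rng X z \<cdot>\<^bsub>X\<^esub> z = z" using z by simp
  show "LM p x \<in> fibre E z" unfolding e using a' x' z by (simp add: in_fibre)
  have kx: "bsmul E k x \<in> fibre E z" "bsmul E k a \<in> fibre E (rng X z)"
    using a' x' by (simp_all add: in_fibre)
  show "LM p (bsmul E k x) = bsmul E k (LM p x)"
    unfolding e unfolding a(2) bundle_lact_unit_fibre[OF z a(1) kx(1)]
    using a' x' z by (simp add: lbdl.fell.bmult_bsmul)
  show "LM (bsmul A k p) x = bsmul E k (LM p x)"
    unfolding e unfolding a(2) using bundle_lact_unit_fibre[OF z kx(2) x] a' x' z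
    by (simp add: lbdl.fell.bmult_bsmul)
  show "LM (badd A p q) x = badd E (LM p x) (LM q x)" "LM (p \<odot>\<^bsub>A\<^esub> q) x = LM p (LM q x)"
    if q: "q \<in> fibre A (fr G X \<alpha> \<beta> z)"
  proof -
    obtain b where b: "b \<in> fibre E (rng X z)" "q = (\<kappa> b, lmom \<alpha> (rng X z))"
      using fibre_A_unit[OF z q] .
    have b': "b \<in> points E" "proj E b = rng X z" using b by (simp_all add: in_fibre)
    have eq: "LM q x = b \<odot>\<^bsub>E\<^esub> x" unfolding b(2) by (rule bundle_lact_unit_fibre[OF z b(1) x])
    have s: "badd E a b \<in> fibre E (rng X z)" "a \<odot>\<^bsub>E\<^esub> b \<in> fibre E (rng X z)" "b \<odot>\<^bsub>E\<^esub> x \<in> fibre E z"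
      using a' b' x' z X.mul_simps(4)[of "rng X z"] by (simp_all add: in_fibre)
    have "badd A p q = (\<kappa> (badd E a b), lmom \<alpha> (rng X z))"
      unfolding a(2) b(2) using a' b' by simp
    then show "LM (badd A p q) x = badd E (LM p x) (LM q x)"
      unfolding e eq using bundle_lact_unit_fibre[OF z s(1) x] a' b' x' z
      by (simp add: lbdl.fell.bmult_badd)
    have "p \<odot>\<^bsub>A\<^esub> q = (\<kappa> (a \<odot>\<^bsub>E\<^esub> b), lmom \<alpha> (rng X z))"
      unfolding a(2) b(2) using a' b' z H.mul_simps(4)[of "lmom \<alpha> (rng X z)"] by simp
    then show "LM (p \<odot>\<^bsub>A\<^esub> q) x = LM p (LM q x)"
      unfolding eq unfolding a(2) bundle_lact_unit_fibre[OF z a(1) s(3)]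
      using bundle_lact_unit_fibre[OF z s(2) x] a' b' x' z
      by (simp add: lbdl.fell.bmult_assoc)
  qed
  show "LM p (badd E x y) = badd E (LM p x) (LM p y)" "LIP (LM p x) y = p \<odot>\<^bsub>A\<^esub> LIP x y"
    if y: "y \<in> fibre E z"
  proof -
    have y': "y \<in> points E" "proj E y = z" using y by (simp_all add: in_fibre)
    have s: "badd E x y \<in> fibre E z" "a \<odot>\<^bsub>E\<^esub> x \<in> fibre E z"
      using a' x' y' z by (simp_all add: in_fibre)
    show "LM p (badd E x y) = badd E (LM p x) (LM p y)"
      unfolding a(2) bundle_lact_unit_fibre[OF z a(1) x] bundle_lact_unit_fibre[OF z a(1) y]
        bundle_lact_unit_fibre[OF z a(1) s(1)]
      using a' x' y' z by (simp add: lbdl.fell.bmult_badd)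
    show "LIP (LM p x) y = p \<odot>\<^bsub>A\<^esub> LIP x y"
      unfolding e lip_fibre[OF z s(2) y] lip_fibre[OF z x y] unfolding a(2)
      using a' x' y' z H.mul_simps(4)[of "lmom \<alpha> (rng X z)"]
      by (simp add: lbdl.fell.bmult_assoc)
  qed
qed

lemma unit_fibre_lip:
  assumes z: "z \<in> arrows X" and x: "x \<in> fibre E z" and y: "y \<in> fibre E z"
  shows "LIP x y \<in> fibre A (fr G X \<alpha> \<beta> z)" "bstar A (LIP x y) = LIP y x"
    "LIP (bsmul E k x) y = bsmul A k (LIP x y)"
    "w \<in> fibre E z \<Longrightarrow> LIP (badd E x w) y = badd A (LIP x y) (LIP w y)"
    "bnorm A (LIP x x) = (bnorm E x)\<^sup>2"
proof -
  have x': "x \<in> points E" "proj E x = z" and y': "y \<in> points E" "proj E y = z"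
    using x y by (simp_all add: in_fibre)
  let ?h = "lmom \<alpha> (src X z)"
  have h: "?h \<in> arrows H" "src H ?h = lmom \<alpha> (src X (proj E y))" "src X (proj E x) = ?h \<triangleright>\<^bsub>\<alpha>\<^esub> src X (proj E y)"
    using z x' y' by simp_all
  have "x \<odot>\<^bsub>E\<^esub> bstar E y \<in> fibre E (rng X z)" using x' y' z by (simp add: in_fibre)
  then show "LIP x y \<in> fibre A (fr G X \<alpha> \<beta> z)"
    unfolding lip_fibre[OF z x y] by (rule in_fibre_A_unit[OF z])
  show "bstar A (LIP x y) = LIP y x" by (rule lip_facts(4)[OF x'(1) y'(1) h])
  show "LIP (bsmul E k x) y = bsmul A k (LIP x y)" by (rule lip_linear(3)[OF x'(1) y'(1) h])
  show "LIP (badd E x w) y = badd A (LIP x y) (LIP w y)" if "w \<in> fibre E z"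
    by (rule lip_linear(1)[OF x'(1) y'(1) h]) (use that x' in simp)
  show "bnorm A (LIP x x) = (bnorm E x)\<^sup>2"
    unfolding lip_fibre[OF z x x] using z x' lbdl.fell.norm_star_mult[of "bstar E x"] by simp
qed

end


section \<open>Reversal of left and right\<close>

text \<open>The acting groupoid occupies the second coordinate of a left product and the first
  coordinate of a right product; this exchange compensates for it.\<close>

abbreviation rev_pair :: "'a \<times> 'b \<Rightarrow> 'b \<times> 'a"
  where "rev_pair \<equiv> \<lambda>p. (snd p, fst p)"

lemma rev_pair_rev_pair: "rev_pair (rev_pair p) = p"
  by simp

lemma homeomorphic_maps_rev_pair:
  assumes "\<And>p. p \<in> topspace (prod_topology T U) \<Longrightarrow> rev_pair p \<in> S' \<longleftrightarrow> p \<in> S"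
  shows "homeomorphic_maps (subtopology (prod_topology T U) S) (subtopology (prod_topology U T) S')
    rev_pair rev_pair"
  unfolding homeomorphic_maps_def continuous_map_in_subtopology
  using assms
  by (auto intro!: continuous_map_pairedI continuous_map_fst_sub continuous_map_snd_sub)

lemma op_orbit_groupoid: "orbit_groupoid (op_groupoid X) orb = op_groupoid (orbit_groupoid X orb)"
proof -
  have "{orb (y \<cdot>\<^bsub>X\<^esub> x) |x y. x \<in> \<xi> \<and> y \<in> \<zeta> \<and> rng X x = src X y}
      = {orb (x \<cdot>\<^bsub>X\<^esub> y) |x y. x \<in> \<zeta> \<and> y \<in> \<xi> \<and> src X x = rng X y}" for \<xi> \<zeta>
    by (auto; metis)
  then show ?thesis by (simp add: orbit_groupoid_def op_groupoid_def)
qed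

lemma op_orbit_bundle:
  assumes "fell_bundle X E"
  shows "orbit_bundle (op_groupoid X) (op_bundle E) xorb orb = op_bundle (orbit_bundle X E xorb orb)"
proof -
  interpret fell_bundle X E by (rule assms)
  have "{orb (c \<odot>\<^bsub>E\<^esub> b) |b c. b \<in> \<Theta> \<and> c \<in> \<Xi> \<and> (b, c) \<in> bcomposable (op_groupoid X) (op_bundle E)}
      = {orb (b \<odot>\<^bsub>E\<^esub> c) |b c. b \<in> \<Xi> \<and> c \<in> \<Theta> \<and> (b, c) \<in> bcomposable X E}" for \<Theta> \<Xi>
    unfolding op_bcomposable by auto
  then show ?thesis by (simp add: orbit_bundle_def op_bundle_def)
qed

context
  fixes G :: "'g groupoid" and Q :: "'x groupoid" and \<beta> :: "('g, 'x) right_ss"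
    and F :: "('b, 'x) fell_bundle" and act :: "'b \<Rightarrow> 'g \<Rightarrow> 'b"
begin

abbreviation (input) Lrev where "Lrev \<equiv> rprod_groupoid G Q \<beta>"
abbreviation (input) Krev where "Krev \<equiv> lprod_groupoid (op_groupoid Q) (op_groupoid G) (op_right \<beta>)"
abbreviation (input) Crev where "Crev \<equiv> rprod_bundle G Q F \<beta> act"
abbreviation (input) Arev where
  "Arev \<equiv> lprod_bundle (op_groupoid Q) (op_bundle F) (op_groupoid G) (op_right \<beta>) (\<lambda>t b. act b t)"

text \<open>With \<open>rprod_bundle_rev\<close> this supplies the equations demanded by the
  transport results for anti-isomorphisms.\<close>

lemma rprod_groupoid_rev:
  "homeomorphic_maps (gtop Krev) (gtop Lrev) rev_pair rev_pair"
  "rng Lrev y = rev_pair (src Krev (rev_pair y))" "src Lrev y = rev_pair (rng Krev (rev_pair y))"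
  "gmult Lrev y z = rev_pair (gmult Krev (rev_pair z) (rev_pair y))"
  "ginv Lrev y = rev_pair (ginv Krev (rev_pair y))"
proof -
  show "homeomorphic_maps (gtop Krev) (gtop Lrev) rev_pair rev_pair"
    unfolding lprod_groupoid_def rprod_groupoid_def groupoid.simps op_groupoid_simps
    by (rule homeomorphic_maps_rev_pair) (auto simp: eq_commute)
qed (cases y; cases z; simp add: lprod_groupoid_def rprod_groupoid_def lprod_unit_def rprod_unit_def)+

lemma arrows_rprod_rev: "y \<in> arrows Lrev \<longleftrightarrow> rev_pair y \<in> arrows Krev"
  by (cases y) (auto simp: lprod_groupoid_def rprod_groupoid_def arrows_def)

lemma rprod_bundle_rev:
  "homeomorphic_maps (btop Arev) (btop Crev) rev_pair rev_pair"
  "proj Crev c = rev_pair (proj Arev (rev_pair c))"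
  "badd Crev c d = rev_pair (badd Arev (rev_pair c) (rev_pair d))"
  "bzero Crev y = rev_pair (bzero Arev (rev_pair y))"
  "bsmul Crev k c = rev_pair (bsmul Arev k (rev_pair c))"
  "bnorm Crev c = bnorm Arev (rev_pair c)"
  "bmult Crev c d = rev_pair (bmult Arev (rev_pair d) (rev_pair c))"
  "bstar Crev c = rev_pair (bstar Arev (rev_pair c))"
proof -
  show "homeomorphic_maps (btop Arev) (btop Crev) rev_pair rev_pair"
    unfolding lprod_bundle_def rprod_bundle_def fell_bundle.simps banach_bundle.simps op_bundle_simps op_groupoid_simps(1)
    by (rule homeomorphic_maps_rev_pair) (auto simp: arrows_rprod_rev)
qed (cases c; cases d; cases y; simp add: lprod_bundle_def rprod_bundle_def)+

lemma points_rprod_rev: "c \<in> points Crev \<longleftrightarrow> rev_pair c \<in> points Arev"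
  by (cases c) (auto simp: points_def lprod_bundle_def rprod_bundle_def arrows_rprod_rev)

end

text \<open>Being in tune is symmetric in the two actions, and freeness and properness pass through
  the exchange of coordinates.\<close>

lemma (in self_similar_para_equivalence) op_para_equivalence:
  "self_similar_para_equivalence (op_groupoid G) (op_groupoid H) (op_groupoid X) (op_right \<beta>) (op_left \<alpha>)"
proof (intro self_similar_para_equivalence.intro self_similar_para_equivalence_axioms.intro
    X.op_topological_groupoid H.op_topological_groupoid G.op_topological_groupoid
    right.op_self_similar_left dual.free_proper_right_action_axioms
    G.op_open_source[OF right.open_source_acting] X.op_open_source[OF open_source_middle])
  show "free_laction (op_groupoid G) (gtop (op_groupoid X)) (lrho (op_groupoid X) (op_right \<beta>)) (lact (op_right \<beta>))"
    using right.free by (auto simp: free_raction_def free_laction_def)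
  show "proper_laction (op_groupoid G) (gtop (op_groupoid X)) (lrho (op_groupoid X) (op_right \<beta>)) (lact (op_right \<beta>))"
  proof -
    have swap: "homeomorphic_map (ldom_top (op_groupoid G) (gtop X) (rsigma X \<beta>))
        (rdom_top G (gtop X) (rsigma X \<beta>)) rev_pair"
      unfolding homeomorphic_map_maps ldom_top_def rdom_top_def op_groupoid_simps
      by (rule exI, rule homeomorphic_maps_rev_pair) auto
    have "proper_map (ldom_top (op_groupoid G) (gtop X) (rsigma X \<beta>)) (prod_topology (gtop X) (gtop X))
        ((\<lambda>(z, k). (z \<blacktriangleleft>\<^bsub>\<beta>\<^esub> k, z)) \<circ> rev_pair)"
      by (rule proper_map_compose[OF homeomorphic_imp_proper_map[OF swap]])
        (use right.proper in \<open>simp add: proper_raction_def\<close>)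
    moreover have "(\<lambda>(z, k). (z \<blacktriangleleft>\<^bsub>\<beta>\<^esub> k, z)) \<circ> rev_pair = (\<lambda>(k, z). (z \<blacktriangleleft>\<^bsub>\<beta>\<^esub> k, z))"
      by (auto simp: fun_eq_iff)
    ultimately show ?thesis by (simp add: proper_laction_def)
  qed
  show "in_tune (op_groupoid G) (op_groupoid H) (op_groupoid X) (op_right \<beta>) (op_left \<alpha>)"
    using in_tune unfolding in_tune_def by auto
qed

text \<open>The hypotheses are stable under reversal, so interpreting the locale for the opposites
  gives every left-hand result a right-hand reading.\<close>

lemma (in self_similar_bundle_equivalence) op_bundle_equivalence:
  "self_similar_bundle_equivalence (op_groupoid G) (op_groupoid H) (op_groupoid X) (op_right \<beta>) (op_left \<alpha>)
    (op_bundle E) (\<lambda>t b. rb b t) (\<lambda>b h. lb h b)"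
proof (intro self_similar_bundle_equivalence.intro self_similar_bundle_equivalence_axioms.intro
    op_para_equivalence rbdl.bdl.op_self_similar_left_bundle free_proper_right_bundle.intro
    dual.free_proper_right_action_axioms lbdl.op_self_similar_right_bundle lbdl.fell.op_saturated[OF saturated])
qed (use bact_commute in simp)

lemma open_quotient_compose:
  assumes "open_quotient X Y q" "open_quotient Y Z r"
  shows "open_quotient X Z (\<lambda>x. r (q x))"
proof -
  have "(\<lambda>x. r (q x)) ` topspace X = r ` q ` topspace X" by (simp add: image_image)
  then show ?thesis
    using assms continuous_map_compose[of X Y q Z r] open_map_compose[of X Y q Z r]
    by (simp add: open_quotient_def o_def)
qed


section \<open>The equivalence\<close>

definition bundle_ract ::
  "'x groupoid \<Rightarrow> ('b, 'x) fell_bundle \<Rightarrow> ('b \<Rightarrow> 'g \<Rightarrow> 'b) \<Rightarrow> 'b \<Rightarrow> 'g \<times> 'b set \<Rightarrow> 'b"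
  where "bundle_ract X E rb = (\<lambda>b (t, \<Xi>).
    let c = (THE c. c \<in> \<Xi> \<and> src X (proj E (rb b t)) = rng X (proj E c)) in rb b t \<odot>\<^bsub>E\<^esub> c)"

definition bundle_rip ::
  "'h groupoid \<Rightarrow> 'g groupoid \<Rightarrow> 'x groupoid \<Rightarrow> ('h, 'x) left_ss \<Rightarrow> ('g, 'x) right_ss
    \<Rightarrow> ('b, 'x) fell_bundle \<Rightarrow> ('h \<Rightarrow> 'b \<Rightarrow> 'b) \<Rightarrow> ('b \<Rightarrow> 'g \<Rightarrow> 'b) \<Rightarrow> 'b \<Rightarrow> 'b \<Rightarrow> 'g \<times> 'b set"
  where "bundle_rip H G X \<alpha> \<beta> E lb rb = (\<lambda>a b.
    let t = (THE t. t \<in> arrows G \<and> rsigma X \<beta> (rng X (proj E a)) = rng G t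
                  \<and> rng X (proj E a) \<blacktriangleleft>\<^bsub>\<beta>\<^esub> t = rng X (proj E b))
    in (proj E (bstar E a) \<blacktriangleright>\<^bsub>\<beta>\<^esub> t, bhorb H X \<alpha> E lb (rb (bstar E a) t \<odot>\<^bsub>E\<^esub> b)))"

context self_similar_bundle_equivalence
begin

text \<open>
  Both sides of the compatibility of the two actions, and of the two inner products, evaluate to
  the products below.
\<close>

lemma bimodule_products:
  assumes a: "a \<in> points E" and m: "m \<in> points E" and c: "c \<in> points E"
    and h: "h \<in> arrows H" "src H h = lmom \<alpha> (rng X (proj E m))" "src X (proj E a) = h \<triangleright>\<^bsub>\<alpha>\<^esub> rng X (proj E m)"
    and t: "t \<in> arrows G" "rng G t = rmom \<beta> (src X (proj E m))" "rng X (proj E c) = src X (proj E m) \<blacktriangleleft>\<^bsub>\<beta>\<^esub> t"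
  defines "k \<equiv> h \<triangleleft>\<^bsub>\<alpha>\<^esub> proj E m" and "s \<equiv> proj E m \<blacktriangleright>\<^bsub>\<beta>\<^esub> t"
  shows "k \<in> arrows H" "src H k = lmom \<alpha> (rng X (proj E c))"
    "a \<odot>\<^bsub>E\<^esub> lb h m \<in> points E" "lb k c \<in> points E" "rng G t = rmom \<beta> (src X (proj E (a \<odot>\<^bsub>E\<^esub> lb h m)))"
    "rng X (proj E (lb k c)) = src X (proj E (a \<odot>\<^bsub>E\<^esub> lb h m)) \<blacktriangleleft>\<^bsub>\<beta>\<^esub> t"
    "s \<in> arrows G" "rng G s = rmom \<beta> (src X (proj E a))"
    "rb m t \<odot>\<^bsub>E\<^esub> c \<in> points E" "lb h (rb m t \<odot>\<^bsub>E\<^esub> c) \<in> points E" "src H h = lmom \<alpha> (rng X (proj E (rb m t \<odot>\<^bsub>E\<^esub> c)))"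
    "rng X (proj E (lb h (rb m t \<odot>\<^bsub>E\<^esub> c))) = src X (proj E a) \<blacktriangleleft>\<^bsub>\<beta>\<^esub> s"
    "LM (\<kappa> (a \<odot>\<^bsub>E\<^esub> lb h m), k) c = rb (a \<odot>\<^bsub>E\<^esub> lb h m) t \<odot>\<^bsub>E\<^esub> lb k c"
    "LM (\<kappa> a, h) (rb m t \<odot>\<^bsub>E\<^esub> c) = rb a s \<odot>\<^bsub>E\<^esub> lb h (rb m t \<odot>\<^bsub>E\<^esub> c)"
    "rb (a \<odot>\<^bsub>E\<^esub> lb h m) t \<odot>\<^bsub>E\<^esub> lb k c = rb a s \<odot>\<^bsub>E\<^esub> lb h (rb m t \<odot>\<^bsub>E\<^esub> c)"
proof -
  let ?x = "proj E m"
  have x: "?x \<in> arrows X" using m by simp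
  show k: "k \<in> arrows H" "src H k = lmom \<alpha> (rng X (proj E c))" unfolding k_def using h t x by simp_all
  show s: "s \<in> arrows G" "rng G s = rmom \<beta> (src X (proj E a))" unfolding s_def using h t x by simp_all
  have hm: "lb h m \<in> points E" "proj E (lb h m) = h \<triangleright>\<^bsub>\<alpha>\<^esub> ?x" "src X (h \<triangleright>\<^bsub>\<alpha>\<^esub> ?x) = k \<triangleright>\<^bsub>\<alpha>\<^esub> src X ?x"
    unfolding k_def using h m x by simp_all
  have kx: "src H k = lmom \<alpha> (src X ?x)" unfolding k_def using h x by simp
  have am: "src X (proj E a) = rng X (proj E (lb h m))" using h m x hm by simp
  show q: "a \<odot>\<^bsub>E\<^esub> lb h m \<in> points E" using a hm(1) am by simp
  have pm: "proj E (a \<odot>\<^bsub>E\<^esub> lb h m) = proj E a \<cdot>\<^bsub>X\<^esub> (h \<triangleright>\<^bsub>\<alpha>\<^esub> ?x)" using a hm(1,2) am by simp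
  have hx: "h \<triangleright>\<^bsub>\<alpha>\<^esub> ?x \<in> arrows X" using h x by simp
  have sq: "src X (proj E (a \<odot>\<^bsub>E\<^esub> lb h m)) = k \<triangleright>\<^bsub>\<alpha>\<^esub> src X ?x"
    unfolding pm X.mul_simps(3)[OF lbdl.fell.proj_arrow[OF a] hx am[unfolded hm(2)]] by (rule hm(3))
  show tq: "rng G t = rmom \<beta> (src X (proj E (a \<odot>\<^bsub>E\<^esub> lb h m)))" unfolding sq using t(2) k(1) kx x by simp
  show kc: "lb k c \<in> points E" using k c by simp
  have rk: "rng X (proj E (lb k c)) = k \<triangleright>\<^bsub>\<alpha>\<^esub> (src X ?x \<blacktriangleleft>\<^bsub>\<beta>\<^esub> t)" using k c t(3) by simp
  show rkc: "rng X (proj E (lb k c)) = src X (proj E (a \<odot>\<^bsub>E\<^esub> lb h m)) \<blacktriangleleft>\<^bsub>\<beta>\<^esub> t"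
    unfolding rk sq using k(1) kx x t(1,2) by simp
  have mt: "rb m t \<in> points E" "proj E (rb m t) = ?x \<blacktriangleleft>\<^bsub>\<beta>\<^esub> t" using m t by simp_all
  have mtc: "src X (proj E (rb m t)) = rng X (proj E c)" using mt x t by simp
  show rc: "rb m t \<odot>\<^bsub>E\<^esub> c \<in> points E" using mt mtc c by simp
  have rrc: "rng X (proj E (rb m t \<odot>\<^bsub>E\<^esub> c)) = rng X ?x \<blacktriangleleft>\<^bsub>\<beta>\<^esub> s" unfolding s_def using mt mtc c x t by simp
  have sx: "rng G s = rmom \<beta> (rng X ?x)" unfolding s_def using x t by simp
  show hrc: "src H h = lmom \<alpha> (rng X (proj E (rb m t \<odot>\<^bsub>E\<^esub> c)))" unfolding rrc using h(2) s(1) sx x by simp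
  show lrc: "lb h (rb m t \<odot>\<^bsub>E\<^esub> c) \<in> points E" using h(1) hrc rc by simp
  have hr: "rng X (proj E (lb h (rb m t \<odot>\<^bsub>E\<^esub> c))) = h \<triangleright>\<^bsub>\<alpha>\<^esub> (rng X ?x \<blacktriangleleft>\<^bsub>\<beta>\<^esub> s)" using h(1) hrc rc rrc by simp
  then show lrcs: "rng X (proj E (lb h (rb m t \<odot>\<^bsub>E\<^esub> c))) = src X (proj E a) \<blacktriangleleft>\<^bsub>\<beta>\<^esub> s"
    unfolding h(3) using h(1,2) x s(1) sx by simp
  \<comment> \<open>The orbit of the product is represented by its translate by \<open>t\<close>,
    whose source is the one required by \<open>k\<close> and \<open>c\<close>.\<close>
  have "LM (\<kappa> (rb (a \<odot>\<^bsub>E\<^esub> lb h m) t), k) c = rb (a \<odot>\<^bsub>E\<^esub> lb h m) t \<odot>\<^bsub>E\<^esub> lb k c"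
  proof (rule bundle_lact_eq[OF _ k(1) c k(2)])
    show "rb (a \<odot>\<^bsub>E\<^esub> lb h m) t \<in> points E" using q t(1) tq by simp
    show "src X (proj E (rb (a \<odot>\<^bsub>E\<^esub> lb h m) t)) = k \<triangleright>\<^bsub>\<alpha>\<^esub> rng X (proj E c)"
      using rkc[unfolded rk] q t(1,3) tq by simp
  qed
  then show "LM (\<kappa> (a \<odot>\<^bsub>E\<^esub> lb h m), k) c = rb (a \<odot>\<^bsub>E\<^esub> lb h m) t \<odot>\<^bsub>E\<^esub> lb k c"
    using rbdl.borb_act[OF t(1) q tq] by simp
  have "LM (\<kappa> (rb a s), h) (rb m t \<odot>\<^bsub>E\<^esub> c) = rb a s \<odot>\<^bsub>E\<^esub> lb h (rb m t \<odot>\<^bsub>E\<^esub> c)"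
  proof (rule bundle_lact_eq[OF _ h(1) rc hrc])
    show "rb a s \<in> points E" using a s by simp
    show "src X (proj E (rb a s)) = h \<triangleright>\<^bsub>\<alpha>\<^esub> rng X (proj E (rb m t \<odot>\<^bsub>E\<^esub> c))"
      using lrcs a s lbdl.bact_point(2)[OF h(1) rc hrc] left.rng_lact[OF h(1) lbdl.fell.proj_arrow[OF rc] hrc]
      by simp
  qed
  then show "LM (\<kappa> a, h) (rb m t \<odot>\<^bsub>E\<^esub> c) = rb a s \<odot>\<^bsub>E\<^esub> lb h (rb m t \<odot>\<^bsub>E\<^esub> c)"
    using rbdl.borb_act[OF s(1) a s(2)] by simp
  have mt': "rng G t = rmom \<beta> (src X (proj E (lb h m)))" unfolding hm(2,3) using t(2) k(1) kx x by simp
  have "rb (a \<odot>\<^bsub>E\<^esub> lb h m) t = rb a (proj E (lb h m) \<blacktriangleright>\<^bsub>\<beta>\<^esub> t) \<odot>\<^bsub>E\<^esub> rb (lb h m) t"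
    using rbdl.bdl.bact_bmult[OF t(1) hm(1) mt' a am[symmetric]] .
  \<comment> \<open>Being in tune: the residual at \<open>t\<close> does not change when
    \<open>h\<close> acts on the arrow of \<open>X\<close>.\<close>
  also have "proj E (lb h m) \<blacktriangleright>\<^bsub>\<beta>\<^esub> t = s" unfolding s_def hm(2) by (rule tune(4)[OF h(1) x t(1) h(2) t(2)])
  finally have 1: "rb (a \<odot>\<^bsub>E\<^esub> lb h m) t = rb a s \<odot>\<^bsub>E\<^esub> rb (lb h m) t" .
  have hmt: "src H h = lmom \<alpha> (rng X (proj E (rb m t)))"
    unfolding mt(2) using tune(2)[OF h(1) x t(1) h(2) t(2)] h(2) by simp
  have "lb h (rb m t \<odot>\<^bsub>E\<^esub> c) = lb h (rb m t) \<odot>\<^bsub>E\<^esub> lb (h \<triangleleft>\<^bsub>\<alpha>\<^esub> proj E (rb m t)) c"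
    by (rule lbdl.bact_bmult[OF h(1) mt(1) hmt c mtc])
  \<comment> \<open>Being in tune: the residual of \<open>h\<close> does not change when
    \<open>t\<close> acts on the arrow of \<open>X\<close>.\<close>
  also have "h \<triangleleft>\<^bsub>\<alpha>\<^esub> proj E (rb m t) = k" unfolding k_def mt(2) by (rule tune(5)[OF h(1) x t(1) h(2) t(2)])
  also have "lb h (rb m t) = rb (lb h m) t" by (rule bact_commute[OF h(1) m t(1) h(2) t(2)])
  finally have 2: "lb h (rb m t \<odot>\<^bsub>E\<^esub> c) = rb (lb h m) t \<odot>\<^bsub>E\<^esub> lb k c" .
  have r: "rb (lb h m) t \<in> points E" "src X (proj E (rb (lb h m) t)) = src X (proj E (lb h m)) \<blacktriangleleft>\<^bsub>\<beta>\<^esub> t"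
    using hm(1) t(1) mt' by simp_all
  \<comment> \<open>Both sides have become products of the same three vectors,
    \<open>rb a s\<close>, \<open>rb (lb h m) t\<close> and \<open>lb k c\<close>, bracketed
    differently.\<close>
  show "rb (a \<odot>\<^bsub>E\<^esub> lb h m) t \<odot>\<^bsub>E\<^esub> lb k c = rb a s \<odot>\<^bsub>E\<^esub> lb h (rb m t \<odot>\<^bsub>E\<^esub> c)"
    unfolding 1 2
  proof (rule lbdl.fell.bmult_assoc)
    have "src X (proj E (rb a s)) = src X (proj E a) \<blacktriangleleft>\<^bsub>\<beta>\<^esub> s" using a s by simp
    also have "\<dots> = h \<triangleright>\<^bsub>\<alpha>\<^esub> (rng X ?x \<blacktriangleleft>\<^bsub>\<beta>\<^esub> s)" using lrcs hr by simp
    also have "rng X ?x \<blacktriangleleft>\<^bsub>\<beta>\<^esub> s = rng X (proj E (rb m t))"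
      unfolding mt(2) s_def by (rule right.rng_ract[OF t(1) x t(2), symmetric])
    also have "h \<triangleright>\<^bsub>\<alpha>\<^esub> rng X (proj E (rb m t)) = rng X (proj E (lb h (rb m t)))"
      using h(1) mt(1) hmt by simp
    finally show "src X (proj E (rb a s)) = rng X (proj E (rb (lb h m) t))"
      unfolding bact_commute[OF h(1) m t(1) h(2) t(2)] .
    show "src X (proj E (rb (lb h m) t)) = rng X (proj E (lb k c))"
      unfolding r(2) rkc sq hm(2,3) ..
    show "rb a s \<in> points E" using a s by simp
  qed (rule r kc)+
qed

end

context self_similar_bundle_equivalence
begin

interpretation D: self_similar_bundle_equivalence "op_groupoid G" "op_groupoid H" "op_groupoid X"
    "op_right \<beta>" "op_left \<alpha>" "op_bundle E" "\<lambda>t b. rb b t" "\<lambda>b h. lb h b"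
  by (rule op_bundle_equivalence)

section \<open>Right-hand structures as reversed left-hand ones\<close>

abbreviation QL where "QL \<equiv> lquot H X \<alpha>"
abbreviation \<beta>L where "\<beta>L \<equiv> ract_on_lquot H X \<alpha> \<beta>"
abbreviation EL where "EL \<equiv> lquot_bundle H X \<alpha> E lb"
abbreviation rbL where "rbL \<equiv> bact_on_lquot H X \<alpha> E lb rb"
abbreviation L where "L \<equiv> rprod_groupoid G QL \<beta>L"
abbreviation C where "C \<equiv> rprod_bundle G QL EL \<beta>L rbL"
abbreviation PR where "PR \<equiv> para_ract X \<beta>"
abbreviation RM where "RM \<equiv> bundle_ract X E rb"
abbreviation RIP where "RIP \<equiv> bundle_rip H G X \<alpha> \<beta> E lb rb"
abbreviation (input) KD where "KD \<equiv> lprod_groupoid (op_groupoid QL) (op_groupoid G) (op_right \<beta>L)"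
abbreviation (input) AD where
  "AD \<equiv> lprod_bundle (op_groupoid QL) (op_bundle EL) (op_groupoid G) (op_right \<beta>L) (\<lambda>t b. rbL b t)"

lemma bhorb_op [simp]:
  "bgorb (op_groupoid H) (op_groupoid X) (op_left \<alpha>) (op_bundle E) (\<lambda>b h. lb h b) = bhorb H X \<alpha> E lb"
  unfolding bgorb_def bhorb_def rorbit_def lorbit_def by (auto simp: fun_eq_iff)

lemma gorb_op [simp]: "horb (op_groupoid G) (op_groupoid X) (op_right \<beta>) = gorb G X \<beta>"
  unfolding gorb_def horb_def rorbit_def lorbit_def by (auto simp: fun_eq_iff)

text \<open>This and the next equations identify what the reversed locale builds with opposites of
  the right-hand objects. At the level of quotients these are equalities; the exchange of
  coordinates enters only with the product constructions.\<close>

lemma QD_eq: "rquot (op_groupoid X) (op_groupoid H) (op_left \<alpha>) = op_groupoid QL"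
  by (simp add: rquot_def lquot_def op_orbit_groupoid)

lemma \<alpha>QD_eq: "lact_on_rquot (op_groupoid H) (op_groupoid X) (op_right \<beta>) (op_left \<alpha>) = op_right \<beta>L"
  by (simp add: lact_on_rquot_def ract_on_lquot_def op_right_def[of "ract_on_lquot H X \<alpha> \<beta>"] fun_eq_iff)

lemma \<beta>LD_eq: "ract_on_lquot (op_groupoid G) (op_groupoid X) (op_right \<beta>) (op_left \<alpha>) = op_left \<alpha>Q"
  by (simp add: lact_on_rquot_def ract_on_lquot_def op_left_def[of "lact_on_rquot G X \<alpha> \<beta>"] fun_eq_iff)

lemma ED_eq: "rquot_bundle (op_groupoid X) (op_bundle E) (op_groupoid H) (op_left \<alpha>) (\<lambda>b h. lb h b)
    = op_bundle EL"
  using op_orbit_bundle[OF lbdl.fell.fell_bundle_axioms] by (simp add: rquot_bundle_def lquot_bundle_def)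

lemma lbD_eq: "bact_on_rquot (op_groupoid H) (op_groupoid X) (op_left \<alpha>) (op_bundle E) (\<lambda>t b. rb b t) (\<lambda>b h. lb h b)
    = (\<lambda>t b. rbL b t)"
  by (simp add: bact_on_rquot_def bact_on_lquot_def fun_eq_iff)

lemmas D_eqs = QD_eq \<alpha>QD_eq ED_eq lbD_eq

lemma fr_rev: "fr (op_groupoid H) (op_groupoid X) (op_right \<beta>) (op_left \<alpha>) x = rev_pair (fs H X \<alpha> \<beta> x)"
  by (simp add: fr_def fs_def \<alpha>QD_eq lprod_unit_def rprod_unit_def)

lemma fs_rev: "fs (op_groupoid G) (op_groupoid X) (op_right \<beta>) (op_left \<alpha>) x = rev_pair (fr G X \<alpha> \<beta> x)"
  by (simp add: fr_def fs_def \<beta>LD_eq lprod_unit_def rprod_unit_def)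

lemma PR_rev: "PR y k = para_lact (op_groupoid X) (op_right \<beta>) (rev_pair k) y"
  by (cases k) (simp add: para_ract_def para_lact_def eq_commute)

lemma RM_rev: "RM m c = bundle_lact (op_groupoid X) (op_bundle E) (\<lambda>t b. rb b t) (rev_pair c) m"
  by (cases c) (simp add: bundle_ract_def bundle_lact_def eq_commute)

text \<open>The arguments change places because the right inner product is linear in its second
  variable and the left one in its first.\<close>

lemma RIP_rev: "RIP m n = rev_pair (bundle_lip (op_groupoid G) (op_groupoid H) (op_groupoid X) (op_right \<beta>)
    (op_left \<alpha>) (op_bundle E) (\<lambda>t b. rb b t) (\<lambda>b h. lb h b) n m)"
proof -
  have "(t \<in> arrows G \<and> rsigma X \<beta> (rng X (proj E m)) = rng G t \<and> rng X (proj E m) \<blacktriangleleft>\<^bsub>\<beta>\<^esub> t = rng X (proj E n))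
    \<longleftrightarrow> (t \<in> arrows G \<and> rng G t = rsigma X \<beta> (rng X (proj E m)) \<and> rng X (proj E n) = rng X (proj E m) \<blacktriangleleft>\<^bsub>\<beta>\<^esub> t)" for t
    by metis
  then show ?thesis by (simp add: bundle_rip_def bundle_lip_def Let_def)
qed

lemmas L_rev = rprod_groupoid_rev[where G = G and Q = QL and \<beta> = \<beta>L]
lemmas C_rev = rprod_bundle_rev[where G = G and Q = QL and \<beta> = \<beta>L and F = EL and act = rbL]
lemmas arrows_L_rev = arrows_rprod_rev[where G = G and Q = QL and \<beta> = \<beta>L]
lemmas points_C_rev = points_rprod_rev[where G = G and Q = QL and \<beta> = \<beta>L and F = EL and act = rbL]

lemmas KD_groupoid = D.K.topological_groupoid_axioms[unfolded D_eqs]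
lemmas AD_bundle = D.fell_bundle_A[unfolded D_eqs]

lemma topological_groupoid_L: "topological_groupoid L"
  by (rule topological_groupoid.anti_isomorphic[OF KD_groupoid L_rev(1)]) (simp_all only: L_rev)

lemma fell_bundle_C: "fell_bundle L C" and saturated_C: "saturated L C"
  using fell_bundle.anti_isomorphic_bundle[OF AD_bundle topological_groupoid_L L_rev(1) L_rev(2-5) C_rev(1) C_rev(2-8)]
    D.saturated_A[unfolded D_eqs] by blast+

text \<open>Units are the arrows equal to their source, and equally those equal to their range, so
  reversal preserves them.\<close>

lemma KD_unit_iff: "y \<in> units L \<longleftrightarrow> rev_pair y \<in> units KD"
proof -
  interpret KD: topological_groupoid KD by (rule KD_groupoid)
  have "y \<in> units L \<longleftrightarrow> rev_pair y \<in> arrows KD \<and> rev_pair (rng KD (rev_pair y)) = y"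
    unfolding topological_groupoid.unit_iff[OF topological_groupoid_L] arrows_L_rev L_rev ..
  also have "\<dots> \<longleftrightarrow> rev_pair y \<in> arrows KD \<and> rng KD (rev_pair y) = rev_pair y"
    by (auto simp: prod_eq_iff)
  also have "\<dots> \<longleftrightarrow> rev_pair y \<in> units KD"
    using KD.rng_in_units[of "rev_pair y"] KD.unit_simps(1)[of "rev_pair y"] KD.unit_arrow[of "rev_pair y"] by metis
  finally show ?thesis .
qed

lemma src_KD_iff: "src KD (rev_pair k) = rev_pair v \<longleftrightarrow> v = rng L k"
  unfolding L_rev by (metis rev_pair_rev_pair)

lemma rdom_L_iff: "(z, k) \<in> rdom L (gtop X) (fs H X \<alpha> \<beta>) \<longleftrightarrow>
    (rev_pair k, z) \<in> ldom KD (gtop X) (fr (op_groupoid H) (op_groupoid X) (op_right \<beta>) (op_left \<alpha>))"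
  unfolding rdom_iff ldom_iff fr_rev arrows_L_rev src_KD_iff by blast

lemma continuous_rev: "continuous_map T (gtop L) f \<Longrightarrow> continuous_map T (gtop KD) (\<lambda>p. rev_pair (f p))"
  "continuous_map T (gtop KD) g \<Longrightarrow> continuous_map T (gtop L) (\<lambda>p. rev_pair (g p))"
  using L_rev(1) continuous_map_compose[of T "gtop L" f "gtop KD" rev_pair]
    continuous_map_compose[of T "gtop KD" g "gtop L" rev_pair]
  unfolding homeomorphic_maps_def by (auto simp: o_def)

lemma groupoid_right_space_L: "groupoid_right_space L (gtop X) (fs H X \<alpha> \<beta>) PR"
proof (intro groupoid_right_space.intro groupoid_right_space_axioms.intro topological_groupoid_L)
  interpret S: groupoid_left_space KD "gtop X"
      "fr (op_groupoid H) (op_groupoid X) (op_right \<beta>) (op_left \<alpha>)" "para_lact (op_groupoid X) (op_right \<beta>)"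
    using D.groupoid_left_space unfolding D_eqs by simp
  have "continuous_map (gtop X) (gtop KD) (\<lambda>x. rev_pair (fs H X \<alpha> \<beta> x))"
    using S.momentum_continuous unfolding S.continuous_unit_top fr_rev by blast
  from continuous_rev(2)[OF this] have "continuous_map (gtop X) (gtop L) (fs H X \<alpha> \<beta>)" by simp
  moreover have "fs H X \<alpha> \<beta> x \<in> units L" if "x \<in> topspace (gtop X)" for x
    using S.momentum_continuous that unfolding S.continuous_unit_top KD_unit_iff fr_rev by blast
  ultimately show "continuous_map (gtop X) (unit_top L) (fs H X \<alpha> \<beta>)"
    unfolding topological_groupoid.continuous_unit_top[OF topological_groupoid_L] by simp
  let ?D = "rdom_top L (gtop X) (fs H X \<alpha> \<beta>)"
  have dom: "topspace ?D = rdom L (gtop X) (fs H X \<alpha> \<beta>)"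
    by (auto simp: rdom_top_def rdom_def arrows_def)
  have c: "continuous_map ?D (gtop X) fst" "continuous_map ?D (gtop L) snd"
    by (simp_all add: rdom_top_def continuous_map_fst_sub continuous_map_snd_sub)
  have "continuous_map ?D (gtop X) (\<lambda>p. para_lact (op_groupoid X) (op_right \<beta>) (rev_pair (snd p)) (fst p))"
    by (rule continuous_map_apply2[OF S.act_continuous[unfolded ldom_top_def] continuous_rev(1)[OF c(2)] c(1)])
      (unfold dom, use rdom_L_iff in auto)
  then show "continuous_map ?D (gtop X) (\<lambda>(z, k). PR z k)"
    by (simp add: PR_rev case_prod_unfold)
  show "fs H X \<alpha> \<beta> (PR z k) = src L k" if "(z, k) \<in> rdom L (gtop X) (fs H X \<alpha> \<beta>)" for z k
  proof -
    have "rev_pair (fs H X \<alpha> \<beta> (PR z k)) = rng KD (rev_pair k)"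
      using S.momentum_act[OF that[unfolded rdom_L_iff]] unfolding PR_rev fr_rev .
    then show ?thesis unfolding L_rev by (metis rev_pair_rev_pair)
  qed
  show "PR (PR z k) k' = PR z (k \<cdot>\<^bsub>L\<^esub> k')"
    if "(z, k) \<in> rdom L (gtop X) (fs H X \<alpha> \<beta>)" "(k, k') \<in> composable L" for z k k'
  proof -
    have "src L k = rng L k'" "k \<in> arrows L" "k' \<in> arrows L" using that(2) by (simp_all add: composable_def)
    then have "(rev_pair k', rev_pair k) \<in> composable KD"
      unfolding composable_def arrows_L_rev L_rev by (simp add: prod_eq_iff)
    then show ?thesis
      using S.act_act[OF _ that(1)[unfolded rdom_L_iff]] unfolding PR_rev L_rev by simp
  qed
  show "PR z (fs H X \<alpha> \<beta> z) = z" if "z \<in> topspace (gtop X)" for z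
    using S.act_unit[OF that] unfolding PR_rev fr_rev .
qed

text \<open>Reversal exchanges the roles of \<open>fr\<close> and \<open>fs\<close>. Freeness,
  properness, invariance, the description of orbits and openness are then readings of the left-hand
  results.\<close>

lemma para_ract_L:
  "free_raction L (gtop X) (fs H X \<alpha> \<beta>) PR" "proper_raction L (gtop X) (fs H X \<alpha> \<beta>) PR"
  "(z, t) \<in> rdom L (gtop X) (fs H X \<alpha> \<beta>) \<Longrightarrow> fr G X \<alpha> \<beta> (PR z t) = fr G X \<alpha> \<beta> z"
  "z \<in> arrows X \<Longrightarrow> rorbit L (fs H X \<alpha> \<beta>) PR z = {y \<in> arrows X. fr G X \<alpha> \<beta> y = fr G X \<alpha> \<beta> z}"
  "open_quotient (gtop X) (unit_top L) (fs H X \<alpha> \<beta>)"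
proof -
  let ?frD = "fr (op_groupoid H) (op_groupoid X) (op_right \<beta>) (op_left \<alpha>)"
  let ?PLD = "para_lact (op_groupoid X) (op_right \<beta>)"
  show "free_raction L (gtop X) (fs H X \<alpha> \<beta>) PR"
    using D.free_para_lact unfolding free_raction_def free_laction_def D_eqs op_groupoid_simps
    by (auto simp: KD_unit_iff rdom_L_iff PR_rev)
  show "proper_raction L (gtop X) (fs H X \<alpha> \<beta>) PR"
  proof -
    have rev: "homeomorphic_map (rdom_top L (gtop X) (fs H X \<alpha> \<beta>)) (ldom_top KD (gtop X) ?frD)
        (\<lambda>p. (rev_pair (snd p), fst p))"
      unfolding homeomorphic_map_maps homeomorphic_maps_def rdom_top_def ldom_top_def continuous_map_in_subtopology
      by (rule exI[of _ "\<lambda>p. (snd p, rev_pair (fst p))"])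
        (auto simp: rdom_L_iff intro!: continuous_map_pairedI continuous_map_fst_sub continuous_map_snd_sub
          continuous_rev[unfolded prod.case])
    have "proper_map (ldom_top KD (gtop X) ?frD) (prod_topology (gtop X) (gtop X)) (\<lambda>(k, z). (?PLD k z, z))"
      using D.proper_para_lact unfolding proper_laction_def D_eqs op_groupoid_simps .
    from proper_map_compose[OF homeomorphic_imp_proper_map[OF rev] this]
    show ?thesis unfolding proper_raction_def PR_rev by (simp add: o_def case_prod_unfold)
  qed
  show "fr G X \<alpha> \<beta> (PR z t) = fr G X \<alpha> \<beta> z" if "(z, t) \<in> rdom L (gtop X) (fs H X \<alpha> \<beta>)"
  proof -
    have "rev_pair (fr G X \<alpha> \<beta> (PR z t)) = rev_pair (fr G X \<alpha> \<beta> z)"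
      using D.fs_para_lact that unfolding D_eqs op_groupoid_simps rdom_L_iff PR_rev fs_rev by blast
    then show ?thesis by (metis rev_pair_rev_pair)
  qed
  show "rorbit L (fs H X \<alpha> \<beta>) PR z = {y \<in> arrows X. fr G X \<alpha> \<beta> y = fr G X \<alpha> \<beta> z}" if "z \<in> arrows X"
  proof -
    have "rorbit L (fs H X \<alpha> \<beta>) PR z = lorbit KD ?frD ?PLD z"
    proof (intro equalityI subsetI)
      fix y assume "y \<in> rorbit L (fs H X \<alpha> \<beta>) PR z"
      then obtain k where "y = PR z k" "k \<in> arrows L" "fs H X \<alpha> \<beta> z = rng L k" by (auto simp: rorbit_def)
      then show "y \<in> lorbit KD ?frD ?PLD z"
        unfolding lorbit_def mem_Collect_eq fr_rev using src_KD_iff[of k "fs H X \<alpha> \<beta> z"] arrows_L_rev[of k]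
        by (intro exI[of _ "rev_pair k"]) (simp only: PR_rev)
    next
      fix y assume "y \<in> lorbit KD ?frD ?PLD z"
      then obtain k where "y = ?PLD k z" "k \<in> arrows KD" "src KD k = rev_pair (fs H X \<alpha> \<beta> z)"
        by (auto simp only: lorbit_def fr_rev)
      then show "y \<in> rorbit L (fs H X \<alpha> \<beta>) PR z"
        unfolding rorbit_def mem_Collect_eq
        using src_KD_iff[of "rev_pair k" "fs H X \<alpha> \<beta> z"] arrows_L_rev[of "rev_pair k"]
        by (intro exI[of _ "rev_pair k"]) (simp add: PR_rev)
    qed
    also have "\<dots> = {y \<in> arrows X. rev_pair (fr G X \<alpha> \<beta> y) = rev_pair (fr G X \<alpha> \<beta> z)}"
      using D.lorbit_para[of z] that unfolding D_eqs op_groupoid_simps fs_rev by simp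
    finally show ?thesis by (auto simp: prod_eq_iff)
  qed
  show "open_quotient (gtop X) (unit_top L) (fs H X \<alpha> \<beta>)"
  proof -
    have "homeomorphic_map (gtop KD) (gtop L) rev_pair" using L_rev(1) homeomorphic_maps_map by blast
    then have "open_quotient (gtop KD) (gtop L) rev_pair"
      using homeomorphic_imp_continuous_map homeomorphic_imp_open_map homeomorphic_imp_surjective_map
      unfolding open_quotient_def by blast
    from open_quotient_restrict[OF this, of "units L"]
    have "open_quotient (unit_top KD) (unit_top L) rev_pair"
      unfolding KD_unit_iff unit_top_def by simp
    moreover have "open_quotient (gtop X) (unit_top KD) ?frD"
      using D.open_quotient_fr unfolding D_eqs op_groupoid_simps .
    ultimately have "open_quotient (gtop X) (unit_top L) (\<lambda>x. rev_pair (?frD x))"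
      by (rule open_quotient_compose[rotated])
    then show ?thesis by (simp add: fr_rev)
  qed
qed

text \<open>The reversed reading of \<open>A_representative\<close>: now the member of the orbit is
  selected by its range.\<close>

lemma C_representative:
  assumes "c \<in> points C" "y \<in> arrows X" "fs H X \<alpha> \<beta> y = rng L (proj C c)"
  obtains b t where "c = (t, bhorb H X \<alpha> E lb b)" "b \<in> points E" "t \<in> arrows G"
    "rmom \<beta> (rng X (proj E b)) = src G t" "rng G t = rmom \<beta> (src X y)" "rng X (proj E b) = src X y \<blacktriangleleft>\<^bsub>\<beta>\<^esub> t"
proof -
  have "rev_pair c \<in> points AD" using assms(1) points_C_rev by blast
  moreover have "src KD (proj AD (rev_pair c)) = fr (op_groupoid H) (op_groupoid X) (op_right \<beta>) (op_left \<alpha>) y"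
    using assms(3) src_KD_iff[of "rev_pair (proj AD (rev_pair c))" "fs H X \<alpha> \<beta> y"] unfolding fr_rev C_rev by simp
  ultimately obtain b t where "rev_pair c = (bhorb H X \<alpha> E lb b, t)" "b \<in> points E" "t \<in> arrows G"
    "rmom \<beta> (rng X (proj E b)) = src G t" "rng G t = rmom \<beta> (src X y)" "rng X (proj E b) = src X y \<blacktriangleleft>\<^bsub>\<beta>\<^esub> t"
    using D.A_representative[of "rev_pair c" y] assms(2)
    unfolding D_eqs op_groupoid_simps op_bundle_simps op_right_simps op_left_simps bhorb_op by blast
  then show thesis using that[of t b] by (cases c) simp
qed

lemma bundle_ract_eq:
  assumes "c \<in> points E" "t \<in> arrows G" "b \<in> points E" "rng G t = rmom \<beta> (src X (proj E b))"
    "rng X (proj E c) = src X (proj E b) \<blacktriangleleft>\<^bsub>\<beta>\<^esub> t"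
  shows "RM b (t, bhorb H X \<alpha> E lb c) = rb b t \<odot>\<^bsub>E\<^esub> c"
  using D.bundle_lact_eq[of c t b] assms by (simp add: RM_rev)

lemma bhorb_lact:
  assumes "h \<in> arrows H" "b \<in> points E" "src H h = lmom \<alpha> (rng X (proj E b))"
  shows "bhorb H X \<alpha> E lb (lb h b) = bhorb H X \<alpha> E lb b"
  using D.rbdl.borb_act[of h b] assms by simp

lemma rip_eq:
  assumes "a \<in> points E" "b \<in> points E" "t \<in> arrows G" "rng G t = rmom \<beta> (rng X (proj E a))"
    "rng X (proj E b) = rng X (proj E a) \<blacktriangleleft>\<^bsub>\<beta>\<^esub> t"
  shows "RIP a b = (ginv X (proj E a) \<blacktriangleright>\<^bsub>\<beta>\<^esub> t, bhorb H X \<alpha> E lb (rb (bstar E a) t \<odot>\<^bsub>E\<^esub> b))"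
  using D.lip_eq[of b a t] assms by (simp add: RIP_rev)

text \<open>\<open>p\<close> and \<open>c\<close> are both represented to match \<open>m\<close>.
  For the product of \<open>p\<close> and \<open>m\<close> the representative of \<open>c\<close> no
  longer fits, but its translate by the residual of \<open>h\<close> at the projection of
  \<open>m\<close> does, and it lies in the same orbit. The rest is
  \<open>bimodule_products\<close>.\<close>

lemma lm_rm_commute:
  assumes a: "p \<in> points A" "m \<in> points E" "src K (proj A p) = fr G X \<alpha> \<beta> (proj E m)"
    and c: "c \<in> points C" "fs H X \<alpha> \<beta> (proj E m) = rng L (proj C c)"
  shows "RM (LM p m) c = LM p (RM m c)"
proof -
  let ?x = "proj E m"
  obtain a h where a: "p = (\<kappa> a, h)" "a \<in> points E" "h \<in> arrows H" "lmom \<alpha> (src X (proj E a)) = rng H h"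
    "src H h = lmom \<alpha> (rng X ?x)" "src X (proj E a) = h \<triangleright>\<^bsub>\<alpha>\<^esub> rng X ?x"
    using a(1) lbdl.fell.proj_arrow[OF a(2)] a(3) by (rule A_representative)
  obtain c0 t where c: "c = (t, bhorb H X \<alpha> E lb c0)" "c0 \<in> points E" "t \<in> arrows G"
    "rmom \<beta> (rng X (proj E c0)) = src G t" "rng G t = rmom \<beta> (src X ?x)" "rng X (proj E c0) = src X ?x \<blacktriangleleft>\<^bsub>\<beta>\<^esub> t"
    using c(1) lbdl.fell.proj_arrow[OF \<open>m \<in> points E\<close>] c(2) by (rule C_representative)
  note m = \<open>m \<in> points E\<close>
  note b = bimodule_products[OF a(2) m c(2) a(3,5,6) c(3,5,6)]
  have "LM p m = a \<odot>\<^bsub>E\<^esub> lb h m" unfolding a(1) by (rule bundle_lact_eq[OF a(2,3) m a(5,6)])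
  then have "RM (LM p m) c = rb (a \<odot>\<^bsub>E\<^esub> lb h m) t \<odot>\<^bsub>E\<^esub> lb (h \<triangleleft>\<^bsub>\<alpha>\<^esub> ?x) c0"
    unfolding c(1) using bundle_ract_eq[OF b(4) c(3) b(3,5,6)] bhorb_lact[OF b(1) c(2) b(2)] by simp
  moreover have "RM m c = rb m t \<odot>\<^bsub>E\<^esub> c0" unfolding c(1) by (rule bundle_ract_eq[OF c(2,3) m c(5,6)])
  ultimately show ?thesis unfolding a(1) using b(14,15) by simp
qed

lemma rip_element:
  assumes "a \<in> points E" "b \<in> points E" "fr G X \<alpha> \<beta> (proj E a) = fr G X \<alpha> \<beta> (proj E b)"
  obtains t where "t \<in> arrows G" "rng G t = rmom \<beta> (rng X (proj E a))" "rng X (proj E b) = rng X (proj E a) \<blacktriangleleft>\<^bsub>\<beta>\<^esub> t"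
  using D.lip_element[of b a] assms by (auto simp: fs_rev)

text \<open>Again \<open>bimodule_products\<close>, with the adjoint of \<open>n\<close> in the
  middle: the left inner product contributes \<open>m\<close> times a translate of this adjoint, the
  right one a translate of it times \<open>p\<close>.\<close>

lemma lip_rip:
  assumes m: "m \<in> points E" "n \<in> points E" "p \<in> points E"
    and fs: "fs H X \<alpha> \<beta> (proj E m) = fs H X \<alpha> \<beta> (proj E n)"
    and fr: "fr G X \<alpha> \<beta> (proj E n) = fr G X \<alpha> \<beta> (proj E p)"
  shows "LM (LIP m n) p = RM m (RIP n p)"
proof -
  let ?y = "proj E n"
  obtain h where h: "h \<in> arrows H" "src H h = lmom \<alpha> (src X ?y)" "src X (proj E m) = h \<triangleright>\<^bsub>\<alpha>\<^esub> src X ?y"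
    using lip_element[OF m(1,2) fs] .
  obtain t where t: "t \<in> arrows G" "rng G t = rmom \<beta> (rng X ?y)" "rng X (proj E p) = rng X ?y \<blacktriangleleft>\<^bsub>\<beta>\<^esub> t"
    using rip_element[OF m(2,3) fr] .
  have n: "bstar E n \<in> points E" "proj E (bstar E n) = ginv X ?y" "rng X (proj E (bstar E n)) = src X ?y"
    "src X (proj E (bstar E n)) = rng X ?y" using m(2) by simp_all
  note b = bimodule_products[of m "bstar E n" p h t, unfolded n(3,4),
      OF m(1) n(1) m(3) h t, unfolded n(2)]
  have "RIP n p = (ginv X ?y \<blacktriangleright>\<^bsub>\<beta>\<^esub> t, bhorb H X \<alpha> E lb (rb (bstar E n) t \<odot>\<^bsub>E\<^esub> p))" by (rule rip_eq[OF m(2,3) t])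
  then have "RM m (RIP n p) = rb m (ginv X ?y \<blacktriangleright>\<^bsub>\<beta>\<^esub> t) \<odot>\<^bsub>E\<^esub> lb h (rb (bstar E n) t \<odot>\<^bsub>E\<^esub> p)"
    using bundle_ract_eq[OF b(10,7) m(1) b(8,12)] bhorb_lact[OF h(1) b(9,11)] by simp
  then show ?thesis unfolding lip_eq[OF m(1,2) h] using b(13,15) by simp
qed

end

lemma (in self_similar_para_equivalence) fr_unit: "z \<in> arrows X \<Longrightarrow> fr G X \<alpha> \<beta> z \<in> units K"
  using continuous_fr unfolding K.continuous_unit_top by (simp add: arrows_def)

text \<open>The theorem assumes commutation when \<open>t\<close> can act on the translate of
  \<open>b\<close>, the locale when it can act on \<open>b\<close>. Being in tune makes the two
  momentum values equal.\<close>

lemma self_similar_bundle_equivalenceI: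
  assumes "para_equivalence H G X \<alpha> \<beta>" and "saturated X E"
    and "self_similar_left_bundle H X \<alpha> E lb" and "self_similar_right_bundle G X \<beta> E rb"
    and commute: "\<And>h b t. \<lbrakk>h \<in> arrows H; b \<in> points E; t \<in> arrows G; src H h = lrho X \<alpha> (proj E b);
        rsigma X \<beta> (h \<triangleright>\<^bsub>\<alpha>\<^esub> proj E b) = rng G t\<rbrakk> \<Longrightarrow> rb (lb h b) t = lb h (rb b t)"
  shows "self_similar_bundle_equivalence H G X \<alpha> \<beta> E lb rb"
proof -
  interpret l: self_similar_left_bundle H X \<alpha> E lb by fact
  interpret r: self_similar_right_bundle G X \<beta> E rb by fact
  have fp: "free_proper_right_action G X \<beta>"
    using assms(1) r.ss.self_similar_right_axioms
    by (simp add: para_equivalence_def free_proper_right_action_def free_proper_right_action_axioms_def)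
  have para: "self_similar_para_equivalence H G X \<alpha> \<beta>"
    using assms(1) fp
    by (simp add: para_equivalence_def self_similar_para_equivalence_def
        self_similar_para_equivalence_axioms_def l.ss.X.topological_groupoid_axioms
        l.ss.H.topological_groupoid_axioms r.ss.G.topological_groupoid_axioms)
  show ?thesis
  proof (intro self_similar_bundle_equivalence.intro self_similar_bundle_equivalence_axioms.intro para
      assms(2,3) free_proper_right_bundle.intro fp assms(4))
    fix h b t
    assume a: "h \<in> arrows H" "b \<in> points E" "t \<in> arrows G" "src H h = lmom \<alpha> (rng X (proj E b))"
      "rng G t = rmom \<beta> (src X (proj E b))"
    then have "rsigma X \<beta> (h \<triangleright>\<^bsub>\<alpha>\<^esub> proj E b) = rng G t"
      using self_similar_para_equivalence.tune(1)[OF para, of h "proj E b" t] by (simp add: rsigma_def)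
    then show "lb h (rb b t) = rb (lb h b) t" using commute a by (simp add: lrho_def)
  qed
qed

context self_similar_bundle_equivalence
begin

interpretation D: self_similar_bundle_equivalence "op_groupoid G" "op_groupoid H" "op_groupoid X"
    "op_right \<beta>" "op_left \<alpha>" "op_bundle E" "\<lambda>t b. rb b t" "\<lambda>b h. lb h b"
  by (rule op_bundle_equivalence)

section \<open>Transfer of the right action and the groupoid equivalence\<close>

abbreviation (input) frD where "frD \<equiv> fr (op_groupoid H) (op_groupoid X) (op_right \<beta>) (op_left \<alpha>)"
abbreviation (input) LMD where "LMD \<equiv> bundle_lact (op_groupoid X) (op_bundle E) (\<lambda>t b. rb b t)"
abbreviation (input) LIPD where "LIPD \<equiv> bundle_lip (op_groupoid G) (op_groupoid H) (op_groupoid X)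
  (op_right \<beta>) (op_left \<alpha>) (op_bundle E) (\<lambda>t b. rb b t) (\<lambda>b h. lb h b)"

lemma C_domain:
  "c \<in> points C \<Longrightarrow> rev_pair c \<in> points AD"
  "fs H X \<alpha> \<beta> y = rng L (proj C c) \<longleftrightarrow> src KD (proj AD (rev_pair c)) = frD y"
  using points_C_rev src_KD_iff[of "rev_pair (proj AD (rev_pair c))" "fs H X \<alpha> \<beta> y"]
  unfolding fr_rev C_rev by auto

lemma bundle_ract_facts:
  assumes "c \<in> points C" "m \<in> points E" "fs H X \<alpha> \<beta> (proj E m) = rng L (proj C c)"
  shows "RM m c \<in> points E" "proj E (RM m c) = PR (proj E m) (proj C c)"
    "bnorm E (RM m c) \<le> bnorm E m * bnorm C c"
  using D.bundle_lact_facts(1-3)[unfolded D_eqs op_bundle_simps, OF C_domain(1)[OF assms(1)] assms(2)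
      assms(3)[unfolded C_domain(2)]]
  unfolding RM_rev PR_rev C_rev by (simp_all add: mult.commute)

lemma bundle_ract_assoc:
  assumes m: "m \<in> points E" and cd: "(c, d) \<in> bcomposable L C"
    and fs: "fs H X \<alpha> \<beta> (proj E m) = rng L (proj C c)"
  shows "RM (RM m c) d = RM m (c \<odot>\<^bsub>C\<^esub> d)"
proof -
  have c: "c \<in> points C" "d \<in> points C" "src L (proj C c) = rng L (proj C d)"
    using cd by (simp_all add: bcomposable_def composable_def)
  then have "src KD (proj AD (rev_pair d)) = rng KD (proj AD (rev_pair c))"
    unfolding L_rev C_rev by (simp add: prod_eq_iff)
  then have "(rev_pair d, rev_pair c) \<in> bcomposable KD AD"
    using C_domain(1)[OF c(1)] C_domain(1)[OF c(2)] fell_bundle.proj_arrow[OF AD_bundle]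
    by (simp add: bcomposable_def composable_def)
  from D.bundle_lact_assoc[unfolded D_eqs op_bundle_simps, OF this m fs[unfolded C_domain(2)]]
  show ?thesis unfolding RM_rev C_rev by simp
qed

lemma bundle_ract_continuous:
  "continuous_map
    (subtopology (prod_topology (btop E) (btop C)) {(m, c). fs H X \<alpha> \<beta> (proj E m) = rng L (proj C c)})
    (btop E) (\<lambda>(m, c). RM m c)" (is "continuous_map ?D _ _")
proof -
  have "continuous_map ?D (btop E) (\<lambda>p. LMD (rev_pair (snd p)) (fst p))"
  proof (rule continuous_map_apply2[OF D.bundle_lact_continuous[unfolded D_eqs op_bundle_simps]])
    show "continuous_map ?D (btop AD) (\<lambda>p. rev_pair (snd p))"
    proof -
      have "continuous_map (btop C) (btop AD) rev_pair"
        using C_rev(1) unfolding homeomorphic_maps_def by blast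
      from continuous_map_compose[OF continuous_map_snd_sub this] show ?thesis by (simp add: o_def)
    qed
    show "continuous_map ?D (btop E) fst" by (rule continuous_map_fst_sub)
    show "(rev_pair (snd p), fst p) \<in> {(a, m). src KD (proj AD a) = frD (proj E m)}" if "p \<in> topspace ?D" for p
      using that C_domain(2)[of "proj E (fst p)" "snd p"] by auto
  qed
  then show ?thesis by (simp add: RM_rev case_prod_unfold)
qed

lemma groupoid_right_space_facts: "z \<in> arrows X \<Longrightarrow> fs H X \<alpha> \<beta> z \<in> units L"
  using groupoid_right_space.momentum_unit[OF groupoid_right_space_L] by (simp add: arrows_def)

text \<open>Read off from commutation on the bundle: all three arguments are lifted to zero vectors,
  and the resulting equation is projected to \<open>X\<close>.\<close>

lemma para_actions_commute:
  assumes kz: "(k, z) \<in> ldom K (gtop X) (fr G X \<alpha> \<beta>)" and zt: "(z, t) \<in> rdom L (gtop X) (fs H X \<alpha> \<beta>)"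
  shows "PR (PL k z) t = PL k (PR z t)"
proof -
  interpret FA: fell_bundle K A by (rule fell_bundle_A)
  interpret FC: fell_bundle L C by (rule fell_bundle_C)
  let ?p = "bzero A k" and ?m = "bzero E z" and ?c = "bzero C t"
  have m: "?m \<in> points E" "proj E ?m = z" using zt by (simp_all add: rdom_iff)
  have p: "?p \<in> points A" "proj A ?p = k" "src K (proj A ?p) = fr G X \<alpha> \<beta> (proj E ?m)"
    using kz m FA.bzero_point[of k] by (simp_all add: ldom_iff arrows_def)
  have c: "?c \<in> points C" "proj C ?c = t" "fs H X \<alpha> \<beta> (proj E ?m) = rng L (proj C ?c)"
    using zt m FC.bzero_point[of t] by (simp_all add: rdom_iff arrows_def)
  note pm = bundle_lact_facts(1,2)[OF p(1) m(1) p(3)] and mc = bundle_ract_facts(1,2)[OF c(1) m(1) c(3)]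
  have "fs H X \<alpha> \<beta> (proj E (LM ?p ?m)) = rng L (proj C ?c)"
    unfolding pm(2) p(2) m(2) fs_para_lact[OF kz] using c m by simp
  then have "proj E (RM (LM ?p ?m) ?c) = PR (PL k z) t"
    using bundle_ract_facts(2)[OF c(1) pm(1)] pm(2) p(2) m(2) c(2) by simp
  moreover have "src K (proj A ?p) = fr G X \<alpha> \<beta> (proj E (RM ?m ?c))"
    unfolding mc(2) c(2) m(2) para_ract_L(3)[OF zt] using p m by simp
  then have "proj E (LM ?p (RM ?m ?c)) = PL k (PR z t)"
    using bundle_lact_facts(2)[OF p(1) mc(1)] mc(2) p(2) m(2) c(2) by simp
  ultimately show ?thesis using lm_rm_commute[OF p(1) m(1) p(3) c(1,3)] by simp
qed

lemma level_set_eq_iff: "\<lbrakk>x \<in> S; y \<in> S\<rbrakk> \<Longrightarrow> {w \<in> S. f w = f x} = {w \<in> S. f w = f y} \<longleftrightarrow> f x = f y"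
  by auto

text \<open>Orbits of either action are level sets of the momentum map of the other, and that map is
  an open quotient onto its unit space. This yields the required homeomorphisms of orbit
  spaces.\<close>

lemma groupoid_equivalence: "groupoid_equivalence K L (gtop X) (fr G X \<alpha> \<beta>) (fs H X \<alpha> \<beta>) PL PR"
proof (intro groupoid_equivalence.intro groupoid_equivalence_axioms.intro groupoid_left_space
    groupoid_right_space_L X.Hausdorff X.locally_compact free_para_lact proper_para_lact para_ract_L(1,2))
  show "open_map (gtop X) (unit_top K) (fr G X \<alpha> \<beta>)" "open_map (gtop X) (unit_top L) (fs H X \<alpha> \<beta>)"
    using open_quotient_fr para_ract_L(5) by (simp_all add: open_quotient_def)
  show "fs H X \<alpha> \<beta> (PL k z) = fs H X \<alpha> \<beta> z" if "(k, z) \<in> ldom K (gtop X) (fr G X \<alpha> \<beta>)" for k z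
    using fs_para_lact[OF that] .
  show "fr G X \<alpha> \<beta> (PR z t) = fr G X \<alpha> \<beta> z" if "(z, t) \<in> rdom L (gtop X) (fs H X \<alpha> \<beta>)" for z t
    using para_ract_L(3)[OF that] .
  show "PR (PL k z) t = PL k (PR z t)"
    if "(k, z) \<in> ldom K (gtop X) (fr G X \<alpha> \<beta>)" "(z, t) \<in> rdom L (gtop X) (fs H X \<alpha> \<beta>)" for k z t
    using para_actions_commute[OF that] .
  show "\<exists>f. homeomorphic_map (quotient_topology (gtop X) (rorbit L (fs H X \<alpha> \<beta>) PR)) (unit_top K) f
      \<and> (\<forall>z\<in>topspace (gtop X). f (rorbit L (fs H X \<alpha> \<beta>) PR z) = fr G X \<alpha> \<beta> z)"
  proof (rule open_quotient_orbit_space[OF open_quotient_fr])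
    fix x y assume xy: "x \<in> topspace (gtop X)" "y \<in> topspace (gtop X)"
    note orb = para_ract_L(4)[OF xy(1)[folded arrows_def]] para_ract_L(4)[OF xy(2)[folded arrows_def]]
    show "rorbit L (fs H X \<alpha> \<beta>) PR x = rorbit L (fs H X \<alpha> \<beta>) PR y \<longleftrightarrow> fr G X \<alpha> \<beta> x = fr G X \<alpha> \<beta> y"
      unfolding orb by (rule level_set_eq_iff) (use xy in \<open>simp_all add: arrows_def\<close>)
  qed
  show "\<exists>f. homeomorphic_map (quotient_topology (gtop X) (lorbit K (fr G X \<alpha> \<beta>) PL)) (unit_top L) f
      \<and> (\<forall>z\<in>topspace (gtop X). f (lorbit K (fr G X \<alpha> \<beta>) PL z) = fs H X \<alpha> \<beta> z)"
  proof (rule open_quotient_orbit_space[OF para_ract_L(5)])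
    fix x y assume xy: "x \<in> topspace (gtop X)" "y \<in> topspace (gtop X)"
    note orb = lorbit_para[OF xy(1)[folded arrows_def]] lorbit_para[OF xy(2)[folded arrows_def]]
    show "lorbit K (fr G X \<alpha> \<beta>) PL x = lorbit K (fr G X \<alpha> \<beta>) PL y \<longleftrightarrow> fs H X \<alpha> \<beta> x = fs H X \<alpha> \<beta> y"
      unfolding orb by (rule level_set_eq_iff) (use xy in \<open>simp_all add: arrows_def\<close>)
  qed
qed

text \<open>Eliminates the arrow of \<open>H\<close> from the earlier facts: equal values of
  \<open>fs\<close> provide one.\<close>

lemma lip_full_facts:
  assumes "m \<in> points E" "n \<in> points E" "fs H X \<alpha> \<beta> (proj E m) = fs H X \<alpha> \<beta> (proj E n)"
  shows "LIP m n \<in> points A" "src K (proj A (LIP m n)) = fr G X \<alpha> \<beta> (proj E n)"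
    "PL (proj A (LIP m n)) (proj E n) = proj E m" "bstar A (LIP m n) = LIP n m"
    "m' \<in> fibre E (proj E m) \<Longrightarrow> LIP (badd E m m') n = badd A (LIP m n) (LIP m' n)"
    "n' \<in> fibre E (proj E n) \<Longrightarrow> LIP m (badd E n n') = badd A (LIP m n) (LIP m n')"
    "LIP (bsmul E k m) n = bsmul A k (LIP m n)" "LIP m (bsmul E k n) = bsmul A (cnj k) (LIP m n)"
    "\<lbrakk>p \<in> points A; src K (proj A p) = fr G X \<alpha> \<beta> (proj E m)\<rbrakk> \<Longrightarrow> LIP (LM p m) n = p \<odot>\<^bsub>A\<^esub> LIP m n"
proof -
  obtain h where h: "h \<in> arrows H" "src H h = lmom \<alpha> (src X (proj E n))"
    "src X (proj E m) = h \<triangleright>\<^bsub>\<alpha>\<^esub> src X (proj E n)"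
    using lip_element[OF assms] .
  show "LIP m n \<in> points A" "src K (proj A (LIP m n)) = fr G X \<alpha> \<beta> (proj E n)"
    "PL (proj A (LIP m n)) (proj E n) = proj E m" "bstar A (LIP m n) = LIP n m"
    using lip_facts[OF assms(1,2) h] by blast+
  show "m' \<in> fibre E (proj E m) \<Longrightarrow> LIP (badd E m m') n = badd A (LIP m n) (LIP m' n)"
    "n' \<in> fibre E (proj E n) \<Longrightarrow> LIP m (badd E n n') = badd A (LIP m n) (LIP m n')"
    "LIP (bsmul E k m) n = bsmul A k (LIP m n)" "LIP m (bsmul E k n) = bsmul A (cnj k) (LIP m n)"
    using lip_linear[OF assms(1,2) h] by blast+
  show "\<lbrakk>p \<in> points A; src K (proj A p) = fr G X \<alpha> \<beta> (proj E m)\<rbrakk> \<Longrightarrow> LIP (LM p m) n = p \<odot>\<^bsub>A\<^esub> LIP m n"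
    using lip_bundle_lact[OF _ assms(1,2) _ h] by blast
qed

end

context self_similar_bundle_equivalence
begin

interpretation D: self_similar_bundle_equivalence "op_groupoid G" "op_groupoid H" "op_groupoid X"
    "op_right \<beta>" "op_left \<alpha>" "op_bundle E" "\<lambda>t b. rb b t" "\<lambda>b h. lb h b"
  by (rule op_bundle_equivalence)

text \<open>The reversed inner product takes its arguments in the other order, so additivity in one
  variable is read from additivity in the other, and the two scalar rules change places.\<close>

lemma rip_full_facts:
  assumes "m \<in> points E" "n \<in> points E" "fr G X \<alpha> \<beta> (proj E m) = fr G X \<alpha> \<beta> (proj E n)"
  shows "RIP m n \<in> points C"
    "fs H X \<alpha> \<beta> (proj E m) = rng L (proj C (RIP m n))"
    "PR (proj E m) (proj C (RIP m n)) = proj E n" "bstar C (RIP m n) = RIP n m"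
    "m' \<in> fibre E (proj E m) \<Longrightarrow> RIP (badd E m m') n = badd C (RIP m n) (RIP m' n)"
    "n' \<in> fibre E (proj E n) \<Longrightarrow> RIP m (badd E n n') = badd C (RIP m n) (RIP m n')"
    "RIP (bsmul E k m) n = bsmul C (cnj k) (RIP m n)" "RIP m (bsmul E k n) = bsmul C k (RIP m n)"
    "\<lbrakk>c \<in> points C; fs H X \<alpha> \<beta> (proj E n) = rng L (proj C c)\<rbrakk> \<Longrightarrow> RIP m (RM n c) = RIP m n \<odot>\<^bsub>C\<^esub> c"
proof -
  have "fs (op_groupoid G) (op_groupoid X) (op_right \<beta>) (op_left \<alpha>) (proj E n)
      = fs (op_groupoid G) (op_groupoid X) (op_right \<beta>) (op_left \<alpha>) (proj E m)"
    unfolding fs_rev using assms(3) by simp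
  note f = D.lip_full_facts[unfolded D_eqs op_bundle_simps, OF assms(2,1) this]
  show "RIP m n \<in> points C" using f(1) unfolding points_C_rev RIP_rev by simp
  show "fs H X \<alpha> \<beta> (proj E m) = rng L (proj C (RIP m n))"
    unfolding C_domain(2) using f(2) unfolding RIP_rev by simp
  show "PR (proj E m) (proj C (RIP m n)) = proj E n"
    using f(3) unfolding PR_rev C_rev RIP_rev by simp
  show "bstar C (RIP m n) = RIP n m" using f(4) unfolding C_rev RIP_rev by simp
  show "RIP (badd E m m') n = badd C (RIP m n) (RIP m' n)" if "m' \<in> fibre E (proj E m)"
    using f(6)[OF that] unfolding C_rev RIP_rev by simp
  show "RIP m (badd E n n') = badd C (RIP m n) (RIP m n')" if "n' \<in> fibre E (proj E n)"
    using f(5)[OF that] unfolding C_rev RIP_rev by simp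
  show "RIP (bsmul E k m) n = bsmul C (cnj k) (RIP m n)" "RIP m (bsmul E k n) = bsmul C k (RIP m n)"
    using f(7,8) unfolding C_rev RIP_rev by simp_all
  show "RIP m (RM n c) = RIP m n \<odot>\<^bsub>C\<^esub> c" if "c \<in> points C" "fs H X \<alpha> \<beta> (proj E n) = rng L (proj C c)"
    using f(9)[OF C_domain(1)[OF that(1)] that(2)[unfolded C_domain(2)]]
    unfolding C_rev RIP_rev RM_rev by simp
qed

text \<open>The one-sided axioms are the fibre facts and their reversed readings. The bimodule rule
  and the exchange relation are restrictions of \<open>lm_rm_commute\<close> and
  \<open>lip_rip\<close>; the two adjointness rules mix an action of one side with the inner product
  of the other and are computed in \<open>E\<close>.\<close>

lemma imprimitivity_fibre:
  assumes z: "z \<in> arrows X"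
  shows "imprimitivity_bimodule (fibre_alg A (fr G X \<alpha> \<beta> z)) (fibre_alg C (fs H X \<alpha> \<beta> z)) (fibre_space E z)
    LM RM LIP RIP"
proof -
  interpret FA: fell_bundle K A by (rule fell_bundle_A)
  interpret FC: fell_bundle L C by (rule fell_bundle_C)
  let ?A = "fibre_alg A (fr G X \<alpha> \<beta> z)" and ?C = "fibre_alg C (fs H X \<alpha> \<beta> z)" and ?V = "fibre_space E z"
  let ?AD = "fibre_alg AD (frD z)"
  have zt: "z \<in> topspace (gtop X)" using z by (simp add: arrows_def)
  have cA: "cstar_algebra ?A" by (rule FA.cstar_algebra_unit_fibre[OF fr_unit[OF z]])
  have uC: "fs H X \<alpha> \<beta> z \<in> units L" by (rule groupoid_right_space_facts[OF z])
  have cC: "cstar_algebra ?C" by (rule FC.cstar_algebra_unit_fibre[OF uC])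
  have uD: "frD z \<in> units KD" using D.fr_unit[of z] z unfolding D_eqs by simp
  have cD: "cstar_algebra ?AD" by (rule fell_bundle.cstar_algebra_unit_fibre[OF AD_bundle uD])
  have fibC: "c \<in> fibre C (fs H X \<alpha> \<beta> z) \<longleftrightarrow> rev_pair c \<in> fibre AD (frD z)" for c
    unfolding in_fibre points_C_rev C_rev fr_rev by (auto simp: prod_eq_iff)
  note M = unit_fibre_module[OF z] and I = unit_fibre_lip[OF z]
  have zD: "z \<in> arrows (op_groupoid X)" using z by simp
  note MD = D.unit_fibre_module[OF zD, unfolded D_eqs op_bundle_simps]
    and ID = D.unit_fibre_lip[OF zD, unfolded D_eqs op_bundle_simps]
  have pA: "p \<in> points A \<and> src K (proj A p) = fr G X \<alpha> \<beta> (proj E x)"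
    if "p \<in> fibre A (fr G X \<alpha> \<beta> z)" "x \<in> fibre E z" for p x
    using that K.unit_simps(2)[OF fr_unit[OF z]] by (simp add: in_fibre)
  have pC: "c \<in> points C \<and> fs H X \<alpha> \<beta> (proj E x) = rng L (proj C c)"
    if "c \<in> fibre C (fs H X \<alpha> \<beta> z)" "x \<in> fibre E z" for c x
    using that topological_groupoid.unit_simps(1)[OF topological_groupoid_L uC] by (simp add: in_fibre)
  have fib: "x \<in> points E" "proj E x = z" if "x \<in> fibre E z" for x
    using that by (simp_all add: in_fibre)
  show ?thesis
  proof (intro imprimitivity_bimodule.intro imprimitivity_bimodule_axioms.intro cA cC
      lbdl.fell.fibre_banach[OF zt], unfold fibre_alg_simps fibre_space_simps)
    show "LM p x \<in> fibre E z" "LM (bsmul A k p) x = bsmul E k (LM p x)" "LM p (bsmul E k x) = bsmul E k (LM p x)"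
      if "p \<in> fibre A (fr G X \<alpha> \<beta> z)" "x \<in> fibre E z" for p x k
      using M that by blast+
    show "LM (badd A p q) x = badd E (LM p x) (LM q x)" "LM (p \<odot>\<^bsub>A\<^esub> q) x = LM p (LM q x)"
      if "p \<in> fibre A (fr G X \<alpha> \<beta> z)" "q \<in> fibre A (fr G X \<alpha> \<beta> z)" "x \<in> fibre E z" for p q x
      using M that by blast+
    show "LM p (badd E x y) = badd E (LM p x) (LM p y)" "LIP (LM p x) y = p \<odot>\<^bsub>A\<^esub> LIP x y"
      if "p \<in> fibre A (fr G X \<alpha> \<beta> z)" "x \<in> fibre E z" "y \<in> fibre E z" for p x y
      using M that by blast+
    show "RM x c \<in> fibre E z" "RM x (bsmul C k c) = bsmul E k (RM x c)" "RM (bsmul E k x) c = bsmul E k (RM x c)"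
      if "x \<in> fibre E z" "c \<in> fibre C (fs H X \<alpha> \<beta> z)" for x c k
      using MD(1-3)[OF that(2)[unfolded fibC] that(1)] unfolding RM_rev C_rev by simp_all
    show "RM x (badd C c d) = badd E (RM x c) (RM x d)" "RM x (c \<odot>\<^bsub>C\<^esub> d) = RM (RM x c) d"
      if "x \<in> fibre E z" "c \<in> fibre C (fs H X \<alpha> \<beta> z)" "d \<in> fibre C (fs H X \<alpha> \<beta> z)" for x c d
      using MD(4)[OF that(2)[unfolded fibC] that(1) that(3)[unfolded fibC]]
        MD(5)[OF that(3)[unfolded fibC] that(1) that(2)[unfolded fibC]]
      unfolding RM_rev C_rev by simp_all
    show "RM (badd E x y) c = badd E (RM x c) (RM y c)"
      if "x \<in> fibre E z" "y \<in> fibre E z" "c \<in> fibre C (fs H X \<alpha> \<beta> z)" for x y c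
      using MD(6)[OF that(3)[unfolded fibC] that(1,2)] unfolding RM_rev by simp
    show "RIP x (RM y c) = RIP x y \<odot>\<^bsub>C\<^esub> c"
      if "x \<in> fibre E z" "y \<in> fibre E z" "c \<in> fibre C (fs H X \<alpha> \<beta> z)" for x y c
      using MD(7)[OF that(3)[unfolded fibC] that(2,1)] unfolding RM_rev RIP_rev C_rev by simp
    show "RM (LM p x) c = LM p (RM x c)"
      if "p \<in> fibre A (fr G X \<alpha> \<beta> z)" "x \<in> fibre E z" "c \<in> fibre C (fs H X \<alpha> \<beta> z)" for p x c
      using lm_rm_commute pA[OF that(1,2)] pC[OF that(3,2)] fib[OF that(2)] by blast
    show "LIP x y \<in> fibre A (fr G X \<alpha> \<beta> z)" "bstar A (LIP x y) = LIP y x"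
      "LIP (bsmul E k x) y = bsmul A k (LIP x y)" if "x \<in> fibre E z" "y \<in> fibre E z" for x y k
      using I that by blast+
    show "LIP (badd E x y) w = badd A (LIP x w) (LIP y w)"
      if "x \<in> fibre E z" "y \<in> fibre E z" "w \<in> fibre E z" for x y w
      using I(4)[OF that(1,3,2)] .
    show "cstar_positive ?A (LIP x x)" "(bnorm E x)\<^sup>2 = bnorm A (LIP x x)" if "x \<in> fibre E z" for x
      using lip_positive[OF z that] I(5)[OF that that] by simp_all
    show "RIP x y \<in> fibre C (fs H X \<alpha> \<beta> z)" "bstar C (RIP x y) = RIP y x"
      "RIP x (bsmul E k y) = bsmul C k (RIP x y)" if "x \<in> fibre E z" "y \<in> fibre E z" for x y k
      using ID(1-3)[OF that(2,1)] unfolding fibC RIP_rev C_rev by simp_all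
    show "RIP x (badd E y w) = badd C (RIP x y) (RIP x w)"
      if "x \<in> fibre E z" "y \<in> fibre E z" "w \<in> fibre E z" for x y w
      using ID(4)[OF that(2,1,3)] unfolding RIP_rev C_rev by simp
    show "(bnorm E x)\<^sup>2 = bnorm C (RIP x x)" if "x \<in> fibre E z" for x
      using ID(5)[OF that that] unfolding RIP_rev C_rev by simp
    show "cstar_positive ?C (RIP x x)" if x: "x \<in> fibre E z" for x
    proof -
      \<comment> \<open>Positivity is known in the reversed algebra. Its factorization by
        \<open>c\<close> becomes one by the adjoint of \<open>c\<close> once the order of the
        product is restored.\<close>
      obtain c where c: "c \<in> fibre AD (frD z)" "LIPD x x = bmult AD (bstar AD c) c"
        using D.lip_positive[of z x] x z unfolding D_eqs cstar_positive_def by auto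
      have "bstar AD c \<in> fibre AD (frD z)" "bstar AD (bstar AD c) = c"
        using cstar_algebra.star_closed[OF cD, of c] cstar_algebra.star_star[OF cD, of c] c(1) by simp_all
      then show ?thesis
        unfolding cstar_positive_def fibre_alg_simps RIP_rev c(2)
        by (intro bexI[of _ "rev_pair (bstar AD c)"]) (simp_all add: fibC C_rev)
    qed
    show "closed_span ?A {LIP x y |x y. x \<in> fibre E z \<and> y \<in> fibre E z} = fibre A (fr G X \<alpha> \<beta> z)"
      by (rule lip_full[OF z])
    show "closed_span ?C {RIP x y |x y. x \<in> fibre E z \<and> y \<in> fibre E z} = fibre C (fs H X \<alpha> \<beta> z)"
    proof -
      let ?S = "{LIPD x y |x y. x \<in> fibre E z \<and> y \<in> fibre E z}"
      have full: "closed_span ?AD ?S = fibre AD (frD z)"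
        using D.lip_full[of z] z unfolding D_eqs by simp
      have S: "?S \<subseteq> carr ?AD" using ID(1) by auto
      \<comment> \<open>Exchanging coordinates is a linear isometric bijection between the two
        fibres, so it carries the closed span of the reversed inner products across.\<close>
      have "closed_span ?C (rev_pair ` ?S) = rev_pair ` closed_span ?AD ?S"
      proof (rule closed_span_transport[OF _ _ _ _ _ _ S])
        show "complex_banach ?AD" using cD by (simp add: cstar_algebra_def)
        show "bij_betw rev_pair (carr ?AD) (carr ?C)"
          by (rule bij_betw_byWitness[of _ rev_pair]) (auto simp: fibC)
      qed (simp_all add: C_rev fr_rev)
      moreover have "rev_pair ` ?S = {RIP x y |x y. x \<in> fibre E z \<and> y \<in> fibre E z}"
        unfolding RIP_rev by blast
      moreover have "rev_pair ` fibre AD (frD z) = fibre C (fs H X \<alpha> \<beta> z)"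
      proof (intro equalityI subsetI)
        fix c assume "c \<in> fibre C (fs H X \<alpha> \<beta> z)"
        then show "c \<in> rev_pair ` fibre AD (frD z)"
          unfolding fibC by (intro image_eqI[of _ _ "rev_pair c"]) simp_all
      qed (auto simp: fibC)
      ultimately show ?thesis using full by simp
    qed
    show "LM (LIP x y) w = RM x (RIP y w)" if "x \<in> fibre E z" "y \<in> fibre E z" "w \<in> fibre E z" for x y w
      using lip_rip fib[OF that(1)] fib[OF that(2)] fib[OF that(3)] by simp
    show "RIP (LM p x) y = RIP x (LM (bstar A p) y)"
      if p: "p \<in> fibre A (fr G X \<alpha> \<beta> z)" and x: "x \<in> fibre E z" and y: "y \<in> fibre E z" for p x y
    proof -
      \<comment> \<open>\<open>p\<close> acts as left multiplication by a vector over the range of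
        \<open>z\<close>; the rule is then associativity and the adjoint of a product in
        \<open>E\<close>.\<close>
      obtain a where a: "a \<in> fibre E (rng X z)" "p = (\<kappa> a, lmom \<alpha> (rng X z))" using fibre_A_unit[OF z p] .
      have a': "bstar E a \<in> fibre E (rng X z)" using a z by (simp add: in_fibre)
      have e: "LM p x = a \<odot>\<^bsub>E\<^esub> x" "LM (bstar A p) y = bstar E a \<odot>\<^bsub>E\<^esub> y"
        unfolding a(2) bstar_unit_fibre[OF z a(1)]
        by (rule bundle_lact_unit_fibre[OF z a(1) x], rule bundle_lact_unit_fibre[OF z a' y])
      have "a \<odot>\<^bsub>E\<^esub> x \<in> fibre E z" "bstar E a \<odot>\<^bsub>E\<^esub> y \<in> fibre E z"
        using M(1)[OF p x] M(1)[OF _ y, of "bstar A p"] e cstar_algebra.star_closed[OF cA, of p] p by simp_all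
      moreover have "bstar E (a \<odot>\<^bsub>E\<^esub> x) \<odot>\<^bsub>E\<^esub> y = bstar E x \<odot>\<^bsub>E\<^esub> (bstar E a \<odot>\<^bsub>E\<^esub> y)"
        using a x y z by (simp add: in_fibre lbdl.fell.bstar_bmult lbdl.fell.bmult_assoc)
      ultimately show ?thesis
        unfolding e RIP_rev using D.lip_fibre[of z y "a \<odot>\<^bsub>E\<^esub> x"] D.lip_fibre[of z "bstar E a \<odot>\<^bsub>E\<^esub> y" x] x y z by simp
    qed
    show "LIP (RM x c) y = LIP x (RM y (bstar C c))"
      if x: "x \<in> fibre E z" and y: "y \<in> fibre E z" and c: "c \<in> fibre C (fs H X \<alpha> \<beta> z)" for x y c
    proof -
      \<comment> \<open>Likewise \<open>c\<close> acts as right multiplication by a vector over the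
        source of \<open>z\<close>.\<close>
      obtain b where b: "b \<in> fibre E (src X z)" "rev_pair c = (bhorb H X \<alpha> E lb b, rmom \<beta> (src X z))"
        using D.fibre_A_unit[of z "rev_pair c"] c[unfolded fibC] z unfolding D_eqs by auto
      have b': "bstar E b \<in> fibre E (src X z)" using b z by (simp add: in_fibre)
      have bs: "rev_pair (bstar C c) = (bhorb H X \<alpha> E lb (bstar E b), rmom \<beta> (src X z))"
        using D.bstar_unit_fibre[of z b] b z unfolding C_rev D_eqs by simp
      have e: "RM x c = x \<odot>\<^bsub>E\<^esub> b" "RM y (bstar C c) = y \<odot>\<^bsub>E\<^esub> bstar E b"
        unfolding RM_rev b(2) bs
        using D.bundle_lact_unit_fibre[of z b x] D.bundle_lact_unit_fibre[of z "bstar E b" y] b(1) b' x y z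
        by simp_all
      have p: "x \<odot>\<^bsub>E\<^esub> b \<in> fibre E z" "y \<odot>\<^bsub>E\<^esub> bstar E b \<in> fibre E z"
        using x y b(1) b' z by (simp_all add: in_fibre)
      have "(x \<odot>\<^bsub>E\<^esub> b) \<odot>\<^bsub>E\<^esub> bstar E y = x \<odot>\<^bsub>E\<^esub> bstar E (y \<odot>\<^bsub>E\<^esub> bstar E b)"
        using b(1) x y z by (simp add: in_fibre lbdl.fell.bstar_bmult lbdl.fell.bmult_assoc)
      then show ?thesis unfolding e lip_fibre[OF z p(1) y] lip_fibre[OF z x p(2)] by simp
    qed
  qed
qed

lemma fell_bundle_equivalence:
  "fell_bundle_equivalence K L (gtop X) (fr G X \<alpha> \<beta>) (fs H X \<alpha> \<beta>) PL PR A C E LM RM LIP RIP"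
proof (intro fell_bundle_equivalence.intro fell_bundle_equivalence_axioms.intro groupoid_equivalence
    fell_bundle_A fell_bundle_C saturated_A saturated_C bundle_lact_continuous bundle_ract_continuous
    lbdl.fell.usc_banach_bundle_axioms)
  show "imprimitivity_bimodule (fibre_alg A (fr G X \<alpha> \<beta> z)) (fibre_alg C (fs H X \<alpha> \<beta> z)) (fibre_space E z)
      LM RM LIP RIP" if "z \<in> topspace (gtop X)" for z
    using imprimitivity_fibre that by (simp add: arrows_def)
qed (use bundle_lact_facts bundle_lact_assoc bundle_ract_facts bundle_ract_assoc lm_rm_commute
    lip_full_facts rip_full_facts lip_rip in metis)+

text \<open>Ensures that the definite descriptions in the four maps denote what is intended on their
  domains. The two right-hand claims are reversed readings with the defining equations turned
  around.\<close>

lemma well_defined: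
  "\<lbrakk>(\<Theta>, h) \<in> points A; b \<in> points E; src K (proj A (\<Theta>, h)) = fr G X \<alpha> \<beta> (proj E b)\<rbrakk>
    \<Longrightarrow> \<exists>!a. a \<in> \<Theta> \<and> src X (proj E a) = rng X (proj E (lb h b))"
  "\<lbrakk>b \<in> points E; (t, \<Xi>) \<in> points C; fs H X \<alpha> \<beta> (proj E b) = rng L (proj C (t, \<Xi>))\<rbrakk>
    \<Longrightarrow> \<exists>!c. c \<in> \<Xi> \<and> src X (proj E (rb b t)) = rng X (proj E c)"
  "\<lbrakk>a \<in> points E; b \<in> points E; fs H X \<alpha> \<beta> (proj E a) = fs H X \<alpha> \<beta> (proj E b)\<rbrakk>
    \<Longrightarrow> \<exists>!h. h \<in> arrows H \<and> src H h = lrho X \<alpha> (src X (proj E b)) \<and> src X (proj E a) = h \<triangleright>\<^bsub>\<alpha>\<^esub> src X (proj E b)"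
  "\<lbrakk>a \<in> points E; b \<in> points E; fr G X \<alpha> \<beta> (proj E a) = fr G X \<alpha> \<beta> (proj E b)\<rbrakk>
    \<Longrightarrow> \<exists>!t. t \<in> arrows G \<and> rsigma X \<beta> (rng X (proj E a)) = rng G t \<and> rng X (proj E a) \<blacktriangleleft>\<^bsub>\<beta>\<^esub> t = rng X (proj E b)"
proof -
  show "\<lbrakk>(\<Theta>, h) \<in> points A; b \<in> points E; src K (proj A (\<Theta>, h)) = fr G X \<alpha> \<beta> (proj E b)\<rbrakk>
    \<Longrightarrow> \<exists>!a. a \<in> \<Theta> \<and> src X (proj E a) = rng X (proj E (lb h b))" by (rule bundle_lact_unique)
  show "\<lbrakk>a \<in> points E; b \<in> points E; fs H X \<alpha> \<beta> (proj E a) = fs H X \<alpha> \<beta> (proj E b)\<rbrakk>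
    \<Longrightarrow> \<exists>!h. h \<in> arrows H \<and> src H h = lrho X \<alpha> (src X (proj E b)) \<and> src X (proj E a) = h \<triangleright>\<^bsub>\<alpha>\<^esub> src X (proj E b)"
    by (rule lip_element_unique)
  assume b: "b \<in> points E"
  show "\<exists>!c. c \<in> \<Xi> \<and> src X (proj E (rb b t)) = rng X (proj E c)"
    if "(t, \<Xi>) \<in> points C" "fs H X \<alpha> \<beta> (proj E b) = rng L (proj C (t, \<Xi>))"
  proof -
    have "\<exists>!c. c \<in> \<Xi> \<and> rng X (proj E c) = src X (proj E (rb b t))"
      using D.bundle_lact_unique[of \<Xi> t b, unfolded D_eqs] C_domain(1)[OF that(1)]
        that(2)[unfolded C_domain(2)] b by simp
    then show ?thesis by metis
  qed
  show "\<exists>!t. t \<in> arrows G \<and> rsigma X \<beta> (rng X (proj E a)) = rng G t \<and> rng X (proj E a) \<blacktriangleleft>\<^bsub>\<beta>\<^esub> t = rng X (proj E b)"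
    if "a \<in> points E" "fr G X \<alpha> \<beta> (proj E a) = fr G X \<alpha> \<beta> (proj E b)"
  proof -
    have "\<exists>!t. t \<in> arrows G \<and> rng G t = rsigma X \<beta> (rng X (proj E a)) \<and> rng X (proj E b) = rng X (proj E a) \<blacktriangleleft>\<^bsub>\<beta>\<^esub> t"
      using D.lip_element_unique[of b a] that b by (simp add: fs_rev)
    then show ?thesis by metis
  qed
qed

end

theorem theorem6p1:
  fixes H :: "'h groupoid" and G :: "'g groupoid" and X :: "'x groupoid"
    and \<alpha> :: "('h, 'x) left_ss" and \<beta> :: "('g, 'x) right_ss"
    and B :: "('b, 'x) fell_bundle"
    and lb :: "'h \<Rightarrow> 'b \<Rightarrow> 'b" and rb :: "'b \<Rightarrow> 'g \<Rightarrow> 'b"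
    and K :: "('x set \<times> 'h) groupoid" and L :: "('g \<times> 'x set) groupoid"
    and A :: "('b set \<times> 'h, 'x set \<times> 'h) fell_bundle"
    and C :: "('g \<times> 'b set, 'g \<times> 'x set) fell_bundle"
    and lm :: "'b set \<times> 'h \<Rightarrow> 'b \<Rightarrow> 'b" and rm :: "'b \<Rightarrow> 'g \<times> 'b set \<Rightarrow> 'b"
    and lip :: "'b \<Rightarrow> 'b \<Rightarrow> 'b set \<times> 'h" and rip :: "'b \<Rightarrow> 'b \<Rightarrow> 'g \<times> 'b set"
  assumes "para_equivalence H G X \<alpha> \<beta>"
    and "fell_bundle X B" and "saturated X B"
    and "self_similar_left_bundle H X \<alpha> B lb"
    and "self_similar_right_bundle G X \<beta> B rb"
    and "\<And>h b t. \<lbrakk>h \<in> arrows H; b \<in> points B; t \<in> arrows G;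
           src H h = lrho X \<alpha> (proj B b); rsigma X \<beta> (h \<triangleright>\<^bsub>\<alpha>\<^esub> proj B b) = rng G t\<rbrakk>
         \<Longrightarrow> rb (lb h b) t = lb h (rb b t)"
    and "K = lprod_groupoid (rquot X G \<beta>) H (lact_on_rquot G X \<alpha> \<beta>)"
    and "L = rprod_groupoid G (lquot H X \<alpha>) (ract_on_lquot H X \<alpha> \<beta>)"
    and "A = lprod_bundle (rquot X G \<beta>) (rquot_bundle X B G \<beta> rb) H
               (lact_on_rquot G X \<alpha> \<beta>) (bact_on_rquot G X \<beta> B lb rb)"
    and "C = rprod_bundle G (lquot H X \<alpha>) (lquot_bundle H X \<alpha> B lb)
               (ract_on_lquot H X \<alpha> \<beta>) (bact_on_lquot H X \<alpha> B lb rb)"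
    and "lm = (\<lambda>(\<Theta>, h) b.
           let a = (THE a. a \<in> \<Theta> \<and> src X (proj B a) = rng X (proj B (lb h b)))
           in a \<odot>\<^bsub>B\<^esub> lb h b)"
    and "rm = (\<lambda>b (t, \<Xi>).
           let c = (THE c. c \<in> \<Xi> \<and> src X (proj B (rb b t)) = rng X (proj B c))
           in rb b t \<odot>\<^bsub>B\<^esub> c)"
    and "lip = (\<lambda>a b.
           let h = (THE h. h \<in> arrows H \<and> src H h = lrho X \<alpha> (src X (proj B b))
                         \<and> src X (proj B a) = h \<triangleright>\<^bsub>\<alpha>\<^esub> src X (proj B b))
           in (bgorb G X \<beta> B rb (a \<odot>\<^bsub>B\<^esub> lb h (bstar B b)), h \<triangleleft>\<^bsub>\<alpha>\<^esub> proj B (bstar B b)))"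
    and "rip = (\<lambda>a b.
           let t = (THE t. t \<in> arrows G \<and> rsigma X \<beta> (rng X (proj B a)) = rng G t
                         \<and> rng X (proj B a) \<blacktriangleleft>\<^bsub>\<beta>\<^esub> t = rng X (proj B b))
           in (proj B (bstar B a) \<blacktriangleright>\<^bsub>\<beta>\<^esub> t, bhorb H X \<alpha> B lb (rb (bstar B a) t \<odot>\<^bsub>B\<^esub> b)))"
  shows "(\<forall>\<Theta> h b. (\<Theta>, h) \<in> points A \<and> b \<in> points B
             \<and> src K (proj A (\<Theta>, h)) = fr G X \<alpha> \<beta> (proj B b) \<longrightarrow>
           (\<exists>!a. a \<in> \<Theta> \<and> src X (proj B a) = rng X (proj B (lb h b))))
       \<and> (\<forall>b t \<Xi>. b \<in> points B \<and> (t, \<Xi>) \<in> points C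
             \<and> fs H X \<alpha> \<beta> (proj B b) = rng L (proj C (t, \<Xi>)) \<longrightarrow>
           (\<exists>!c. c \<in> \<Xi> \<and> src X (proj B (rb b t)) = rng X (proj B c)))
       \<and> (\<forall>a b. a \<in> points B \<and> b \<in> points B
             \<and> fs H X \<alpha> \<beta> (proj B a) = fs H X \<alpha> \<beta> (proj B b) \<longrightarrow>
           (\<exists>!h. h \<in> arrows H \<and> src H h = lrho X \<alpha> (src X (proj B b))
                \<and> src X (proj B a) = h \<triangleright>\<^bsub>\<alpha>\<^esub> src X (proj B b)))
       \<and> (\<forall>a b. a \<in> points B \<and> b \<in> points B
             \<and> fr G X \<alpha> \<beta> (proj B a) = fr G X \<alpha> \<beta> (proj B b) \<longrightarrow>
           (\<exists>!t. t \<in> arrows G \<and> rsigma X \<beta> (rng X (proj B a)) = rng G t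
                \<and> rng X (proj B a) \<blacktriangleleft>\<^bsub>\<beta>\<^esub> t = rng X (proj B b)))
       \<and> fell_bundle_equivalence K L (gtop X) (fr G X \<alpha> \<beta>) (fs H X \<alpha> \<beta>)
           (para_lact X \<alpha>) (para_ract X \<beta>) A C B lm rm lip rip"
proof -
  interpret S: self_similar_bundle_equivalence H G X \<alpha> \<beta> B lb rb
    by (rule self_similar_bundle_equivalenceI[OF assms(1,3,4,5,6)])
  have maps: "lm = bundle_lact X B lb" "rm = bundle_ract X B rb"
      "lip = bundle_lip H G X \<alpha> \<beta> B lb rb" "rip = bundle_rip H G X \<alpha> \<beta> B lb rb"
    unfolding assms(11-14) bundle_lact_def bundle_ract_def bundle_lip_def bundle_rip_def by (rule refl)+
  note objects = assms(7-10)
  show ?thesis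
    unfolding maps using S.well_defined[folded objects] S.fell_bundle_equivalence[folded objects] by blast
qed

end
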